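(* Let $\Omega\subset\mathbb{R}^3$ be open and bounded with continuous boundary, and let $m$ be the number of connected components of $\mathbb{R}^3\setminus\overline{\Omega}$. Let $$\mathcal{H}:=\ker(\mathring{\operatorname{Curl}}_{\mathbb{S}})\cap\ker(\operatorname{divDiv}_{\mathbb{S}})\subset L^{2,3\times3}_{\mathbb{S}}(\Omega).$$ Then $\dim\mathcal{H}=4(m-1)$, and a basis of $\mathcal{H}$ is given by $$\big\{\operatorname{Gradgrad}u_{\ell,j}:\ell\in\{1,\dots,m-1\},\ j\in\{0,\dots,3\}\big\},$$ where $u_{\ell,j}=\xi_{\ell,j}-\psi_{\ell,j}\in H^2(\Omega)$ are the functions constructed in the context.
   Context: All function spaces are real. $L^{2,3\times3}_{\mathbb{S}}(\Omega)$, $L^{2,3\times3}_{\mathbb{T}}(\Omega)$: symmetric, trace-free $3\times3$ tensor fields with $L^2$ entries. $\operatorname{Curl}$ and $\operatorname{Div}$ act row-wise; $\operatorname{Gradgrad}u$ is the Hessian. $\mathring{\operatorname{Gradgrad}}$ is the closure of $\operatorname{Gradgrad}:C^\infty_c(\Omega)\subset L^2(\Omega)\to L^{2,3\times3}_{\mathbb{S}}(\Omega)$ (its domain is $H^2_0(\Omega)$ and its range is closed); $\operatorname{divDiv}_{\mathbb{S}}:=(\mathring{\operatorname{Gradgrad}})^*$; $\mathring{\operatorname{Curl}}_{\mathbb{S}}$ is the closure of $\operatorname{Curl}$ on smooth compactly supported symmetric fields, $L^{2,3\times3}_{\mathbb{S}}(\Omega)\to L^{2,3\times3}_{\mathbb{T}}(\Omega)$.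 Continuous boundary: the boundary is locally the graph of a continuous function (equivalently, $\Omega$ has the segment property). Construction. Let $\Xi_0$ be the unbounded and $\Xi_1,\dots,\Xi_{m-1}$ the remaining connected components of $\mathbb{R}^3\setminus\overline{\Omega}$. Let $\xi_\ell\in C^\infty_c(\mathbb{R}^3)$, $\ell\in\{1,\dots,m-1\}$, have pairwise disjoint supports with $\xi_\ell=1$ in a neighbourhood of $\Xi_\ell$ and $\xi_\ell=0$ in a neighbourhood of $\Xi_k$ for all $k\in\{0,\dots,m-1\}\setminus\{\ell\}$. Let $\widehat{p}_0(x):=1$, $\widehat{p}_j(x):=x_j$ for $j\in\{1,2,3\}$, and $\xi_{\ell,j}:=\xi_\ell\widehat{p}_j$. Let $\pi$ be the orthogonal projector in $L^{2,3\times3}_{\mathbb{S}}(\Omega)=\operatorname{ran}(\mathring{\operatorname{Gradgrad}})\oplus\ker(\operatorname{divDiv}_{\mathbb{S}})$ onto $\ker(\operatorname{divDiv}_{\mathbb{S}})$. Then $\psi_{\ell,j}\in H^2_0(\Omega)$ is the unique function with $\pi\operatorname{Gradgrad}\xi_{\ell,j}=\operatorname{Gradgrad}(\xi_{\ell,j}-\psi_{\ell,j})$ in $\Omega$. *)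

theory Defs
  imports "HOL-Analysis.Analysis"
begin

section \<open>The Hilbert spaces\<close>

definition square_integrable :: "(real^3 \<Rightarrow> 'b::euclidean_space) \<Rightarrow> bool" where
  "square_integrable f \<longleftrightarrow>
     f \<in> borel_measurable lborel \<and> integrable lborel (\<lambda>x. (norm (f x))\<^sup>2)"

lemma square_integrable_zero: "square_integrable (\<lambda>x. 0)"
  by (simp add: square_integrable_def)

lemma square_integrable_add:
  assumes "square_integrable f" "square_integrable g"
  shows "square_integrable (\<lambda>x. f x + g x)"
proof -
  have [measurable]: "f \<in> borel_measurable lborel" "g \<in> borel_measurable lborel"
    using assms by (auto simp: square_integrable_def)
  have "integrable lborel (\<lambda>x. 2 * (norm (f x))\<^sup>2 + 2 * (norm (g x))\<^sup>2)"
    using assms by (auto simp: square_integrable_def)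
  then have "integrable lborel (\<lambda>x. (norm (f x + g x))\<^sup>2)"
  proof (rule Bochner_Integration.integrable_bound)
    have "(norm (f x + g x))\<^sup>2 \<le> 2 * (norm (f x))\<^sup>2 + 2 * (norm (g x))\<^sup>2" for x
    proof -
      have "(norm (f x + g x))\<^sup>2 \<le> (norm (f x) + norm (g x))\<^sup>2"
        by (intro power_mono norm_triangle_ineq norm_ge_zero)
      also have "\<dots> \<le> 2 * (norm (f x))\<^sup>2 + 2 * (norm (g x))\<^sup>2"
        using sum_squares_bound[of "norm (f x)" "norm (g x)"] by (simp add: power2_sum)
      finally show ?thesis .
    qed
    then show "AE x in lborel. norm ((norm (f x + g x))\<^sup>2)
        \<le> norm (2 * (norm (f x))\<^sup>2 + 2 * (norm (g x))\<^sup>2)" by auto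
  qed measurable
  then show ?thesis by (simp add: square_integrable_def)
qed

lemma square_integrable_scaleR:
  "square_integrable f \<Longrightarrow> square_integrable (\<lambda>x. c *\<^sub>R f x)"
  by (auto simp: square_integrable_def power_mult_distrib)

lemma integrable_inner_square_integrable:
  assumes "square_integrable f" "square_integrable g"
  shows "integrable lborel (\<lambda>x. f x \<bullet> g x)"
proof -
  have [measurable]: "f \<in> borel_measurable lborel" "g \<in> borel_measurable lborel"
    using assms by (auto simp: square_integrable_def)
  have "integrable lborel (\<lambda>x. (norm (f x))\<^sup>2 + (norm (g x))\<^sup>2)"
    using assms by (auto simp: square_integrable_def)
  then show ?thesis
  proof (rule Bochner_Integration.integrable_bound)
    have "\<bar>f x \<bullet> g x\<bar> \<le> (norm (f x))\<^sup>2 + (norm (g x))\<^sup>2" for x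
    proof -
      have "\<bar>f x \<bullet> g x\<bar> \<le> norm (f x) * norm (g x)" by (rule Cauchy_Schwarz_ineq2)
      moreover have "0 \<le> norm (f x) * norm (g x)" by simp
      ultimately show ?thesis
        using sum_squares_bound[of "norm (f x)" "norm (g x)"] by linarith
    qed
    then show "AE x in lborel. norm (f x \<bullet> g x) \<le> norm ((norm (f x))\<^sup>2 + (norm (g x))\<^sup>2)"
      by auto
  qed measurable
qed

text \<open>\<open>'b L2\<close> is the space of \<open>'b\<close>-valued square integrable fields on the whole space
  modulo equality almost everywhere.\<close>

definition L2_eq :: "(real^3 \<Rightarrow> 'b::euclidean_space) \<Rightarrow> (real^3 \<Rightarrow> 'b) \<Rightarrow> bool" where
  "L2_eq f g \<longleftrightarrow>
     square_integrable f \<and> square_integrable g \<and> (AE x in lborel. f x = g x)"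

lemma part_equivp_L2_eq: "part_equivp L2_eq"
proof (rule part_equivpI)
  show "\<exists>f. L2_eq f f"
    using square_integrable_zero by (auto simp: L2_eq_def)
  show "symp L2_eq" by (rule sympI) (auto simp: L2_eq_def)
  show "transp L2_eq" by (rule transpI) (auto simp: L2_eq_def)
qed

quotient_type (overloaded) 'b L2 = "real^3 \<Rightarrow> 'b::euclidean_space" / partial: L2_eq
  by (rule part_equivp_L2_eq)

instantiation L2 :: (euclidean_space) real_vector
begin

lift_definition zero_L2 :: "'a L2" is "\<lambda>x. 0"
  by (simp add: L2_eq_def square_integrable_zero)

lift_definition plus_L2 :: "'a L2 \<Rightarrow> 'a L2 \<Rightarrow> 'a L2" is "\<lambda>f g x. f x + g x"
  by (auto simp: L2_eq_def square_integrable_add)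

lift_definition scaleR_L2 :: "real \<Rightarrow> 'a L2 \<Rightarrow> 'a L2" is "\<lambda>c f x. c *\<^sub>R f x"
  by (auto simp: L2_eq_def square_integrable_scaleR)

lift_definition uminus_L2 :: "'a L2 \<Rightarrow> 'a L2" is "\<lambda>f x. - f x"
  by (auto simp: L2_eq_def square_integrable_def)

definition minus_L2 :: "'a L2 \<Rightarrow> 'a L2 \<Rightarrow> 'a L2" where "minus_L2 f g = f + (- g)"

instance
proof
  fix a b c :: "'a L2" and r s :: real
  show "a + b + c = a + (b + c)"
    by transfer
      (auto simp: L2_eq_def square_integrable_add add.assoc square_integrable_zero)
  show "a + b = b + a"
    by transfer (auto simp: L2_eq_def square_integrable_add add.commute)
  show "0 + a = a" by transfer (auto simp: L2_eq_def)
  show "- a + a = 0"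
    by transfer (auto simp: L2_eq_def square_integrable_zero)
  show "a - b = a + - b" by (simp add: minus_L2_def)
  show "r *\<^sub>R (a + b) = r *\<^sub>R a + r *\<^sub>R b"
    by transfer
      (auto simp: L2_eq_def scaleR_add_right square_integrable_add square_integrable_scaleR)
  show "(r + s) *\<^sub>R a = r *\<^sub>R a + s *\<^sub>R a"
    by transfer
      (auto simp: L2_eq_def scaleR_add_left intro!: square_integrable_add square_integrable_scaleR)
  show "r *\<^sub>R s *\<^sub>R a = (r * s) *\<^sub>R a"
    by transfer (auto simp: L2_eq_def square_integrable_scaleR)
  show "1 *\<^sub>R a = a" by transfer (auto simp: L2_eq_def)
qed

end

instantiation L2 :: (euclidean_space) real_inner
begin

lift_definition inner_L2 :: "'a L2 \<Rightarrow> 'a L2 \<Rightarrow> real" is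
  "\<lambda>f g. LINT x|lborel. f x \<bullet> g x"
proof -
  fix f f' g g' :: "real^3 \<Rightarrow> 'a"
  assume a: "L2_eq f f'" "L2_eq g g'"
  then have [measurable]: "f \<in> borel_measurable lborel" "g \<in> borel_measurable lborel"
    "f' \<in> borel_measurable lborel" "g' \<in> borel_measurable lborel"
    by (auto simp: L2_eq_def square_integrable_def)
  show "(LINT x|lborel. f x \<bullet> g x) = (LINT x|lborel. f' x \<bullet> g' x)"
    using a by (intro integral_cong_AE) (auto simp: L2_eq_def)
qed

definition norm_L2 :: "'a L2 \<Rightarrow> real" where "norm_L2 f = sqrt (inner f f)"
definition sgn_L2 :: "'a L2 \<Rightarrow> 'a L2" where "sgn_L2 f = f /\<^sub>R norm f"
definition dist_L2 :: "'a L2 \<Rightarrow> 'a L2 \<Rightarrow> real" where "dist_L2 f g = norm (f - g)"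
definition uniformity_L2 :: "('a L2 \<times> 'a L2) filter" where
  "uniformity_L2 = (INF e\<in>{0 <..}. principal {(x, y). dist x y < e})"
definition open_L2 :: "'a L2 set \<Rightarrow> bool" where
  "open_L2 U \<longleftrightarrow> (\<forall>x\<in>U. eventually (\<lambda>(x', y). x' = x \<longrightarrow> y \<in> U) uniformity)"

instance
proof
  fix a b c :: "'a L2" and r :: real and U :: "'a L2 set"
  show "sgn a = a /\<^sub>R norm a" by (rule sgn_L2_def)
  show "dist a b = norm (a - b)" by (rule dist_L2_def)
  show "(uniformity :: ('a L2 \<times> 'a L2) filter) =
      (INF e\<in>{0 <..}. principal {(x, y). dist x y < e})"
    by (rule uniformity_L2_def)
  show "open U \<longleftrightarrow> (\<forall>x\<in>U. eventually (\<lambda>(x', y). x' = x \<longrightarrow> y \<in> U) uniformity)"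
    by (rule open_L2_def)
  show "inner a b = inner b a" by transfer (simp add: inner_commute)
  show "inner (a + b) c = inner a c + inner b c"
    by transfer
      (simp add: L2_eq_def inner_add_left integrable_inner_square_integrable)
  show "inner (r *\<^sub>R a) b = r * inner a b" by transfer simp
  show "0 \<le> inner a a" by transfer simp
  show "inner a a = 0 \<longleftrightarrow> a = 0"
  proof transfer
    fix f :: "real^3 \<Rightarrow> 'a"
    assume f: "L2_eq f f"
    have "(LINT x|lborel. f x \<bullet> f x) = 0 \<longleftrightarrow> (AE x in lborel. f x \<bullet> f x = 0)"
      using f by (intro integral_nonneg_eq_0_iff_AE integrable_inner_square_integrable)
        (auto simp: L2_eq_def)
    then show "(LINT x|lborel. f x \<bullet> f x) = 0 \<longleftrightarrow> L2_eq f (\<lambda>x. 0)"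
      using f by (auto simp: L2_eq_def square_integrable_zero)
  qed
  show "norm a = sqrt (inner a a)" by (rule norm_L2_def)
qed

end

text \<open>The space of square integrable fields on \<open>\<Omega>\<close> is identified, isometrically, with the
  closed subspace of fields vanishing almost everywhere outside \<open>\<Omega>\<close>. The class
  \<open>restr \<Omega> f\<close> represents the restriction to \<open>\<Omega>\<close> of \<open>f\<close>; it is only
  meaningful when \<open>f\<close> is square integrable on \<open>\<Omega>\<close>.\<close>

definition L2_on :: "(real^3) set \<Rightarrow> 'b::euclidean_space L2 set" where
  "L2_on \<Omega> = {u. AE x in lborel. x \<notin> \<Omega> \<longrightarrow> rep_L2 u x = 0}"

definition restr :: "(real^3) set \<Rightarrow> (real^3 \<Rightarrow> 'b::euclidean_space) \<Rightarrow> 'b L2" where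
  "restr \<Omega> f = abs_L2 (\<lambda>x. indicator \<Omega> x *\<^sub>R f x)"

definition L2_S :: "(real^3) set \<Rightarrow> (real^3^3) L2 set" where
  "L2_S \<Omega> = {T \<in> L2_on \<Omega>. AE x in lborel. transpose (rep_L2 T x) = rep_L2 T x}"


section \<open>Smooth fields and classical differential operators\<close>

primrec times_differentiable ::
  "nat \<Rightarrow> ('a::real_normed_vector \<Rightarrow> 'b::real_normed_vector) \<Rightarrow> bool" where
  "times_differentiable 0 f \<longleftrightarrow> continuous_on UNIV f"
| "times_differentiable (Suc n) f \<longleftrightarrow> (\<forall>x. f differentiable (at x)) \<and>
     (\<forall>v. times_differentiable n (\<lambda>x. frechet_derivative f (at x) v))"

definition smooth :: "('a::real_normed_vector \<Rightarrow> 'b::real_normed_vector) \<Rightarrow> bool" where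
  "smooth f \<longleftrightarrow> (\<forall>n. times_differentiable n f)"

definition supp :: "('a::topological_space \<Rightarrow> 'b::zero) \<Rightarrow> 'a set" where
  "supp f = closure {x. f x \<noteq> 0}"

definition test_fields :: "(real^3) set \<Rightarrow> (real^3 \<Rightarrow> 'b::euclidean_space) set" where
  "test_fields \<Omega> = {\<phi>. smooth \<phi> \<and> compact (supp \<phi>) \<and> supp \<phi> \<subseteq> \<Omega>}"

definition partial_deriv ::
  "3 \<Rightarrow> (real^3 \<Rightarrow> 'b::real_normed_vector) \<Rightarrow> real^3 \<Rightarrow> 'b" where
  "partial_deriv i f x = frechet_derivative f (at x) (axis i 1)"

definition grad :: "(real^3 \<Rightarrow> real) \<Rightarrow> real^3 \<Rightarrow> real^3" where
  "grad f x = (\<chi> i. partial_deriv i f x)"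

definition hess :: "(real^3 \<Rightarrow> real) \<Rightarrow> real^3 \<Rightarrow> real^3^3" where
  "hess f x = (\<chi> i j. partial_deriv i (partial_deriv j f) x)"

definition diverg :: "(real^3 \<Rightarrow> real^3) \<Rightarrow> real^3 \<Rightarrow> real" where
  "diverg v x = (\<Sum>i\<in>UNIV. partial_deriv i (\<lambda>y. v y $ i) x)"

definition curl :: "(real^3 \<Rightarrow> real^3) \<Rightarrow> real^3 \<Rightarrow> real^3" where
  "curl v x = vector
     [partial_deriv 2 (\<lambda>y. v y $ 3) x - partial_deriv 3 (\<lambda>y. v y $ 2) x,
      partial_deriv 3 (\<lambda>y. v y $ 1) x - partial_deriv 1 (\<lambda>y. v y $ 3) x,
      partial_deriv 1 (\<lambda>y. v y $ 2) x - partial_deriv 2 (\<lambda>y. v y $ 1) x]"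

text \<open>The row \<open>i\<close> of a tensor \<open>T\<close> is \<open>T $ i\<close>.\<close>

definition Div :: "(real^3 \<Rightarrow> real^3^3) \<Rightarrow> real^3 \<Rightarrow> real^3" where
  "Div T x = (\<chi> i. diverg (\<lambda>y. T y $ i) x)"

definition Curl :: "(real^3 \<Rightarrow> real^3^3) \<Rightarrow> real^3 \<Rightarrow> real^3^3" where
  "Curl T x = (\<chi> i. curl (\<lambda>y. T y $ i) x)"


section \<open>Sobolev spaces\<close>

text \<open>Testing with vector and tensor valued fields is the usual componentwise definition of
  weak derivatives of first and second order, all components being collected in one identity.\<close>

definition is_weak_grad :: "(real^3) set \<Rightarrow> real L2 \<Rightarrow> (real^3) L2 \<Rightarrow> bool" where
  "is_weak_grad \<Omega> u g \<longleftrightarrow> g \<in> L2_on \<Omega> \<and>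
     (\<forall>\<Phi>\<in>test_fields \<Omega>. u \<bullet> restr \<Omega> (diverg \<Phi>) = - (g \<bullet> restr \<Omega> \<Phi>))"

definition is_weak_hess :: "(real^3) set \<Rightarrow> real L2 \<Rightarrow> (real^3^3) L2 \<Rightarrow> bool" where
  "is_weak_hess \<Omega> u T \<longleftrightarrow> T \<in> L2_on \<Omega> \<and>
     (\<forall>\<Phi>\<in>test_fields \<Omega>. u \<bullet> restr \<Omega> (diverg (Div \<Phi>)) = T \<bullet> restr \<Omega> \<Phi>)"

definition H2 :: "(real^3) set \<Rightarrow> real L2 set" where
  "H2 \<Omega> = {u \<in> L2_on \<Omega>. (\<exists>g. is_weak_grad \<Omega> u g) \<and> (\<exists>T. is_weak_hess \<Omega> u T)}"

definition weak_grad :: "(real^3) set \<Rightarrow> real L2 \<Rightarrow> (real^3) L2" where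
  "weak_grad \<Omega> u = (THE g. is_weak_grad \<Omega> u g)"

definition Gradgrad :: "(real^3) set \<Rightarrow> real L2 \<Rightarrow> (real^3^3) L2" where
  "Gradgrad \<Omega> u = (THE T. is_weak_hess \<Omega> u T)"

definition H2_norm :: "(real^3) set \<Rightarrow> real L2 \<Rightarrow> real" where
  "H2_norm \<Omega> u =
     sqrt ((norm u)\<^sup>2 + (norm (weak_grad \<Omega> u))\<^sup>2 + (norm (Gradgrad \<Omega> u))\<^sup>2)"

definition H20 :: "(real^3) set \<Rightarrow> real L2 set" where
  "H20 \<Omega> = {u \<in> H2 \<Omega>. \<exists>\<phi>. (\<forall>n. \<phi> n \<in> test_fields \<Omega>) \<and>
     (\<lambda>n. H2_norm \<Omega> (u - restr \<Omega> (\<phi> n))) \<longlonglongrightarrow> 0}"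


section \<open>Unbounded operators\<close>

text \<open>Operators are represented by their graphs, so that the closure of an operator is the
  topological closure of its graph. The subspaces \<open>L2_on \<Omega>\<close> and \<open>L2_S \<Omega>\<close> (as well as that of
  trace free tensor fields) are closed, hence the closure may be taken in the ambient spaces.\<close>

definition kernel :: "('a \<times> 'b::zero) set \<Rightarrow> 'a set" where
  "kernel A = {x. (x, 0) \<in> A}"

text \<open>Hilbert space adjoint of an operator from \<open>X\<close> to \<open>Y\<close>.\<close>

definition adjoint_op ::
  "'a::real_inner set \<Rightarrow> 'b::real_inner set \<Rightarrow> ('a \<times> 'b) set \<Rightarrow> ('b \<times> 'a) set" where
  "adjoint_op X Y A = {(y, z). y \<in> Y \<and> z \<in> X \<and> (\<forall>(x, w)\<in>A. w \<bullet> y = x \<bullet> z)}"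

definition orth_proj :: "'a::real_inner set \<Rightarrow> 'a \<Rightarrow> 'a" where
  "orth_proj K x = (THE p. p \<in> K \<and> (\<forall>q\<in>K. (x - p) \<bullet> q = 0))"

definition Gradgrad0 :: "(real^3) set \<Rightarrow> (real L2 \<times> (real^3^3) L2) set" where
  "Gradgrad0 \<Omega> = closure {(restr \<Omega> \<phi>, restr \<Omega> (hess \<phi>)) | \<phi>. \<phi> \<in> test_fields \<Omega>}"

definition divDiv_S :: "(real^3) set \<Rightarrow> ((real^3^3) L2 \<times> real L2) set" where
  "divDiv_S \<Omega> = adjoint_op (L2_on \<Omega>) (L2_S \<Omega>) (Gradgrad0 \<Omega>)"

definition Curl0_S :: "(real^3) set \<Rightarrow> ((real^3^3) L2 \<times> (real^3^3) L2) set" where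
  "Curl0_S \<Omega> = closure {(restr \<Omega> \<Phi>, restr \<Omega> (Curl \<Phi>)) | \<Phi>.
     \<Phi> \<in> test_fields \<Omega> \<and> (\<forall>x. transpose (\<Phi> x) = \<Phi> x)}"

definition harmonic_fields :: "(real^3) set \<Rightarrow> (real^3^3) L2 set" where
  "harmonic_fields \<Omega> = kernel (Curl0_S \<Omega>) \<inter> kernel (divDiv_S \<Omega>)"


section \<open>Geometry and the construction of the basis\<close>

text \<open>Around every boundary point there are orthogonal coordinates \<open>y = Q (x - p)\<close> and a box in
  these coordinates in which \<open>\<Omega>\<close> is the subgraph, and its boundary the graph, of a
  continuous function.\<close>

definition continuous_boundary :: "(real^3) set \<Rightarrow> bool" where
  "continuous_boundary \<Omega> \<longleftrightarrow> (\<forall>p\<in>frontier \<Omega>.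
     \<exists>(Q :: real^3 \<Rightarrow> real^3) (a :: real^3) (g :: real \<times> real \<Rightarrow> real).
       orthogonal_transformation Q \<and> (\<forall>i. 0 < a $ i) \<and>
       continuous_on ({- a$1<..<a$1} \<times> {- a$2<..<a$2}) g \<and>
       (\<forall>s\<in>{- a$1<..<a$1}. \<forall>t\<in>{- a$2<..<a$2}. \<bar>g (s, t)\<bar> \<le> a$3 / 2) \<and>
       (\<forall>x. let y = Q (x - p) in (\<forall>i. \<bar>y $ i\<bar> < a $ i) \<longrightarrow>
          (x \<in> \<Omega> \<longleftrightarrow> y$3 < g (y$1, y$2)) \<and>
          (x \<in> frontier \<Omega> \<longleftrightarrow> y$3 = g (y$1, y$2))))"

text \<open>\<open>\<Xi>\<close> enumerates the components of the exterior domain, the unbounded one first, and \<open>\<xi>\<close> are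
  the associated cutoff functions. Note that the components are open sets, so a neighbourhood of
  \<open>\<Xi> k\<close> need not contain the boundary of \<open>\<Xi> k\<close>.\<close>

definition exterior_cutoffs ::
  "(real^3) set \<Rightarrow> nat \<Rightarrow> (nat \<Rightarrow> (real^3) set) \<Rightarrow> (nat \<Rightarrow> real^3 \<Rightarrow> real) \<Rightarrow> bool" where
  "exterior_cutoffs \<Omega> m \<Xi> \<xi> \<longleftrightarrow>
     bij_betw \<Xi> {0..<m} (components (- closure \<Omega>)) \<and>
     \<not> bounded (\<Xi> 0) \<and>
     (\<forall>l\<in>{1..<m}. \<xi> l \<in> test_fields UNIV) \<and>
     (\<forall>l\<in>{1..<m}. \<forall>k\<in>{1..<m}. l \<noteq> k \<longrightarrow> supp (\<xi> l) \<inter> supp (\<xi> k) = {}) \<and>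
     (\<forall>l\<in>{1..<m}. \<exists>U. open U \<and> \<Xi> l \<subseteq> U \<and> (\<forall>x\<in>U. \<xi> l x = 1)) \<and>
     (\<forall>l\<in>{1..<m}. \<forall>k\<in>{0..<m} - {l}. \<exists>U. open U \<and> \<Xi> k \<subseteq> U \<and> (\<forall>x\<in>U. \<xi> l x = 0))"

definition p_hat :: "nat \<Rightarrow> real^3 \<Rightarrow> real" where
  "p_hat j x = [1, x $ 1, x $ 2, x $ 3] ! j"

definition xi :: "(nat \<Rightarrow> real^3 \<Rightarrow> real) \<Rightarrow> nat \<Rightarrow> nat \<Rightarrow> real^3 \<Rightarrow> real" where
  "xi \<xi> l j x = \<xi> l x * p_hat j x"

definition psi ::
  "(real^3) set \<Rightarrow> (nat \<Rightarrow> real^3 \<Rightarrow> real) \<Rightarrow> nat \<Rightarrow> nat \<Rightarrow> real L2" where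
  "psi \<Omega> \<xi> l j = (THE \<psi>. \<psi> \<in> H20 \<Omega> \<and>
     orth_proj (kernel (divDiv_S \<Omega>)) (Gradgrad \<Omega> (restr \<Omega> (xi \<xi> l j))) =
     Gradgrad \<Omega> (restr \<Omega> (xi \<xi> l j) - \<psi>))"

definition u_fun ::
  "(real^3) set \<Rightarrow> (nat \<Rightarrow> real^3 \<Rightarrow> real) \<Rightarrow> nat \<Rightarrow> nat \<Rightarrow> real L2" where
  "u_fun \<Omega> \<xi> l j = restr \<Omega> (xi \<xi> l j) - psi \<Omega> \<xi> l j"

end

theory Submission
  imports Defs
begin

text \<open>A function is represented by its second order jet, the triple of its values, gradient and
  Hessian, and \<open>W \<Omega>\<close> denotes the closure in \<open>L\<^sup>2\<close> of the jets of test functions, that is, the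
  Sobolev space with vanishing traces. By Friedrichs' inequality the Hessians of \<open>W \<Omega>\<close> form a closed
  space, whose orthogonal complement among the symmetric fields is the kernel of \<open>divDiv_S\<close>.

  If \<open>T\<close> is a harmonic field, its mollifications are curl free symmetric test fields on a ball and hence
  Hessians of test functions, so that \<open>T\<close> is the Hessian of some \<open>v\<close> in \<open>W\<close> of a ball. Since
  \<open>T\<close> vanishes outside \<open>\<Omega>\<close>, \<open>v\<close> is affine on every component of the exterior, and zero on the unbounded
  one. Subtracting the corresponding combination of the \<open>\<xi>\<^bsub>l,j\<^esub>\<close> leaves an element of \<open>W UNIV\<close> vanishing
  outside \<open>closure \<Omega>\<close>. The continuous boundary allows to push it, locally, into \<open>\<Omega>\<close>, so
  it belongs to \<open>W \<Omega>\<close>, and projecting gives \<open>T\<close> as a combination of the claimed basis fields. As to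
  linear independence, Friedrichs' inequality shows that the compactly supported potential of a
  vanishing combination is zero, and its affine values on \<open>\<Xi>\<^sub>l\<close> determine the coefficients.\<close>

text \<open>A merely continuous boundary excludes traces and extension operators. What survives is a
  local direction along which \<open>closure \<Omega>\<close> moves into \<Omega>; a translation
  followed by a mollification of small radius keeps supports inside \<Omega>. Hence all objects are
  extended by zero to the whole space, and membership in \<open>W \<Omega>\<close> is read off from
  the support alone. Jets carry value, gradient and Hessian in one \<open>L2\<close> class, so each
  limit is the image of a single convergent sequence under a bounded operator; weak derivatives
  enter only when results are translated to \<open>H2\<close>, \<open>H20\<close> and
  \<open>Gradgrad\<close>. The factor 4 is the dimension of the affine functions, the kernel of the
  Hessian on a connected open set. One component contributes nothing: the potential of a harmonic
  field has compact support, so its affine piece on the unbounded component is zero. No topological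
  condition on \<Omega> appears, because potentials are sought on a ball, with a compactly supported
  field as datum.\<close>

section \<open>Calculus of smooth functions\<close>

lemma has_derivative_frechet_derivative: "f differentiable (at x) \<Longrightarrow> (f has_derivative frechet_derivative f (at x)) (at x)"
  by (simp add: frechet_derivative_works)

lemma frechet_derivative_eqI: "(f has_derivative f') (at x) \<Longrightarrow> frechet_derivative f (at x) = f'"
  by (rule frechet_derivative_at[symmetric])

text \<open>Level \<open>Suc n\<close> does not ask for continuity of the function itself; in the
  base case it is recovered from differentiability.\<close>

lemma times_differentiable_SucD: "times_differentiable (Suc n) f \<Longrightarrow> times_differentiable n f"
proof (induction n arbitrary: f)
  case 0
  then show ?case
    by (auto intro!: continuous_at_imp_continuous_on differentiable_imp_continuous_within)
next
  case (Suc n)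
  then show ?case by (metis times_differentiable.simps(2))
qed

lemma times_differentiable_const: "times_differentiable n (\<lambda>x. c)"
proof (induction n arbitrary: c)
  case (Suc n)
  then show ?case by simp
qed simp

lemma times_differentiable_linear:
  assumes "bounded_linear L"
  shows "times_differentiable n L"
proof (cases n)
  case 0
  then show ?thesis using assms by (simp add: linear_continuous_on)
next
  case (Suc m)
  have "frechet_derivative L (at x) = L" for x
    by (rule frechet_derivative_eqI) (rule bounded_linear_imp_has_derivative[OF assms])
  then show ?thesis using assms Suc times_differentiable_const
    by (auto simp: bounded_linear_imp_differentiable)
qed

lemma times_differentiable_add:
  "times_differentiable n f \<Longrightarrow> times_differentiable n g \<Longrightarrow> times_differentiable n (\<lambda>x. f x + g x)"
proof (induction n arbitrary: f g)
  case 0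
  then show ?case by (simp add: continuous_on_add)
next
  case (Suc n)
  have "frechet_derivative (\<lambda>x. f x + g x) (at x) =
      (\<lambda>v. frechet_derivative f (at x) v + frechet_derivative g (at x) v)" for x
    using Suc.prems by (intro frechet_derivative_eqI has_derivative_add has_derivative_frechet_derivative) auto
  with Suc show ?case by simp
qed

text \<open>One induction serves all products: the derivative is a sum of two terms of the same
  shape with one factor differentiated, while the other factor is lowered by one level.\<close>

lemma times_differentiable_bilinear:
  assumes "bounded_bilinear pr"
  shows "times_differentiable n f \<Longrightarrow> times_differentiable n g \<Longrightarrow>
    times_differentiable n (\<lambda>x. pr (f x) (g x))"
proof (induction n arbitrary: f g)
  case 0
  then show ?case by (simp add: bounded_bilinear.continuous_on[OF assms])
next
  case (Suc n)
  have d: "((\<lambda>x. pr (f x) (g x)) has_derivative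
      (\<lambda>v. pr (f x) (frechet_derivative g (at x) v) + pr (frechet_derivative f (at x) v) (g x))) (at x)" for x
    using Suc.prems by (intro bounded_bilinear.FDERIV[OF assms] has_derivative_frechet_derivative) auto
  show ?case
    using frechet_derivative_eqI[OF d] d Suc times_differentiable_SucD[OF Suc.prems(1)] times_differentiable_SucD[OF Suc.prems(2)]
    by (auto intro!: times_differentiable_add differentiableI)
qed

lemma times_differentiable_linear_comp:
  assumes "bounded_linear L"
  shows "times_differentiable n f \<Longrightarrow> times_differentiable n (\<lambda>x. L (f x))"
proof (induction n arbitrary: f)
  case 0
  then show ?case using assms by (simp add: bounded_linear.continuous_on)
next
  case (Suc n)
  have d: "((\<lambda>x. L (f x)) has_derivative (\<lambda>v. L (frechet_derivative f (at x) v))) (at x)" for x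
    using Suc.prems by (intro bounded_linear.has_derivative[OF assms] has_derivative_frechet_derivative) auto
  show ?case using frechet_derivative_eqI[OF d] d Suc by (auto intro!: differentiableI)
qed

lemma times_differentiable_affine:
  assumes "bounded_linear L"
  shows "times_differentiable n f \<Longrightarrow> times_differentiable n (\<lambda>x. f (a + L x))"
proof (induction n arbitrary: f)
  case 0
  have "continuous_on UNIV (\<lambda>x. a + L x)"
    using assms by (intro continuous_intros linear_continuous_on)
  then show ?case using 0 by (auto intro: continuous_on_compose2)
next
  case (Suc n)
  have d: "((\<lambda>x. f (a + L x)) has_derivative (\<lambda>v. frechet_derivative f (at (a + L x)) (L v))) (at x)" for x
  proof (rule has_derivative_compose[where f="\<lambda>x. a + L x" and g=f])
    show "((\<lambda>x. a + L x) has_derivative L) (at x)"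
      by (auto intro!: derivative_eq_intros bounded_linear_imp_has_derivative[OF assms])
    show "(f has_derivative frechet_derivative f (at (a + L x))) (at (a + L x))"
      using Suc.prems by (intro has_derivative_frechet_derivative) auto
  qed
  have "times_differentiable n (\<lambda>x. frechet_derivative f (at (a + L x)) (L v))" for v
    using Suc.IH[of "\<lambda>x. frechet_derivative f (at x) (L v)"] Suc.prems by simp
  then show ?case using frechet_derivative_eqI[OF d] d by (auto intro!: differentiableI)
qed

text \<open>The derivative \<open>- (1/f) f' (1/f)\<close> contains the reciprocal again, but only
  at the lower level, where the induction hypothesis covers it.\<close>

lemma times_differentiable_inverse:
  fixes f :: "'a::real_normed_vector \<Rightarrow> real"
  shows "times_differentiable n f \<Longrightarrow> (\<And>x. f x \<noteq> 0) \<Longrightarrow> times_differentiable n (\<lambda>x. inverse (f x))"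
proof (induction n arbitrary: f)
  case 0
  then show ?case by (simp add: continuous_on_inverse)
next
  case (Suc n)
  have d: "((\<lambda>x. inverse (f x)) has_derivative
      (\<lambda>v. (-1) *\<^sub>R (inverse (f x) * frechet_derivative f (at x) v * inverse (f x)))) (at x)" for x
    using Suc.prems by (auto intro!: derivative_eq_intros has_derivative_frechet_derivative)
  have "times_differentiable n (\<lambda>x. inverse (f x))"
    using Suc.IH times_differentiable_SucD[OF Suc.prems(1)] Suc.prems(2) by blast
  then show ?case using frechet_derivative_eqI[OF d] d Suc.prems
    by (auto intro!: differentiableI times_differentiable_linear_comp[OF bounded_linear_minus[OF bounded_linear_ident]]
        times_differentiable_bilinear[OF bounded_bilinear_mult])
qed

lemma smooth_iff:
  "smooth f \<longleftrightarrow> (\<forall>x. f differentiable (at x)) \<and> (\<forall>v. smooth (\<lambda>x. frechet_derivative f (at x) v))"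
  unfolding smooth_def
  by (metis times_differentiable.simps(2) times_differentiable_SucD)

lemma smooth_differentiable: "smooth f \<Longrightarrow> f differentiable (at x)"
  and smooth_frechet: "smooth f \<Longrightarrow> smooth (\<lambda>x. frechet_derivative f (at x) v)"
  by (auto simp: smooth_iff[of f])

lemma smooth_fd: "smooth f \<Longrightarrow> (f has_derivative frechet_derivative f (at x)) (at x)"
  by (simp add: has_derivative_frechet_derivative smooth_differentiable)

lemma smooth_continuous_on: "smooth f \<Longrightarrow> continuous_on S f"
  unfolding smooth_def by (metis continuous_on_subset subset_UNIV times_differentiable.simps(1))

lemma smooth_const: "smooth (\<lambda>x. c)"
  and smooth_add: "smooth f \<Longrightarrow> smooth g \<Longrightarrow> smooth (\<lambda>x. f x + g x)"
  and smooth_bilinear: "bounded_bilinear pr \<Longrightarrow> smooth h \<Longrightarrow> smooth k \<Longrightarrow> smooth (\<lambda>x. pr (h x) (k x))"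
  and smooth_linear_comp: "bounded_linear L \<Longrightarrow> smooth f \<Longrightarrow> smooth (\<lambda>x. L (f x))"
  and smooth_linear: "bounded_linear L' \<Longrightarrow> smooth L'"
  and smooth_affine: "bounded_linear L'' \<Longrightarrow> smooth f \<Longrightarrow> smooth (\<lambda>x. f (a + L'' x))"
  unfolding smooth_def
  by (blast intro: times_differentiable_const times_differentiable_add times_differentiable_bilinear
      times_differentiable_linear_comp times_differentiable_linear times_differentiable_affine)+

lemma smooth_inverse:
  fixes f :: "'a::real_normed_vector \<Rightarrow> real"
  shows "smooth f \<Longrightarrow> (\<And>x. f x \<noteq> 0) \<Longrightarrow> smooth (\<lambda>x. inverse (f x))"
  unfolding smooth_def by (blast intro: times_differentiable_inverse)

lemma smooth_mult:
  fixes f g :: "'a::real_normed_vector \<Rightarrow> real"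
  shows "smooth f \<Longrightarrow> smooth g \<Longrightarrow> smooth (\<lambda>x. f x * g x)"
  by (rule smooth_bilinear[OF bounded_bilinear_mult])

lemma smooth_scaleR: "smooth f \<Longrightarrow> smooth g \<Longrightarrow> smooth (\<lambda>x. f x *\<^sub>R g x)"
  by (rule smooth_bilinear[OF bounded_bilinear_scaleR])

lemma smooth_cmult: "smooth f \<Longrightarrow> smooth (\<lambda>x. c *\<^sub>R f x)"
  by (rule smooth_linear_comp[OF bounded_linear_scaleR_right])

lemma smooth_minus: "smooth f \<Longrightarrow> smooth (\<lambda>x. - f x)"
  by (rule smooth_linear_comp[OF bounded_linear_minus[OF bounded_linear_ident]])

lemma smooth_diff: "smooth f \<Longrightarrow> smooth g \<Longrightarrow> smooth (\<lambda>x. f x - g x)"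
  using smooth_add[of f "\<lambda>x. - g x"] smooth_minus[of g] by simp

lemma smooth_sum: "(\<And>i. i \<in> I \<Longrightarrow> smooth (f i)) \<Longrightarrow> smooth (\<lambda>x. \<Sum>i\<in>I. f i x)"
  by (induction I rule: infinite_finite_induct) (auto intro: smooth_const smooth_add)

lemma smooth_prod:
  fixes f :: "'i \<Rightarrow> 'a::real_normed_vector \<Rightarrow> real"
  shows "(\<And>i. i \<in> I \<Longrightarrow> smooth (f i)) \<Longrightarrow> smooth (\<lambda>x. \<Prod>i\<in>I. f i x)"
  by (induction I rule: infinite_finite_induct) (auto intro: smooth_const smooth_mult)

lemma linear_axis: "linear (\<lambda>v. axis i v)"
  by (auto simp: linear_iff axis_def vec_eq_iff)

lemma bounded_linear_axis: "bounded_linear (\<lambda>v::'a::euclidean_space. axis (i::'n::finite) v)"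
  by (simp add: linear_axis linear_conv_bounded_linear[symmetric])

text \<open>Presents a vector as a finite sum of linear images of its entries, so that closure under
  sums and linear maps yields closure under \<open>\<chi>\<close>.\<close>

lemma sum_axis: "(\<Sum>i\<in>UNIV. axis i (f i)) = ((\<chi> i. f i) :: ('a::ab_group_add)^'n::finite)"
  by (simp add: vec_eq_iff axis_def)

lemma smooth_vec:
  fixes f :: "'n::finite \<Rightarrow> 'a::real_normed_vector \<Rightarrow> 'b::euclidean_space"
  assumes "\<And>i. smooth (f i)"
  shows "smooth (\<lambda>x. \<chi> i. f i x)"
  unfolding sum_axis[symmetric]
  by (intro smooth_sum smooth_linear_comp[OF bounded_linear_axis] assms)

lemma smooth_partial_deriv: "smooth f \<Longrightarrow> smooth (partial_deriv i f)"
  unfolding partial_deriv_def[abs_def] by (rule smooth_frechet)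

lemma smooth_grad: "smooth f \<Longrightarrow> smooth (grad f)"
  unfolding grad_def[abs_def] by (intro smooth_vec smooth_partial_deriv)

lemma smooth_hess: "smooth f \<Longrightarrow> smooth (hess f)"
  unfolding hess_def[abs_def] by (intro smooth_vec smooth_partial_deriv)

section \<open>Partial derivatives and the symmetry of second derivatives\<close>

lemma vec3_expand: "(v::real^3) = (\<Sum>i\<in>UNIV. (v $ i) *\<^sub>R axis i 1)"
proof -
  have "(v $ i) *\<^sub>R axis i 1 = axis i (v $ i)" for i
    by (simp add: vec_eq_iff axis_def)
  then show ?thesis by (simp add: sum_axis)
qed

lemma frechet_derivative_partial:
  assumes "f differentiable (at x)"
  shows "frechet_derivative f (at x) v = (\<Sum>i\<in>UNIV. (v $ i) *\<^sub>R partial_deriv i f x)"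
proof -
  interpret linear "frechet_derivative f (at x)"
    by (rule linear_frechet_derivative[OF assms])
  have "frechet_derivative f (at x) (\<Sum>i\<in>UNIV. (v $ i) *\<^sub>R axis i 1) = (\<Sum>i\<in>UNIV. (v $ i) *\<^sub>R partial_deriv i f x)"
    unfolding partial_deriv_def sum by (simp add: scaleR)
  then show ?thesis unfolding vec3_expand[symmetric] .
qed

lemma partial_deriv_add:
  assumes "f differentiable (at x)" "g differentiable (at x)"
  shows "partial_deriv i (\<lambda>x. f x + g x) x = partial_deriv i f x + partial_deriv i g x"
  using frechet_derivative_eqI[OF has_derivative_add[OF has_derivative_frechet_derivative[OF assms(1)] has_derivative_frechet_derivative[OF assms(2)]]]
  by (simp add: partial_deriv_def)

lemma partial_deriv_linear_comp:
  assumes "bounded_linear L" "f differentiable (at x)"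
  shows "partial_deriv i (\<lambda>x. L (f x)) x = L (partial_deriv i f x)"
  using frechet_derivative_eqI[OF bounded_linear.has_derivative[OF assms(1) has_derivative_frechet_derivative[OF assms(2)]]]
  by (simp add: partial_deriv_def)

lemma partial_deriv_scaleR:
  assumes "f differentiable (at x)" "g differentiable (at x)"
  shows "partial_deriv i (\<lambda>x. f x *\<^sub>R g x) x = f x *\<^sub>R partial_deriv i g x + partial_deriv i f x *\<^sub>R g x"
  using frechet_derivative_eqI[OF has_derivative_scaleR[OF has_derivative_frechet_derivative[OF assms(1)] has_derivative_frechet_derivative[OF assms(2)]]]
  by (simp add: partial_deriv_def)

lemma partial_deriv_mult:
  fixes f g :: "real^3 \<Rightarrow> real"
  shows "f differentiable (at x) \<Longrightarrow> g differentiable (at x) \<Longrightarrow>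
   partial_deriv i (\<lambda>x. f x * g x) x = f x * partial_deriv i g x + partial_deriv i f x * g x"
  using partial_deriv_scaleR[of f x g i] by simp

lemma partial_deriv_const [simp]: "partial_deriv i (\<lambda>x. c) x = 0"
  by (simp add: partial_deriv_def)

lemma partial_deriv_coord: "partial_deriv i (\<lambda>x. x $ j) x = (if i = j then 1 else 0)"
  using frechet_derivative_eqI[OF bounded_linear_imp_has_derivative[OF bounded_linear_vec_nth[of j]], of x]
  by (simp add: axis_def partial_deriv_def)

lemma partial_deriv_cong_open:
  assumes "open S" "x \<in> S" "\<And>y. y \<in> S \<Longrightarrow> f y = g y"
  shows "partial_deriv i f x = partial_deriv i g x"
proof -
  have "(f has_derivative f') (at x) \<longleftrightarrow> (g has_derivative f') (at x)" for f'
    using assms has_derivative_transform_within_open[of f f' x UNIV S g]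
      has_derivative_transform_within_open[of g f' x UNIV S f] by auto
  then show ?thesis unfolding partial_deriv_def frechet_derivative_def by simp
qed

text \<open>The second difference is symmetric in \<open>u\<close> and \<open>v\<close>, whence the symmetry of second derivatives.\<close>

lemma mixed_difference:
  fixes f :: "'a::real_normed_vector \<Rightarrow> real"
  assumes f: "smooth f" and h: "0 < h"
  shows "\<exists>s\<in>{0..h}. \<exists>t\<in>{0..h}. f (x + h *\<^sub>R u + h *\<^sub>R v) - f (x + h *\<^sub>R u) - f (x + h *\<^sub>R v) + f x
      = h * h * frechet_derivative (\<lambda>y. frechet_derivative f (at y) u) (at (x + s *\<^sub>R u + t *\<^sub>R v)) v"
proof -
  define g where "g = (\<lambda>y. frechet_derivative f (at y) u)"
  have g: "smooth g" unfolding g_def by (rule smooth_frechet[OF f])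
  have d1: "((\<lambda>s. k (a + s *\<^sub>R w)) has_derivative (\<lambda>r. r * frechet_derivative k (at (a + s *\<^sub>R w)) w)) (at s)"
    if "smooth k" for k :: "'a \<Rightarrow> real" and a w s
  proof -
    have "((\<lambda>s. k (a + s *\<^sub>R w)) has_derivative (\<lambda>r. frechet_derivative k (at (a + s *\<^sub>R w)) (r *\<^sub>R w))) (at s)"
      by (rule has_derivative_compose[where g=k, OF _ smooth_fd[OF that]]) (auto intro!: derivative_eq_intros)
    moreover have "frechet_derivative k (at (a + s *\<^sub>R w)) (r *\<^sub>R w) = r * frechet_derivative k (at (a + s *\<^sub>R w)) w" for r
      using linear_cmul[OF linear_frechet_derivative[OF smooth_differentiable[OF that]]] by simp
    ultimately show ?thesis by simp
  qed
  \<comment> \<open>Mean value theorem in direction \<open>u\<close> for the difference of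
    \<open>f\<close> across \<open>h v\<close>; a second application, in direction \<open>v\<close>,
    then produces the mixed derivative at an intermediate point.\<close>
  have "\<exists>s. 0 < s \<and> s < h \<and> (f (x + h *\<^sub>R v + h *\<^sub>R u) - f (x + h *\<^sub>R u)) - (f (x + h *\<^sub>R v + 0 *\<^sub>R u) - f (x + 0 *\<^sub>R u))
     = (h - 0) * (g (x + h *\<^sub>R v + s *\<^sub>R u) - g (x + s *\<^sub>R u))"
    using h by (intro MVT2) (auto simp: has_field_derivative_def g_def mult.commute right_diff_distrib
      intro!: has_derivative_diff[OF d1[OF f] d1[OF f], THEN has_derivative_eq_rhs])
  then obtain s where s: "0 < s" "s < h" "f (x + h *\<^sub>R v + h *\<^sub>R u) - f (x + h *\<^sub>R u) - f (x + h *\<^sub>R v) + f x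
     = h * (g (x + h *\<^sub>R v + s *\<^sub>R u) - g (x + s *\<^sub>R u))" by (auto simp: algebra_simps)
  have "\<exists>t. 0 < t \<and> t < h \<and> g (x + s *\<^sub>R u + h *\<^sub>R v) - g (x + s *\<^sub>R u + 0 *\<^sub>R v)
     = (h - 0) * frechet_derivative g (at (x + s *\<^sub>R u + t *\<^sub>R v)) v"
    using h d1[OF g] by (intro MVT2) (auto simp: has_field_derivative_def mult.commute
      intro!: d1[OF g, THEN has_derivative_eq_rhs])
  then obtain t where t: "0 < t" "t < h" "g (x + s *\<^sub>R u + h *\<^sub>R v) - g (x + s *\<^sub>R u)
     = h * frechet_derivative g (at (x + s *\<^sub>R u + t *\<^sub>R v)) v" by auto
  show ?thesis
    using s t unfolding g_def[symmetric]
    by (intro bexI[of _ s] bexI[of _ t]) (auto simp: algebra_simps)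
qed

lemma smooth_second_symmetric:
  fixes f :: "'a::real_normed_vector \<Rightarrow> real"
  assumes f: "smooth f"
  shows "frechet_derivative (\<lambda>y. frechet_derivative f (at y) u) (at x) v =
         frechet_derivative (\<lambda>y. frechet_derivative f (at y) v) (at x) u"
proof -
  define q where "q h = (f (x + h *\<^sub>R u + h *\<^sub>R v) - f (x + h *\<^sub>R u) - f (x + h *\<^sub>R v) + f x) / (h * h)" for h
  define H where "H n = inverse (real (Suc n))" for n
  have H: "H n > 0" for n by (simp add: H_def)
  have Hl: "H \<longlonglongrightarrow> 0" unfolding H_def by (rule LIMSEQ_inverse_real_of_nat)
  \<comment> \<open>Stated for arbitrary directions because it is applied a second time with
    \<open>u\<close> and \<open>v\<close> exchanged, which leaves the quotient unchanged.\<close>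
  have lim: "(\<lambda>n. q (H n)) \<longlonglongrightarrow> frechet_derivative (\<lambda>y. frechet_derivative f (at y) u) (at x) v"
    if q: "\<And>h. q h = (f (x + h *\<^sub>R u + h *\<^sub>R v) - f (x + h *\<^sub>R u) - f (x + h *\<^sub>R v) + f x) / (h * h)" for u v q
  proof -
    define D where "D y = frechet_derivative (\<lambda>y. frechet_derivative f (at y) u) (at y) v" for y
    have "smooth D" unfolding D_def by (intro smooth_frechet f)
    then have D: "continuous_on UNIV D" by (rule smooth_continuous_on)
    have "\<forall>n. \<exists>s t. s \<in> {0..H n} \<and> t \<in> {0..H n} \<and> q (H n) = D (x + s *\<^sub>R u + t *\<^sub>R v)"
    proof
      fix n
      from mixed_difference[OF f H[of n], of x u v] H[of n]
      show "\<exists>s t. s \<in> {0..H n} \<and> t \<in> {0..H n} \<and> q (H n) = D (x + s *\<^sub>R u + t *\<^sub>R v)"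
        unfolding q D_def by (metis (no_types, lifting) less_irrefl mult_eq_0_iff nonzero_mult_div_cancel_left)
    qed
    then obtain s t where st: "\<And>n. s n \<in> {0..H n}" "\<And>n. t n \<in> {0..H n}" 
      "\<And>n. q (H n) = D (x + s n *\<^sub>R u + t n *\<^sub>R v)" by metis
    have s0: "s \<longlonglongrightarrow> 0" using st(1) by (intro tendsto_sandwich[OF _ _ tendsto_const Hl]) auto
    have t0: "t \<longlonglongrightarrow> 0" using st(2) by (intro tendsto_sandwich[OF _ _ tendsto_const Hl]) auto
    have "(\<lambda>n. x + s n *\<^sub>R u + t n *\<^sub>R v) \<longlonglongrightarrow> x + 0 *\<^sub>R u + 0 *\<^sub>R v" by (intro tendsto_intros s0 t0)
    then have "(\<lambda>n. D (x + s n *\<^sub>R u + t n *\<^sub>R v)) \<longlonglongrightarrow> D (x + 0 *\<^sub>R u + 0 *\<^sub>R v)"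
      by (rule continuous_on_tendsto_compose[OF D]) auto
    then show ?thesis unfolding st(3) by (simp add: D_def)
  qed
  have "(\<lambda>n. q (H n)) \<longlonglongrightarrow> frechet_derivative (\<lambda>y. frechet_derivative f (at y) u) (at x) v"
    by (rule lim) (rule q_def)
  moreover have "(\<lambda>n. q (H n)) \<longlonglongrightarrow> frechet_derivative (\<lambda>y. frechet_derivative f (at y) v) (at x) u"
    by (rule lim) (simp add: q_def algebra_simps)
  ultimately show ?thesis by (rule LIMSEQ_unique)
qed

lemma partial_deriv_commute:
  fixes f :: "real^3 \<Rightarrow> real"
  assumes "smooth f"
  shows "partial_deriv i (partial_deriv j f) x = partial_deriv j (partial_deriv i f) x"
  unfolding partial_deriv_def[abs_def] by (rule smooth_second_symmetric[OF assms])

lemma transpose_hess: "smooth f \<Longrightarrow> transpose (hess f x) = hess f x"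
  by (simp add: vec_eq_iff transpose_def hess_def partial_deriv_commute)

subsection \<open>Cutoff functions\<close>

text \<open>The functions exp(-1/x) x^(-k) on the positive axis, extended by zero. The family is
  closed under differentiation up to linear combinations, so smoothness becomes an induction over
  all \<open>k\<close> at once.\<close>

definition bump_exp :: "nat \<Rightarrow> real \<Rightarrow> real" where
  "bump_exp k x = (if x \<le> 0 then 0 else exp (- inverse x) * inverse x ^ k)"

text \<open>With y = 1/x, the exponential series dominates its single term y^(k+2)/(k+2)!. The
  resulting quadratic bound makes the difference quotient at 0 tend to zero.\<close>

lemma bump_exp_bound: "\<bar>bump_exp k x\<bar> \<le> fact (k + 2) * x\<^sup>2"
proof (cases "x \<le> 0")
  case False
  define y where "y = inverse x"
  define c :: real where "c = fact (k + 2)"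
  have y: "y > 0" and c: "c > 0" using False by (simp_all add: y_def c_def)
  have "y ^ (k + 2) / c \<le> exp y"
    using sum_le_suminf[OF summable_exp[of y], of "{k + 2}"] y
    unfolding c_def by (simp add: exp_def divide_inverse mult.commute)
  then have "y ^ k * y\<^sup>2 \<le> c * exp y" using c by (simp add: power_add power2_eq_square pos_divide_le_eq ac_simps)
  then have "exp (- y) * (y ^ k * y\<^sup>2) \<le> exp (- y) * (c * exp y)" by (intro mult_left_mono) auto
  then have "exp (- y) * y ^ k * y\<^sup>2 \<le> c" by (simp add: exp_minus field_simps)
  then have "exp (- y) * y ^ k \<le> c / y\<^sup>2" using y by (simp add: pos_le_divide_eq)
  then show ?thesis using False by (simp add: bump_exp_def y_def c_def power_inverse divide_inverse)
qed (simp add: bump_exp_def)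

lemma bump_exp_deriv:
  "(bump_exp k has_real_derivative (bump_exp (k + 2) x - real k * bump_exp (k + 1) x)) (at x)"
proof (cases x "0::real" rule: linorder_cases)
  case less
  have "((\<lambda>x. 0) has_real_derivative 0) (at x)" by simp
  then have "(bump_exp k has_real_derivative 0) (at x)"
    by (rule has_field_derivative_transform_within_open[of _ _ _ "{..<0}"]) (use less in \<open>auto simp: bump_exp_def\<close>)
  then show ?thesis using less by (simp add: bump_exp_def)
next
  case equal
  have b: "norm ((bump_exp k (0 + h) - bump_exp k 0) / h) \<le> fact (k + 2) * \<bar>h\<bar>" for h
  proof (cases "h = 0")
    case False
    have "\<bar>bump_exp k h\<bar> \<le> fact (k + 2) * \<bar>h\<bar> * \<bar>h\<bar>"
      using bump_exp_bound[of k h] by (simp only: power2_eq_square mult.assoc abs_mult_self_eq)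
    then have "\<bar>bump_exp k h\<bar> / \<bar>h\<bar> \<le> fact (k + 2) * \<bar>h\<bar>"
      using False by (simp add: pos_divide_le_eq)
    then show ?thesis by (simp add: bump_exp_def[of k 0])
  qed simp
  have "((\<lambda>h. (bump_exp k (0 + h) - bump_exp k 0) / h) \<longlongrightarrow> 0) (at 0)"
  proof (rule Lim_null_comparison[where g="\<lambda>h. fact (k + 2) * \<bar>h\<bar>"])
    show "\<forall>\<^sub>F h in at 0. norm ((bump_exp k (0 + h) - bump_exp k 0) / h) \<le> fact (k + 2) * \<bar>h\<bar>"
      using b by (intro always_eventually allI)
    show "((\<lambda>h. fact (k + 2) * \<bar>h\<bar>) \<longlongrightarrow> 0) (at (0::real))"
      by (auto intro!: tendsto_mult_right_zero tendsto_rabs_zero)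
  qed
  then show ?thesis using equal by (simp add: DERIV_def bump_exp_def)
next
  case greater
  \<comment> \<open>The exponent \<open>k - 1\<close> comes from the power rule; at
    \<open>k = 0\<close> the factor \<open>real k\<close> vanishes, so truncated subtraction does no
    harm.\<close>
  have k: "real k * inverse x ^ (k - 1) * inverse x = real k * inverse x ^ k" by (cases k) auto
  have "((\<lambda>x. exp (- inverse x) * inverse x ^ k) has_real_derivative
      (exp (- inverse x) * (inverse x * inverse x)) * inverse x ^ k
       - exp (- inverse x) * ((real k * inverse x ^ (k - 1) * inverse x) * inverse x)) (at x)"
    using greater by (auto intro!: derivative_eq_intros simp: algebra_simps)
  then have "((\<lambda>x. exp (- inverse x) * inverse x ^ k) has_real_derivative
      (bump_exp (k + 2) x - real k * bump_exp (k + 1) x)) (at x)"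
    unfolding k using greater by (simp add: bump_exp_def algebra_simps)
  then show ?thesis
    by (rule has_field_derivative_transform_within_open[of _ _ _ "{0<..}"]) (use greater in \<open>auto simp: bump_exp_def\<close>)
qed

lemma smooth_bump_exp: "smooth (bump_exp k)"
proof -
  have d: "(bump_exp k has_derivative (\<lambda>v. v *\<^sub>R (bump_exp (k + 2) x + (- real k) *\<^sub>R bump_exp (k + 1) x))) (at x)" for k x
    using bump_exp_deriv[of k x] unfolding has_field_derivative_def
    by (rule has_derivative_eq_rhs) (simp add: fun_eq_iff)
  have "times_differentiable n (bump_exp k)" for n
  proof (induction n arbitrary: k)
    case 0
    show ?case using d by (auto intro!: continuous_at_imp_continuous_on has_derivative_continuous)
  next
    case (Suc n)
    have "times_differentiable n (\<lambda>x. v *\<^sub>R (bump_exp (k + 2) x + (- real k) *\<^sub>R bump_exp (k + 1) x))" for v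
      by (intro times_differentiable_linear_comp[OF bounded_linear_scaleR_right] times_differentiable_add Suc)
    then show ?case using frechet_derivative_eqI[OF d] d by (auto intro!: differentiableI)
  qed
  then show ?thesis by (simp add: smooth_def)
qed

text \<open>The standard transition b(x) / (b(x) + b(1-x)) from 0 on the left of 0 to 1 on the right
  of 1. The reflection is written in affine form to match \<open>smooth_affine\<close>.\<close>

definition smooth_step :: "real \<Rightarrow> real" where
  "smooth_step x = bump_exp 0 x * inverse (bump_exp 0 x + bump_exp 0 (1 + (-1) *\<^sub>R x))"

lemma bump_exp_nonneg: "0 \<le> bump_exp k x" by (simp add: bump_exp_def)

lemma smooth_step_denom: "0 < bump_exp 0 x + bump_exp 0 (1 + (-1) *\<^sub>R x)"
  using bump_exp_nonneg[of 0 x] bump_exp_nonneg[of 0 "1 - x"]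
  by (auto simp: bump_exp_def add_pos_pos)

lemma smooth_smooth_step: "smooth smooth_step"
  unfolding smooth_step_def[abs_def]
  by (intro smooth_mult smooth_inverse smooth_add smooth_bump_exp smooth_affine bounded_linear_scaleR_right)
     (use smooth_step_denom in \<open>auto simp: less_le\<close>)

lemma smooth_step_ge: "0 \<le> smooth_step x"
  and smooth_step_le: "smooth_step x \<le> 1"
  and smooth_step_0: "x \<le> 0 \<Longrightarrow> smooth_step x = 0"
  and smooth_step_1: "1 \<le> x \<Longrightarrow> smooth_step x = 1"
proof -
  show "0 \<le> smooth_step x" "smooth_step x \<le> 1"
    using smooth_step_denom[of x] bump_exp_nonneg[of 0 x] bump_exp_nonneg[of 0 "1 - x"]
    by (auto simp: smooth_step_def field_simps)
  show "x \<le> 0 \<Longrightarrow> smooth_step x = 0" "1 \<le> x \<Longrightarrow> smooth_step x = 1"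
    by (auto simp: smooth_step_def bump_exp_def)
qed

subsection \<open>Test fields\<close>

text \<open>Spares the computation of \<open>supp\<close>: a compact set off which the function
  vanishes is closed, hence contains the closure of the nonzero set.\<close>

lemma test_fieldsI:
  assumes "smooth \<phi>" "compact K" "K \<subseteq> \<Omega>" "\<And>x. x \<notin> K \<Longrightarrow> \<phi> x = 0"
  shows "\<phi> \<in> test_fields \<Omega>"
proof -
  have "supp \<phi> \<subseteq> K"
    unfolding supp_def using assms(2,4) by (intro closure_minimal compact_imp_closed) auto
  moreover from this have "compact (supp \<phi>)"
    using compact_Int_closed[OF assms(2), of "supp \<phi>"] by (simp add: supp_def Int_absorb1)
  ultimately show ?thesis using assms by (auto simp: test_fields_def)
qed

lemma test_fieldsE:
  assumes "\<phi> \<in> test_fields \<Omega>"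
  obtains K where "smooth \<phi>" "compact K" "K \<subseteq> \<Omega>" "\<And>x. x \<notin> K \<Longrightarrow> \<phi> x = 0"
proof
  show "smooth \<phi>" "compact (supp \<phi>)" "supp \<phi> \<subseteq> \<Omega>" using assms by (auto simp: test_fields_def)
  show "\<phi> x = 0" if "x \<notin> supp \<phi>" for x
    using that closure_subset[of "{x. \<phi> x \<noteq> 0}"] by (auto simp: supp_def)
qed

lemma test_fields_smooth: "\<phi> \<in> test_fields \<Omega> \<Longrightarrow> smooth \<phi>"
  by (simp add: test_fields_def)

lemma test_fields_mono: "\<Omega> \<subseteq> \<Omega>' \<Longrightarrow> test_fields \<Omega> \<subseteq> test_fields \<Omega>'"
  by (auto simp: test_fields_def)

lemma test_fields_UNIV: "\<phi> \<in> test_fields \<Omega> \<Longrightarrow> \<phi> \<in> test_fields UNIV"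
  by (auto simp: test_fields_def)

lemma test_fields_outside:
  assumes "\<phi> \<in> test_fields \<Omega>" "x \<notin> \<Omega>"
  shows "\<phi> x = 0"
proof -
  from assms(1) obtain K where K: "K \<subseteq> \<Omega>" "\<And>x. x \<notin> K \<Longrightarrow> \<phi> x = 0" by (rule test_fieldsE) (rule that)
  then show ?thesis using assms(2) by (intro K(2)) auto
qed

lemma test_fields_zero: "(\<lambda>x. 0) \<in> test_fields \<Omega>"
  by (rule test_fieldsI[of _ "{}"]) (auto simp: smooth_const)

lemma test_fields_add:
  assumes "\<phi> \<in> test_fields \<Omega>" "\<psi> \<in> test_fields \<Omega>"
  shows "(\<lambda>x. \<phi> x + \<psi> x) \<in> test_fields \<Omega>"
proof -
  from assms(1) obtain K where K: "smooth \<phi>" "compact K" "K \<subseteq> \<Omega>" "\<And>x. x \<notin> K \<Longrightarrow> \<phi> x = 0" by (rule test_fieldsE) (rule that)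
  from assms(2) obtain L where L: "smooth \<psi>" "compact L" "L \<subseteq> \<Omega>" "\<And>x. x \<notin> L \<Longrightarrow> \<psi> x = 0" by (rule test_fieldsE) (rule that)
  show ?thesis
    by (rule test_fieldsI[of _ "K \<union> L"]) (use K L in \<open>auto intro: smooth_add compact_Un\<close>)
qed

lemma test_fields_linear_comp:
  assumes L: "bounded_linear L" and "\<phi> \<in> test_fields \<Omega>"
  shows "(\<lambda>x. L (\<phi> x)) \<in> test_fields \<Omega>"
proof -
  from assms(2) obtain K where K: "smooth \<phi>" "compact K" "K \<subseteq> \<Omega>" "\<And>x. x \<notin> K \<Longrightarrow> \<phi> x = 0" by (rule test_fieldsE) (rule that)
  show ?thesis
    by (rule test_fieldsI[of _ K]) (use K in \<open>auto intro: smooth_linear_comp[OF L] simp: linear_0[OF bounded_linear.linear[OF L]]\<close>)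
qed

lemma test_fields_scaleR: "\<phi> \<in> test_fields \<Omega> \<Longrightarrow> (\<lambda>x. c *\<^sub>R \<phi> x) \<in> test_fields \<Omega>"
  by (rule test_fields_linear_comp[OF bounded_linear_scaleR_right])

lemma test_fields_diff:
  assumes "\<phi> \<in> test_fields \<Omega>" "\<psi> \<in> test_fields \<Omega>"
  shows "(\<lambda>x. \<phi> x - \<psi> x) \<in> test_fields \<Omega>"
proof -
  have "(\<lambda>x. \<phi> x + (-1) *\<^sub>R \<psi> x) \<in> test_fields \<Omega>"
    by (rule test_fields_add[OF assms(1) test_fields_scaleR[OF assms(2)]])
  then show ?thesis by simp
qed

lemma test_fields_sum:
  "(\<And>i. i \<in> I \<Longrightarrow> f i \<in> test_fields \<Omega>) \<Longrightarrow> (\<lambda>x. \<Sum>i\<in>I. f i x) \<in> test_fields \<Omega>"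
proof (induction I rule: infinite_finite_induct)
  case (insert i I)
  have "(\<lambda>x. f i x + (\<Sum>j\<in>I. f j x)) \<in> test_fields \<Omega>"
    by (rule test_fields_add) (use insert in blast)+
  then show ?case using insert.hyps by simp
qed (simp_all add: test_fields_zero)

lemma test_fields_bilinear:
  assumes p: "bounded_bilinear pr" and g: "smooth g"
  shows "\<phi> \<in> test_fields \<Omega> \<Longrightarrow> (\<lambda>x. pr (g x) (\<phi> x)) \<in> test_fields \<Omega>"
proof (erule test_fieldsE)
  fix K assume K: "smooth \<phi>" "compact K" "K \<subseteq> \<Omega>" "\<And>x. x \<notin> K \<Longrightarrow> \<phi> x = 0"
  show ?thesis
    by (rule test_fieldsI[of _ K]) (use K in \<open>auto intro: smooth_bilinear[OF p g] simp: bounded_bilinear.zero_right[OF p]\<close>)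
qed

lemmas test_fields_smooth_mult = test_fields_bilinear[OF bounded_bilinear_mult]

lemma test_fields_mult_smooth:
  assumes "\<phi> \<in> test_fields \<Omega>" "smooth g"
  shows "(\<lambda>x. \<phi> x *\<^sub>R g x) \<in> test_fields \<Omega>"
proof -
  from assms(1) obtain K where K: "smooth \<phi>" "compact K" "K \<subseteq> \<Omega>" "\<And>x. x \<notin> K \<Longrightarrow> \<phi> x = 0" by (rule test_fieldsE) (rule that)
  show ?thesis
    by (rule test_fieldsI[OF smooth_scaleR[OF K(1) assms(2)] K(2,3)]) (simp add: K(4))
qed

lemma partial_deriv_outside:
  assumes "closed K" "\<And>x. x \<notin> K \<Longrightarrow> f x = 0" "x \<notin> K"
  shows "partial_deriv i f x = 0"
  using partial_deriv_cong_open[of "- K" x f "\<lambda>x. 0" i] assms by (auto simp: open_Compl)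

lemma grad_outside: "closed K \<Longrightarrow> (\<And>x. x \<notin> K \<Longrightarrow> f x = 0) \<Longrightarrow> x \<notin> K \<Longrightarrow> grad f x = 0"
  by (simp add: grad_def vec_eq_iff partial_deriv_outside[of K])

lemma hess_outside: "closed K \<Longrightarrow> (\<And>x. x \<notin> K \<Longrightarrow> f x = 0) \<Longrightarrow> x \<notin> K \<Longrightarrow> hess f x = 0"
  by (simp add: hess_def vec_eq_iff partial_deriv_outside[of K])

lemma test_fields_partial_deriv:
  assumes "\<phi> \<in> test_fields \<Omega>"
  shows "partial_deriv i \<phi> \<in> test_fields \<Omega>"
proof -
  from assms obtain K where K: "smooth \<phi>" "compact K" "K \<subseteq> \<Omega>" "\<And>x. x \<notin> K \<Longrightarrow> \<phi> x = 0" by (rule test_fieldsE) (rule that)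
  show ?thesis
    by (rule test_fieldsI[of _ K]) (use K in \<open>auto intro: smooth_partial_deriv partial_deriv_outside[of K] simp: compact_imp_closed\<close>)
qed

lemma test_fields_vec:
  fixes f :: "'n::finite \<Rightarrow> real^3 \<Rightarrow> 'b::euclidean_space"
  shows "(\<And>i. f i \<in> test_fields \<Omega>) \<Longrightarrow> (\<lambda>x. \<chi> i. f i x) \<in> test_fields \<Omega>"
  unfolding sum_axis[symmetric]
  by (intro test_fields_sum test_fields_linear_comp[OF bounded_linear_axis])

lemma test_fields_grad: "\<phi> \<in> test_fields \<Omega> \<Longrightarrow> grad \<phi> \<in> test_fields \<Omega>"
  unfolding grad_def[abs_def] by (intro test_fields_vec test_fields_partial_deriv)

lemma test_fields_hess: "\<phi> \<in> test_fields \<Omega> \<Longrightarrow> hess \<phi> \<in> test_fields \<Omega>"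
  unfolding hess_def[abs_def] by (intro test_fields_vec test_fields_partial_deriv)

lemma test_fields_nth: "\<phi> \<in> test_fields \<Omega> \<Longrightarrow> (\<lambda>x. \<phi> x $ i) \<in> test_fields \<Omega>"
  by (rule test_fields_linear_comp[OF bounded_linear_vec_nth])

lemma test_fields_Pair:
  assumes "\<phi> \<in> test_fields \<Omega>" "\<psi> \<in> test_fields \<Omega>"
  shows "(\<lambda>x. (\<phi> x, \<psi> x)) \<in> test_fields \<Omega>"
proof -
  have "(\<lambda>x. (\<phi> x, 0) + (0, \<psi> x)) \<in> test_fields \<Omega>"
    by (rule test_fields_add test_fields_linear_comp[of "\<lambda>y. (y, 0)"] test_fields_linear_comp[of "\<lambda>y. (0, y)"]
        bounded_linear_Pair bounded_linear_ident bounded_linear_zero assms)+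
  then show ?thesis by simp
qed

lemma test_fields_bounded:
  assumes "\<phi> \<in> test_fields \<Omega>"
  obtains B where "0 \<le> B" "\<And>x. norm (\<phi> x) \<le> B"
proof -
  from assms obtain K where K: "smooth \<phi>" "compact K" "\<And>x. x \<notin> K \<Longrightarrow> \<phi> x = 0" by (rule test_fieldsE) (rule that)
  have "compact (\<phi> ` K)" using K by (intro compact_continuous_image smooth_continuous_on)
  then obtain B where B: "\<forall>y\<in>\<phi> ` K. norm y \<le> B" using compact_imp_bounded[of "\<phi> ` K"] unfolding bounded_iff by blast
  show ?thesis
  proof (rule that[of "max 0 B"])
    fix x show "norm (\<phi> x) \<le> max 0 B" using bspec[OF B, of "\<phi> x"] K(3)[of x] by (cases "x \<in> K") auto
  qed simp
qed

lemma test_fields_ball: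
  assumes "\<phi> \<in> test_fields \<Omega>"
  obtains R where "0 < R" "\<And>x. R < norm x \<Longrightarrow> \<phi> x = 0"
proof -
  from assms obtain K where K: "smooth \<phi>" "compact K" "\<And>x. x \<notin> K \<Longrightarrow> \<phi> x = 0" by (rule test_fieldsE) (rule that)
  obtain B where B: "0 < B" "\<forall>y\<in>K. norm y \<le> B" using compact_imp_bounded[OF K(2)] unfolding bounded_pos by blast
  show ?thesis
  proof (rule that[OF B(1)])
    fix x :: "real^3" assume "B < norm x"
    then have "x \<notin> K" using B(2) by auto
    then show "\<phi> x = 0" by (rule K(3))
  qed
qed

lemma smooth_measurable: "smooth \<phi> \<Longrightarrow> \<phi> \<in> borel_measurable borel"
  by (rule borel_measurable_continuous_onI[OF smooth_continuous_on])

lemma test_fields_measurable: "\<phi> \<in> test_fields \<Omega> \<Longrightarrow> \<phi> \<in> borel_measurable borel"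
  by (rule smooth_measurable[OF test_fields_smooth])

lemma test_fields_integrable:
  fixes \<phi> :: "real^3 \<Rightarrow> 'b::euclidean_space"
  assumes "\<phi> \<in> test_fields \<Omega>"
  shows "integrable lborel \<phi>"
proof -
  from assms obtain K where K: "smooth \<phi>" "compact K" "\<And>x. x \<notin> K \<Longrightarrow> \<phi> x = 0" by (rule test_fieldsE) (rule that)
  have "integrable lborel (\<lambda>x. indicator K x *\<^sub>R \<phi> x)"
    by (rule borel_integrable_compact[OF K(2) smooth_continuous_on[OF K(1)]])
  moreover have "(\<lambda>x. indicator K x *\<^sub>R \<phi> x) = \<phi>" using K(3) by (auto simp: indicator_def)
  ultimately show ?thesis by simp
qed

lemma test_fields_square_integrable:
  fixes \<phi> :: "real^3 \<Rightarrow> 'b::euclidean_space"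
  assumes "\<phi> \<in> test_fields \<Omega>"
  shows "square_integrable \<phi>"
proof -
  have "(\<lambda>x. \<phi> x \<bullet> \<phi> x) \<in> test_fields \<Omega>"
    by (rule test_fields_bilinear[OF bounded_bilinear_inner test_fields_smooth[OF assms] assms])
  from test_fields_integrable[OF this] test_fields_smooth[OF assms] show ?thesis
    by (simp add: square_integrable_def power2_norm_eq_inner smooth_measurable)
qed

subsection \<open>Square integrable fields\<close>

lemma L2_eq_rep: "L2_eq (rep_L2 u) (rep_L2 u)"
  by (rule Quotient_rep_reflp[OF Quotient_L2])

lemma sq_rep: "square_integrable (rep_L2 u)"
  using L2_eq_rep[of u] by (simp add: L2_eq_def)

lemma rep_measurable [measurable]: "rep_L2 u \<in> borel_measurable borel"
  using sq_rep[of u] by (simp add: square_integrable_def)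

lemma abs_rep: "abs_L2 (rep_L2 u) = u"
  by (rule Quotient_abs_rep[OF Quotient_L2])

lemma rep_abs: "square_integrable f \<Longrightarrow> AE x in lborel. rep_L2 (abs_L2 f) x = f x"
  using Quotient_rep_abs[OF Quotient_L2, of f] by (auto simp: L2_eq_def)

lemma abs_eq_iff: "square_integrable f \<Longrightarrow> square_integrable g \<Longrightarrow>
   abs_L2 f = abs_L2 g \<longleftrightarrow> (AE x in lborel. f x = g x)"
  using Quotient_rel[OF Quotient_L2, of f g] by (auto simp: L2_eq_def)

lemma L2_eq_iff_rep: "u = v \<longleftrightarrow> (AE x in lborel. rep_L2 u x = rep_L2 v x)"
  using abs_eq_iff[OF sq_rep sq_rep, of u v] by (simp add: abs_rep)

lemma abs_add: "square_integrable f \<Longrightarrow> square_integrable g \<Longrightarrow> abs_L2 f + abs_L2 g = abs_L2 (\<lambda>x. f x + g x)"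
  by (rule plus_L2.abs_eq) (auto simp: eq_onp_def L2_eq_def)

lemma abs_scaleR: "square_integrable f \<Longrightarrow> c *\<^sub>R abs_L2 f = abs_L2 (\<lambda>x. c *\<^sub>R f x)"
  by (rule scaleR_L2.abs_eq) (auto simp: eq_onp_def L2_eq_def)

lemma abs_inner: "square_integrable f \<Longrightarrow> square_integrable g \<Longrightarrow> abs_L2 f \<bullet> abs_L2 g = (LINT x|lborel. f x \<bullet> g x)"
  by (rule inner_L2.abs_eq) (auto simp: eq_onp_def L2_eq_def)

lemma abs_zero: "abs_L2 (\<lambda>x. 0) = 0"
  by (simp add: zero_L2_def)

lemma abs_diff: "square_integrable f \<Longrightarrow> square_integrable g \<Longrightarrow> abs_L2 f - abs_L2 g = abs_L2 (\<lambda>x. f x - g x)"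
  using abs_add[of f "\<lambda>x. (-1) *\<^sub>R g x"] abs_scaleR[of g "-1"] square_integrable_scaleR[of g "-1"]
  by (simp add: diff_conv_add_uminus del: add_uminus_conv_diff)

lemma square_integrable_diff:
  "square_integrable f \<Longrightarrow> square_integrable g \<Longrightarrow> square_integrable (\<lambda>x. f x - g x)"
  using square_integrable_add[of f "\<lambda>x. (-1) *\<^sub>R g x"] square_integrable_scaleR[of g "-1"] by simp

lemma square_integrable_sum:
  "(\<And>i. i \<in> I \<Longrightarrow> square_integrable (f i)) \<Longrightarrow> square_integrable (\<lambda>x. \<Sum>i\<in>I. f i x)"
  by (induction I rule: infinite_finite_induct) (auto intro: square_integrable_zero square_integrable_add)

lemma abs_sum:
  "(\<And>i. i \<in> I \<Longrightarrow> square_integrable (f i)) \<Longrightarrow> (\<Sum>i\<in>I. abs_L2 (f i)) = abs_L2 (\<lambda>x. \<Sum>i\<in>I. f i x)"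
proof (induction I rule: infinite_finite_induct)
  case (insert i I)
  have "(\<Sum>j\<in>insert i I. abs_L2 (f j)) = abs_L2 (f i) + abs_L2 (\<lambda>x. \<Sum>j\<in>I. f j x)"
    using insert by simp
  also have "\<dots> = abs_L2 (\<lambda>x. f i x + (\<Sum>j\<in>I. f j x))"
    by (intro abs_add square_integrable_sum insert.prems) auto
  finally show ?case using insert.hyps by simp
qed (simp_all add: abs_zero)

lemma rep_add: "AE x in lborel. rep_L2 (u + v) x = rep_L2 u x + rep_L2 v x"
  using rep_abs[OF square_integrable_add[OF sq_rep sq_rep], of u v] abs_add[OF sq_rep sq_rep, of u v]
  by (simp add: abs_rep)

lemma rep_diff: "AE x in lborel. rep_L2 (u - v) x = rep_L2 u x - rep_L2 v x"
  using rep_abs[OF square_integrable_diff[OF sq_rep sq_rep], of u v] abs_diff[OF sq_rep sq_rep, of u v]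
  by (simp add: abs_rep)

lemma rep_scaleR: "AE x in lborel. rep_L2 (c *\<^sub>R u) x = c *\<^sub>R rep_L2 u x"
  using rep_abs[OF square_integrable_scaleR[OF sq_rep], of c u] abs_scaleR[OF sq_rep, of c u]
  by (simp add: abs_rep)

lemma rep_zero: "AE x in lborel. rep_L2 0 x = 0"
  using rep_abs[OF square_integrable_zero] by (simp add: abs_zero)

lemma inner_L2_rep: "u \<bullet> v = (LINT x|lborel. rep_L2 u x \<bullet> rep_L2 v x)"
  using abs_inner[OF sq_rep sq_rep, of u v] by (simp add: abs_rep)

lemma norm_L2_sq: "(norm u)\<^sup>2 = (LINT x|lborel. (norm (rep_L2 u x))\<^sup>2)"
  by (simp add: power2_norm_eq_inner inner_L2_rep)

lemma norm_abs_sq: "square_integrable f \<Longrightarrow> (norm (abs_L2 f))\<^sup>2 = (LINT x|lborel. (norm (f x))\<^sup>2)"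
  by (simp add: power2_norm_eq_inner abs_inner)

lemma ennreal_norm_L2_sq: "ennreal ((norm u)\<^sup>2) = (\<integral>\<^sup>+x. ennreal ((norm (rep_L2 u x))\<^sup>2) \<partial>lborel)"
  using sq_rep[of u] unfolding norm_L2_sq
  by (subst nn_integral_eq_integral) (auto simp: square_integrable_def)

lemma square_integrable_indicator:
  assumes "square_integrable f" "A \<in> sets borel"
  shows "square_integrable (\<lambda>x. indicator A x *\<^sub>R f x)"
proof -
  have [measurable]: "f \<in> borel_measurable borel" "A \<in> sets borel" and "integrable lborel (\<lambda>x. (norm (f x))\<^sup>2)"
    using assms by (auto simp: square_integrable_def)
  then have "integrable lborel (\<lambda>x. (norm (indicator A x *\<^sub>R f x))\<^sup>2)"
    by (elim Bochner_Integration.integrable_bound) (auto simp: indicator_def)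
  then show ?thesis by (auto simp: square_integrable_def)
qed

lemma square_integrable_norm_le:
  fixes f :: "real^3 \<Rightarrow> 'b::euclidean_space" and g :: "real^3 \<Rightarrow> 'c::euclidean_space"
  assumes "square_integrable f" "g \<in> borel_measurable borel" "\<And>x. norm (g x) \<le> C * norm (f x)"
  shows "square_integrable g"
proof -
  have "integrable lborel (\<lambda>x. C\<^sup>2 * (norm (f x))\<^sup>2)"
    using assms(1) by (auto simp: square_integrable_def)
  then have "integrable lborel (\<lambda>x. (norm (g x))\<^sup>2)"
  proof (rule Bochner_Integration.integrable_bound)
    show "AE x in lborel. norm ((norm (g x))\<^sup>2) \<le> norm (C\<^sup>2 * (norm (f x))\<^sup>2)"
      using power_mono[OF assms(3), of _ 2] by (auto simp: power_mult_distrib)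
    have [measurable]: "g \<in> borel_measurable borel" by fact
    show "(\<lambda>x. (norm (g x))\<^sup>2) \<in> borel_measurable lborel" by measurable
  qed
  then show ?thesis using assms by (auto simp: square_integrable_def)
qed

lemma norm_abs_le:
  fixes f :: "real^3 \<Rightarrow> 'b::euclidean_space" and g :: "real^3 \<Rightarrow> 'c::euclidean_space"
  assumes "square_integrable f" "square_integrable g" "\<And>x. norm (g x) \<le> C * norm (f x)" "0 \<le> C"
  shows "norm (abs_L2 g) \<le> C * norm (abs_L2 f)"
proof (rule power2_le_imp_le)
  have "(LINT x|lborel. (norm (g x))\<^sup>2) \<le> (LINT x|lborel. C\<^sup>2 * (norm (f x))\<^sup>2)"
    using assms(1,2) power_mono[OF assms(3), of _ 2]
    by (intro integral_mono) (auto simp: square_integrable_def power_mult_distrib)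
  then show "(norm (abs_L2 g))\<^sup>2 \<le> (C * norm (abs_L2 f))\<^sup>2"
    using assms(1,2) by (simp add: norm_abs_sq power_mult_distrib)
qed (use assms in simp)

subsection \<open>Pointwise linear operators\<close>

text \<open>Multiplication by a uniformly bounded field of linear maps. The notion covers constant
  linear maps (jet projections, transposition), truncation by an indicator and the Leibniz operator
  on jets, all of which thereby become bounded operators on \<open>L2\<close>.\<close>

definition pw_bounded :: "(real^3 \<Rightarrow> 'b::euclidean_space \<Rightarrow> 'c::euclidean_space) \<Rightarrow> bool" where
  "pw_bounded A \<longleftrightarrow> (\<forall>x. linear (A x)) \<and> (\<exists>C. \<forall>x v. norm (A x v) \<le> C * norm v) \<and>
     (\<forall>f\<in>borel_measurable borel. (\<lambda>x. A x (f x)) \<in> borel_measurable borel)"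

definition pw :: "(real^3 \<Rightarrow> 'b::euclidean_space \<Rightarrow> 'c::euclidean_space) \<Rightarrow> 'b L2 \<Rightarrow> 'c L2" where
  "pw A u = abs_L2 (\<lambda>x. A x (rep_L2 u x))"

lemma pw_boundedE:
  assumes "pw_bounded A"
  obtains C where "0 \<le> C" "\<And>x v. norm (A x v) \<le> C * norm v"
proof -
  have "\<exists>C. \<forall>x v. norm (A x v) \<le> C * norm v"
    using assms unfolding pw_bounded_def by (elim conjE)
  then obtain C where C: "\<forall>x v. norm (A x v) \<le> C * norm v" ..
  show ?thesis
  proof (rule that[of "max 0 C"])
    fix x v
    have "norm (A x v) \<le> C * norm v" using C[THEN spec, THEN spec] .
    also have "\<dots> \<le> max 0 C * norm v" by (intro mult_right_mono) auto
    finally show "norm (A x v) \<le> max 0 C * norm v" .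
  qed simp
qed

lemma pw_measurable:
  assumes "pw_bounded A" "f \<in> borel_measurable borel"
  shows "(\<lambda>x. A x (f x)) \<in> borel_measurable borel"
proof -
  have "\<forall>f\<in>borel_measurable borel. (\<lambda>x. A x (f x)) \<in> borel_measurable borel"
    using assms(1) unfolding pw_bounded_def by (elim conjE)
  then show ?thesis using assms(2) by (rule bspec)
qed

lemma pw_square_integrable:
  assumes "pw_bounded A" "square_integrable f"
  shows "square_integrable (\<lambda>x. A x (f x))"
proof -
  from assms(1) obtain C where "0 \<le> C" and C: "\<And>x v. norm (A x v) \<le> C * norm v" by (rule pw_boundedE) (rule that)
  have "f \<in> borel_measurable borel" using assms(2) by (simp add: square_integrable_def)
  then have "(\<lambda>x. A x (f x)) \<in> borel_measurable borel" by (rule pw_measurable[OF assms(1)])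
  then show ?thesis by (rule square_integrable_norm_le[OF assms(2)]) (rule C)
qed

lemma pw_abs:
  assumes "pw_bounded A" "square_integrable f"
  shows "pw A (abs_L2 f) = abs_L2 (\<lambda>x. A x (f x))"
proof -
  have "AE x in lborel. A x (rep_L2 (abs_L2 f) x) = A x (f x)" using rep_abs[OF assms(2)] by eventually_elim simp
  then show ?thesis
    unfolding pw_def using abs_eq_iff[OF pw_square_integrable[OF assms(1) sq_rep] pw_square_integrable[OF assms]] by simp
qed

lemma rep_pw:
  assumes "pw_bounded A"
  shows "AE x in lborel. rep_L2 (pw A u) x = A x (rep_L2 u x)"
  unfolding pw_def by (rule rep_abs[OF pw_square_integrable[OF assms sq_rep]])

lemma bounded_linear_pw:
  assumes "pw_bounded A"
  shows "bounded_linear (pw A)"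
proof -
  from assms obtain C where C: "0 \<le> C" "\<And>x v. norm (A x v) \<le> C * norm v" by (rule pw_boundedE) (rule that)
  have lin: "linear (A x)" for x using assms by (simp add: pw_bounded_def)
  note sq = pw_square_integrable[OF assms sq_rep]
  show ?thesis
  proof (rule bounded_linear_intro[of _ C])
    fix u v :: "'a L2" and r :: real
    show "pw A (u + v) = pw A u + pw A v"
    proof -
      have "AE x in lborel. A x (rep_L2 (u + v) x) = A x (rep_L2 u x) + A x (rep_L2 v x)"
        using rep_add[of u v] by eventually_elim (simp add: linear_add[OF lin])
      then show ?thesis
        unfolding pw_def abs_add[OF sq sq] using abs_eq_iff[OF sq square_integrable_add[OF sq sq]] by simp
    qed
    show "pw A (r *\<^sub>R u) = r *\<^sub>R pw A u"
    proof -
      have "AE x in lborel. A x (rep_L2 (r *\<^sub>R u) x) = r *\<^sub>R A x (rep_L2 u x)"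
        using rep_scaleR[of r u] by eventually_elim (simp add: linear_scale[OF lin])
      then show ?thesis
        unfolding pw_def abs_scaleR[OF sq] using abs_eq_iff[OF sq square_integrable_scaleR[OF sq]] by simp
    qed
    show "norm (pw A u) \<le> norm u * C"
      using norm_abs_le[OF sq_rep sq C(2) C(1), of u] by (simp add: abs_rep pw_def mult.commute)
  qed
qed

lemma pw_bounded_linear:
  assumes "bounded_linear L"
  shows "pw_bounded (\<lambda>x. L)"
proof -
  interpret bounded_linear L by fact
  obtain C where C: "\<And>v. norm (L v) \<le> norm v * C" using bounded by blast
  show ?thesis
    unfolding pw_bounded_def
  proof (intro conjI allI ballI exI[of _ C])
    show "linear L" by (rule linear_axioms)
    show "norm (L v) \<le> C * norm v" for v using C[of v] by (simp add: mult.commute)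
    show "(\<lambda>x. L (f x)) \<in> borel_measurable borel" if "f \<in> borel_measurable borel" for f
      by (rule borel_measurable_continuous_on[OF linear_continuous_on[OF assms] that])
  qed
qed

lemma pw_bounded_indicator:
  assumes "A \<in> sets borel"
  shows "pw_bounded (\<lambda>x v. indicator A x *\<^sub>R v)"
  unfolding pw_bounded_def
proof (intro conjI allI ballI exI[of _ 1])
  show "linear (\<lambda>v::'a. indicat_real A x *\<^sub>R v)" for x :: "real^3"
    by (rule bounded_linear.linear[OF bounded_linear_scaleR_right])
  show "norm (indicator A x *\<^sub>R v) \<le> 1 * norm v" for x :: "real^3" and v :: 'a
    by (simp add: indicator_def)
  show "(\<lambda>x. indicator A x *\<^sub>R f x) \<in> borel_measurable borel" if "f \<in> borel_measurable borel" for f :: "real^3 \<Rightarrow> 'a"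
    by (rule borel_measurable_scaleR[OF borel_measurable_indicator[OF assms] that])
qed

lemma restr_pw:
  assumes "A \<in> sets borel" "square_integrable f"
  shows "restr A f = pw (\<lambda>x v. indicator A x *\<^sub>R v) (abs_L2 f)"
  unfolding pw_abs[OF pw_bounded_indicator[OF assms(1)] assms(2)] restr_def ..

text \<open>Fields vanishing off \<open>A\<close> are the fixed points of a bounded operator, from
  which the closedness of \<open>L2_on A\<close> is immediate.\<close>

lemma L2_on_iff:
  assumes "A \<in> sets borel"
  shows "u \<in> L2_on A \<longleftrightarrow> pw (\<lambda>x v. indicator A x *\<^sub>R v) u = u"
proof -
  have r: "AE x in lborel. rep_L2 (pw (\<lambda>x v. indicator A x *\<^sub>R v) u) x = indicator A x *\<^sub>R rep_L2 u x"
    by (rule rep_pw[OF pw_bounded_indicator[OF assms]])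
  show ?thesis
    unfolding L2_on_def L2_eq_iff_rep[of _ u] mem_Collect_eq
  proof
    assume "AE x in lborel. x \<notin> A \<longrightarrow> rep_L2 u x = 0"
    with r show "AE x in lborel. rep_L2 (pw (\<lambda>x v. indicator A x *\<^sub>R v) u) x = rep_L2 u x"
      by eventually_elim (auto simp: indicator_def)
  next
    assume "AE x in lborel. rep_L2 (pw (\<lambda>x v. indicator A x *\<^sub>R v) u) x = rep_L2 u x"
    with r show "AE x in lborel. x \<notin> A \<longrightarrow> rep_L2 u x = 0"
      by eventually_elim (auto simp: indicator_def)
  qed
qed

lemma closed_L2_on: "A \<in> sets borel \<Longrightarrow> closed (L2_on A :: 'b::euclidean_space L2 set)"
proof -
  assume A: "A \<in> sets borel"
  have "L2_on A = {u::'b L2. pw (\<lambda>x v. indicator A x *\<^sub>R v) u = u}" using L2_on_iff[OF A] by auto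
  moreover have "closed {u::'b L2. pw (\<lambda>x v. indicator A x *\<^sub>R v) u = u}"
    by (rule closed_Collect_eq[OF linear_continuous_on[OF bounded_linear_pw[OF pw_bounded_indicator[OF A]]] continuous_on_id])
  ultimately show ?thesis by simp
qed

lemma subspace_L2_on: "subspace (L2_on A :: 'a::euclidean_space L2 set)"
proof (rule subspaceI)
  show "(0 :: 'a L2) \<in> L2_on A"
    unfolding L2_on_def mem_Collect_eq using rep_zero[where 'a='a] by eventually_elim simp
  fix u v :: "'a L2" and c
  assume uv: "u \<in> L2_on A" "v \<in> L2_on A"
  have u0: "AE x in lborel. x \<notin> A \<longrightarrow> rep_L2 u x = 0" using uv(1) by (simp add: L2_on_def)
  have v0: "AE x in lborel. x \<notin> A \<longrightarrow> rep_L2 v x = 0" using uv(2) by (simp add: L2_on_def)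
  have "AE x in lborel. x \<notin> A \<longrightarrow> rep_L2 (u + v) x = 0" using rep_add[of u v] u0 v0 by eventually_elim simp
  then show "u + v \<in> L2_on A" by (simp add: L2_on_def)
  have "AE x in lborel. x \<notin> A \<longrightarrow> rep_L2 (c *\<^sub>R u) x = 0"
    using rep_scaleR[of c u] u0 by eventually_elim simp
  then show "c *\<^sub>R u \<in> L2_on A" by (simp add: L2_on_def)
qed

lemma restr_L2_on: "A \<in> sets borel \<Longrightarrow> square_integrable f \<Longrightarrow> restr A f \<in> L2_on A"
proof -
  assume "A \<in> sets borel" "square_integrable f"
  then have "AE x in lborel. rep_L2 (restr A f) x = indicator A x *\<^sub>R f x"
    unfolding restr_def by (intro rep_abs square_integrable_indicator)
  then have "AE x in lborel. x \<notin> A \<longrightarrow> rep_L2 (restr A f) x = 0" by eventually_elim auto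
  then show ?thesis by (simp add: L2_on_def)
qed

lemma inner_L2_on_restr:
  assumes "A \<in> sets borel" "square_integrable f" "u \<in> L2_on A"
  shows "u \<bullet> restr A f = u \<bullet> abs_L2 f"
proof -
  have "u \<bullet> restr A f = abs_L2 (rep_L2 u) \<bullet> abs_L2 (\<lambda>x. indicator A x *\<^sub>R f x)" by (simp add: restr_def abs_rep)
  also have "\<dots> = (LINT x|lborel. rep_L2 u x \<bullet> (indicator A x *\<^sub>R f x))"
    by (intro abs_inner sq_rep square_integrable_indicator assms)
  also have "\<dots> = (LINT x|lborel. rep_L2 u x \<bullet> f x)"
  proof (rule integral_cong_AE)
    have [measurable]: "f \<in> borel_measurable borel" "A \<in> sets borel" using assms by (auto simp: square_integrable_def)
    show "(\<lambda>x. rep_L2 u x \<bullet> (indicator A x *\<^sub>R f x)) \<in> borel_measurable lborel" by measurable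
    show "(\<lambda>x. rep_L2 u x \<bullet> f x) \<in> borel_measurable lborel" by measurable
    show "AE x in lborel. rep_L2 u x \<bullet> indicator A x *\<^sub>R f x = rep_L2 u x \<bullet> f x"
      using assms(3)[unfolded L2_on_def mem_Collect_eq] by eventually_elim (auto simp: indicator_def)
  qed
  also have "\<dots> = u \<bullet> abs_L2 f" using abs_inner[OF sq_rep assms(2), of u] by (simp add: abs_rep)
  finally show ?thesis .
qed

lemma restr_test: "\<phi> \<in> test_fields A \<Longrightarrow> restr A \<phi> = abs_L2 \<phi>"
  unfolding restr_def by (rule arg_cong[where f=abs_L2]) (auto simp: indicator_def test_fields_outside)

subsection \<open>Completeness and orthogonal projection\<close>

text \<open>Fatou and Tonelli deliver bounds on nonnegative integrals of functions not yet known to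
  be square integrable; such a bound gives membership and the norm estimate together.\<close>

lemma square_integrable_nn:
  fixes f :: "real^3 \<Rightarrow> 'b::euclidean_space"
  assumes "f \<in> borel_measurable borel" "(\<integral>\<^sup>+x. ennreal ((norm (f x))\<^sup>2) \<partial>lborel) \<le> ennreal c" "0 \<le> c"
  shows "square_integrable f" "(norm (abs_L2 f))\<^sup>2 \<le> c"
proof -
  have [measurable]: "f \<in> borel_measurable borel" by fact
  have i: "integrable lborel (\<lambda>x. (norm (f x))\<^sup>2)"
  proof (rule integrableI_nonneg)
    show "(\<integral>\<^sup>+x. ennreal ((norm (f x))\<^sup>2) \<partial>lborel) < \<infinity>"
      using assms(2) ennreal_less_top[of c] by (simp add: le_less_trans)
  qed auto
  then show sq: "square_integrable f" by (simp add: square_integrable_def)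
  have "ennreal (LINT x|lborel. (norm (f x))\<^sup>2) \<le> ennreal c"
    using assms(2) nn_integral_eq_integral[OF i] by simp
  then show "(norm (abs_L2 f))\<^sup>2 \<le> c"
    using assms(3) by (simp add: norm_abs_sq[OF sq])
qed

text \<open>The Riesz-Fischer argument for a sequence with geometric increments: a weighted sum of
  squared increments is integrable, hence finite almost everywhere, which forces pointwise
  convergence; Fatou's lemma then bounds the distance to the limit.\<close>

lemma L2_fast_convergent:
  fixes X :: "nat \<Rightarrow> 'b::euclidean_space L2"
  assumes X: "\<And>m n. m \<le> n \<Longrightarrow> norm (X m - X n) \<le> (1/2)^m"
  shows "\<exists>L. \<forall>m. norm (X m - L) \<le> (1/2)^m"
proof -
  define f where "f n = rep_L2 (X n)" for n
  have sqf: "square_integrable (f n)" for n unfolding f_def by (rule sq_rep)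
  have [measurable]: "f n \<in> borel_measurable borel" for n unfolding f_def by measurable
  have nd: "(\<integral>\<^sup>+x. ennreal ((norm (f m x - f n x))\<^sup>2) \<partial>lborel) = ennreal ((norm (X m - X n))\<^sup>2)" for m n
    unfolding ennreal_norm_L2_sq
  proof (rule nn_integral_cong_AE)
    show "AE x in lborel. ennreal ((norm (f m x - f n x))\<^sup>2) = ennreal ((norm (rep_L2 (X m - X n) x))\<^sup>2)"
      using rep_diff[of "X m" "X n"] unfolding f_def by eventually_elim simp
  qed
  have lim: "AE x in lborel. convergent (\<lambda>n. f n x)"
  proof -
    \<comment> \<open>The weights \<open>2^n\<close> still leave a convergent series, since the
      squared norms decay like 4^(-n), and they turn finiteness of the sum at \<open>x\<close> into
      increments of order 2^(-n/2), which are summable.\<close>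
    have "(\<integral>\<^sup>+x. (\<Sum>n. ennreal (2^n * (norm (f n x - f (Suc n) x))\<^sup>2)) \<partial>lborel)
        = (\<Sum>n. \<integral>\<^sup>+x. ennreal (2^n * (norm (f n x - f (Suc n) x))\<^sup>2) \<partial>lborel)"
      by (rule nn_integral_suminf) measurable
    also have "\<dots> = (\<Sum>n. ennreal (2^n * (norm (X n - X (Suc n)))\<^sup>2))"
    proof (rule suminf_cong)
      fix n
      have "(\<integral>\<^sup>+x. ennreal (2^n * (norm (f n x - f (Suc n) x))\<^sup>2) \<partial>lborel)
          = (\<integral>\<^sup>+x. ennreal (2^n) * ennreal ((norm (f n x - f (Suc n) x))\<^sup>2) \<partial>lborel)"
        by (simp add: ennreal_mult)
      also have "\<dots> = ennreal (2^n) * ennreal ((norm (X n - X (Suc n)))\<^sup>2)"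
        by (subst nn_integral_cmult) (auto simp: nd)
      finally show "(\<integral>\<^sup>+x. ennreal (2^n * (norm (f n x - f (Suc n) x))\<^sup>2) \<partial>lborel)
        = ennreal (2^n * (norm (X n - X (Suc n)))\<^sup>2)" by (simp add: ennreal_mult)
    qed
    also have "\<dots> \<le> (\<Sum>n. ennreal ((1/2)^n))"
    proof (intro suminf_le ennreal_leI)
      fix n
      have "(norm (X n - X (Suc n)))\<^sup>2 \<le> ((1/2)^n)\<^sup>2" by (intro power_mono X) auto
      then have "2^n * (norm (X n - X (Suc n)))\<^sup>2 \<le> 2^n * ((1/2)^n)\<^sup>2" by simp
      also have "\<dots> = (1/2)^n" by (simp add: power2_eq_square power_one_over)
      finally show "2^n * (norm (X n - X (Suc n)))\<^sup>2 \<le> (1/2)^n" .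
    qed auto
    also have "\<dots> = ennreal (\<Sum>n. (1/2)^n)" by (rule suminf_ennreal2) (auto intro: summable_geometric)
    finally have "(\<integral>\<^sup>+x. (\<Sum>n. ennreal (2^n * (norm (f n x - f (Suc n) x))\<^sup>2)) \<partial>lborel) \<noteq> \<infinity>"
      by (auto simp: top_unique)
    then have "AE x in lborel. (\<Sum>n. ennreal (2^n * (norm (f n x - f (Suc n) x))\<^sup>2)) \<noteq> \<infinity>"
      by (rule nn_integral_noteq_infinite[rotated]) measurable
    then show ?thesis
    proof eventually_elim
      fix x assume fin: "(\<Sum>n. ennreal (2^n * (norm (f n x - f (Suc n) x))\<^sup>2)) \<noteq> \<infinity>"
      define h where "h n = ennreal (2^n * (norm (f n x - f (Suc n) x))\<^sup>2)" for n
      have "suminf h \<noteq> \<infinity>" using fin unfolding h_def[abs_def] .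
      then obtain B where B: "suminf h = ennreal B" "0 \<le> B"
        by (cases "suminf h" rule: ennreal_cases) auto
      have "norm (f (Suc n) x - f n x) \<le> sqrt B * (1 / sqrt 2)^n" for n
      proof -
        have "sum h {n} \<le> suminf h" by (rule sum_le_suminf) auto
        then have "ennreal (2^n * (norm (f n x - f (Suc n) x))\<^sup>2) \<le> ennreal B" using B(1) by (simp add: h_def)
        then have "2^n * (norm (f n x - f (Suc n) x))\<^sup>2 \<le> B" using B(2) by simp
        then have "sqrt (2^n * (norm (f n x - f (Suc n) x))\<^sup>2) \<le> sqrt B" by simp
        then have "sqrt 2 ^ n * norm (f n x - f (Suc n) x) \<le> sqrt B" by (simp add: real_sqrt_mult real_sqrt_power)
        then have "norm (f n x - f (Suc n) x) \<le> sqrt B / sqrt 2 ^ n" by (simp add: field_simps)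
        then show ?thesis by (simp add: norm_minus_commute divide_inverse power_inverse)
      qed
      moreover have "summable (\<lambda>n. sqrt B * (1 / sqrt 2)^n)"
        by (intro summable_mult summable_geometric) (simp add: real_less_rsqrt)
      ultimately have "summable (\<lambda>n. f (Suc n) x - f n x)"
        using summable_comparison_test'[of "\<lambda>n. sqrt B * (1 / sqrt 2)^n" 0 "\<lambda>n. f (Suc n) x - f n x"] by blast
      then have "(\<lambda>n. f 0 x + (\<Sum>k<n. f (Suc k) x - f k x)) \<longlonglongrightarrow> f 0 x + (\<Sum>k. f (Suc k) x - f k x)"
        by (intro tendsto_add tendsto_const summable_LIMSEQ)
      then show "convergent (\<lambda>n. f n x)"
        using sum_lessThan_telescope[of "\<lambda>k. f k x"] by (auto simp: convergent_def)
    qed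
  qed
  define g where "g x = lim (\<lambda>n. f n x)" for x
  have [measurable]: "g \<in> borel_measurable borel" unfolding g_def[abs_def] by measurable
  have b: "(\<integral>\<^sup>+x. ennreal ((norm (f m x - g x))\<^sup>2) \<partial>lborel) \<le> ennreal (((1/2)^m)\<^sup>2)" for m
  proof -
    have "(\<integral>\<^sup>+x. ennreal ((norm (f m x - g x))\<^sup>2) \<partial>lborel) = (\<integral>\<^sup>+x. liminf (\<lambda>n. ennreal ((norm (f m x - f n x))\<^sup>2)) \<partial>lborel)"
    proof (rule nn_integral_cong_AE)
      show "AE x in lborel. ennreal ((norm (f m x - g x))\<^sup>2) = liminf (\<lambda>n. ennreal ((norm (f m x - f n x))\<^sup>2))"
        using lim
      proof eventually_elim
        fix x assume "convergent (\<lambda>n. f n x)"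
        then have "(\<lambda>n. f n x) \<longlonglongrightarrow> g x" unfolding g_def by (simp add: convergent_LIMSEQ_iff)
        then have "(\<lambda>n. ennreal ((norm (f m x - f n x))\<^sup>2)) \<longlonglongrightarrow> ennreal ((norm (f m x - g x))\<^sup>2)"
          by (intro tendsto_intros)
        then show "ennreal ((norm (f m x - g x))\<^sup>2) = liminf (\<lambda>n. ennreal ((norm (f m x - f n x))\<^sup>2))"
          by (rule lim_imp_Liminf[OF sequentially_bot, symmetric])
      qed
    qed
    also have "\<dots> \<le> liminf (\<lambda>n. \<integral>\<^sup>+x. ennreal ((norm (f m x - f n x))\<^sup>2) \<partial>lborel)"
      by (rule nn_integral_liminf) measurable
    also have "\<dots> = liminf (\<lambda>n. ennreal ((norm (X m - X n))\<^sup>2))" unfolding nd ..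
    also have "\<dots> \<le> liminf (\<lambda>n. ennreal (((1/2)^m)\<^sup>2))"
    proof (rule Liminf_mono)
      show "\<forall>\<^sub>F n in sequentially. ennreal ((norm (X m - X n))\<^sup>2) \<le> ennreal (((1/2)^m)\<^sup>2)"
        using eventually_ge_at_top[of m] by eventually_elim (intro ennreal_leI power_mono X, auto)
    qed
    also have "\<dots> = ennreal (((1/2)^m)\<^sup>2)" by (simp add: Liminf_const)
    finally show ?thesis .
  qed
  have sqd: "square_integrable (\<lambda>x. f m x - g x)" "(norm (abs_L2 (\<lambda>x. f m x - g x)))\<^sup>2 \<le> ((1/2)^m)\<^sup>2" for m
    using square_integrable_nn[OF _ b] by auto
  have "square_integrable (\<lambda>x. f 0 x - (f 0 x - g x))" by (rule square_integrable_diff[OF sqf sqd(1)])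
  then have sqg: "square_integrable g" by simp
  show ?thesis
  proof (intro exI allI)
    fix m
    have "X m - abs_L2 g = abs_L2 (\<lambda>x. f m x - g x)"
      using abs_diff[OF sqf sqg, of m] by (simp add: f_def abs_rep)
    then show "norm (X m - abs_L2 g) \<le> (1/2)^m" using sqd(2)[of m] by (auto intro: power2_le_imp_le)
  qed
qed

instance L2 :: (euclidean_space) banach
proof
  fix X :: "nat \<Rightarrow> 'a L2" assume X: "Cauchy X"
  have "\<exists>N. \<forall>i\<ge>N. \<forall>j\<ge>N. norm (X i - X j) < (1/2)^m" for m
    by (rule CauchyD[OF X]) simp
  then obtain N where N: "\<And>m i j. i \<ge> N m \<Longrightarrow> j \<ge> N m \<Longrightarrow> norm (X i - X j) < (1/2)^m" by metis
  \<comment> \<open>Summing the thresholds makes \<open>r n\<close> dominate every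
    \<open>N m\<close> with \<open>m \<le> n\<close>.\<close>
  define r where "r n = (\<Sum>k\<le>n. N k)" for n
  have rN: "N m \<le> r n" if "m \<le> n" for m n
    unfolding r_def using that by (intro member_le_sum[of m "{..n}" N]) auto
  have "norm (X (r m) - X (r n)) \<le> (1/2)^m" if "m \<le> n" for m n
    using N[OF rN rN, of m m n] that by simp
  then obtain L where L: "\<And>m. norm (X (r m) - L) \<le> (1/2)^m" using L2_fast_convergent[of "\<lambda>n. X (r n)"] by blast
  have "X \<longlonglongrightarrow> L"
  proof (rule metric_LIMSEQ_I)
    fix e :: real assume "0 < e"
    then obtain m where m: "(1/2)^m < e / 2" using real_arch_pow_inv[of "e/2" "1/2"] by auto
    have "dist (X i) L < e" if "i \<ge> N m" for i
    proof -
      have "dist (X i) L \<le> dist (X i) (X (r m)) + dist (X (r m)) L" by (rule dist_triangle)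
      also have "\<dots> < (1/2)^m + (1/2)^m + 0"
        using N[OF that rN[of m m]] L[of m] by (simp add: dist_norm)
      finally show ?thesis using m by simp
    qed
    then show "\<exists>no. \<forall>n\<ge>no. dist (X n) L < e" by blast
  qed
  then show "convergent X" by (rule convergentI)
qed

text \<open>A minimising sequence for the distance is Cauchy by the parallelogram identity,
  midpoints staying in \<open>M\<close>; its limit is then varied in the directions of
  \<open>M\<close>.\<close>

lemma orthogonal_projection_exists:
  fixes M :: "'a::{real_inner, complete_space} set"
  assumes M: "subspace M" "closed M"
  shows "\<exists>p\<in>M. \<forall>q\<in>M. (x - p) \<bullet> q = 0"
proof -
  define \<delta> where "\<delta> = (INF q\<in>M. (norm (x - q))\<^sup>2)"
  have ne: "M \<noteq> {}" using subspace_0[OF M(1)] by auto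
  have bdd: "bdd_below ((\<lambda>q. (norm (x - q))\<^sup>2) ` M)" by (rule bdd_belowI[of _ 0]) auto
  have low: "\<delta> \<le> (norm (x - q))\<^sup>2" if "q \<in> M" for q unfolding \<delta>_def by (rule cINF_lower[OF bdd that])
  have "\<exists>q\<in>M. (norm (x - q))\<^sup>2 < \<delta> + inverse (real (Suc n))" for n
    using cINF_less_iff[OF ne bdd, of "\<delta> + inverse (real (Suc n))"] unfolding \<delta>_def[symmetric] by simp
  then obtain q where q: "\<And>n. q n \<in> M" "\<And>n. (norm (x - q n))\<^sup>2 < \<delta> + inverse (real (Suc n))" by metis
  have par: "(norm (q m - q n))\<^sup>2 \<le> 2 * inverse (real (Suc m)) + 2 * inverse (real (Suc n))" for m n
  proof -
    have "(1/2) *\<^sub>R (q m + q n) \<in> M" using q(1) M(1) by (intro subspace_scale subspace_add)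
    then have "\<delta> \<le> (norm (x - (1/2) *\<^sub>R (q m + q n)))\<^sup>2" by (rule low)
    moreover have "(norm (q m - q n))\<^sup>2 = 2 * (norm (x - q m))\<^sup>2 + 2 * (norm (x - q n))\<^sup>2 - 4 * (norm (x - (1/2) *\<^sub>R (q m + q n)))\<^sup>2"
      by (simp add: power2_norm_eq_inner inner_diff_left inner_diff_right inner_add_left inner_add_right inner_commute algebra_simps)
    ultimately show ?thesis using q(2)[of m] q(2)[of n] by simp
  qed
  have "Cauchy q"
  proof (rule metric_CauchyI)
    fix e :: real assume e: "0 < e"
    then obtain n0 where n0: "inverse (real (Suc n0)) < e\<^sup>2 / 4" using reals_Archimedean[of "e\<^sup>2 / 4"] by auto
    have "dist (q m) (q n) < e" if "m \<ge> n0" "n \<ge> n0" for m n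
    proof -
      have "inverse (real (Suc m)) \<le> inverse (real (Suc n0))" "inverse (real (Suc n)) \<le> inverse (real (Suc n0))"
        using that by (auto intro!: le_imp_inverse_le)
      then have "(norm (q m - q n))\<^sup>2 < e\<^sup>2" using par[of m n] n0 by linarith
      then show ?thesis unfolding dist_norm using e by (simp add: power2_less_imp_less)
    qed
    then show "\<exists>M. \<forall>m\<ge>M. \<forall>n\<ge>M. dist (q m) (q n) < e" by blast
  qed
  then obtain p where p: "q \<longlonglongrightarrow> p" using Cauchy_convergent convergent_def by blast
  have pM: "p \<in> M" using closed_sequentially[OF M(2) q(1) p] .
  have "(\<lambda>n. (norm (x - q n))\<^sup>2) \<longlonglongrightarrow> (norm (x - p))\<^sup>2" by (intro tendsto_intros p)
  moreover have "(\<lambda>n. \<delta> + inverse (real (Suc n))) \<longlonglongrightarrow> \<delta> + 0" by (intro tendsto_intros LIMSEQ_inverse_real_of_nat)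
  ultimately have pd: "(norm (x - p))\<^sup>2 \<le> \<delta>" using q(2) by (intro LIMSEQ_le[of _ _ _ "\<delta>"]) (auto intro: less_imp_le)
  have "(x - p) \<bullet> v = 0" if v: "v \<in> M" for v
  proof (rule ccontr)
    assume n0: "(x - p) \<bullet> v \<noteq> 0"
    then have vn: "v \<bullet> v > 0" by auto
    \<comment> \<open>The step length that minimises the distance from \<open>x\<close> to the line
      through \<open>p\<close> in direction \<open>v\<close>.\<close>
    define t where "t = ((x - p) \<bullet> v) / (v \<bullet> v)"
    have "\<delta> \<le> (norm (x - (p + t *\<^sub>R v)))\<^sup>2" using pM v M(1) by (intro low subspace_add subspace_scale)
    also have "\<dots> = (norm (x - p))\<^sup>2 - 2 * t * ((x - p) \<bullet> v) + t * (t * (v \<bullet> v))"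
      by (simp add: power2_norm_eq_inner inner_diff_left inner_diff_right inner_add_left inner_add_right inner_commute algebra_simps)
    also have "t * (v \<bullet> v) = (x - p) \<bullet> v" using vn by (simp add: t_def)
    finally have "t * ((x - p) \<bullet> v) \<le> 0" using pd by simp
    moreover have "t * ((x - p) \<bullet> v) > 0" using vn n0 by (simp add: t_def power2_eq_square[symmetric])
    ultimately show False by simp
  qed
  with pM show ?thesis by blast
qed

subsection \<open>Density of test fields\<close>

text \<open>The space is Lindelof: countably many of the neighbourhoods already cover
  \<open>U\<close>, and countably many null sets may be united.\<close>

lemma AE_locally:
  fixes U :: "(real^3) set"
  assumes "\<And>x. x \<in> U \<Longrightarrow> \<exists>N. open N \<and> x \<in> N \<and> (AE y in lborel. y \<in> N \<longrightarrow> P y)"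
  shows "AE y in lborel. y \<in> U \<longrightarrow> P y"
proof -
  define F where "F = {N. open N \<and> (AE y in lborel. y \<in> N \<longrightarrow> P y)}"
  obtain F' where F': "F' \<subseteq> F" "countable F'" "\<Union>F' = \<Union>F" using Lindelof[of F] unfolding F_def by blast
  have ae: "AE y in lborel. \<forall>N\<in>F'. y \<in> N \<longrightarrow> P y"
    unfolding AE_ball_countable[OF F'(2)] using F'(1) by (auto simp: F_def)
  have sub: "U \<subseteq> \<Union>F'"
  proof
    fix x assume "x \<in> U"
    from assms[OF this] obtain N where "N \<in> F" "x \<in> N" by (auto simp: F_def)
    then show "x \<in> \<Union>F'" unfolding F'(3) by blast
  qed
  from ae show ?thesis
  proof eventually_elim
    case (elim y)
    then show ?case using sub by blast
  qed
qed

text \<open>Products of smooth steps of slope \<open>n\<close>. The values stay between 0 and 1 and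
  vanish off the open box, which is the form required by dominated convergence.\<close>

lemma smooth_indicator_seq:
  fixes a b :: "real^3"
  obtains \<beta> :: "nat \<Rightarrow> real^3 \<Rightarrow> real" where "\<And>n. smooth (\<beta> n)" "\<And>n x. 0 \<le> \<beta> n x" "\<And>n x. \<beta> n x \<le> 1"
    "\<And>n x. x \<notin> box a b \<Longrightarrow> \<beta> n x = 0" "\<And>x. (\<lambda>n. \<beta> n x) \<longlonglongrightarrow> indicator (box a b) x"
proof
  define \<beta> where "\<beta> n x = (\<Prod>i\<in>UNIV. smooth_step (real n * (x $ i - a $ i)) * smooth_step (real n * (b $ i - x $ i)))" for n :: nat and x :: "real^3"
  have s1: "smooth (\<lambda>x::real^3. smooth_step (c + d * (x $ i)))" for c d i
    by (rule smooth_affine[where L''="\<lambda>x::real^3. d * (x $ i)" and f=smooth_step and a=c,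
        OF bounded_linear_const_mult[OF bounded_linear_vec_nth] smooth_smooth_step])
  have "smooth (\<lambda>x::real^3. smooth_step (real n * (x $ i - a $ i)))" "smooth (\<lambda>x::real^3. smooth_step (real n * (b $ i - x $ i)))" for n i
    using s1[of "- real n * a $ i" "real n" i] s1[of "real n * b $ i" "- real n" i] by (simp_all add: algebra_simps)
  then show "smooth (\<beta> n)" for n unfolding \<beta>_def[abs_def] by (intro smooth_prod smooth_mult)
  show "0 \<le> \<beta> n x" for n x unfolding \<beta>_def by (intro prod_nonneg mult_nonneg_nonneg ballI smooth_step_ge)
  show "\<beta> n x \<le> 1" for n x
    unfolding \<beta>_def by (intro prod_le_1 conjI mult_nonneg_nonneg smooth_step_ge mult_le_one smooth_step_le)
  show z: "\<beta> n x = 0" if "x \<notin> box a b" for n x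
  proof -
    from that obtain i where "x $ i \<le> a $ i \<or> b $ i \<le> x $ i" by (auto simp: mem_box_cart not_less)
    then have "real n * (x $ i - a $ i) \<le> 0 \<or> real n * (b $ i - x $ i) \<le> 0"
      by (auto simp: mult_nonneg_nonpos)
    then have "smooth_step (real n * (x $ i - a $ i)) * smooth_step (real n * (b $ i - x $ i)) = 0"
      by (auto simp: smooth_step_0)
    then show ?thesis unfolding \<beta>_def by (intro prod_zero) auto
  qed
  show "(\<lambda>n. \<beta> n x) \<longlonglongrightarrow> indicator (box a b) x" for x
  proof (cases "x \<in> box a b")
    case True
    then have pos: "0 < x $ i - a $ i" "0 < b $ i - x $ i" for i by (auto simp: mem_box_cart)
    have "\<forall>i. \<forall>\<^sub>F n in sequentially. 1 \<le> real n * (x $ i - a $ i) \<and> 1 \<le> real n * (b $ i - x $ i)"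
    proof (intro allI eventually_conj)
      fix i
      have l: "\<forall>\<^sub>F n in sequentially. 1 \<le> real n * c" if "0 < c" for c
      proof -
        have "\<forall>\<^sub>F n in sequentially. 1 / c \<le> real n" using filterlim_real_sequentially by (simp add: filterlim_at_top)
        then show ?thesis by eventually_elim (use that in \<open>simp add: field_simps\<close>)
      qed
      show "\<forall>\<^sub>F n in sequentially. 1 \<le> real n * (x $ i - a $ i)" "\<forall>\<^sub>F n in sequentially. 1 \<le> real n * (b $ i - x $ i)"
        by (intro l pos)+
    qed
    then have "\<forall>\<^sub>F n in sequentially. \<forall>i. 1 \<le> real n * (x $ i - a $ i) \<and> 1 \<le> real n * (b $ i - x $ i)"
      by (simp add: eventually_all_finite)
    then have "\<forall>\<^sub>F n in sequentially. \<beta> n x = 1"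
      by eventually_elim (simp add: \<beta>_def smooth_step_1)
    then show ?thesis using True by (simp add: tendsto_eventually)
  qed (simp add: z)
qed

text \<open>Dominated convergence carries orthogonality from the smooth approximations to the
  indicator of the box, in each fixed direction \<open>v\<close>. The closed box has to lie in
  \<Omega>, since it serves as the compact set carrying the approximations.\<close>

lemma test_fields_orthogonal_box:
  fixes g :: "'b::euclidean_space L2"
  assumes o: "\<And>\<Phi>. \<Phi> \<in> test_fields \<Omega> \<Longrightarrow> g \<bullet> abs_L2 \<Phi> = 0" and ab: "cbox a b \<subseteq> \<Omega>"
  shows "integrable lborel (\<lambda>x. indicator (box a b) x * (rep_L2 g x \<bullet> v))"
    "(LINT x|lborel. indicator (box a b) x * (rep_L2 g x \<bullet> v)) = 0"
proof -
  obtain \<beta> :: "nat \<Rightarrow> real^3 \<Rightarrow> real" where \<beta>: "\<And>n. smooth (\<beta> n)" "\<And>n x. 0 \<le> \<beta> n x" "\<And>n x. \<beta> n x \<le> 1"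
    "\<And>n x. x \<notin> box a b \<Longrightarrow> \<beta> n x = 0" "\<And>x. (\<lambda>n. \<beta> n x) \<longlonglongrightarrow> indicator (box a b) x"
    by (rule smooth_indicator_seq) (rule that)
  have t: "(\<lambda>x. \<beta> n x *\<^sub>R v) \<in> test_fields \<Omega>" for n
  proof (rule test_fieldsI[OF smooth_scaleR[OF \<beta>(1) smooth_const] compact_cbox ab])
    fix x assume "x \<notin> cbox a b"
    then have "x \<notin> box a b" using box_subset_cbox by blast
    then show "\<beta> n x *\<^sub>R v = 0" by (simp add: \<beta>(4))
  qed
  have sqv: "square_integrable (\<lambda>x. indicator (box a b) x *\<^sub>R v)"
  proof -
    have "(\<lambda>x. (norm (indicator (box a b) x *\<^sub>R v))\<^sup>2) = (\<lambda>x. indicator (box a b) x * (norm v)\<^sup>2)"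
      by (auto simp: indicator_def)
    moreover have "integrable lborel (\<lambda>x. indicator (box a b) x * (norm v)\<^sup>2)"
      by (intro integrable_mult_left integrable_real_indicator emeasure_lborel_box_finite) simp
    ultimately show ?thesis by (simp add: square_integrable_def)
  qed
  have int: "integrable lborel (\<lambda>x. rep_L2 g x \<bullet> (indicator (box a b) x *\<^sub>R v))"
    by (rule integrable_inner_square_integrable[OF sq_rep sqv])
  then show int': "integrable lborel (\<lambda>x. indicator (box a b) x * (rep_L2 g x \<bullet> v))" by simp
  have "(\<lambda>n. LINT x|lborel. rep_L2 g x \<bullet> (\<beta> n x *\<^sub>R v)) \<longlonglongrightarrow> (LINT x|lborel. indicator (box a b) x * (rep_L2 g x \<bullet> v))"
  proof (rule integral_dominated_convergence)
    have [measurable]: "\<beta> n \<in> borel_measurable borel" for n by (rule smooth_measurable[OF \<beta>(1)])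
    show "(\<lambda>x. rep_L2 g x \<bullet> (\<beta> n x *\<^sub>R v)) \<in> borel_measurable lborel" for n by measurable
    show "(\<lambda>x. indicator (box a b) x * (rep_L2 g x \<bullet> v)) \<in> borel_measurable lborel" by measurable
    show "integrable lborel (\<lambda>x. \<bar>indicator (box a b) x * (rep_L2 g x \<bullet> v)\<bar>)" using int' by (rule integrable_abs)
    show "AE x in lborel. (\<lambda>n. rep_L2 g x \<bullet> (\<beta> n x *\<^sub>R v)) \<longlonglongrightarrow> indicator (box a b) x * (rep_L2 g x \<bullet> v)"
      using \<beta>(5) by (auto intro!: tendsto_mult_right)
    show "AE x in lborel. norm (rep_L2 g x \<bullet> (\<beta> n x *\<^sub>R v)) \<le> \<bar>indicator (box a b) x * (rep_L2 g x \<bullet> v)\<bar>" for n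
    proof (rule AE_I2)
      fix x show "norm (rep_L2 g x \<bullet> (\<beta> n x *\<^sub>R v)) \<le> \<bar>indicator (box a b) x * (rep_L2 g x \<bullet> v)\<bar>"
        using \<beta>(2)[of n x] \<beta>(3)[of n x] mult_right_mono[OF \<beta>(3)[of n x], of "\<bar>rep_L2 g x \<bullet> v\<bar>"]
        by (cases "x \<in> box a b") (auto simp: \<beta>(4) abs_mult)
    qed
  qed
  moreover have "(LINT x|lborel. rep_L2 g x \<bullet> (\<beta> n x *\<^sub>R v)) = 0" for n
    using o[OF t] abs_inner[OF sq_rep test_fields_square_integrable[OF t], of g n] by (simp add: abs_rep)
  ultimately show "(LINT x|lborel. indicator (box a b) x * (rep_L2 g x \<bullet> v)) = 0"
    by (simp only: LIMSEQ_const_iff)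
qed

text \<open>Open boxes form an intersection-stable generator of the Borel sets, so the integral
  vanishes over every Borel set. Support in one box makes the total integral a box integral, which
  is what complements call for.\<close>

lemma box_integrals_zero:
  fixes k :: "real^3 \<Rightarrow> real"
  assumes k: "integrable lborel k" and z: "\<And>a b. set_lebesgue_integral lborel (box a b) k = 0"
    and c: "k = (\<lambda>x. indicator (box c d) x * k x)"
  shows "AE x in lborel. k x = 0"
proof (rule sigma_finite_measure.density_zero[OF sigma_finite_lborel k])
  fix A :: "(real^3) set" assume "A \<in> sets lborel"
  then have A: "A \<in> sigma_sets UNIV (range (\<lambda>(a, b). box a b))" unfolding sets_lborel borel_eq_box by simp
  have st: "Int_stable (range (\<lambda>(a, b). box a b :: (real^3) set))" by (auto simp: Int_stable_def box_Int_box)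
  have si: "set_integrable lborel A k" if "A \<in> sets borel" for A
    using that integrable_mult_indicator[OF _ k, of A] by (simp add: set_integrable_def)
  have kU: "(LINT x|lborel. k x) = 0"
    using z[of c d] c by (simp add: set_lebesgue_integral_def)
  have sp: "range (\<lambda>(a, b). box a b :: (real^3) set) \<subseteq> Pow UNIV" by auto
  show "set_lebesgue_integral lborel A k = 0"
    using st sp A
  proof (induction rule: sigma_sets_induct_disjoint)
    case (basic A) then show ?case using z by auto
  next
    case empty then show ?case by (simp add: set_lebesgue_integral_def)
  next
    case (compl A)
    then have [measurable]: "A \<in> sets borel" by (simp add: borel_eq_box)
    have "(LINT x|lborel. k x) = set_lebesgue_integral lborel A k + set_lebesgue_integral lborel (UNIV - A) k"
      using set_integral_Un[of A "UNIV - A" lborel k] si[of A] si[of "UNIV - A"] by (simp add: set_lebesgue_integral_def)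
    then show ?case using compl kU by simp
  next
    case (union F)
    then have F: "F i \<in> sets borel" for i by (simp add: borel_eq_box subset_eq)
    have "set_lebesgue_integral lborel (\<Union>i. F i) k = (\<Sum>i. set_lebesgue_integral lborel (F i) k)"
    proof (rule lebesgue_integral_countable_add)
      show "set_integrable lborel (\<Union>i. F i) k" using F by (intro si) auto
      show "F i \<inter> F j = {}" if "i \<noteq> j" for i j using union(1) that by (auto simp: disjoint_family_on_def)
    qed (use F in auto)
    then show ?case using union by simp
  qed
qed

text \<open>The fundamental lemma of the calculus of variations, proved by components on boxes with
  closure in \<Omega> and globalised by \<open>AE_locally\<close>.\<close>

lemma test_fields_orthogonal_zero:
  fixes g :: "'b::euclidean_space L2"
  assumes \<Omega>: "open \<Omega>" and g: "g \<in> L2_on \<Omega>" and o: "\<And>\<Phi>. \<Phi> \<in> test_fields \<Omega> \<Longrightarrow> g \<bullet> abs_L2 \<Phi> = 0"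
  shows "g = 0"
proof -
  have bz: "AE x in lborel. x \<in> box c d \<longrightarrow> rep_L2 g x \<bullet> v = 0" if cd: "cbox c d \<subseteq> \<Omega>" for c d and v
  proof -
    define k where "k x = indicator (box c d) x * (rep_L2 g x \<bullet> v)" for x
    have "AE x in lborel. k x = 0"
    proof (rule box_integrals_zero)
      show "integrable lborel k" unfolding k_def by (rule test_fields_orthogonal_box(1)[OF o cd])
      show "k = (\<lambda>x. indicator (box c d) x * k x)" by (auto simp: k_def indicator_def)
      fix a b :: "real^3"
      obtain a' b' where ab: "box a b \<inter> box c d = box a' b'" by (auto simp: box_Int_box)
      have "set_lebesgue_integral lborel (box a b) k = (LINT x|lborel. indicator (box a' b') x * (rep_L2 g x \<bullet> v))"
        unfolding set_lebesgue_integral_def k_def ab[symmetric] by (simp add: indicator_inter_arith mult.assoc)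
      also have "\<dots> = 0"
      proof (cases "box a' b' = {}")
        case False
        have "cbox a' b' = closure (box a' b')" using False by (simp add: closure_box)
        also have "\<dots> \<subseteq> cbox c d"
          using ab box_subset_cbox[of c d] by (intro closure_minimal closed_cbox) blast
        finally have c': "cbox a' b' \<subseteq> \<Omega>" using cd by blast
        show ?thesis by (rule test_fields_orthogonal_box(2)[OF o c'])
      qed simp
      finally show "set_lebesgue_integral lborel (box a b) k = 0" .
    qed
    then show ?thesis by eventually_elim (auto simp: k_def)
  qed
  have "AE x in lborel. x \<in> \<Omega> \<longrightarrow> rep_L2 g x = 0"
  proof (rule AE_locally)
    fix x assume "x \<in> \<Omega>"
    then obtain c d where cd: "cbox c d \<subseteq> \<Omega>" "x \<in> box c d" by (rule open_contains_cbox[OF \<Omega>]) (rule that)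
    have "AE y in lborel. \<forall>v\<in>Basis. y \<in> box c d \<longrightarrow> rep_L2 g y \<bullet> v = 0"
      by (rule AE_finite_allI[OF finite_Basis]) (rule bz[OF cd(1)])
    then have "AE y in lborel. y \<in> box c d \<longrightarrow> rep_L2 g y = 0"
      by eventually_elim (auto simp: euclidean_eq_iff[where 'a='b])
    then show "\<exists>N. open N \<and> x \<in> N \<and> (AE y in lborel. y \<in> N \<longrightarrow> rep_L2 g y = 0)"
      using cd by (intro exI[of _ "box c d"]) auto
  qed
  moreover have "AE x in lborel. x \<notin> \<Omega> \<longrightarrow> rep_L2 g x = 0" using g by (simp add: L2_on_def)
  ultimately have "AE x in lborel. rep_L2 g x = rep_L2 0 x" using rep_zero[where 'a='b]
    by eventually_elim auto
  then show ?thesis by (simp add: L2_eq_iff_rep)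
qed

subsection \<open>Integrals of translated test functions\<close>

lemma line_derivative:
  fixes k :: "'a::real_normed_vector \<Rightarrow> real"
  assumes "smooth k"
  shows "((\<lambda>s. k (a + s *\<^sub>R w)) has_real_derivative frechet_derivative k (at (a + s *\<^sub>R w)) w) (at s)"
proof -
  have "((\<lambda>s. k (a + s *\<^sub>R w)) has_derivative (\<lambda>r. frechet_derivative k (at (a + s *\<^sub>R w)) (r *\<^sub>R w))) (at s)"
    by (rule has_derivative_compose[where g=k, OF _ smooth_fd[OF assms]]) (auto intro!: derivative_eq_intros)
  moreover have "frechet_derivative k (at (a + s *\<^sub>R w)) (r *\<^sub>R w) = frechet_derivative k (at (a + s *\<^sub>R w)) w * r" for r
    using linear_cmul[OF linear_frechet_derivative[OF smooth_differentiable[OF assms]]] by simp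
  ultimately show ?thesis by (simp add: has_field_derivative_def)
qed

lemma frechet_second_expand:
  fixes k :: "real^3 \<Rightarrow> real"
  assumes k: "smooth k"
  shows "frechet_derivative (\<lambda>y. frechet_derivative k (at y) h) (at p) h =
    (\<Sum>j\<in>UNIV. \<Sum>i\<in>UNIV. h $ j * (h $ i * partial_deriv i (partial_deriv j k) p))"
proof -
  have "frechet_derivative (\<lambda>y. frechet_derivative k (at y) h) (at p) h =
      (\<Sum>j\<in>UNIV. h $ j * partial_deriv j (\<lambda>y. frechet_derivative k (at y) h) p)"
    using frechet_derivative_partial[OF smooth_differentiable[OF smooth_frechet[OF k, of h]], of p h] by simp
  also have "\<dots> = (\<Sum>j\<in>UNIV. h $ j * frechet_derivative (partial_deriv j k) (at p) h)"
    unfolding partial_deriv_def[abs_def] by (simp add: smooth_second_symmetric[OF k, of h])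
  also have "\<dots> = (\<Sum>j\<in>UNIV. \<Sum>i\<in>UNIV. h $ j * (h $ i * partial_deriv i (partial_deriv j k) p))"
    by (simp add: frechet_derivative_partial[of "partial_deriv j k" for j] smooth_differentiable smooth_partial_deriv k sum_distrib_left)
  finally show ?thesis .
qed

text \<open>A second order remainder that is uniform in \<open>z\<close>; it is what allows
  differentiation under the integral sign. The constant sums the bounds of all second partial
  derivatives.\<close>

lemma test_fields_taylor:
  fixes k :: "real^3 \<Rightarrow> real"
  assumes k: "k \<in> test_fields UNIV"
  obtains C where "0 \<le> C" "\<And>z h. \<bar>k (z + h) - k z - frechet_derivative k (at z) h\<bar> \<le> C * (norm h)\<^sup>2"
proof -
  have sk: "smooth k" by (rule test_fields_smooth[OF k])
  have "\<exists>B. 0 \<le> B \<and> (\<forall>x. norm (partial_deriv i (partial_deriv j k) x) \<le> B)" for i j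
    using test_fields_bounded[OF test_fields_partial_deriv[OF test_fields_partial_deriv[OF k]]] by metis
  then obtain B where B: "\<And>i j. 0 \<le> B i j" "\<And>i j x. \<bar>partial_deriv i (partial_deriv j k) x\<bar> \<le> B i j"
    unfolding real_norm_def by metis
  define C where "C = (\<Sum>j\<in>UNIV. \<Sum>i\<in>UNIV. B i j)"
  show ?thesis
  proof (rule that[of C])
    show "0 \<le> C" unfolding C_def by (intro sum_nonneg B)
    fix z h :: "real^3"
    have b: "\<bar>frechet_derivative (\<lambda>y. frechet_derivative k (at y) h) (at p) h\<bar> \<le> C * (norm h)\<^sup>2" for p
    proof -
      have "\<bar>h $ j * (h $ i * partial_deriv i (partial_deriv j k) p)\<bar> \<le> B i j * (norm h)\<^sup>2" for i j
      proof -
        have "\<bar>h $ j\<bar> * (\<bar>h $ i\<bar> * \<bar>partial_deriv i (partial_deriv j k) p\<bar>) \<le> norm h * (norm h * B i j)"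
          by (intro mult_mono B component_le_norm_cart mult_nonneg_nonneg) auto
        then show ?thesis by (simp add: abs_mult power2_eq_square mult_ac)
      qed
      then have "(\<Sum>j\<in>UNIV. \<Sum>i\<in>UNIV. \<bar>h $ j * (h $ i * partial_deriv i (partial_deriv j k) p)\<bar>) \<le> (\<Sum>j\<in>UNIV. \<Sum>i\<in>UNIV. B i j * (norm h)\<^sup>2)"
        by (intro sum_mono)
      moreover have "\<bar>\<Sum>j\<in>UNIV. \<Sum>i\<in>UNIV. h $ j * (h $ i * partial_deriv i (partial_deriv j k) p)\<bar>
          \<le> (\<Sum>j\<in>UNIV. \<Sum>i\<in>UNIV. \<bar>h $ j * (h $ i * partial_deriv i (partial_deriv j k) p)\<bar>)"
        by (rule order_trans[OF sum_abs]) (rule sum_mono, rule sum_abs)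
      ultimately show ?thesis unfolding frechet_second_expand[OF sk] C_def by (simp add: sum_distrib_right)
    qed
    define D where "D y = frechet_derivative k (at y) h" for y
    have sD: "smooth D" unfolding D_def by (rule smooth_frechet[OF sk])
    \<comment> \<open>The mean value theorem is applied to \<open>k\<close> minus its linear part
      along the segment, and afterwards to the directional derivative \<open>D\<close>, which yields
      the second derivative.\<close>
    have "\<exists>s>0. s < 1 \<and> (k (z + 1 *\<^sub>R h) - 1 * D z) - (k (z + 0 *\<^sub>R h) - 0 * D z) = (1 - 0) * (D (z + s *\<^sub>R h) - D z)"
    proof (rule MVT2)
      fix s
      show "((\<lambda>s. k (z + s *\<^sub>R h) - s * D z) has_real_derivative D (z + s *\<^sub>R h) - D z) (at s)"
        using DERIV_diff[OF line_derivative[OF sk, of z h s] DERIV_cmult_right[OF DERIV_ident, of "D z"]]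
        by (simp add: D_def)
    qed simp
    then obtain s where s: "0 < s" "s < 1" "k (z + h) - k z - D z = D (z + s *\<^sub>R h) - D z" by auto
    have "\<exists>t>0. t < s \<and> D (z + s *\<^sub>R h) - D (z + 0 *\<^sub>R h) = (s - 0) * frechet_derivative D (at (z + t *\<^sub>R h)) h"
      using s(1) by (intro MVT2) (auto intro: line_derivative[OF sD])
    then obtain t where t: "D (z + s *\<^sub>R h) - D z = s * frechet_derivative D (at (z + t *\<^sub>R h)) h" by auto
    have "\<bar>s * frechet_derivative D (at (z + t *\<^sub>R h)) h\<bar> \<le> 1 * (C * (norm h)\<^sup>2)"
      unfolding abs_mult using s b[of "z + t *\<^sub>R h"] by (intro mult_mono) (auto simp: D_def[abs_def])
    then show "\<bar>k (z + h) - k z - frechet_derivative k (at z) h\<bar> \<le> C * (norm h)\<^sup>2"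
      using s(3) t by (simp add: D_def)
  qed
qed

lemma times_differentiable_sum:
  "(\<And>i. i \<in> I \<Longrightarrow> times_differentiable n (f i)) \<Longrightarrow> times_differentiable n (\<lambda>x. \<Sum>i\<in>I. f i x)"
proof (induction I rule: infinite_finite_induct)
  case (insert i I)
  have "times_differentiable n (\<lambda>x. f i x + (\<Sum>j\<in>I. f j x))"
    by (rule times_differentiable_add) (use insert in blast)+
  then show ?case using insert.hyps by simp
qed (simp_all add: times_differentiable_const)

text \<open>Convolution with a measure on \<open>real^3\<close> given as the image under \<open>E\<close> of the (vector) measure with density
  \<open>f\<close>; besides mollification, this covers the potentials integrated along a line.\<close>

locale kernel_integral =
  fixes M :: "'m measure" and E :: "'m \<Rightarrow> real^3" and f :: "'m \<Rightarrow> 'b::euclidean_space"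
  assumes E_meas [measurable]: "E \<in> borel_measurable M" and f_meas [measurable]: "f \<in> borel_measurable M"
    and f_loc: "\<And>R. integrable M (\<lambda>y. indicator (cball 0 R) (E y) * norm (f y))"
begin

definition kint :: "(real^3 \<Rightarrow> real) \<Rightarrow> real^3 \<Rightarrow> 'b" where
  "kint k x = (LINT y|M. k (x - E y) *\<^sub>R f y)"

text \<open>Only parameters with \<open>norm (E y) \<le> R + norm x\<close> contribute, where
  \<open>R\<close> bounds the support of \<open>k\<close>; there local integrability of
  \<open>f\<close> applies.\<close>

lemma kint_integrable:
  assumes k: "k \<in> test_fields UNIV"
  shows "integrable M (\<lambda>y. k (x - E y) *\<^sub>R f y)"
proof -
  obtain B where B: "0 \<le> B" "\<And>x. norm (k x) \<le> B" by (rule test_fields_bounded[OF k]) (rule that)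
  obtain R where R: "0 < R" "\<And>x. R < norm x \<Longrightarrow> k x = 0" by (rule test_fields_ball[OF k]) (rule that)
  have [measurable]: "k \<in> borel_measurable borel" by (rule smooth_measurable[OF test_fields_smooth[OF k]])
  have "integrable M (\<lambda>y. B * (indicator (cball 0 (R + norm x)) (E y) * norm (f y)))"
    using f_loc by (rule integrable_mult_right)
  then show ?thesis
  proof (rule Bochner_Integration.integrable_bound)
    show "(\<lambda>y. k (x - E y) *\<^sub>R f y) \<in> borel_measurable M" by measurable
    show "AE y in M. norm (k (x - E y) *\<^sub>R f y) \<le> norm (B * (indicator (cball 0 (R + norm x)) (E y) * norm (f y)))"
    proof (rule AE_I2)
      fix y
      show "norm (k (x - E y) *\<^sub>R f y) \<le> norm (B * (indicator (cball 0 (R + norm x)) (E y) * norm (f y)))"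
      proof (cases "R < norm (x - E y)")
        case False
        then have "norm (E y) \<le> R + norm x" using norm_triangle_sub[of "E y" x] by (simp add: norm_minus_commute)
        then show ?thesis using B by (auto simp: abs_mult intro!: mult_right_mono)
      qed (simp add: R)
    qed
  qed
qed

lemma kint_frechet:
  assumes k: "k \<in> test_fields UNIV"
  shows "(\<lambda>z. frechet_derivative k (at z) v) \<in> test_fields UNIV"
    "kint (\<lambda>z. frechet_derivative k (at z) v) x = (\<Sum>i\<in>UNIV. (v $ i) *\<^sub>R kint (partial_deriv i k) x)"
proof -
  have e: "(\<lambda>z. frechet_derivative k (at z) v) = (\<lambda>z. \<Sum>i\<in>UNIV. (v $ i) *\<^sub>R partial_deriv i k z)"
    using frechet_derivative_partial[OF smooth_differentiable[OF test_fields_smooth[OF k]]] by (simp add: fun_eq_iff)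
  show "(\<lambda>z. frechet_derivative k (at z) v) \<in> test_fields UNIV"
    unfolding e by (intro test_fields_sum test_fields_scaleR test_fields_partial_deriv k)
  have "kint (\<lambda>z. \<Sum>i\<in>UNIV. (v $ i) *\<^sub>R partial_deriv i k z) x
      = (LINT y|M. (\<Sum>i\<in>UNIV. (v $ i) *\<^sub>R (partial_deriv i k (x - E y) *\<^sub>R f y)))"
    unfolding kint_def by (simp add: scaleR_sum_left)
  also have "\<dots> = (\<Sum>i\<in>UNIV. (v $ i) *\<^sub>R kint (partial_deriv i k) x)"
    unfolding kint_def integral_scaleR_right[symmetric]
    by (rule Bochner_Integration.integral_sum[OF integrable_scaleR_right[OF kint_integrable[OF test_fields_partial_deriv[OF k]]]])
  finally show "kint (\<lambda>z. frechet_derivative k (at z) v) x = (\<Sum>i\<in>UNIV. (v $ i) *\<^sub>R kint (partial_deriv i k) x)"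
    unfolding e .
qed

text \<open>The difference quotient error is at most the Taylor remainder of \<open>k\<close>,
  uniform in the point, times the mass of \<open>f\<close> on a ball, hence of order
  \<open>norm (y - x)\<close>.\<close>

lemma kint_has_derivative:
  assumes k: "k \<in> test_fields UNIV"
  shows "(kint k has_derivative (\<lambda>v. kint (\<lambda>z. frechet_derivative k (at z) v) x)) (at x)"
proof -
  obtain C where C: "0 \<le> C" "\<And>z h. \<bar>k (z + h) - k z - frechet_derivative k (at z) h\<bar> \<le> C * (norm h)\<^sup>2"
    by (rule test_fields_taylor[OF k]) (rule that)
  obtain R where R: "0 < R" "\<And>x. R < norm x \<Longrightarrow> k x = 0" by (rule test_fields_ball[OF k]) (rule that)
  \<comment> \<open>The additional 1 in the radius leaves room for displacements shorter than 1, so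
    that outside this ball all three kernel values vanish.\<close>
  define G where "G = (\<lambda>y. indicator (cball 0 (R + norm x + 1)) (E y) * norm (f y))"
  have iG: "integrable M G" unfolding G_def by (rule f_loc)
  define I where "I = (LINT y|M. G y)"
  have bnd: "norm (kint k y - kint k x - kint (\<lambda>z. frechet_derivative k (at z) (y - x)) x) / norm (y - x) \<le> C * I * norm (y - x)"
    if y: "dist y x < 1" "y \<noteq> x" for y
  proof -
    define h where "h = y - x"
    have hn: "norm h < 1" "h \<noteq> 0" using y by (auto simp: h_def dist_norm)
    note int = kint_integrable[OF k, of y] kint_integrable[OF k, of x] kint_integrable[OF kint_frechet(1)[OF k], of x h]
    have eq: "kint k y - kint k x - kint (\<lambda>z. frechet_derivative k (at z) h) x =
       (LINT m|M. (k (y - E m) - k (x - E m) - frechet_derivative k (at (x - E m)) h) *\<^sub>R f m)"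
      unfolding kint_def using int by (simp add: scaleR_diff_left)
    have inti: "integrable M (\<lambda>m. (k (y - E m) - k (x - E m) - frechet_derivative k (at (x - E m)) h) *\<^sub>R f m)"
      unfolding scaleR_diff_left using int by (intro Bochner_Integration.integrable_diff)
    have pt: "norm ((k (y - E m) - k (x - E m) - frechet_derivative k (at (x - E m)) h) *\<^sub>R f m) \<le> C * (norm h)\<^sup>2 * G m" for m
    proof (cases "norm (E m) \<le> R + norm x + 1")
      case True
      have "\<bar>k (y - E m) - k (x - E m) - frechet_derivative k (at (x - E m)) h\<bar> \<le> C * (norm h)\<^sup>2"
        using C(2)[of "x - E m" h] by (simp add: h_def)
      then show ?thesis using True by (simp add: G_def mult_right_mono)
    next
      case False
      have "norm (E m) \<le> norm (x - E m) + norm x" using norm_triangle_sub[of "E m" x] by (simp add: norm_minus_commute)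
      then have nx: "R + 1 < norm (x - E m)" using False by simp
      have "norm (x - E m) \<le> norm (y - E m) + norm h"
        using norm_triangle_sub[of "x - E m" "y - E m"] by (simp add: h_def norm_minus_commute)
      then have ny: "R < norm (y - E m)" using nx hn by simp
      have "partial_deriv i k (x - E m) = 0" for i
        by (rule partial_deriv_outside[of "cball 0 R"]) (use nx R in auto)
      then have "frechet_derivative k (at (x - E m)) h = 0"
        using frechet_derivative_partial[OF smooth_differentiable[OF test_fields_smooth[OF k]], of "x - E m" h] by simp
      then show ?thesis using R(2) nx ny False by (simp add: G_def)
    qed
    have "norm (kint k y - kint k x - kint (\<lambda>z. frechet_derivative k (at z) h) x) \<le>
        (LINT m|M. norm ((k (y - E m) - k (x - E m) - frechet_derivative k (at (x - E m)) h) *\<^sub>R f m))"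
      unfolding eq by (rule integral_norm_bound)
    also have "\<dots> \<le> (LINT m|M. C * (norm h)\<^sup>2 * G m)"
      by (rule integral_mono[OF integrable_norm[OF inti] integrable_mult_right[OF iG] pt])
    also have "\<dots> = C * I * norm h * norm h" by (simp add: I_def power2_eq_square)
    finally show ?thesis using hn(2) by (simp add: h_def[symmetric] pos_divide_le_eq)
  qed
  show ?thesis
  proof (rule has_derivativeI_sandwich[where e=1 and H="\<lambda>y. C * I * norm (y - x)"])
    show "bounded_linear (\<lambda>v. kint (\<lambda>z. frechet_derivative k (at z) v) x)"
      unfolding kint_frechet(2)[OF k]
      by (intro bounded_linear_sum bounded_linear_compose[OF bounded_linear_scaleR_left bounded_linear_vec_nth])
    show "((\<lambda>y. C * I * norm (y - x)) \<longlongrightarrow> 0) (at x)"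
      by (rule tendsto_eq_rhs, (rule tendsto_intros)+, simp)
  qed (use bnd in \<open>auto simp: diff_diff_eq\<close>)
qed

lemma kint_partial_deriv: "k \<in> test_fields UNIV \<Longrightarrow> partial_deriv i (kint k) = kint (partial_deriv i k)"
  unfolding partial_deriv_def[abs_def] fun_eq_iff by (simp add: frechet_derivative_eqI[OF kint_has_derivative])

lemma smooth_kint: "k \<in> test_fields UNIV \<Longrightarrow> smooth (kint k)"
proof -
  have "k \<in> test_fields UNIV \<Longrightarrow> times_differentiable n (kint k)" for n
  proof (induction n arbitrary: k)
    case 0
    then show ?case using has_derivative_continuous[OF kint_has_derivative]
      by (auto intro!: continuous_at_imp_continuous_on)
  next
    case (Suc n)
    have "times_differentiable n (\<lambda>x. \<Sum>i\<in>UNIV. (v $ i) *\<^sub>R kint (partial_deriv i k) x)" for v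
      by (intro times_differentiable_sum times_differentiable_linear_comp[OF bounded_linear_scaleR_right]
          Suc.IH test_fields_partial_deriv Suc.prems)
    then show ?case
      using kint_has_derivative[OF Suc.prems] frechet_derivative_eqI[OF kint_has_derivative[OF Suc.prems]] kint_frechet(2)[OF Suc.prems]
      by (auto intro!: differentiableI)
  qed
  then show "k \<in> test_fields UNIV \<Longrightarrow> smooth (kint k)" by (simp add: smooth_def)
qed

end

subsection \<open>Translation invariance and integration by parts\<close>

lemma distr_reflect: "distr lborel borel (\<lambda>y. x - y) = (lborel :: (real^3) measure)"
  using lborel_affine[of "-1" x] by (simp add: density_1)

lemma integral_reflect:
  fixes f :: "real^3 \<Rightarrow> 'b::euclidean_space"
  assumes "f \<in> borel_measurable borel"
  shows "(LINT y|lborel. f (x - y)) = (LINT y|lborel. f y)"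
  using integral_distr[of "\<lambda>y. x - y" lborel borel f] assms by (simp add: distr_reflect)

lemma integrable_indicator_cball: "integrable lborel (indicat_real (cball (c::real^3) R))"
  using emeasure_bounded_finite[OF bounded_cball[of c R]] by (intro integrable_real_indicator) auto

text \<open>Convolution with the constant 1 is the constant function with value the integral;
  differentiating it under the integral sign gives zero.\<close>

lemma integral_partial_deriv:
  fixes \<phi> :: "real^3 \<Rightarrow> real"
  assumes \<phi>: "\<phi> \<in> test_fields \<Omega>"
  shows "(LINT x|lborel. partial_deriv i \<phi> x) = 0"
proof -
  have \<phi>U: "\<phi> \<in> test_fields UNIV" by (rule test_fields_UNIV[OF \<phi>])
  interpret K: kernel_integral lborel "\<lambda>y::real^3. y" "\<lambda>y. 1 :: real"
  proof
    show "integrable lborel (\<lambda>y::real^3. indicator (cball 0 R) y * norm (1::real))" for R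
      by (simp add: integrable_indicator_cball)
  qed auto
  have c: "K.kint k x = (LINT y|lborel. k y)" if "k \<in> test_fields UNIV" for k x
    unfolding K.kint_def
    using integral_reflect[of k x] smooth_measurable[OF test_fields_smooth[OF that]] by simp
  have "K.kint \<phi> = (\<lambda>x. LINT y|lborel. \<phi> y)" using c[OF \<phi>U] by (simp add: fun_eq_iff)
  then have "partial_deriv i (K.kint \<phi>) 0 = 0" by simp
  then show ?thesis by (simp add: K.kint_partial_deriv[OF \<phi>U] c test_fields_partial_deriv[OF \<phi>U])
qed

lemma integral_by_parts:
  fixes f g :: "real^3 \<Rightarrow> real"
  assumes f: "smooth f" and g: "g \<in> test_fields \<Omega>"
  shows "(LINT x|lborel. f x * partial_deriv i g x) = - (LINT x|lborel. partial_deriv i f x * g x)"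
proof -
  have t: "(\<lambda>x. f x * g x) \<in> test_fields \<Omega>" by (rule test_fields_smooth_mult[OF f g])
  note i1 = test_fields_integrable[OF test_fields_smooth_mult[OF f test_fields_partial_deriv[OF g, of i]]]
  note i2 = test_fields_integrable[OF test_fields_smooth_mult[OF smooth_partial_deriv[OF f, of i] g]]
  have "partial_deriv i (\<lambda>x. f x * g x) x = f x * partial_deriv i g x + partial_deriv i f x * g x" for x
    by (rule partial_deriv_mult[OF smooth_differentiable[OF f] smooth_differentiable[OF test_fields_smooth[OF g]]])
  then have "(LINT x|lborel. f x * partial_deriv i g x + partial_deriv i f x * g x) = 0"
    using integral_partial_deriv[OF t, of i] by simp
  then show ?thesis using i1 i2 by simp
qed

subsection \<open>Mollification\<close>

text \<open>On a ball the norm of the field is integrable as a product of two square integrable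
  functions, the indicator being the other factor.\<close>

lemma kernel_integral_L2: "kernel_integral lborel (\<lambda>y. y) (rep_L2 u)"
proof
  fix R
  have sq: "square_integrable (\<lambda>x::real^3. indicator (cball 0 R) x :: real)"
  proof -
    have "(\<lambda>x::real^3. (norm (indicator (cball 0 R) x :: real))\<^sup>2) = indicator (cball 0 R)" by (auto simp: indicator_def)
    then show ?thesis by (simp add: square_integrable_def integrable_indicator_cball borel_measurable_indicator)
  qed
  have sqn: "square_integrable (\<lambda>x. norm (rep_L2 u x))"
    by (rule square_integrable_norm_le[of "rep_L2 u" _ 1]) (auto simp: sq_rep)
  show "integrable lborel (\<lambda>y. indicator (cball 0 R) y * norm (rep_L2 u y))"
    using integrable_inner_square_integrable[OF sq sqn] by simp
qed auto

interpretation convolution: kernel_integral lborel "\<lambda>y. y" "rep_L2 u" for u :: "'b::euclidean_space L2"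
  by (rule kernel_integral_L2)

definition conv :: "(real^3 \<Rightarrow> real) \<Rightarrow> 'b::euclidean_space L2 \<Rightarrow> real^3 \<Rightarrow> 'b" where
  "conv k u x = (LINT y|lborel. k (x - y) *\<^sub>R rep_L2 u y)"

lemma conv_kint: "conv k u = convolution.kint u k"
  by (simp add: conv_def convolution.kint_def fun_eq_iff)

lemma smooth_conv: "k \<in> test_fields UNIV \<Longrightarrow> smooth (conv k u)"
  and conv_partial_deriv: "k \<in> test_fields UNIV \<Longrightarrow> partial_deriv i (conv k u) = conv (partial_deriv i k) u"
  and conv_integrable: "k \<in> test_fields UNIV \<Longrightarrow> integrable lborel (\<lambda>y. k (x - y) *\<^sub>R rep_L2 u y)"
  unfolding conv_kint by (rule convolution.smooth_kint convolution.kint_partial_deriv convolution.kint_integrable, assumption)+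

lemma conv_abs:
  assumes "k \<in> test_fields UNIV" "square_integrable f"
  shows "conv k (abs_L2 f) x = (LINT y|lborel. k (x - y) *\<^sub>R f y)"
proof -
  have [measurable]: "k \<in> borel_measurable borel" by (rule test_fields_measurable[OF assms(1)])
  have [measurable]: "f \<in> borel_measurable borel" using assms(2) by (simp add: square_integrable_def)
  show ?thesis
    unfolding conv_def
  proof (rule integral_cong_AE)
    show "AE y in lborel. k (x - y) *\<^sub>R rep_L2 (abs_L2 f) y = k (x - y) *\<^sub>R f y"
      using rep_abs[OF assms(2)] by eventually_elim simp
  qed measurable
qed

lemma conv_linear:
  assumes k: "k \<in> test_fields UNIV" and L: "bounded_linear L"
  shows "conv k (pw (\<lambda>x. L) u) x = L (conv k u x)"
proof -
  interpret L: bounded_linear L by fact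
  have "conv k (pw (\<lambda>x. L) u) x = (LINT y|lborel. k (x - y) *\<^sub>R L (rep_L2 u y))"
    unfolding pw_def by (rule conv_abs[OF k pw_square_integrable[OF pw_bounded_linear[OF L] sq_rep]])
  also have "\<dots> = (LINT y|lborel. L (k (x - y) *\<^sub>R rep_L2 u y))" by (simp add: L.scaleR)
  also have "\<dots> = L (conv k u x)" unfolding conv_def by (rule integral_bounded_linear[OF L conv_integrable[OF k]])
  finally show ?thesis .
qed

lemma conv_diff:
  assumes k: "k \<in> test_fields UNIV"
  shows "conv k (u - v) x = conv k u x - conv k v x"
proof -
  have "conv k (u - v) x = (LINT y|lborel. k (x - y) *\<^sub>R (rep_L2 u y - rep_L2 v y))"
    using conv_abs[OF k square_integrable_diff[OF sq_rep sq_rep], of u v x] abs_diff[OF sq_rep sq_rep, of u v]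
    by (simp add: abs_rep)
  then show ?thesis
    unfolding conv_def scaleR_diff_right
    using Bochner_Integration.integral_diff[OF conv_integrable[OF k] conv_integrable[OF k], of x u x v] by simp
qed

text \<open>Cauchy-Schwarz at a fixed point \<open>x\<close>. Convolution thus maps
  \<open>L2\<close> convergence to pointwise convergence, and identities for test functions pass to
  limits.\<close>

lemma conv_norm_le:
  assumes k: "k \<in> test_fields UNIV"
  shows "norm (conv k u x) \<le> norm (abs_L2 k) * norm u"
proof -
  have [measurable]: "k \<in> borel_measurable borel" by (rule smooth_measurable[OF test_fields_smooth[OF k]])
  have sk: "square_integrable k" by (rule test_fields_square_integrable[OF k])
  have i: "(LINT y|lborel. (norm (k (x - y)))\<^sup>2) = (LINT y|lborel. (norm (k y))\<^sup>2)"
    by (rule integral_reflect[where f="\<lambda>y. (norm (k y))\<^sup>2"]) measurable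
  have ik: "integrable lborel (\<lambda>y. (norm (k (x - y)))\<^sup>2)"
    using integrable_distr_eq[of "\<lambda>y. x - y" lborel borel "\<lambda>y. (norm (k y))\<^sup>2"] sk
    by (simp add: distr_reflect square_integrable_def)
  have skx: "square_integrable (\<lambda>y. \<bar>k (x - y)\<bar>)" using ik by (simp add: square_integrable_def)
  have sqn: "square_integrable (\<lambda>y. norm (rep_L2 u y))"
    by (rule square_integrable_norm_le[of "rep_L2 u" _ 1]) (auto simp: sq_rep)
  have "norm (conv k u x) \<le> (LINT y|lborel. norm (k (x - y) *\<^sub>R rep_L2 u y))"
    unfolding conv_def by (rule integral_norm_bound)
  also have "\<dots> = abs_L2 (\<lambda>y. \<bar>k (x - y)\<bar>) \<bullet> abs_L2 (\<lambda>y. norm (rep_L2 u y))"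
    by (simp add: abs_inner[OF skx sqn])
  also have "\<dots> \<le> norm (abs_L2 (\<lambda>y. \<bar>k (x - y)\<bar>)) * norm (abs_L2 (\<lambda>y. norm (rep_L2 u y)))"
    by (rule norm_cauchy_schwarz)
  also have "norm (abs_L2 (\<lambda>y. \<bar>k (x - y)\<bar>)) = norm (abs_L2 k)"
    by (rule power2_eq_imp_eq) (use i norm_abs_sq[OF skx] norm_abs_sq[OF sk] in simp_all)
  also have "norm (abs_L2 (\<lambda>y. norm (rep_L2 u y))) = norm u"
    by (rule power2_eq_imp_eq) (use norm_abs_sq[OF sqn] norm_L2_sq[of u] in simp_all)
  finally show ?thesis .
qed

lemma conv_tendsto:
  assumes k: "k \<in> test_fields UNIV" and X: "X \<longlonglongrightarrow> u"
  shows "(\<lambda>n. conv k (X n) x) \<longlonglongrightarrow> conv k u x"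
proof -
  have "(\<lambda>n. norm (abs_L2 k) * norm (X n - u)) \<longlonglongrightarrow> norm (abs_L2 k) * norm (u - u)" by (intro tendsto_intros X)
  then have "(\<lambda>n. norm (abs_L2 k) * norm (X n - u)) \<longlonglongrightarrow> 0" by simp
  then have "(\<lambda>n. conv k (X n) x - conv k u x) \<longlonglongrightarrow> 0"
    by (rule Lim_null_comparison[rotated])
      (auto simp: conv_diff[OF k, symmetric] conv_norm_le[OF k] intro!: always_eventually)
  then show ?thesis by (simp add: LIM_zero_iff)
qed

text \<open>The convolution of two test functions is symmetric, so the derivative, which
  \<open>conv_partial_deriv\<close> puts on the kernel, may be put on the other factor.\<close>

lemma conv_test_partial_deriv:
  fixes \<phi> :: "real^3 \<Rightarrow> real"
  assumes k: "k \<in> test_fields UNIV" and \<phi>: "\<phi> \<in> test_fields UNIV"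
  shows "partial_deriv i (conv k (abs_L2 \<phi>)) x = conv k (abs_L2 (partial_deriv i \<phi>)) x"
proof -
  have sw: "conv k (abs_L2 \<psi>) x = (LINT z|lborel. \<psi> (x - z) *\<^sub>R rep_L2 (abs_L2 k) z)" if \<psi>: "\<psi> \<in> test_fields UNIV" for \<psi> x
  proof -
    have [measurable]: "k \<in> borel_measurable borel" by (rule test_fields_measurable[OF k])
    have [measurable]: "\<psi> \<in> borel_measurable borel" by (rule test_fields_measurable[OF \<psi>])
    have "conv k (abs_L2 \<psi>) x = (LINT y|lborel. k (x - y) * \<psi> y)"
      using conv_abs[OF k test_fields_square_integrable[OF \<psi>]] by simp
    also have "\<dots> = (LINT y|lborel. k (x - (x - y)) * \<psi> (x - y))"
      by (rule integral_reflect[where f="\<lambda>y. k (x - y) * \<psi> y", symmetric]) measurable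
    also have "\<dots> = (LINT z|lborel. \<psi> (x - z) *\<^sub>R rep_L2 (abs_L2 k) z)"
    proof (rule integral_cong_AE)
      show "AE z in lborel. k (x - (x - z)) * \<psi> (x - z) = \<psi> (x - z) *\<^sub>R rep_L2 (abs_L2 k) z"
        using rep_abs[OF test_fields_square_integrable[OF k]] by eventually_elim simp
    qed measurable
    finally show ?thesis .
  qed
  have "partial_deriv i (conv k (abs_L2 \<phi>)) = partial_deriv i (conv \<phi> (abs_L2 k))"
    using sw[OF \<phi>] by (intro arg_cong[where f="partial_deriv i"]) (simp add: conv_def fun_eq_iff)
  also have "\<dots> = conv (partial_deriv i \<phi>) (abs_L2 k)" by (rule conv_partial_deriv[OF \<phi>])
  finally show ?thesis using sw[OF test_fields_partial_deriv[OF \<phi>, of i]] by (simp add: conv_def)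
qed

section \<open>Mollifiers: contraction, rate of approximation, existence\<close>

text \<open>Only a radius is prescribed, neither a shape nor a centre, so that a translated kernel
  is again a mollifier, of larger radius.\<close>

definition mollifier :: "real \<Rightarrow> (real^3 \<Rightarrow> real) \<Rightarrow> bool" where
  "mollifier r k \<longleftrightarrow> k \<in> test_fields UNIV \<and> (\<forall>x. 0 \<le> k x) \<and> (LINT x|lborel. k x) = 1 \<and> (\<forall>x. r < norm x \<longrightarrow> k x = 0)"

lemma mollifierD:
  assumes "mollifier r k"
  shows "k \<in> test_fields UNIV" "0 \<le> k x" "(LINT x|lborel. k x) = 1" "r < norm x \<Longrightarrow> k x = 0"
  using assms by (auto simp: mollifier_def)

text \<open>Jensen's inequality for the probability density \<open>k (x - y)\<close> bounds the
  square pointwise by the convolution of the squares; Tonelli and translation invariance integrate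
  this bound.\<close>

lemma conv_square_integrable:
  fixes u :: "'b::euclidean_space L2"
  assumes m: "mollifier r k"
  shows "square_integrable (conv k u)" "norm (abs_L2 (conv k u)) \<le> norm u"
proof -
  note k = mollifierD(1)[OF m]
  have [measurable]: "k \<in> borel_measurable borel" by (rule smooth_measurable[OF test_fields_smooth[OF k]])
  have [measurable]: "conv k u \<in> borel_measurable borel" by (rule smooth_measurable[OF smooth_conv[OF k]])
  interpret K: kernel_integral lborel "\<lambda>y. y" "\<lambda>y. (norm (rep_L2 u y))\<^sup>2"
  proof
    fix R
    have "integrable lborel (\<lambda>y. (norm (rep_L2 u y))\<^sup>2)" using sq_rep[of u] by (simp add: square_integrable_def)
    from integrable_mult_indicator[OF _ this, of "cball 0 R"]
    show "integrable lborel (\<lambda>y. indicator (cball 0 R) y * norm ((norm (rep_L2 u y))\<^sup>2))" by simp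
  qed auto
  have ikx: "integrable lborel (\<lambda>y. k (x - y))" for x
    using integrable_distr_eq[of "\<lambda>y. x - y" lborel borel k] test_fields_integrable[OF k]
    by (simp add: distr_reflect)
  have pt: "(norm (conv k u x))\<^sup>2 \<le> (LINT y|lborel. k (x - y) * (norm (rep_L2 u y))\<^sup>2)" for x
  proof -
    define c where "c = (LINT y|lborel. k (x - y) * norm (rep_L2 u y))"
    have i1: "integrable lborel (\<lambda>y. k (x - y) * norm (rep_L2 u y))"
      using integrable_norm[OF conv_integrable[OF k, of x u]] mollifierD(2)[OF m] by simp
    have i2: "integrable lborel (\<lambda>y. k (x - y) * (norm (rep_L2 u y))\<^sup>2)" using K.kint_integrable[OF k, of x] by simp
    have n: "norm (conv k u x) \<le> c"
    proof -
      have "norm (conv k u x) \<le> (LINT y|lborel. norm (k (x - y) *\<^sub>R rep_L2 u y))" unfolding conv_def by (rule integral_norm_bound)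
      then show ?thesis using mollifierD(2)[OF m] by (simp add: c_def)
    qed
    \<comment> \<open>Jensen's inequality in the form that a variance is nonnegative;
      \<open>c\<close> is the mean of the norm under the density.\<close>
    have "0 \<le> (LINT y|lborel. k (x - y) * (norm (rep_L2 u y) - c)\<^sup>2)"
      by (intro integral_nonneg_AE AE_I2 mult_nonneg_nonneg mollifierD(2)[OF m]) auto
    also have "\<dots> = (LINT y|lborel. k (x - y) * (norm (rep_L2 u y))\<^sup>2 - 2 * c * (k (x - y) * norm (rep_L2 u y)) + c\<^sup>2 * k (x - y))"
      by (intro Bochner_Integration.integral_cong refl) (simp add: power2_eq_square algebra_simps)
    also have "\<dots> = (LINT y|lborel. k (x - y) * (norm (rep_L2 u y))\<^sup>2) - 2 * c * c + c\<^sup>2 * 1"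
      using i1 i2 ikx integral_reflect[of k x] mollifierD(3)[OF m] by (simp add: c_def)
    finally have "c\<^sup>2 \<le> (LINT y|lborel. k (x - y) * (norm (rep_L2 u y))\<^sup>2)" by (simp add: power2_eq_square)
    moreover have "(norm (conv k u x))\<^sup>2 \<le> c\<^sup>2" using n by (intro power_mono) auto
    ultimately show ?thesis by linarith
  qed
  have "(\<integral>\<^sup>+x. ennreal ((norm (conv k u x))\<^sup>2) \<partial>lborel) \<le> (\<integral>\<^sup>+x. (\<integral>\<^sup>+y. ennreal (k (x - y) * (norm (rep_L2 u y))\<^sup>2) \<partial>lborel) \<partial>lborel)"
  proof (rule nn_integral_mono)
    fix x
    have "integrable lborel (\<lambda>y. k (x - y) * (norm (rep_L2 u y))\<^sup>2)" using K.kint_integrable[OF k, of x] by simp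
    then have "(\<integral>\<^sup>+y. ennreal (k (x - y) * (norm (rep_L2 u y))\<^sup>2) \<partial>lborel) = ennreal (LINT y|lborel. k (x - y) * (norm (rep_L2 u y))\<^sup>2)"
      by (rule nn_integral_eq_integral) (simp add: mollifierD(2)[OF m])
    then show "ennreal ((norm (conv k u x))\<^sup>2) \<le> (\<integral>\<^sup>+y. ennreal (k (x - y) * (norm (rep_L2 u y))\<^sup>2) \<partial>lborel)"
      using pt[of x] by (simp add: ennreal_leI)
  qed
  also have "\<dots> = (\<integral>\<^sup>+y. (\<integral>\<^sup>+x. ennreal (k (x - y) * (norm (rep_L2 u y))\<^sup>2) \<partial>lborel) \<partial>lborel)"
    by (rule lborel_pair.Fubini'[symmetric]) measurable
  also have "\<dots> = (\<integral>\<^sup>+y. ennreal ((norm (rep_L2 u y))\<^sup>2) \<partial>lborel)"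
  proof (rule nn_integral_cong)
    fix y :: "real^3"
    have d: "distr lborel borel (\<lambda>x. x - y) = (lborel :: (real^3) measure)"
    proof -
      have "(\<lambda>x. x - y) = (+) (- y)" by (simp add: fun_eq_iff)
      then show ?thesis using lborel_distr_plus[of "- y"] by simp
    qed
    have "(\<integral>\<^sup>+x. ennreal (k (x - y)) \<partial>lborel) = (\<integral>\<^sup>+x. ennreal (k x) \<partial>lborel)"
      using nn_integral_distr[of "\<lambda>x. x - y" lborel borel "\<lambda>x. ennreal (k x)"] by (simp add: d)
    also have "\<dots> = 1"
      using nn_integral_eq_integral[OF test_fields_integrable[OF k]] mollifierD(2,3)[OF m] by simp
    finally show "(\<integral>\<^sup>+x. ennreal (k (x - y) * (norm (rep_L2 u y))\<^sup>2) \<partial>lborel) = ennreal ((norm (rep_L2 u y))\<^sup>2)"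
      using mollifierD(2)[OF m] by (simp add: ennreal_mult nn_integral_multc)
  qed
  also have "\<dots> = ennreal ((norm u)\<^sup>2)" by (rule ennreal_norm_L2_sq[symmetric])
  finally have f: "(\<integral>\<^sup>+x. ennreal ((norm (conv k u x))\<^sup>2) \<partial>lborel) \<le> ennreal ((norm u)\<^sup>2)" .
  show "square_integrable (conv k u)" by (rule square_integrable_nn(1)[OF _ f]) auto
  have "(norm (abs_L2 (conv k u)))\<^sup>2 \<le> (norm u)\<^sup>2" by (rule square_integrable_nn(2)[OF _ f]) auto
  then show "norm (abs_L2 (conv k u)) \<le> norm u" by (rule power2_le_imp_le) simp
qed

lemma subspace_closure:
  fixes S :: "'a::real_normed_vector set"
  assumes S: "subspace S"
  shows "subspace (closure S)"
proof (rule subspaceI)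
  show "0 \<in> closure S" using subspace_0[OF S] closure_subset by blast
next
  fix x y assume "x \<in> closure S" "y \<in> closure S"
  then obtain f g where f: "\<And>n. f n \<in> S" "f \<longlonglongrightarrow> x" and g: "\<And>n. g n \<in> S" "g \<longlonglongrightarrow> y"
    unfolding closure_sequential by blast
  have "(\<lambda>n. f n + g n) \<longlonglongrightarrow> x + y" by (intro tendsto_add f g)
  then show "x + y \<in> closure S"
    unfolding closure_sequential using subspace_add[OF S f(1) g(1)] by (intro exI[of _ "\<lambda>n. f n + g n"]) simp
next
  fix c x assume "x \<in> closure S"
  then obtain f where f: "\<And>n. f n \<in> S" "f \<longlonglongrightarrow> x" unfolding closure_sequential by blast
  have "(\<lambda>n. c *\<^sub>R f n) \<longlonglongrightarrow> c *\<^sub>R x" by (intro tendsto_scaleR tendsto_const f)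
  then show "c *\<^sub>R x \<in> closure S"
    unfolding closure_sequential using subspace_scale[OF S f(1)] by (intro exI[of _ "\<lambda>n. c *\<^sub>R f n"]) simp
qed

lemma test_fields_lipschitz:
  fixes \<phi> :: "real^3 \<Rightarrow> 'b::euclidean_space"
  assumes \<phi>: "\<phi> \<in> test_fields \<Omega>"
  obtains L where "0 \<le> L" "\<And>x y. norm (\<phi> x - \<phi> y) \<le> L * norm (x - y)"
proof -
  have "\<exists>B. 0 \<le> B \<and> (\<forall>x. norm (partial_deriv i \<phi> x) \<le> B)" for i
    using test_fields_bounded[OF test_fields_partial_deriv[OF \<phi>]] by metis
  then obtain B where B: "\<And>i. 0 \<le> B i" "\<And>i x. norm (partial_deriv i \<phi> x) \<le> B i" by metis
  define L where "L = (\<Sum>i\<in>UNIV. B i)"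
  have L: "0 \<le> L" unfolding L_def by (intro sum_nonneg B)
  have o: "onorm (frechet_derivative \<phi> (at x)) \<le> L" for x
  proof (rule onorm_bound[OF L])
    fix v
    have "norm (frechet_derivative \<phi> (at x) v) \<le> (\<Sum>i\<in>UNIV. norm ((v $ i) *\<^sub>R partial_deriv i \<phi> x))"
      unfolding frechet_derivative_partial[OF smooth_differentiable[OF test_fields_smooth[OF \<phi>]]] by (rule norm_sum)
    also have "\<dots> \<le> (\<Sum>i\<in>UNIV. norm v * B i)"
      unfolding norm_scaleR real_norm_def[of "v $ i" for i]
      by (intro sum_mono mult_mono B component_le_norm_cart) auto
    finally show "norm (frechet_derivative \<phi> (at x) v) \<le> L * norm v"
      by (simp add: L_def sum_distrib_right sum_distrib_left mult.commute)
  qed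
  show ?thesis
  proof (rule that[OF L])
    fix x y
    show "norm (\<phi> x - \<phi> y) \<le> L * norm (x - y)"
      by (rule differentiable_bound[OF convex_UNIV _ o])
        (use smooth_fd[OF test_fields_smooth[OF \<phi>]] in \<open>auto\<close>)
  qed
qed

lemma square_integrable_indicator_cball: "square_integrable (indicat_real (cball (c::real^3) R))"
proof -
  have "(\<lambda>x. (indicat_real (cball c R) x)\<^sup>2) = indicat_real (cball c R)" by (auto simp: indicator_def)
  then show ?thesis by (simp add: square_integrable_def integrable_indicator_cball borel_measurable_indicator)
qed

text \<open>The error is at most the Lipschitz constant times \<open>r\<close> and vanishes off the
  ball of radius \<open>R + 1\<close>. The constant depends on \<phi> alone, so the rate holds for
  all mollifiers of radius \<open>r\<close>, including translated ones.\<close>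

lemma mollify_test:
  fixes \<phi> :: "real^3 \<Rightarrow> 'b::euclidean_space"
  assumes \<phi>: "\<phi> \<in> test_fields \<Omega>"
  obtains C where "0 \<le> C" "\<And>k r. mollifier r k \<Longrightarrow> 0 \<le> r \<Longrightarrow> r \<le> 1 \<Longrightarrow> norm (abs_L2 (conv k (abs_L2 \<phi>)) - abs_L2 \<phi>) \<le> C * r"
proof -
  obtain L where L: "0 \<le> L" "\<And>x y. norm (\<phi> x - \<phi> y) \<le> L * norm (x - y)" by (rule test_fields_lipschitz[OF \<phi>]) (rule that)
  obtain R where R: "0 < R" "\<And>x. R < norm x \<Longrightarrow> \<phi> x = 0" by (rule test_fields_ball[OF \<phi>]) (rule that)
  define I where "I = indicat_real (cball (0::real^3) (R + 1))"
  have sI: "square_integrable I" unfolding I_def by (rule square_integrable_indicator_cball)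
  have s\<phi>: "square_integrable \<phi>" by (rule test_fields_square_integrable[OF \<phi>])
  show ?thesis
  proof (rule that[of "L * norm (abs_L2 I)"])
    show "0 \<le> L * norm (abs_L2 I)" using L by simp
    fix k r assume m: "mollifier r k" and r: "0 \<le> r" "r \<le> 1"
    note k = mollifierD(1)[OF m]
    have [measurable]: "k \<in> borel_measurable borel" by (rule test_fields_measurable[OF k])
    have [measurable]: "\<phi> \<in> borel_measurable borel" by (rule test_fields_measurable[OF \<phi>])
    have ikx: "integrable lborel (\<lambda>y. k (x - y))" for x
      using integrable_distr_eq[of "\<lambda>y. x - y" lborel borel k] test_fields_integrable[OF k]
      by (simp add: distr_reflect)
    have ik1: "(LINT y|lborel. k (x - y)) = 1" for x using integral_reflect[of k x] mollifierD(3)[OF m] by simp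
    have i\<phi>: "integrable lborel (\<lambda>y. k (x - y) *\<^sub>R \<phi> y)" for x
    proof -
      have "integrable lborel (\<lambda>y. k (x - y) *\<^sub>R rep_L2 (abs_L2 \<phi>) y)" by (rule conv_integrable[OF k])
      then show ?thesis
      proof (rule integrable_cong_AE_imp)
        show "AE y in lborel. k (x - y) *\<^sub>R rep_L2 (abs_L2 \<phi>) y = k (x - y) *\<^sub>R \<phi> y"
          using rep_abs[OF s\<phi>] by eventually_elim simp
      qed measurable
    qed
    have pt: "norm (conv k (abs_L2 \<phi>) x - \<phi> x) \<le> L * r * norm (I x)" for x
    proof -
      have eq: "conv k (abs_L2 \<phi>) x - \<phi> x = (LINT y|lborel. k (x - y) *\<^sub>R (\<phi> y - \<phi> x))"
        using i\<phi>[of x] ikx[of x] ik1[of x] by (simp add: conv_abs[OF k s\<phi>] scaleR_diff_right)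
      have i2: "integrable lborel (\<lambda>y. k (x - y) *\<^sub>R (\<phi> y - \<phi> x))"
        unfolding scaleR_diff_right using i\<phi>[of x] ikx[of x] by simp
      have "norm (conv k (abs_L2 \<phi>) x - \<phi> x) \<le> (LINT y|lborel. norm (k (x - y) *\<^sub>R (\<phi> y - \<phi> x)))"
        unfolding eq by (rule integral_norm_bound)
      also have "\<dots> \<le> (LINT y|lborel. (L * r * norm (I x)) * k (x - y))"
      proof (rule integral_mono[OF integrable_norm[OF i2] integrable_mult_right[OF ikx]])
        fix y
        show "norm (k (x - y) *\<^sub>R (\<phi> y - \<phi> x)) \<le> L * r * norm (I x) * k (x - y)"
        proof (cases "r < norm (x - y)")
          case True then show ?thesis by (simp add: mollifierD(4)[OF m])
        next
          case False
          have d: "norm (\<phi> y - \<phi> x) \<le> L * r"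
            using L(2)[of y x] False L(1) by (metis mult_left_mono norm_minus_commute not_less order_trans)
          show ?thesis
          proof (cases "norm x \<le> R + 1")
            case True
            then show ?thesis using d mollifierD(2)[OF m, of "x - y"] mult_right_mono[OF d, of "k (x - y)"]
              by (simp add: I_def mult.commute)
          next
            case nx: False
            have "norm x \<le> norm y + norm (x - y)" using norm_triangle_sub[of x y] .
            then have "R < norm y" using nx False r by simp
            then show ?thesis using nx R by (simp add: I_def)
          qed
        qed
      qed
      also have "\<dots> = L * r * norm (I x)" using ik1 by simp
      finally show ?thesis .
    qed
    note sc = conv_square_integrable(1)[OF m, of "abs_L2 \<phi>"]
    have "norm (abs_L2 (\<lambda>x. conv k (abs_L2 \<phi>) x - \<phi> x)) \<le> L * r * norm (abs_L2 I)"
      by (rule norm_abs_le[OF sI square_integrable_diff[OF sc s\<phi>] pt]) (use L r in simp)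
    then show "norm (abs_L2 (conv k (abs_L2 \<phi>)) - abs_L2 \<phi>) \<le> L * norm (abs_L2 I) * r"
      unfolding abs_diff[OF sc s\<phi>] by (simp add: mult_ac)
  qed
qed

text \<open>A three-term estimate with a test field close to \<open>u\<close>. The closure
  hypothesis stands in for density; fields obtained as limits of test fields satisfy it by
  construction.\<close>

lemma mollify_tendsto:
  fixes u :: "'b::euclidean_space L2"
  assumes u: "u \<in> closure (abs_L2 ` test_fields UNIV)"
    and m: "\<And>n. mollifier (r n) (k n)" and r: "\<And>n. 0 \<le> r n" "r \<longlonglongrightarrow> 0"
  shows "(\<lambda>n. abs_L2 (conv (k n) u)) \<longlonglongrightarrow> u"
proof (rule metric_LIMSEQ_I)
  fix e :: real assume e: "0 < e"
  obtain \<phi> where \<phi>: "\<phi> \<in> test_fields UNIV" "norm (abs_L2 \<phi> - u) < e / 3"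
    using u e unfolding closure_approachable dist_norm by (auto dest: spec[of _ "e/3"])
  obtain C where C: "0 \<le> C" "\<And>k r. mollifier r k \<Longrightarrow> 0 \<le> r \<Longrightarrow> r \<le> 1 \<Longrightarrow> norm (abs_L2 (conv k (abs_L2 \<phi>)) - abs_L2 \<phi>) \<le> C * r"
    by (rule mollify_test[OF \<phi>(1)]) (rule that)
  have "(\<lambda>n. C * r n) \<longlonglongrightarrow> C * 0" by (intro tendsto_intros r)
  then have "\<forall>\<^sub>F n in sequentially. C * r n < e / 3" using e by (intro order_tendstoD) auto
  moreover have "\<forall>\<^sub>F n in sequentially. r n < 1" using r(2) by (intro order_tendstoD) auto
  ultimately have "\<forall>\<^sub>F n in sequentially. dist (abs_L2 (conv (k n) u)) u < e"
  proof eventually_elim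
    case (elim n)
    note sq = conv_square_integrable(1)[OF m[of n]]
    have "abs_L2 (conv (k n) u) - abs_L2 (conv (k n) (abs_L2 \<phi>)) = abs_L2 (conv (k n) (u - abs_L2 \<phi>))"
      unfolding abs_diff[OF sq sq] conv_diff[OF mollifierD(1)[OF m[of n]], symmetric] ..
    then have 1: "norm (abs_L2 (conv (k n) u) - abs_L2 (conv (k n) (abs_L2 \<phi>))) < e / 3"
      using conv_square_integrable(2)[OF m[of n], of "u - abs_L2 \<phi>"] \<phi>(2) by (simp add: norm_minus_commute)
    have 2: "norm (abs_L2 (conv (k n) (abs_L2 \<phi>)) - abs_L2 \<phi>) < e / 3"
      using C(2)[OF m[of n] r(1)] elim by fastforce
    have "norm (abs_L2 (conv (k n) u) - u) \<le> norm (abs_L2 (conv (k n) u) - abs_L2 (conv (k n) (abs_L2 \<phi>)))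
        + norm (abs_L2 (conv (k n) (abs_L2 \<phi>)) - abs_L2 \<phi>) + norm (abs_L2 \<phi> - u)"
      using norm_triangle_ineq[of "abs_L2 (conv (k n) u) - abs_L2 (conv (k n) (abs_L2 \<phi>))" "abs_L2 (conv (k n) (abs_L2 \<phi>)) - abs_L2 \<phi>"]
        norm_triangle_ineq[of "abs_L2 (conv (k n) u) - abs_L2 \<phi>" "abs_L2 \<phi> - u"] by simp
    then show ?case using 1 2 \<phi>(2) by (simp add: dist_norm)
  qed
  then show "\<exists>no. \<forall>n\<ge>no. dist (abs_L2 (conv (k n) u)) u < e" by (simp add: eventually_sequentially)
qed

lemma conv_zero:
  assumes "AE y in lborel. y \<in> K \<or> rep_L2 u y = 0" "\<And>y. y \<in> K \<Longrightarrow> k (x - y) = 0"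
  shows "conv k u x = 0"
  unfolding conv_def
proof (rule integral_eq_zero_AE)
  show "AE y in lborel. k (x - y) *\<^sub>R rep_L2 u y = 0"
    using assms(1) by eventually_elim (use assms(2) in auto)
qed

text \<open>A product of one dimensional bumps; it is even, so that mollification preserves affine functions.\<close>

lemma mollifier_exists:
  assumes r: "0 < r"
  obtains k where "mollifier r k" "\<And>x. k (- x) = k x"
proof -
  \<comment> \<open>The norm is at most the sum of the three absolute coordinates, so the cube of
    half side \<open>r / 3\<close> lies in the ball of radius \<open>r\<close>.\<close>
  define q where "q = r / 3"
  define b :: "real^3 \<Rightarrow> real" where "b x = (\<Prod>i\<in>UNIV. bump_exp 0 (q + x $ i) * bump_exp 0 (q - x $ i))" for x
  have s1: "smooth (\<lambda>x::real^3. bump_exp 0 (q + d * (x $ i)))" for d i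
    by (rule smooth_affine[where L''="\<lambda>x::real^3. d * (x $ i)" and f="bump_exp 0" and a=q,
        OF bounded_linear_const_mult[OF bounded_linear_vec_nth] smooth_bump_exp])
  have sb: "smooth b" unfolding b_def[abs_def]
    by (intro smooth_prod smooth_mult) (use s1[of 1] s1[of "-1"] in simp_all)
  have nb: "0 \<le> b x" for x unfolding b_def by (intro prod_nonneg mult_nonneg_nonneg ballI bump_exp_nonneg)
  have zb: "b x = 0" if "r < norm x" for x
  proof -
    have "\<exists>i. q \<le> \<bar>x $ i\<bar>"
    proof (rule ccontr)
      assume "\<not> ?thesis"
      then have "(\<Sum>i\<in>UNIV. \<bar>x $ i\<bar>) \<le> (\<Sum>i\<in>(UNIV::3 set). q)" by (intro sum_mono) (auto simp: not_le less_imp_le)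
      then show False using norm_le_l1_cart[of x] that by (simp add: q_def)
    qed
    then obtain i where "q \<le> \<bar>x $ i\<bar>" ..
    then have "bump_exp 0 (q + x $ i) * bump_exp 0 (q - x $ i) = 0" by (auto simp: bump_exp_def)
    then show ?thesis unfolding b_def by (intro prod_zero) auto
  qed
  have tb: "b \<in> test_fields UNIV"
    by (rule test_fieldsI[OF sb compact_cball[of 0 r]]) (auto intro: zb)
  have ib: "integrable lborel b" by (rule test_fields_integrable[OF tb])
  \<comment> \<open>If the integral vanished, \<open>b\<close> would be zero almost everywhere,
    although it is positive on the open cube, which is not negligible.\<close>
  have pos: "0 < (LINT x|lborel. b x)"
  proof (rule ccontr)
    assume "\<not> ?thesis"
    moreover have "0 \<le> (LINT x|lborel. b x)" using nb by (intro integral_nonneg_AE) auto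
    ultimately have "(LINT x|lborel. b x) = 0" by simp
    then have ae: "AE x in lborel. b x = 0" using integral_nonneg_eq_0_iff_AE[OF ib] nb by simp
    define B where "B = box (\<chi> i. - q) (\<chi> i. q :: real^3)"
    have "AE x in lborel. x \<notin> B"
      using ae
    proof eventually_elim
      case (elim x)
      show ?case
      proof
        assume "x \<in> B"
        then have "- q < x $ i \<and> x $ i < q" for i by (simp add: B_def mem_box_cart)
        then have "\<not> q + x $ i \<le> 0 \<and> \<not> q - x $ i \<le> 0" for i by (simp add: not_le) (smt (verit))
        then have "0 < b x" unfolding b_def by (intro prod_pos) (simp add: bump_exp_def)
        then show False using elim by simp
      qed
    qed
    then have "B \<in> null_sets lborel" unfolding B_def by (subst AE_iff_null_sets) auto
    then have "negligible B" unfolding negligible_iff_null_sets by (rule null_sets_completionI)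
    moreover have "0 \<in> B" using r by (simp add: B_def mem_box_cart q_def)
    ultimately show False using open_not_negligible[of B] by (auto simp: B_def)
  qed
  define k where "k x = (1 / (LINT x|lborel. b x)) *\<^sub>R b x" for x
  show ?thesis
  proof (rule that)
    show "mollifier r k"
      unfolding mollifier_def
    proof (intro conjI allI impI)
      show "k \<in> test_fields UNIV" unfolding k_def[abs_def] by (rule test_fields_scaleR[OF tb])
      show "0 \<le> k x" for x using nb pos by (simp add: k_def)
      show "(LINT x|lborel. k x) = 1" using pos by (simp add: k_def)
      show "k x = 0" if "r < norm x" for x using zb[OF that] by (simp add: k_def)
    qed
    show "k (- x) = k x" for x by (simp add: k_def b_def mult.commute)
  qed
qed

subsection \<open>Jets\<close>

type_synonym jet = "real \<times> (real^3) \<times> (real^3^3)"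

definition J :: "(real^3 \<Rightarrow> real) \<Rightarrow> real^3 \<Rightarrow> jet" where
  "J \<phi> x = (\<phi> x, grad \<phi> x, hess \<phi> x)"

definition W :: "(real^3) set \<Rightarrow> jet L2 set" where
  "W \<Omega> = closure ((\<lambda>\<phi>. abs_L2 (J \<phi>)) ` test_fields \<Omega>)"

definition jfun :: "jet L2 \<Rightarrow> real L2" where "jfun = pw (\<lambda>x. fst)"
definition jgrad :: "jet L2 \<Rightarrow> (real^3) L2" where "jgrad = pw (\<lambda>x v. fst (snd v))"
definition jhess :: "jet L2 \<Rightarrow> (real^3^3) L2" where "jhess = pw (\<lambda>x v. snd (snd v))"

lemma bl_jet: "bounded_linear (fst :: jet \<Rightarrow> real)" "bounded_linear (\<lambda>v::jet. fst (snd v))" "bounded_linear (\<lambda>v::jet. snd (snd v))"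
  by (intro bounded_linear_fst bounded_linear_compose[OF bounded_linear_fst bounded_linear_snd]
      bounded_linear_compose[OF bounded_linear_snd bounded_linear_snd])+

lemma bounded_linear_j: "bounded_linear jfun" "bounded_linear jgrad" "bounded_linear jhess"
  unfolding jfun_def jgrad_def jhess_def by (intro bounded_linear_pw pw_bounded_linear bl_jet)+

lemma test_fields_J: "\<phi> \<in> test_fields \<Omega> \<Longrightarrow> J \<phi> \<in> test_fields \<Omega>"
  unfolding J_def[abs_def] by (intro test_fields_Pair test_fields_grad test_fields_hess)

lemma sq_J: "\<phi> \<in> test_fields \<Omega> \<Longrightarrow> square_integrable (J \<phi>)"
  by (rule test_fields_square_integrable[OF test_fields_J])

lemma j_J:
  assumes "square_integrable (J \<phi>)"
  shows "jfun (abs_L2 (J \<phi>)) = abs_L2 \<phi>" "jgrad (abs_L2 (J \<phi>)) = abs_L2 (grad \<phi>)" "jhess (abs_L2 (J \<phi>)) = abs_L2 (hess \<phi>)"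
  unfolding jfun_def jgrad_def jhess_def
  by (simp_all add: pw_abs[OF pw_bounded_linear[OF bl_jet(1)] assms] pw_abs[OF pw_bounded_linear[OF bl_jet(2)] assms]
      pw_abs[OF pw_bounded_linear[OF bl_jet(3)] assms] J_def)

lemma J_add:
  assumes "smooth \<phi>" "smooth \<psi>"
  shows "J (\<lambda>x. \<phi> x + \<psi> x) x = J \<phi> x + J \<psi> x"
proof -
  have p: "partial_deriv i (\<lambda>x. f x + g x) = (\<lambda>x. partial_deriv i f x + partial_deriv i g x)"
    if "smooth f" "smooth g" for i and f g :: "real^3 \<Rightarrow> real"
    using that by (simp add: fun_eq_iff partial_deriv_add smooth_differentiable)
  show ?thesis using assms
    by (simp add: J_def grad_def hess_def p smooth_partial_deriv vec_eq_iff)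
qed

lemma J_scaleR:
  assumes "smooth \<phi>"
  shows "J (\<lambda>x. c *\<^sub>R \<phi> x) x = c *\<^sub>R J \<phi> x"
proof -
  have p: "partial_deriv i (\<lambda>x. c *\<^sub>R f x) = (\<lambda>x. c *\<^sub>R partial_deriv i f x)"
    if "smooth f" for i and f :: "real^3 \<Rightarrow> real"
    using partial_deriv_linear_comp[OF bounded_linear_scaleR_right smooth_differentiable[OF that]] by (simp add: fun_eq_iff)
  show ?thesis using assms p[of \<phi>] p[of "partial_deriv i \<phi>" for i]
    by (simp add: J_def grad_def hess_def smooth_partial_deriv vec_eq_iff)
qed

lemma subspace_W: "subspace (W \<Omega>)"
  unfolding W_def
proof (rule subspace_closure, rule subspaceI)
  have p0: "partial_deriv i (\<lambda>x. 0 :: real) = (\<lambda>x. 0)" for i by (rule ext) simp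
  have "J (\<lambda>x. 0) = (\<lambda>x. 0)" by (rule ext) (simp add: J_def grad_def hess_def vec_eq_iff zero_prod_def p0)
  then show "0 \<in> (\<lambda>\<phi>. abs_L2 (J \<phi>)) ` test_fields \<Omega>"
    using test_fields_zero by (intro image_eqI[of _ _ "\<lambda>x. 0"]) (auto simp: abs_zero)
next
  fix a b assume "a \<in> (\<lambda>\<phi>. abs_L2 (J \<phi>)) ` test_fields \<Omega>" "b \<in> (\<lambda>\<phi>. abs_L2 (J \<phi>)) ` test_fields \<Omega>"
  then obtain \<phi> \<psi> where p: "\<phi> \<in> test_fields \<Omega>" "\<psi> \<in> test_fields \<Omega>" "a = abs_L2 (J \<phi>)" "b = abs_L2 (J \<psi>)" by auto
  have "J (\<lambda>x. \<phi> x + \<psi> x) = (\<lambda>x. J \<phi> x + J \<psi> x)"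
    using J_add[OF test_fields_smooth[OF p(1)] test_fields_smooth[OF p(2)]] by (simp add: fun_eq_iff)
  then have "a + b = abs_L2 (J (\<lambda>x. \<phi> x + \<psi> x))"
    using p abs_add[OF sq_J[OF p(1)] sq_J[OF p(2)]] by simp
  then show "a + b \<in> (\<lambda>\<phi>. abs_L2 (J \<phi>)) ` test_fields \<Omega>" using test_fields_add[OF p(1,2)] by blast
next
  fix c a assume "a \<in> (\<lambda>\<phi>. abs_L2 (J \<phi>)) ` test_fields \<Omega>"
  then obtain \<phi> where p: "\<phi> \<in> test_fields \<Omega>" "a = abs_L2 (J \<phi>)" by auto
  have "J (\<lambda>x. c *\<^sub>R \<phi> x) = (\<lambda>x. c *\<^sub>R J \<phi> x)"
    by (intro ext J_scaleR test_fields_smooth[OF p(1)])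
  then have "c *\<^sub>R a = abs_L2 (J (\<lambda>x. c *\<^sub>R \<phi> x))"
    using p abs_scaleR[OF sq_J[OF p(1)], of c] by simp
  then show "c *\<^sub>R a \<in> (\<lambda>\<phi>. abs_L2 (J \<phi>)) ` test_fields \<Omega>" using test_fields_scaleR[OF p(1)] by blast
qed

lemma W_J: "\<phi> \<in> test_fields \<Omega> \<Longrightarrow> abs_L2 (J \<phi>) \<in> W \<Omega>"
  unfolding W_def by (rule subsetD[OF closure_subset]) (rule imageI)

lemma closed_W: "closed (W \<Omega>)" by (simp add: W_def)

lemma W_mono: "\<Omega> \<subseteq> \<Omega>' \<Longrightarrow> W \<Omega> \<subseteq> W \<Omega>'"
  unfolding W_def by (intro closure_mono image_mono test_fields_mono)

lemma W_sequence:
  assumes "w \<in> W \<Omega>"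
  obtains \<phi> where "\<And>n. \<phi> n \<in> test_fields \<Omega>" "(\<lambda>n. abs_L2 (J (\<phi> n))) \<longlonglongrightarrow> w"
proof -
  from assms obtain f where f: "\<forall>n. f n \<in> (\<lambda>\<phi>. abs_L2 (J \<phi>)) ` test_fields \<Omega>" "f \<longlonglongrightarrow> w"
    unfolding W_def closure_sequential by blast
  then have "\<forall>n. \<exists>\<phi>. \<phi> \<in> test_fields \<Omega> \<and> f n = abs_L2 (J \<phi>)" by blast
  then obtain \<phi> where \<phi>: "\<And>n. \<phi> n \<in> test_fields \<Omega>" "\<And>n. f n = abs_L2 (J (\<phi> n))" by metis
  have "f = (\<lambda>n. abs_L2 (J (\<phi> n)))" using \<phi>(2) by (simp add: fun_eq_iff)
  then show ?thesis using \<phi>(1) f(2) by (intro that) auto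
qed

lemma W_mollify_closure:
  assumes "w \<in> W UNIV"
  shows "w \<in> closure (abs_L2 ` test_fields UNIV)"
proof -
  have "(\<lambda>\<phi>. abs_L2 (J \<phi>)) ` test_fields UNIV \<subseteq> abs_L2 ` test_fields UNIV"
    using test_fields_J by auto
  from subsetD[OF closure_mono[OF this]] show ?thesis using assms unfolding W_def .
qed

text \<open>For jets of test functions convolution commutes with derivatives; in general both sides
  are continuous in \<open>w\<close>, because on the right the derivatives can be moved to
  \<open>k\<close>. Mollifying a jet therefore gives the jet of a smooth function determined by the
  first component.\<close>

lemma conv_W:
  assumes w: "w \<in> W UNIV" and k: "k \<in> test_fields UNIV"
  shows "conv k w x = J (conv k (jfun w)) x"
proof -
  obtain \<phi> where \<phi>: "\<And>n. \<phi> n \<in> test_fields UNIV" "(\<lambda>n. abs_L2 (J (\<phi> n))) \<longlonglongrightarrow> w" by (rule W_sequence[OF w]) (rule that)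
  have k1: "partial_deriv i k \<in> test_fields UNIV" for i by (rule test_fields_partial_deriv[OF k])
  have k2: "partial_deriv i (partial_deriv j k) \<in> test_fields UNIV" for i j by (rule test_fields_partial_deriv[OF k1])
  have Je: "J (conv k v) x = (conv k v x, \<chi> i. conv (partial_deriv i k) v x, \<chi> i j. conv (partial_deriv i (partial_deriv j k)) v x)" for v
    unfolding J_def grad_def hess_def conv_partial_deriv[OF k] conv_partial_deriv[OF k1] ..
  have l: "(\<lambda>n. abs_L2 (\<phi> n)) \<longlonglongrightarrow> jfun w"
    using bounded_linear.tendsto[OF bounded_linear_j(1) \<phi>(2)] by (simp add: j_J[OF sq_J[OF \<phi>(1)]])
  have J1: "conv k (abs_L2 (J (\<phi> n))) x = J (conv k (abs_L2 (\<phi> n))) x" for n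
  proof -
    note p = \<phi>(1)[of n]
    have L: "L (conv k (abs_L2 (J (\<phi> n))) x) = conv k (abs_L2 (\<lambda>x. L (J (\<phi> n) x))) x" if "bounded_linear L" for L :: "jet \<Rightarrow> real"
      unfolding conv_linear[OF k that, symmetric] pw_abs[OF pw_bounded_linear[OF that] sq_J[OF p]] ..
    have f: "fst (conv k (abs_L2 (J (\<phi> n))) x) = conv k (abs_L2 (\<phi> n)) x"
      using L[OF bl_jet(1)] by (simp add: J_def)
    have g: "fst (snd (conv k (abs_L2 (J (\<phi> n))) x)) $ i = partial_deriv i (conv k (abs_L2 (\<phi> n))) x" for i
      using L[OF bounded_linear_compose[OF bounded_linear_vec_nth[of i] bl_jet(2)]]
      by (simp add: J_def grad_def conv_test_partial_deriv[OF k p])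
    have h: "snd (snd (conv k (abs_L2 (J (\<phi> n))) x)) $ i $ j = partial_deriv i (partial_deriv j (conv k (abs_L2 (\<phi> n)))) x" for i j
    proof -
      have "partial_deriv j (conv k (abs_L2 (\<phi> n))) = conv k (abs_L2 (partial_deriv j (\<phi> n)))"
        by (simp add: fun_eq_iff conv_test_partial_deriv[OF k p])
      then show ?thesis
        using L[OF bounded_linear_compose[OF bounded_linear_vec_nth[of j] bounded_linear_compose[OF bounded_linear_vec_nth[of i] bl_jet(3)]]]
        by (simp add: J_def hess_def conv_test_partial_deriv[OF k test_fields_partial_deriv[OF p]])
    qed
    show ?thesis by (simp add: J_def prod_eq_iff f vec_eq_iff g h grad_def hess_def)
  qed
  have "(\<lambda>n. conv k (abs_L2 (J (\<phi> n))) x) \<longlonglongrightarrow> conv k w x" by (rule conv_tendsto[OF k \<phi>(2)])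
  moreover have "(\<lambda>n. J (conv k (abs_L2 (\<phi> n))) x) \<longlonglongrightarrow> J (conv k (jfun w)) x"
    unfolding Je by (intro tendsto_Pair tendsto_vec_lambda conv_tendsto k k1 k2 l)
  ultimately show ?thesis unfolding J1 by (rule LIMSEQ_unique)
qed

lemma norm_axis: "norm (axis i x :: 'a::real_inner^'n::finite) = norm x"
  unfolding norm_eq_sqrt_inner inner_axis by (simp add: axis_def)

subsection \<open>The Friedrichs inequality\<close>

text \<open>Integration of \<phi>^2 by parts against the coordinate \<open>x $ i\<close>, whose
  modulus is at most \<open>R\<close> on the support; the factor 2 comes from differentiating the
  square.\<close>

lemma friedrichs_partial:
  fixes \<phi> :: "real^3 \<Rightarrow> real"
  assumes \<phi>: "\<phi> \<in> test_fields UNIV" and R: "0 < R" "\<And>x. R < norm x \<Longrightarrow> \<phi> x = 0"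
  shows "norm (abs_L2 \<phi>) \<le> 2 * R * norm (abs_L2 (partial_deriv i \<phi>))"
proof -
  note d\<phi> = test_fields_partial_deriv[OF \<phi>, of i]
  have s\<phi>: "square_integrable \<phi>" "square_integrable (partial_deriv i \<phi>)"
    by (rule test_fields_square_integrable[OF \<phi>] test_fields_square_integrable[OF d\<phi>])+
  define g where "g x = \<phi> x * \<phi> x" for x
  have tg: "g \<in> test_fields UNIV"
    unfolding g_def[abs_def] by (rule test_fields_smooth_mult[OF test_fields_smooth[OF \<phi>] \<phi>])
  have pg: "partial_deriv i g x = 2 * (\<phi> x * partial_deriv i \<phi> x)" for x
    unfolding g_def[abs_def]
    by (subst partial_deriv_mult) (simp_all add: smooth_differentiable[OF test_fields_smooth[OF \<phi>]])
  have sc: "smooth (\<lambda>x::real^3. x $ i)" by (rule smooth_linear[OF bounded_linear_vec_nth])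
  have tx: "(\<lambda>x. (x $ i) * \<phi> x) \<in> test_fields UNIV" by (rule test_fields_smooth_mult[OF sc \<phi>])
  note sx = test_fields_square_integrable[OF tx]
  \<comment> \<open>The constant 1 is written as the derivative of the coordinate in order to
    integrate by parts.\<close>
  have "(norm (abs_L2 \<phi>))\<^sup>2 = (LINT x|lborel. partial_deriv i (\<lambda>x. x $ i) x * g x)"
    unfolding norm_abs_sq[OF s\<phi>(1)] by (simp add: partial_deriv_coord g_def power2_eq_square)
  also have "\<dots> = - (LINT x|lborel. x $ i * partial_deriv i g x)"
    using integral_by_parts[OF sc tg, of i] by simp
  also have "\<dots> = - 2 * (LINT x|lborel. (x $ i * \<phi> x) * partial_deriv i \<phi> x)"
    unfolding pg by (simp add: mult_ac flip: integral_mult_right_zero)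
  also have "\<dots> = - 2 * (abs_L2 (\<lambda>x. x $ i * \<phi> x) \<bullet> abs_L2 (partial_deriv i \<phi>))"
    by (simp add: abs_inner[OF sx s\<phi>(2)])
  also have "\<dots> \<le> 2 * (norm (abs_L2 (\<lambda>x. x $ i * \<phi> x)) * norm (abs_L2 (partial_deriv i \<phi>)))"
    using Cauchy_Schwarz_ineq2[of "abs_L2 (\<lambda>x. x $ i * \<phi> x)" "abs_L2 (partial_deriv i \<phi>)"] by linarith
  also have "\<dots> \<le> 2 * (R * norm (abs_L2 \<phi>) * norm (abs_L2 (partial_deriv i \<phi>)))"
  proof -
    have "norm (x $ i * \<phi> x) \<le> R * norm (\<phi> x)" for x
      using component_le_norm_cart[of x i] R(2)[of x]
      by (cases "R < norm x") (auto simp: abs_mult intro!: mult_right_mono)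
    from norm_abs_le[OF s\<phi>(1) sx this] R(1) show ?thesis by (intro mult_left_mono mult_right_mono) auto
  qed
  finally have *: "norm (abs_L2 \<phi>) * norm (abs_L2 \<phi>) \<le> norm (abs_L2 \<phi>) * (2 * R * norm (abs_L2 (partial_deriv i \<phi>)))"
    by (simp add: power2_eq_square mult_ac)
  show ?thesis
  proof (cases "norm (abs_L2 \<phi>) = 0")
    case True
    then show ?thesis using R(1) by simp
  next
    case False
    then have "0 < norm (abs_L2 \<phi>)" by simp
    with * show ?thesis by (rule mult_left_le_imp_le)
  qed
qed

text \<open>The summands of the constant come from two applications of the partial estimate for the
  value, one application to each of the three gradient entries, and the Hessian itself.\<close>

lemma norm_J_le:
  assumes \<phi>: "\<phi> \<in> test_fields UNIV" and R: "0 < R" "\<And>x. R < norm x \<Longrightarrow> \<phi> x = 0"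
  shows "norm (abs_L2 (J \<phi>)) \<le> (4 * R * R + 6 * R + 1) * norm (abs_L2 (hess \<phi>))"
proof -
  define h where "h = norm (abs_L2 (hess \<phi>))"
  note t1 = test_fields_partial_deriv[OF \<phi>] and th = test_fields_hess[OF \<phi>] and tg = test_fields_grad[OF \<phi>]
  note t2 = test_fields_partial_deriv[OF t1]
  note sq = test_fields_square_integrable
  have z1: "partial_deriv i \<phi> x = 0" if "R < norm x" for i x
    by (rule partial_deriv_outside[of "cball 0 R"]) (use that R in auto)
  have d2: "norm (abs_L2 (partial_deriv i (partial_deriv i \<phi>))) \<le> h" for i
  proof -
    have "norm (partial_deriv i (partial_deriv i \<phi>) x) \<le> 1 * norm (hess \<phi> x)" for x
    proof -
      have "norm (hess \<phi> x $ i $ i) \<le> norm (hess \<phi> x $ i)" by (rule Finite_Cartesian_Product.norm_nth_le)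
      also have "\<dots> \<le> norm (hess \<phi> x)" by (rule Finite_Cartesian_Product.norm_nth_le)
      finally show ?thesis by (simp add: hess_def)
    qed
    from norm_abs_le[OF sq[OF th] sq[OF t2] this] show ?thesis by (simp add: h_def)
  qed
  have d1: "norm (abs_L2 (partial_deriv i \<phi>)) \<le> 2 * R * h" for i
  proof -
    have "norm (abs_L2 (partial_deriv i \<phi>)) \<le> 2 * R * norm (abs_L2 (partial_deriv i (partial_deriv i \<phi>)))"
      by (rule friedrichs_partial[OF t1 R(1) z1])
    also have "\<dots> \<le> 2 * R * h" using d2 R(1) by (intro mult_left_mono) auto
    finally show ?thesis .
  qed
  have d0: "norm (abs_L2 \<phi>) \<le> 4 * R * R * h"
  proof -
    have "norm (abs_L2 \<phi>) \<le> 2 * R * norm (abs_L2 (partial_deriv 1 \<phi>))" by (rule friedrichs_partial[OF \<phi> R])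
    also have "\<dots> \<le> 2 * R * (2 * R * h)" using d1 R(1) by (intro mult_left_mono) auto
    finally show ?thesis by (simp add: mult_ac)
  qed
  have s0: "square_integrable (\<lambda>x. (\<phi> x, 0, 0) :: jet)"
    by (rule sq[OF test_fields_Pair[OF \<phi> test_fields_Pair[OF test_fields_zero test_fields_zero]]])
  have sg: "square_integrable (\<lambda>x. (0, \<Sum>i\<in>UNIV. axis i (partial_deriv i \<phi> x), 0) :: jet)"
    unfolding sum_axis grad_def[symmetric]
    by (rule sq[OF test_fields_Pair[OF test_fields_zero test_fields_Pair[OF tg test_fields_zero]]])
  have sh: "square_integrable (\<lambda>x. (0, 0, hess \<phi> x) :: jet)"
    by (rule sq[OF test_fields_Pair[OF test_fields_zero test_fields_Pair[OF test_fields_zero th]]])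
  have sgi: "square_integrable (\<lambda>x. axis i (partial_deriv i \<phi> x) :: real^3)" for i
    by (rule sq[OF test_fields_linear_comp[OF bounded_linear_axis t1]])
  have eq: "abs_L2 (J \<phi>) = abs_L2 (\<lambda>x. (\<phi> x, 0, 0) :: jet) + abs_L2 (\<lambda>x. (0, \<Sum>i\<in>UNIV. axis i (partial_deriv i \<phi> x), 0) :: jet)
      + abs_L2 (\<lambda>x. (0, 0, hess \<phi> x) :: jet)"
    unfolding abs_add[OF s0 sg] abs_add[OF square_integrable_add[OF s0 sg] sh]
    by (rule arg_cong[where f=abs_L2]) (simp add: fun_eq_iff J_def sum_axis grad_def)
  have n0: "norm (abs_L2 (\<lambda>x. (\<phi> x, 0, 0) :: jet)) \<le> 4 * R * R * h"
    using norm_abs_le[OF sq[OF \<phi>] s0, of 1] d0 by (simp add: norm_Pair zero_prod_def[symmetric])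
  have nh: "norm (abs_L2 (\<lambda>x. (0, 0, hess \<phi> x) :: jet)) \<le> h"
    using norm_abs_le[OF sq[OF th] sh, of 1] by (simp add: norm_Pair h_def)
  have "norm (abs_L2 (\<lambda>x. (0, \<Sum>i\<in>UNIV. axis i (partial_deriv i \<phi> x), 0) :: jet)) \<le> norm (abs_L2 (\<lambda>x. \<Sum>i\<in>UNIV. axis i (partial_deriv i \<phi> x) :: real^3))"
    using norm_abs_le[OF square_integrable_sum[of UNIV "\<lambda>i x. axis i (partial_deriv i \<phi> x) :: real^3", OF sgi] sg, of 1]
    by (simp add: norm_Pair)
  also have "\<dots> = norm (\<Sum>i\<in>UNIV. abs_L2 (\<lambda>x. axis i (partial_deriv i \<phi> x) :: real^3))"
    by (subst abs_sum) (use sgi in auto)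
  also have "\<dots> \<le> (\<Sum>i\<in>UNIV. norm (abs_L2 (\<lambda>x. axis i (partial_deriv i \<phi> x) :: real^3)))" by (rule norm_sum)
  also have "\<dots> \<le> (\<Sum>i\<in>(UNIV::3 set). 2 * R * h)"
  proof (rule sum_mono)
    fix i :: 3
    have "norm (abs_L2 (\<lambda>x. axis i (partial_deriv i \<phi> x) :: real^3)) \<le> 1 * norm (abs_L2 (partial_deriv i \<phi>))"
      by (rule norm_abs_le[OF sq[OF t1] sgi]) (simp_all add: norm_axis)
    then show "norm (abs_L2 (\<lambda>x. axis i (partial_deriv i \<phi> x) :: real^3)) \<le> 2 * R * h" using d1[of i] by simp
  qed
  also have "\<dots> = 6 * R * h" by simp
  finally have ng: "norm (abs_L2 (\<lambda>x. (0, \<Sum>i\<in>UNIV. axis i (partial_deriv i \<phi> x), 0) :: jet)) \<le> 6 * R * h" .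
  have "norm (abs_L2 (J \<phi>)) \<le> 4 * R * R * h + 6 * R * h + h"
    unfolding eq by (intro order_trans[OF norm_triangle_ineq] add_mono n0 ng nh)
  then show ?thesis by (simp add: h_def algebra_simps)
qed

lemma friedrichs:
  assumes "bounded \<Omega>"
  obtains C where "0 < C" "\<And>w. w \<in> W \<Omega> \<Longrightarrow> norm w \<le> C * norm (jhess w)"
proof -
  obtain R where R: "0 < R" "\<forall>x\<in>\<Omega>. norm x \<le> R" using assms unfolding bounded_pos by blast
  define C where "C = 4 * R * R + 6 * R + 1"
  show ?thesis
  proof (rule that[of C])
    show "0 < C" using R(1) by (simp add: C_def add_pos_pos)
    fix w assume "w \<in> W \<Omega>"
    then obtain \<phi> where \<phi>: "\<And>n. \<phi> n \<in> test_fields \<Omega>" "(\<lambda>n. abs_L2 (J (\<phi> n))) \<longlonglongrightarrow> w"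
      by (rule W_sequence) (rule that)
    have b: "norm (abs_L2 (J (\<phi> n))) \<le> C * norm (jhess (abs_L2 (J (\<phi> n))))" for n
    proof -
      have z: "\<phi> n x = 0" if "R < norm x" for x
        by (rule test_fields_outside[OF \<phi>(1)]) (use R(2) that in force)
      show ?thesis unfolding j_J(3)[OF sq_J[OF \<phi>(1)]] C_def
        by (rule norm_J_le[OF test_fields_UNIV[OF \<phi>(1)] R(1) z])
    qed
    have l1: "(\<lambda>n. norm (abs_L2 (J (\<phi> n)))) \<longlonglongrightarrow> norm w" by (rule tendsto_norm[OF \<phi>(2)])
    have l2: "(\<lambda>n. C * norm (jhess (abs_L2 (J (\<phi> n))))) \<longlonglongrightarrow> C * norm (jhess w)"
      by (intro tendsto_mult tendsto_const tendsto_norm bounded_linear.tendsto[OF bounded_linear_j(3) \<phi>(2)])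
    show "norm w \<le> C * norm (jhess w)" by (rule LIMSEQ_le[OF l1 l2]) (use b in auto)
  qed
qed

text \<open>By Friedrichs' inequality \<open>jhess\<close> is bounded below on the complete space
  \<open>W \<Omega>\<close>, hence has complete image.\<close>

lemma closed_hess_range:
  assumes "bounded \<Omega>"
  shows "closed (jhess ` W \<Omega>)"
proof -
  obtain C where C: "0 < C" "\<And>w. w \<in> W \<Omega> \<Longrightarrow> norm w \<le> C * norm (jhess w)" by (rule friedrichs[OF assms]) (rule that)
  have "complete (jhess ` W \<Omega>)"
  proof (rule complete_isometric_image[where e="1 / C", OF _ subspace_W bounded_linear_j(3)])
    show "\<forall>x\<in>W \<Omega>. 1 / C * norm x \<le> norm (jhess x)" using C by (simp add: field_simps)
    show "complete (W \<Omega>)" using closed_W by (simp add: complete_eq_closed)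
  qed (use C in simp)
  then show ?thesis by (rule complete_imp_closed)
qed

subsection \<open>Potentials of curl free symmetric fields\<close>

text \<open>On a connected open set the gradient is constant first, and then so is \<open>u\<close>
  minus its linear part.\<close>

lemma hess_zero_connected:
  fixes u :: "real^3 \<Rightarrow> real"
  assumes u: "smooth u" and S: "open S" "connected S" and h: "\<And>x. x \<in> S \<Longrightarrow> hess u x = 0"
    and p: "p \<in> S" and x: "x \<in> S"
  shows "u x = u p + grad u p \<bullet> (x - p)"
proof -
  have g: "partial_deriv j u y = partial_deriv j u p" if y: "y \<in> S" for j y
  proof (rule has_derivative_zero_unique_connected[OF S _ y p])
    fix z assume z: "z \<in> S"
    have s: "smooth (partial_deriv j u)" by (rule smooth_partial_deriv[OF u])
    have "partial_deriv i (partial_deriv j u) z = 0" for i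
      using h[OF z] by (simp add: hess_def vec_eq_iff)
    then have "frechet_derivative (partial_deriv j u) (at z) = (\<lambda>v. 0)"
      using frechet_derivative_partial[OF smooth_differentiable[OF s]] by (simp add: fun_eq_iff)
    with smooth_fd[OF s, of z] show "(partial_deriv j u has_derivative (\<lambda>x. 0)) (at z)" by simp
  qed
  have "u x - grad u p \<bullet> x = u p - grad u p \<bullet> p"
  proof (rule has_derivative_zero_unique_connected[OF S _ x p])
    fix z assume z: "z \<in> S"
    have "frechet_derivative u (at z) = (\<lambda>v. grad u p \<bullet> v)"
      unfolding fun_eq_iff frechet_derivative_partial[OF smooth_differentiable[OF u]] g[OF z] grad_def inner_vec_def by (simp add: mult.commute)
    then have "(u has_derivative (\<lambda>v. grad u p \<bullet> v)) (at z)" using smooth_fd[OF u, of z] by simp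
    then show "((\<lambda>x. u x - grad u p \<bullet> x) has_derivative (\<lambda>x. 0)) (at z)"
      by (auto intro!: derivative_eq_intros)
  qed
  then show ?thesis by (simp add: inner_diff_right)
qed

text \<open>The density \<open>max 0 s\<close> is the fundamental solution of the second derivative
  on a line, so convolution with its image on the first axis integrates twice along that axis,
  starting from minus infinity.\<close>

lemma line_kernel: "kernel_integral lborel (\<lambda>s::real. s *\<^sub>R axis 1 1) (\<lambda>s. max 0 s)"
proof
  fix R
  have eq: "(\<lambda>y. indicator (cball 0 R) (y *\<^sub>R axis 1 1 :: real^3) * norm (max 0 y)) = (\<lambda>y. indicat_real {-R..R} y * norm (max 0 y))"
    by (auto simp: fun_eq_iff indicator_def norm_axis)
  have "integrable lborel (\<lambda>s. \<bar>R\<bar> * indicat_real {-R..R} s)"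
    by (intro integrable_mult_right integrable_real_indicator emeasure_bounded_finite) auto
  then show "integrable lborel (\<lambda>y. indicator (cball 0 R) (y *\<^sub>R axis 1 1 :: real^3) * norm (max 0 y))"
    unfolding eq by (rule Bochner_Integration.integrable_bound) (auto simp: indicator_def)
qed measurable

interpretation line_potential: kernel_integral lborel "\<lambda>s::real. s *\<^sub>R (axis 1 1 :: real^3)" "\<lambda>s. max 0 s"
  by (rule line_kernel)

lemma line_second_integral:
  fixes G :: "real^3 \<Rightarrow> real"
  assumes G: "G \<in> test_fields UNIV"
  shows "line_potential.kint (partial_deriv 1 (partial_deriv 1 G)) x = G x"
proof -
  obtain R where R: "0 < R" "\<And>x. R < norm x \<Longrightarrow> G x = 0" by (rule test_fields_ball[OF G]) (rule that)
  define e where "e = (axis 1 1 :: real^3)"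
  define M where "M = R + norm x + 1"
  note sG = test_fields_smooth[OF G]
  have far: "R < norm (x - s *\<^sub>R e)" if "M \<le> s" for s
  proof -
    have "s \<le> norm (s *\<^sub>R e)" by (simp add: e_def norm_axis)
    also have "\<dots> \<le> norm (x - s *\<^sub>R e) + norm x" using norm_triangle_sub[of "s *\<^sub>R e" x] by (simp add: norm_minus_commute)
    finally show ?thesis using that by (simp add: M_def)
  qed
  have z: "partial_deriv 1 G y = 0" "partial_deriv 1 (partial_deriv 1 G) y = 0" if "R < norm y" for y
  proof -
    have z1: "partial_deriv 1 G y = 0" if "y \<notin> cball 0 R" for y
      by (rule partial_deriv_outside[of "cball 0 R"]) (use that R in auto)
    then show "partial_deriv 1 G y = 0" using that by simp
    show "partial_deriv 1 (partial_deriv 1 G) y = 0"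
      by (rule partial_deriv_outside[of "cball 0 R", OF _ z1]) (use that in auto)
  qed
  have d: "((\<lambda>s. k (x - s *\<^sub>R e)) has_real_derivative - partial_deriv 1 k (x - s *\<^sub>R e)) (at s)" if "smooth k" for k :: "real^3 \<Rightarrow> real" and s
  proof -
    have "frechet_derivative k (at (x - s *\<^sub>R e)) (- e) = - partial_deriv 1 k (x - s *\<^sub>R e)"
      unfolding partial_deriv_def e_def
      by (rule linear_neg[OF linear_frechet_derivative[OF smooth_differentiable[OF that]]])
    then show ?thesis using line_derivative[OF that, of x "- e" s] by simp
  qed
  \<comment> \<open>A primitive of \<open>F'\<close> found by partial integration. At
    \<open>M\<close> everything vanishes because the point has left the support, and at 0 the value
    \<open>- G x\<close> remains.\<close>
  define F where "F s = s * (- partial_deriv 1 G (x - s *\<^sub>R e)) - G (x - s *\<^sub>R e)" for s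
  define F' where "F' s = s * partial_deriv 1 (partial_deriv 1 G) (x - s *\<^sub>R e)" for s
  have FD: "DERIV F s :> F' s" for s
    unfolding F_def F'_def
    by (rule DERIV_cong[OF DERIV_diff[OF DERIV_mult[OF DERIV_ident DERIV_minus[OF d[OF smooth_partial_deriv[OF sG]]]] d[OF sG]]]) simp
  have "continuous_on UNIV F'"
    unfolding F'_def
    by (intro continuous_intros continuous_on_compose2[OF smooth_continuous_on[OF smooth_partial_deriv[OF smooth_partial_deriv[OF sG]]]]) auto
  then have Fc: "isCont F' s" for s by (simp add: continuous_on_eq_continuous_at)
  have "line_potential.kint (partial_deriv 1 (partial_deriv 1 G)) x = (LINT s|lborel. F' s * indicator {0..M} s)"
    unfolding line_potential.kint_def unfolding e_def[symmetric]
  proof (rule Bochner_Integration.integral_cong[OF refl])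
    fix s
    show "partial_deriv 1 (partial_deriv 1 G) (x - s *\<^sub>R e) *\<^sub>R max 0 s = F' s * indicator {0..M} s"
      using z(2)[OF far, of s] by (auto simp: F'_def indicator_def max_def not_le)
  qed
  also have "\<dots> = F M - F 0"
    by (rule integral_FTC_Icc_real) (use R FD Fc in \<open>auto simp: M_def\<close>)
  also have "\<dots> = G x" using z(1)[OF far[OF order_refl]] R(2)[OF far[OF order_refl]] by (simp add: F_def)
  finally show ?thesis .
qed

text \<open>The potential is obtained from the single component \<open>T $ 1 $ 1\<close> by integrating it twice along
  the first axis.\<close>

lemma potential_exists:
  fixes T :: "real^3 \<Rightarrow> real^3^3"
  assumes T: "T \<in> test_fields UNIV" and R: "0 < R" "\<And>x. R < norm x \<Longrightarrow> T x = 0"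
    and sym: "\<And>x i j. T x $ i $ j = T x $ j $ i"
    and curl: "\<And>x i j l. partial_deriv l (\<lambda>x. T x $ i $ j) x = partial_deriv j (\<lambda>x. T x $ i $ l) x"
  obtains u where "u \<in> test_fields UNIV" "\<And>x. R < norm x \<Longrightarrow> u x = 0" "hess u = T"
proof -
  define t where "t i j = (\<lambda>x. T x $ i $ j)" for i j
  have tt: "t i j \<in> test_fields UNIV" for i j unfolding t_def by (rule test_fields_nth[OF test_fields_nth[OF T]])
  have sy: "t i j = t j i" for i j unfolding t_def using sym by (simp add: fun_eq_iff)
  have cu: "partial_deriv l (t i j) = partial_deriv j (t i l)" for i j l using curl by (simp add: fun_eq_iff t_def)
  define u where "u = line_potential.kint (t 1 1)"
  have su: "smooth u" unfolding u_def by (rule line_potential.smooth_kint[OF tt])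
  \<comment> \<open>Vanishing curl exchanges a derivative index with a column index, and symmetry
    brings the row index into column position; applying both twice moves \<open>i\<close> and
    \<open>j\<close> into the tensor.\<close>
  have key: "partial_deriv i (partial_deriv j (t 1 1)) = partial_deriv 1 (partial_deriv 1 (t i j))" for i j
  proof -
    have c: "partial_deriv i (partial_deriv 1 g) = partial_deriv 1 (partial_deriv i g)" if "smooth g" for i and g :: "real^3 \<Rightarrow> real"
      by (rule ext) (rule partial_deriv_commute[OF that])
    have "partial_deriv i (partial_deriv j (t 1 1)) = partial_deriv i (partial_deriv 1 (t 1 j))" by (simp only: cu[of j 1 1])
    also have "\<dots> = partial_deriv 1 (partial_deriv i (t j 1))" by (simp only: c[OF test_fields_smooth[OF tt]] sy[of 1 j])
    also have "\<dots> = partial_deriv 1 (partial_deriv 1 (t j i))" by (simp only: cu[of i j 1])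
    finally show ?thesis by (simp only: sy[of j i])
  qed
  have hu: "hess u = T"
  proof (rule ext)
    fix x
    have "partial_deriv i (partial_deriv j u) x = t i j x" for i j
      unfolding u_def line_potential.kint_partial_deriv[OF tt] line_potential.kint_partial_deriv[OF test_fields_partial_deriv[OF tt]] key
      by (rule line_second_integral[OF tt])
    then show "hess u x = T x" by (simp add: hess_def t_def vec_eq_iff)
  qed
  define S where "S = - cball (0::real^3) R"
  have oS: "open S" and cS: "connected S"
    unfolding S_def by (auto intro!: connected_complement_bounded_convex simp: open_Compl)
  define p where "p = - (R + 1) *\<^sub>R (axis 1 1 :: real^3)"
  have pS: "p \<in> S" using R(1) by (simp add: S_def p_def norm_axis)
  \<comment> \<open>Paths of integration ending in this half space never meet the support of
    \<open>T\<close>, so \<open>u\<close> vanishes there. Since \<open>u\<close> has zero Hessian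
    off the ball, whose complement is connected, the value and gradient at \<open>p\<close> force it
    to vanish off the whole ball.\<close>
  define H where "H = {x::real^3. x $ 1 < - R}"
  have oH: "open H" unfolding H_def by (rule open_halfspace_component_lt_cart)
  have uH: "u x = 0" if "x \<in> H" for x
  proof -
    have "t 1 1 (x - s *\<^sub>R axis 1 1) *\<^sub>R max 0 s = 0" for s
    proof (cases "s \<le> 0")
      case False
      then have "R < \<bar>(x - s *\<^sub>R axis 1 1) $ 1\<bar>" using that R(1) by (simp add: H_def)
      also have "\<dots> \<le> norm (x - s *\<^sub>R axis 1 1)" by (rule component_le_norm_cart)
      finally show ?thesis by (simp add: t_def R(2))
    qed (simp add: max_def)
    then have z: "(\<lambda>s. t 1 1 (x - s *\<^sub>R axis 1 1) *\<^sub>R max 0 s) = (\<lambda>s. 0)" by (rule ext)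
    show ?thesis unfolding u_def line_potential.kint_def z by simp
  qed
  have pH: "p \<in> H" using R(1) by (simp add: p_def H_def)
  have "partial_deriv i u p = 0" for i
    using partial_deriv_cong_open[OF oH pH, of u "\<lambda>x. 0" i] uH by simp
  then have gp: "grad u p = 0" by (simp add: grad_def vec_eq_iff)
  have uz: "u x = 0" if "R < norm x" for x
  proof -
    have "u x = u p + grad u p \<bullet> (x - p)"
      by (rule hess_zero_connected[OF su oS cS _ pS]) (use hu R that in \<open>auto simp: S_def\<close>)
    then show ?thesis using gp uH[OF pH] by simp
  qed
  show ?thesis
  proof (rule that[OF _ uz hu])
    show "u \<in> test_fields UNIV"
      by (rule test_fieldsI[OF su compact_cball[of 0 R]]) (use uz in auto)
  qed
qed

section \<open>Potentials of limits of symmetric test fields\<close>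

lemma mollifier_sequence:
  assumes "\<And>n::nat. 0 < r n"
  obtains k where "\<And>n. mollifier (r n) (k n)"
proof -
  have "\<exists>k. mollifier (r n) k" for n by (rule mollifier_exists[OF assms[of n]]) blast
  then show ?thesis using that by metis
qed

text \<open>Vanishing curl is used below as symmetry in the derivative and column indices; this
  bounds the defect of that symmetry by the norm of the curl, for every pair of indices.\<close>

lemma curl_component_le:
  "\<bar>partial_deriv l (\<lambda>y. v y $ j) x - partial_deriv j (\<lambda>y. v y $ l) x\<bar> \<le> norm (curl v x)"
proof -
  define c where "c = curl v x"
  have c: "c $ 1 = partial_deriv 2 (\<lambda>y. v y $ 3) x - partial_deriv 3 (\<lambda>y. v y $ 2) x"
    "c $ 2 = partial_deriv 3 (\<lambda>y. v y $ 1) x - partial_deriv 1 (\<lambda>y. v y $ 3) x"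
    "c $ 3 = partial_deriv 1 (\<lambda>y. v y $ 2) x - partial_deriv 2 (\<lambda>y. v y $ 1) x"
    unfolding c_def curl_def by (simp_all add: vector_3)
  have n: "\<bar>c $ m\<bar> \<le> norm c" for m by (rule component_le_norm_cart)
  show ?thesis
    using n[of 1] n[of 2] n[of 3] exhaust_3[of l] exhaust_3[of j]
    unfolding c_def[symmetric] c by (elim disjE) (simp_all add: abs_minus_commute)
qed

lemma test_fields_curl:
  assumes v: "v \<in> test_fields \<Omega>"
  shows "curl v \<in> test_fields \<Omega>"
proof -
  have d: "partial_deriv i (\<lambda>y. v y $ j) \<in> test_fields \<Omega>" for i j
    by (intro test_fields_partial_deriv test_fields_nth v)
  have "curl v = (\<lambda>x. axis 1 (partial_deriv 2 (\<lambda>y. v y $ 3) x - partial_deriv 3 (\<lambda>y. v y $ 2) x)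
     + (axis 2 (partial_deriv 3 (\<lambda>y. v y $ 1) x - partial_deriv 1 (\<lambda>y. v y $ 3) x)
     + axis 3 (partial_deriv 1 (\<lambda>y. v y $ 2) x - partial_deriv 2 (\<lambda>y. v y $ 1) x)))"
    by (simp add: fun_eq_iff vec_eq_iff forall_3 curl_def vector_3 axis_def)
  also have "\<dots> \<in> test_fields \<Omega>"
    by (intro test_fields_add test_fields_linear_comp[OF bounded_linear_axis] test_fields_diff d)
  finally show ?thesis .
qed

lemma test_fields_Curl: "T \<in> test_fields \<Omega> \<Longrightarrow> Curl T \<in> test_fields \<Omega>"
  unfolding Curl_def[abs_def] by (intro test_fields_vec test_fields_curl test_fields_nth)

lemma L2_limit_on:
  assumes "open \<Omega>" "\<And>n. \<Phi> n \<in> test_fields \<Omega>" "(\<lambda>n. abs_L2 (\<Phi> n)) \<longlonglongrightarrow> T"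
  shows "T \<in> L2_on \<Omega>"
proof (rule closed_sequentially[OF closed_L2_on _ assms(3)])
  show "\<Omega> \<in> sets borel" using assms(1) by auto
  fix n
  have "restr \<Omega> (\<Phi> n) \<in> L2_on \<Omega>"
    using assms(1) by (intro restr_L2_on test_fields_square_integrable[OF assms(2)]) auto
  then show "abs_L2 (\<Phi> n) \<in> L2_on \<Omega>" by (simp add: restr_test[OF assms(2)])
qed

text \<open>Symmetry and vanishing curl are exact for each mollified field, being pointwise limits
  of the corresponding relations for \<open>\<Phi> m\<close>. Each mollified field then has a
  potential, and closedness of the Hessian range on one fixed ball transfers this to
  \<open>T\<close>.\<close>

lemma curl_kernel_potential:
  assumes \<Omega>: "open \<Omega>" "bounded \<Omega>" and \<Phi>: "\<And>n. \<Phi> n \<in> test_fields \<Omega>" "\<And>n x. transpose (\<Phi> n x) = \<Phi> n x"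
    and T: "(\<lambda>n. abs_L2 (\<Phi> n)) \<longlonglongrightarrow> T" and C: "(\<lambda>n. abs_L2 (Curl (\<Phi> n))) \<longlonglongrightarrow> 0"
  obtains R w where "w \<in> W (ball 0 R)" "jhess w = T"
proof -
  obtain R where R: "0 < R" "\<forall>x\<in>\<Omega>. norm x \<le> R" using \<Omega>(2) unfolding bounded_pos by blast
  define r where "r n = inverse (real (Suc n))" for n
  have r: "0 < r n" "r n \<le> 1" for n unfolding r_def by (simp_all add: inverse_le_1_iff)
  obtain k where k: "\<And>n. mollifier (r n) (k n)" by (rule mollifier_sequence[OF r(1)]) (rule that)
  have "T \<in> closure (abs_L2 ` test_fields UNIV)"
    unfolding closure_sequential using T test_fields_UNIV[OF \<Phi>(1)] by (intro exI[of _ "\<lambda>n. abs_L2 (\<Phi> n)"]) auto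
  moreover have "r \<longlonglongrightarrow> 0" unfolding r_def[abs_def] by (rule LIMSEQ_inverse_real_of_nat)
  ultimately have lim: "(\<lambda>n. abs_L2 (conv (k n) T)) \<longlonglongrightarrow> T"
    by (rule mollify_tendsto[OF _ k less_imp_le[OF r(1)]])
  have Ton: "T \<in> L2_on \<Omega>" by (rule L2_limit_on[OF \<Omega>(1) \<Phi>(1) T])
  then have ae: "AE y in lborel. y \<in> \<Omega> \<or> rep_L2 T y = 0" unfolding L2_on_def by (auto simp: disj_commute)
  \<comment> \<open>Mollification of radius at most 1 enlarges the support to the closed ball of
    radius \<open>R + 1\<close>, which is compact in this open ball; the same ball serves all
    \<open>n\<close>.\<close>
  define B where "B = ball (0::real^3) (R + 2)"
  have "\<exists>u. u \<in> test_fields B \<and> hess u = conv (k n) T" for n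
  proof -
    note kt = mollifierD(1)[OF k[of n]]
    have z: "conv (k n) T x = 0" if "R + 1 < norm x" for x
    proof (rule conv_zero[OF ae])
      fix y assume "y \<in> \<Omega>"
      then have "norm y \<le> R" using R(2) by blast
      then have "r n < norm (x - y)" using that norm_triangle_sub[of x y] r(2)[of n] by simp
      then show "k n (x - y) = 0" by (rule mollifierD(4)[OF k])
    qed
    have tc: "conv (k n) T \<in> test_fields UNIV"
      by (rule test_fieldsI[OF smooth_conv[OF kt] compact_cball[of 0 "R + 1"]]) (use z in auto)
    define L where "L i j = (\<lambda>v::real^3^3. v $ i $ j)" for i j
    have L: "bounded_linear (L i j)" for i j
      unfolding L_def by (intro bounded_linear_compose[OF bounded_linear_vec_nth bounded_linear_vec_nth])
    define p where "p m i j = (\<lambda>x. \<Phi> m x $ i $ j)" for m i j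
    have tp: "p m i j \<in> test_fields \<Omega>" for m i j unfolding p_def by (intro test_fields_nth \<Phi>(1))
    note tpU = test_fields_UNIV[OF tp]
    have limp: "(\<lambda>m. abs_L2 (p m i j)) \<longlonglongrightarrow> pw (\<lambda>x. L i j) T" for i j
    proof -
      have "pw (\<lambda>x. L i j) (abs_L2 (\<Phi> m)) = abs_L2 (p m i j)" for m
        using pw_abs[OF pw_bounded_linear[OF L[of i j]] test_fields_square_integrable[OF \<Phi>(1)[of m]]]
        by (simp add: L_def[abs_def] p_def)
      then show ?thesis
        using bounded_linear.tendsto[OF bounded_linear_pw[OF pw_bounded_linear[OF L]] T, of i j] by simp
    qed
    have comp: "(\<lambda>x. conv (k n) T x $ i $ j) = conv (k n) (pw (\<lambda>x. L i j) T)" for i j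
    proof (rule ext)
      fix x show "conv (k n) T x $ i $ j = conv (k n) (pw (\<lambda>x. L i j) T) x"
        unfolding conv_linear[OF kt L] by (simp add: L_def)
    qed
    have symT: "pw (\<lambda>x. L i j) T = pw (\<lambda>x. L j i) T" for i j
    proof (rule LIMSEQ_unique[OF limp])
      have "p m j i = p m i j" for m
      proof (rule ext)
        fix x show "p m j i x = p m i j x"
          using arg_cong[OF \<Phi>(2)[of m x], of "\<lambda>v. v $ i $ j"] by (simp add: p_def transpose_def)
      qed
      then show "(\<lambda>m. abs_L2 (p m i j)) \<longlonglongrightarrow> pw (\<lambda>x. L j i) T" using limp[of j i] by simp
    qed
    \<comment> \<open>The derivative is moved to the kernel before passing to the limit, since
      derivatives of \<open>\<Phi> m\<close> need not converge one by one; only the differences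
      forming the curl do.\<close>
    have dlim: "(\<lambda>m. conv (k n) (abs_L2 (partial_deriv l (p m i j))) x) \<longlonglongrightarrow> partial_deriv l (\<lambda>x. conv (k n) T x $ i $ j) x" for l i j x
      unfolding comp conv_partial_deriv[OF kt] conv_test_partial_deriv[OF kt tpU, symmetric]
      by (rule conv_tendsto[OF test_fields_partial_deriv[OF kt] limp])
    have cl: "partial_deriv l (\<lambda>x. conv (k n) T x $ i $ j) x = partial_deriv j (\<lambda>x. conv (k n) T x $ i $ l) x" for l i j x
    proof -
      define D where "D m = (\<lambda>x. partial_deriv l (p m i j) x - partial_deriv j (p m i l) x)" for m
      note sq1 = test_fields_square_integrable[OF test_fields_partial_deriv[OF tp]]
      have sD: "square_integrable (D m)" for m unfolding D_def by (rule square_integrable_diff[OF sq1 sq1])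
      have tC: "Curl (\<Phi> m) \<in> test_fields \<Omega>" for m by (rule test_fields_Curl[OF \<Phi>(1)])
      have Db: "norm (abs_L2 (D m)) \<le> norm (abs_L2 (Curl (\<Phi> m)))" for m
      proof -
        have "norm (D m x) \<le> 1 * norm (Curl (\<Phi> m) x)" for x
        proof -
          have "norm (D m x) \<le> norm (curl (\<lambda>y. \<Phi> m y $ i) x)"
            unfolding D_def p_def real_norm_def by (rule curl_component_le)
          also have "\<dots> = norm (Curl (\<Phi> m) x $ i)" by (simp add: Curl_def)
          also have "\<dots> \<le> norm (Curl (\<Phi> m) x)" by (rule Finite_Cartesian_Product.norm_nth_le)
          finally show ?thesis by simp
        qed
        from norm_abs_le[OF test_fields_square_integrable[OF tC] sD this] show ?thesis by simp
      qed
      have "(\<lambda>m. abs_L2 (D m)) \<longlonglongrightarrow> 0"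
        by (rule Lim_null_comparison[OF always_eventually tendsto_norm_zero[OF C]]) (simp add: Db)
      then have "(\<lambda>m. conv (k n) (abs_L2 (D m)) x) \<longlonglongrightarrow> conv (k n) 0 x" by (rule conv_tendsto[OF kt])
      moreover have "conv (k n) (0 :: real L2) x = 0"
        using conv_diff[OF kt, of "0 :: real L2" 0 x] by simp
      moreover have "conv (k n) (abs_L2 (D m)) x = conv (k n) (abs_L2 (partial_deriv l (p m i j))) x - conv (k n) (abs_L2 (partial_deriv j (p m i l))) x" for m
        unfolding conv_diff[OF kt, symmetric] abs_diff[OF sq1 sq1] D_def ..
      ultimately have "(\<lambda>m. conv (k n) (abs_L2 (partial_deriv l (p m i j))) x - conv (k n) (abs_L2 (partial_deriv j (p m i l))) x) \<longlonglongrightarrow> 0"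
        by simp
      from LIMSEQ_unique[OF this tendsto_diff[OF dlim dlim]] show ?thesis by simp
    qed
    have "0 < R + 1" using R(1) by simp
    moreover have "conv (k n) T x $ i $ j = conv (k n) T x $ j $ i" for x i j
      using comp[of i j] comp[of j i] symT[of i j] by (metis)
    ultimately obtain u where u: "u \<in> test_fields UNIV" "\<And>x. R + 1 < norm x \<Longrightarrow> u x = 0" "hess u = conv (k n) T"
      using potential_exists[OF tc _ z _ cl] by blast
    have "u \<in> test_fields B"
      by (rule test_fieldsI[OF test_fields_smooth[OF u(1)] compact_cball[of 0 "R + 1"]]) (use u(2) in \<open>auto simp: B_def\<close>)
    then show ?thesis using u(3) by blast
  qed
  then obtain u where u: "\<And>n. u n \<in> test_fields B" "\<And>n. hess (u n) = conv (k n) T" by metis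
  have "T \<in> jhess ` W B"
  proof (rule closed_sequentially[OF closed_hess_range _ lim])
    show "bounded B" by (simp add: B_def)
    show "abs_L2 (conv (k n) T) \<in> jhess ` W B" for n
    proof -
      have "abs_L2 (conv (k n) T) = jhess (abs_L2 (J (u n)))" unfolding j_J(3)[OF sq_J[OF u(1)]] u(2) ..
      then show ?thesis using W_J[OF u(1), of n] by simp
    qed
  qed
  then show ?thesis using that unfolding B_def by blast
qed

subsection \<open>Jets with vanishing second order part\<close>

text \<open>The total mass 1 reproduces the constant part, and evenness of the kernel kills its
  first moments.\<close>

lemma affine_reproduced:
  assumes m: "mollifier d k" and ev: "\<And>z. k (- z) = k z" and v: "square_integrable v"
    and a: "\<And>y. norm (x - y) \<le> d \<Longrightarrow> v y = c + b \<bullet> (y - x)"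
  shows "conv k (abs_L2 v) x = c"
proof -
  note k = mollifierD(1)[OF m]
  have [measurable]: "k \<in> borel_measurable borel" by (rule test_fields_measurable[OF k])
  have sb: "smooth (\<lambda>z. b \<bullet> z)" by (rule smooth_linear[OF bounded_linear_inner_right])
  have ib: "integrable lborel (\<lambda>z. b \<bullet> z * k z)" by (rule test_fields_integrable[OF test_fields_smooth_mult[OF sb k]])
  have "(LINT z|lborel. b \<bullet> (0 - z) * k (0 - z)) = (LINT z|lborel. b \<bullet> z * k z)"
    by (rule integral_reflect[where f="\<lambda>z. b \<bullet> z * k z"]) measurable
  then have z: "(LINT z|lborel. b \<bullet> z * k z) = 0" by (simp add: ev)
  have "conv k (abs_L2 v) x = (LINT y|lborel. k (x - y) * v y)" using conv_abs[OF k v] by simp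
  also have "\<dots> = (LINT y|lborel. c * k (x - y) - b \<bullet> (x - y) * k (x - y))"
  proof (rule Bochner_Integration.integral_cong[OF refl])
    fix y
    show "k (x - y) * v y = c * k (x - y) - b \<bullet> (x - y) * k (x - y)"
    proof (cases "d < norm (x - y)")
      case True then show ?thesis by (simp add: mollifierD(4)[OF m])
    next
      case False
      then have vy: "v y = c - b \<bullet> (x - y)" using a[of y] by (simp add: inner_diff_right)
      show ?thesis unfolding vy by (simp only: right_diff_distrib mult.commute)
    qed
  qed
  also have "\<dots> = (LINT z|lborel. c * k z - b \<bullet> z * k z)"
    by (rule integral_reflect[where f="\<lambda>z. c * k z - b \<bullet> z * k z"]) measurable
  also have "\<dots> = c" using ib test_fields_integrable[OF k] z mollifierD(3)[OF m] by simp
  finally show ?thesis .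
qed

text \<open>Mollifications of radius at most \<open>d\<close> are smooth with zero Hessian on the
  ball of radius \<open>3 * d\<close>, hence affine there, and one fixed even mollifier of radius
  \<open>d\<close> reproduces them on the ball of radius \<open>d\<close>. In the limit
  \<open>u\<close> agrees almost everywhere on that ball with its own mollification, which is
  affine.\<close>

lemma hess_zero_locally_affine:
  assumes w: "w \<in> W UNIV" and d: "0 < d"
    and h: "AE x in lborel. x \<in> ball x0 (4 * d) \<longrightarrow> rep_L2 (jhess w) x = 0"
  shows "\<exists>a b. AE x in lborel. x \<in> ball x0 d \<longrightarrow> rep_L2 (jfun w) x = a + b \<bullet> x"
proof -
  define u where "u = jfun w"
  have hz: "hess (conv k u) x = 0" if k: "mollifier r k" and r: "r \<le> d" and x: "x \<in> ball x0 (3 * d)" for k r x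
  proof -
    note kt = mollifierD(1)[OF k]
    have "hess (conv k u) x = snd (snd (conv k w x))" unfolding conv_W[OF w kt] u_def J_def by simp
    also have "\<dots> = conv k (jhess w) x" unfolding jhess_def by (rule conv_linear[OF kt bl_jet(3), symmetric])
    also have "\<dots> = 0"
    proof (rule conv_zero[where K="- ball x0 (4 * d)"])
      show "AE y in lborel. y \<in> - ball x0 (4 * d) \<or> rep_L2 (jhess w) y = 0" using h by eventually_elim auto
      fix y assume y: "y \<in> - ball x0 (4 * d)"
      have "r < norm (x - y)"
        using y x r dist_triangle[of x0 y x] by (simp add: dist_norm)
      then show "k (x - y) = 0" by (rule mollifierD(4)[OF k])
    qed
    finally show ?thesis .
  qed
  have aff: "conv k u y = conv k u x + grad (conv k u) x \<bullet> (y - x)"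
    if "mollifier r k" "r \<le> d" "x \<in> ball x0 (3 * d)" "y \<in> ball x0 (3 * d)" for k r x y
    by (rule hess_zero_connected[OF smooth_conv[OF mollifierD(1)[OF that(1)]] open_ball connected_ball hz[OF that(1,2)] that(3,4)])
  obtain k where k: "mollifier d k" "\<And>z. k (- z) = k z" by (rule mollifier_exists[OF d]) (rule that)
  note kt = mollifierD(1)[OF k(1)]
  define r where "r n = d * inverse (real (Suc n))" for n
  have r: "0 < r n" "r n \<le> d" for n unfolding r_def using d by (simp_all add: field_simps)
  obtain kn where kn: "\<And>n. mollifier (r n) (kn n)" by (rule mollifier_sequence[OF r(1)]) (rule that)
  have r0: "r \<longlonglongrightarrow> 0"
    using tendsto_mult[OF tendsto_const[of d] LIMSEQ_inverse_real_of_nat] by (simp add: r_def[abs_def])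
  have ucl: "u \<in> closure (abs_L2 ` test_fields UNIV)"
  proof -
    obtain \<phi> where \<phi>: "\<And>n. \<phi> n \<in> test_fields UNIV" "(\<lambda>n. abs_L2 (J (\<phi> n))) \<longlonglongrightarrow> w" by (rule W_sequence[OF w]) (rule that)
    have "(\<lambda>n. abs_L2 (\<phi> n)) \<longlonglongrightarrow> u"
      using bounded_linear.tendsto[OF bounded_linear_j(1) \<phi>(2)] by (simp add: j_J[OF sq_J[OF \<phi>(1)]] u_def)
    then show ?thesis unfolding closure_sequential using \<phi>(1) by (intro exI[of _ "\<lambda>n. abs_L2 (\<phi> n)"]) auto
  qed
  have lim: "(\<lambda>n. abs_L2 (conv (kn n) u)) \<longlonglongrightarrow> u"
    by (rule mollify_tendsto[OF ucl kn less_imp_le[OF r(1)] r0])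
  note sqn = conv_square_integrable(1)[OF kn]
  note sqk = conv_square_integrable(1)[OF k(1)]
  define A :: "real^3 \<Rightarrow> real \<Rightarrow> real" where "A x v = indicator (ball x0 d) x *\<^sub>R v" for x v
  have A: "pw_bounded A" unfolding A_def[abs_def] by (rule pw_bounded_indicator) auto
  have blA: "bounded_linear (pw A)" by (rule bounded_linear_pw[OF A])
  \<comment> \<open>Truncation to the small ball turns the local reproduction identity into an
    identity in \<open>L2\<close>, whose two sides are continuous in the inner
    mollification.\<close>
  have eqn: "pw A (abs_L2 (conv (kn n) u)) = pw A (abs_L2 (conv k (abs_L2 (conv (kn n) u))))" for n
  proof -
    have "A x (conv (kn n) u x) = A x (conv k (abs_L2 (conv (kn n) u)) x)" for x
    proof (cases "x \<in> ball x0 d")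
      case True
      have x3: "x \<in> ball x0 (3 * d)" using True d by auto
      have "conv k (abs_L2 (conv (kn n) u)) x = conv (kn n) u x"
      proof (rule affine_reproduced[OF k sqn])
        fix y assume "norm (x - y) \<le> d"
        then have "y \<in> ball x0 (3 * d)" using True d dist_triangle[of x0 y x] by (simp add: dist_norm)
        then show "conv (kn n) u y = conv (kn n) u x + grad (conv (kn n) u) x \<bullet> (y - x)"
          by (rule aff[OF kn r(2) x3])
      qed
      then show ?thesis by simp
    qed (simp add: A_def)
    then show ?thesis unfolding pw_abs[OF A sqn] pw_abs[OF A sqk] by simp
  qed
  have "(\<lambda>n. abs_L2 (conv k (abs_L2 (conv (kn n) u)))) \<longlonglongrightarrow> abs_L2 (conv k u)"
  proof -
    have "(\<lambda>n. abs_L2 (conv k (abs_L2 (conv (kn n) u))) - abs_L2 (conv k u)) \<longlonglongrightarrow> 0"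
    proof (rule Lim_null_comparison[OF always_eventually])
      show "\<forall>n. norm (abs_L2 (conv k (abs_L2 (conv (kn n) u))) - abs_L2 (conv k u)) \<le> norm (abs_L2 (conv (kn n) u) - u)"
        unfolding abs_diff[OF sqk sqk] conv_diff[OF kt, symmetric] by (rule allI) (rule conv_square_integrable(2)[OF k(1)])
      show "(\<lambda>n. norm (abs_L2 (conv (kn n) u) - u)) \<longlonglongrightarrow> 0"
        using lim by (intro tendsto_norm_zero) (simp add: LIM_zero_iff)
    qed
    then show ?thesis by (simp add: LIM_zero_iff)
  qed
  from bounded_linear.tendsto[OF blA this] have "(\<lambda>n. pw A (abs_L2 (conv (kn n) u))) \<longlonglongrightarrow> pw A (abs_L2 (conv k u))"
    unfolding eqn .
  then have "pw A u = pw A (abs_L2 (conv k u))"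
    using LIMSEQ_unique[OF bounded_linear.tendsto[OF blA lim]] by blast
  then have "AE x in lborel. rep_L2 (pw A u) x = rep_L2 (pw A (abs_L2 (conv k u))) x" by simp
  moreover note rep_pw[OF A, of u] rep_pw[OF A, of "abs_L2 (conv k u)"] rep_abs[OF sqk, of u]
  ultimately have "AE x in lborel. x \<in> ball x0 d \<longrightarrow> rep_L2 u x = (conv k u x0 - grad (conv k u) x0 \<bullet> x0) + grad (conv k u) x0 \<bullet> x"
  proof eventually_elim
    case (elim x)
    show ?case
    proof
      assume x: "x \<in> ball x0 d"
      then have "rep_L2 u x = conv k u x" using elim by (simp add: A_def)
      also have "\<dots> = conv k u x0 + grad (conv k u) x0 \<bullet> (x - x0)"
        by (rule aff[OF k(1) order_refl]) (use x d in auto)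
      finally show "rep_L2 u x = (conv k u x0 - grad (conv k u) x0 \<bullet> x0) + grad (conv k u) x0 \<bullet> x"
        by (simp add: inner_diff_right)
    qed
  qed
  then show ?thesis unfolding u_def by blast
qed

text \<open>The points of \<open>S\<close> where the function is nonzero form an open null set,
  hence there are none; a small step along \<open>b\<close> then detects the slope.\<close>

lemma affine_zero_open:
  fixes b :: "real^3"
  assumes S: "open S" "S \<noteq> {}" and z: "AE x in lborel. x \<in> S \<longrightarrow> a + b \<bullet> x = 0"
  shows "a = 0 \<and> b = 0"
proof -
  define N where "N = S \<inter> {x. a + b \<bullet> x \<noteq> 0}"
  have oN: "open N" unfolding N_def using S(1)
    by (intro open_Int open_Collect_neq continuous_intros)
  have "AE x in lborel. x \<notin> N" using z by eventually_elim (auto simp: N_def)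
  then have "N \<in> null_sets lborel" using oN by (subst AE_iff_null_sets) auto
  then have "negligible N" unfolding negligible_iff_null_sets by (rule null_sets_completionI)
  then have "N = {}" using open_not_negligible[OF oN] by blast
  then have z': "a + b \<bullet> x = 0" if "x \<in> S" for x using that by (auto simp: N_def)
  obtain x where x: "x \<in> S" using S(2) by blast
  obtain e where e: "0 < e" "cball x e \<subseteq> S" using S(1) x open_contains_cball by blast
  define t where "t = e / (norm b + 1)"
  have t: "0 < t" using e by (simp add: t_def add_nonneg_pos)
  have "norm (t *\<^sub>R b) \<le> e"
  proof -
    have "norm (t *\<^sub>R b) = t * norm b" using t by simp
    also have "\<dots> = e * (norm b / (norm b + 1))" by (simp add: t_def)
    also have "\<dots> \<le> e * 1" using e by (intro mult_left_mono) (auto simp: add_nonneg_pos)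
    finally show ?thesis by simp
  qed
  then have "x + t *\<^sub>R b \<in> S" using e(2) by (auto simp: dist_norm)
  moreover have "b \<bullet> (x + t *\<^sub>R b) = b \<bullet> x + t * (b \<bullet> b)" by (simp add: inner_add_right)
  ultimately have "t * (b \<bullet> b) = 0" using z'[of "x + t *\<^sub>R b"] z'[OF x] by linarith
  then have "b = 0" using t by simp
  then show ?thesis using z'[OF x] by simp
qed

text \<open>The coefficients of the local affine representations are unique, so they form a locally
  constant function on \<open>U\<close>, which is constant by connectedness.\<close>

lemma hess_zero_affine:
  assumes w: "w \<in> W UNIV" and U: "open U" "connected U"
    and h: "AE x in lborel. x \<in> U \<longrightarrow> rep_L2 (jhess w) x = 0"
  shows "\<exists>a b. AE x in lborel. x \<in> U \<longrightarrow> rep_L2 (jfun w) x = a + b \<bullet> x"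
proof (cases "U = {}")
  case False
  then obtain x1 where x1: "x1 \<in> U" by blast
  define P where "P q x \<longleftrightarrow> (\<exists>r>0. AE y in lborel. y \<in> ball x r \<longrightarrow> rep_L2 (jfun w) y = fst q + snd q \<bullet> y)" for q x
  have ex: "\<exists>q. P q x" if x: "x \<in> U" for x
  proof -
    obtain e where e: "0 < e" "ball x e \<subseteq> U" using U(1) x open_contains_ball by blast
    have "AE y in lborel. y \<in> ball x (4 * (e/4)) \<longrightarrow> rep_L2 (jhess w) y = 0"
      using h by eventually_elim (use e in auto)
    from hess_zero_locally_affine[OF w _ this] e obtain a b where
      "AE y in lborel. y \<in> ball x (e/4) \<longrightarrow> rep_L2 (jfun w) y = a + b \<bullet> y" by auto
    then have "P (a, b) x" unfolding P_def using e by (intro exI[of _ "e/4"]) auto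
    then show ?thesis ..
  qed
  have uniq: "q = q'" if q: "P q x" "P q' x" for q q' x
  proof -
    obtain r r' where r: "r > 0" "AE y in lborel. y \<in> ball x r \<longrightarrow> rep_L2 (jfun w) y = fst q + snd q \<bullet> y"
      and r': "r' > 0" "AE y in lborel. y \<in> ball x r' \<longrightarrow> rep_L2 (jfun w) y = fst q' + snd q' \<bullet> y"
      using q unfolding P_def by blast
    have "AE y in lborel. y \<in> ball x r \<inter> ball x r' \<longrightarrow> (fst q - fst q') + (snd q - snd q') \<bullet> y = 0"
      using r(2) r'(2) by eventually_elim (auto simp: inner_diff_left)
    moreover have "x \<in> ball x r \<inter> ball x r'" using r(1) r'(1) by simp
    then have "ball x r \<inter> ball x r' \<noteq> {}" by blast
    ultimately have "fst q - fst q' = 0 \<and> snd q - snd q' = 0"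
      by (intro affine_zero_open[OF open_Int[OF open_ball open_ball]])
    then show ?thesis by (simp add: prod_eq_iff)
  qed
  define Q where "Q x = (SOME q. P q x)" for x
  have PQ: "P (Q x) x" if "x \<in> U" for x unfolding Q_def by (rule someI_ex[OF ex[OF that]])
  have const: "Q x = Q x1" if x: "x \<in> U" for x
  proof (rule connected_local_const[OF U(2) x x1], rule ballI)
    fix y assume y: "y \<in> U"
    obtain r where r: "r > 0" "AE z in lborel. z \<in> ball y r \<longrightarrow> rep_L2 (jfun w) z = fst (Q y) + snd (Q y) \<bullet> z"
      using PQ[OF y] unfolding P_def by blast
    have "Q y = Q z" if z: "z \<in> ball y r" "z \<in> U" for z
    proof (rule uniq[OF _ PQ[OF z(2)]])
      obtain s where s: "s > 0" "ball z s \<subseteq> ball y r" using z(1) open_contains_ball open_ball by blast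
      have "AE x in lborel. x \<in> ball z s \<longrightarrow> rep_L2 (jfun w) x = fst (Q y) + snd (Q y) \<bullet> x"
        using r(2) by eventually_elim (use s(2) in auto)
      then show "P (Q y) z" unfolding P_def using s(1) by blast
    qed
    then show "\<forall>\<^sub>F z in at y within U. Q y = Q z"
      unfolding eventually_at using r(1) by (intro exI[of _ r]) (auto simp: dist_commute)
  qed
  have "AE x in lborel. x \<in> U \<longrightarrow> rep_L2 (jfun w) x = fst (Q x1) + snd (Q x1) \<bullet> x"
  proof (rule AE_locally)
    fix x assume x: "x \<in> U"
    from PQ[OF x] const[OF x] obtain r where "r > 0" "AE y in lborel. y \<in> ball x r \<longrightarrow> rep_L2 (jfun w) y = fst (Q x1) + snd (Q x1) \<bullet> y"
      unfolding P_def by auto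
    then show "\<exists>N. open N \<and> x \<in> N \<and> (AE y in lborel. y \<in> N \<longrightarrow> rep_L2 (jfun w) y = fst (Q x1) + snd (Q x1) \<bullet> y)"
      by (intro exI[of _ "ball x r"]) auto
  qed
  then show ?thesis by blast
qed simp

subsection \<open>Jets vanishing outside a set that can be pushed into the domain\<close>

text \<open>Translating the kernel translates the mollified function, so pushing and smoothing
  happen in a single convolution, to which the convergence result for mollifiers applies
  directly.\<close>

lemma mollifier_shift:
  assumes m: "mollifier r k"
  shows "mollifier (r + norm a) (\<lambda>x. k (a + x))"
  unfolding mollifier_def
proof (intro conjI allI impI)
  note k = mollifierD(1)[OF m]
  have sm: "smooth (\<lambda>x. k (a + x))"
    by (rule smooth_affine[where L''="\<lambda>x. x" and f=k and a=a, OF bounded_linear_ident test_fields_smooth[OF k]])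
  show z: "k (a + x) = 0" if "r + norm a < norm x" for x
  proof (rule mollifierD(4)[OF m])
    show "r < norm (a + x)" using that norm_triangle_sub[of x "- a"] by (simp add: add.commute)
  qed
  show "(\<lambda>x. k (a + x)) \<in> test_fields UNIV"
    by (rule test_fieldsI[OF sm compact_cball[of 0 "r + norm a"]]) (use z in auto)
  show "0 \<le> k (a + x)" for x by (rule mollifierD(2)[OF m])
  have "(LINT x|distr lborel borel ((+) a). k x) = (LINT x|lborel. k (a + x))"
    by (rule integral_distr) (use test_fields_measurable[OF k] in auto)
  then show "(LINT x|lborel. k (a + x)) = 1" by (simp add: lborel_distr_plus mollifierD(3)[OF m])
qed

text \<open>Convolution with the shifted kernel moves the support to a neighbourhood of
  \<open>K - t d\<close>, a compact subset of \<Omega>, so the result is the jet of a test function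
  in \<Omega>; these converge to \<open>w\<close> as shift and radius tend to zero.\<close>

lemma W_push_inside:
  assumes w: "w \<in> W UNIV" and \<Omega>: "open \<Omega>" and K: "compact K"
    and ae: "AE y in lborel. y \<in> K \<or> rep_L2 (jfun w) y = 0"
    and t0: "0 < t0" and push: "\<And>t y. 0 < t \<Longrightarrow> t < t0 \<Longrightarrow> y \<in> K \<Longrightarrow> y - t *\<^sub>R d \<in> \<Omega>"
  shows "w \<in> W \<Omega>"
proof -
  \<comment> \<open>The double \<open>Suc\<close> keeps the shift strictly below \<open>t0\<close>
    already at \<open>n = 0\<close>.\<close>
  define t where "t n = t0 * inverse (real (Suc (Suc n)))" for n
  have t: "0 < t n" "t n < t0" for n
  proof -
    show "0 < t n" unfolding t_def using t0 by simp
    have "inverse (real (Suc (Suc n))) < 1" by (simp add: inverse_less_1_iff)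
    from mult_strict_left_mono[OF this t0] show "t n < t0" by (simp add: t_def)
  qed
  have t_lim: "t \<longlonglongrightarrow> 0"
    using tendsto_mult[OF tendsto_const[of t0] LIMSEQ_Suc[OF LIMSEQ_inverse_real_of_nat]] by (simp add: t_def[abs_def])
  define Kt where "Kt n = (\<lambda>y. y - t n *\<^sub>R d) ` K" for n
  have cK: "compact (Kt n)" for n unfolding Kt_def by (intro compact_continuous_image K continuous_intros)
  have KO: "Kt n \<subseteq> \<Omega>" for n unfolding Kt_def using push[OF t] by auto
  \<comment> \<open>The mollification radius is chosen after the shift, small enough for the shifted
    compact set to keep its distance from the complement of \<Omega>.\<close>
  have "\<exists>e. 0 < e \<and> e \<le> inverse (real (Suc n)) \<and> (\<forall>x\<in>Kt n. cball x e \<subseteq> \<Omega>)" for n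
  proof -
    obtain e where e: "0 < e" "(\<Union>x\<in>Kt n. cball x e) \<subseteq> \<Omega>"
      by (rule compact_subset_open_imp_cball_epsilon_subset[OF cK \<Omega> KO]) (rule that)
    have "cball x (min e (inverse (real (Suc n)))) \<subseteq> \<Omega>" if "x \<in> Kt n" for x using e(2) that by force
    then show ?thesis using e(1) by (intro exI[of _ "min e (inverse (real (Suc n)))"]) auto
  qed
  then obtain e where e: "\<And>n. 0 < e n" "\<And>n. e n \<le> inverse (real (Suc n))" "\<And>n x. x \<in> Kt n \<Longrightarrow> cball x (e n) \<subseteq> \<Omega>" by metis
  obtain k where k: "\<And>n. mollifier (e n) (k n)" by (rule mollifier_sequence[OF e(1)]) (rule that)
  define l where "l n = (\<lambda>x. k n (t n *\<^sub>R d + x))" for n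
  define r where "r n = e n + norm (t n *\<^sub>R d)" for n
  have l: "mollifier (r n) (l n)" for n unfolding l_def r_def by (rule mollifier_shift[OF k])
  have r: "0 \<le> r n" for n using e(1)[of n] by (simp add: r_def)
  have rl: "r \<longlonglongrightarrow> 0"
  proof -
    have "e \<longlonglongrightarrow> 0"
      by (rule tendsto_sandwich[OF always_eventually[OF allI[OF less_imp_le[OF e(1)]]]
            always_eventually[OF allI[OF e(2)]] tendsto_const LIMSEQ_inverse_real_of_nat])
    moreover have "(\<lambda>n. norm (t n *\<^sub>R d)) \<longlonglongrightarrow> norm (0 *\<^sub>R d)" by (intro tendsto_intros t_lim)
    ultimately show ?thesis using tendsto_add[of e 0 sequentially "\<lambda>n. norm (t n *\<^sub>R d)" 0] by (simp add: r_def[abs_def])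
  qed
  have lim: "(\<lambda>n. abs_L2 (conv (l n) w)) \<longlonglongrightarrow> w"
    by (rule mollify_tendsto[OF W_mollify_closure[OF w] l r rl])
  have "abs_L2 (conv (l n) w) \<in> W \<Omega>" for n
  proof -
    note lt = mollifierD(1)[OF l[of n]]
    define S where "S = {x + y |x y. x \<in> Kt n \<and> y \<in> cball 0 (e n)}"
    have cS: "compact S" unfolding S_def by (rule compact_sums[OF cK compact_cball])
    have SO: "S \<subseteq> \<Omega>"
    proof
      fix z assume "z \<in> S"
      then obtain x y where xy: "z = x + y" "x \<in> Kt n" "norm y \<le> e n" by (auto simp: S_def)
      then have "z \<in> cball x (e n)" by (simp add: dist_norm)
      then show "z \<in> \<Omega>" using e(3)[OF xy(2)] by blast
    qed
    have "conv (l n) (jfun w) \<in> test_fields \<Omega>"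
    proof (rule test_fieldsI[OF smooth_conv[OF lt] cS SO])
      fix x assume x: "x \<notin> S"
      show "conv (l n) (jfun w) x = 0"
      proof (rule conv_zero[OF ae])
        fix y assume y: "y \<in> K"
        have "e n < norm (t n *\<^sub>R d + (x - y))"
        proof (rule ccontr)
          assume "\<not> ?thesis"
          then have "x \<in> S" unfolding S_def Kt_def using y
            by (intro CollectI exI[of _ "y - t n *\<^sub>R d"] exI[of _ "t n *\<^sub>R d + (x - y)"]) auto
          then show False using x by simp
        qed
        then show "l n (x - y) = 0" unfolding l_def by (rule mollifierD(4)[OF k])
      qed
    qed
    moreover have "conv (l n) w = J (conv (l n) (jfun w))" by (rule ext) (rule conv_W[OF w lt])
    ultimately show ?thesis using W_J by simp
  qed
  then show ?thesis by (rule closed_sequentially[OF closed_W _ lim])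
qed

subsection \<open>Multiplication by test functions\<close>

text \<open>The Leibniz rule up to second order: the jet of a product with \<beta>, expressed
  linearly in the jet of the other factor.\<close>

definition jmul :: "(real^3 \<Rightarrow> real) \<Rightarrow> real^3 \<Rightarrow> jet \<Rightarrow> jet" where
  "jmul \<beta> x v = (\<beta> x * fst v, \<beta> x *\<^sub>R fst (snd v) + fst v *\<^sub>R grad \<beta> x,
     \<beta> x *\<^sub>R snd (snd v) + (\<chi> i j. grad \<beta> x $ i * fst (snd v) $ j + fst (snd v) $ i * grad \<beta> x $ j) + fst v *\<^sub>R hess \<beta> x)"

text \<open>Images of basis vectors are continuous in \<open>x\<close> and vanish off a compact set,
  hence are bounded; linearity extends the bound to all vectors.\<close>

lemma pw_boundedI:
  fixes A :: "real^3 \<Rightarrow> 'b::euclidean_space \<Rightarrow> 'c::euclidean_space"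
  assumes lin: "\<And>x. linear (A x)" and cont: "continuous_on UNIV (\<lambda>p. A (fst p) (snd p))"
    and K: "compact K" "\<And>x v. x \<notin> K \<Longrightarrow> A x v = 0"
  shows "pw_bounded A"
  unfolding pw_bounded_def
proof (intro conjI allI ballI)
  show "linear (A x)" for x by (rule lin)
  show "(\<lambda>x. A x (f x)) \<in> borel_measurable borel" if [measurable]: "f \<in> borel_measurable borel" for f
    by (rule borel_measurable_continuous_Pair[OF _ that cont, of "\<lambda>x. x"]) measurable
  have "\<exists>B. 0 \<le> B \<and> (\<forall>x. norm (A x b) \<le> B)" for b
  proof -
    have "continuous_on K (\<lambda>x. A x b)"
      using continuous_on_compose2[OF cont, of K "\<lambda>x. (x, b)"] by (simp add: continuous_intros)
    then have "bounded ((\<lambda>x. A x b) ` K)" using K(1) by (intro compact_imp_bounded compact_continuous_image)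
    then obtain B where B: "\<forall>y\<in>(\<lambda>x. A x b) ` K. norm y \<le> B" unfolding bounded_iff by blast
    have "norm (A x b) \<le> max 0 B" for x using B K(2)[of x b] by (cases "x \<in> K") (auto simp: le_max_iff_disj)
    then show ?thesis by (intro exI[of _ "max 0 B"]) auto
  qed
  then obtain B where B: "\<And>b. 0 \<le> B b" "\<And>b x. norm (A x b) \<le> B b" by metis
  have "norm (A x v) \<le> (\<Sum>b\<in>Basis. B b) * norm v" for x v
  proof -
    have "A x v = A x (\<Sum>b\<in>Basis. (v \<bullet> b) *\<^sub>R b)" by (simp add: euclidean_representation)
    also have "\<dots> = (\<Sum>b\<in>Basis. (v \<bullet> b) *\<^sub>R A x b)" by (simp add: linear_sum[OF lin] linear_scale[OF lin])
    also have "norm \<dots> \<le> (\<Sum>b\<in>Basis. norm ((v \<bullet> b) *\<^sub>R A x b))" by (rule norm_sum)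
    also have "\<dots> \<le> (\<Sum>b\<in>Basis. norm v * B b)"
      unfolding norm_scaleR by (intro sum_mono mult_mono B Basis_le_norm) auto
    also have "\<dots> = (\<Sum>b\<in>Basis. B b) * norm v" unfolding sum_distrib_right by (simp add: mult.commute)
    finally show ?thesis .
  qed
  then show "\<exists>C. \<forall>x v. norm (A x v) \<le> C * norm v" by blast
qed

lemma pw_bounded_jmul:
  assumes \<beta>: "\<beta> \<in> test_fields UNIV"
  shows "pw_bounded (jmul \<beta>)"
proof -
  from \<beta> obtain K where K: "compact K" "\<And>x. x \<notin> K \<Longrightarrow> \<beta> x = 0" by (rule test_fieldsE) (rule that)
  note s = test_fields_smooth[OF \<beta>]
  have c: "continuous_on UNIV (\<lambda>p. \<beta> (fst p))" "continuous_on UNIV (\<lambda>p. grad \<beta> (fst p))" "continuous_on UNIV (\<lambda>p. hess \<beta> (fst p))"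
    by (rule continuous_on_compose2[OF smooth_continuous_on[OF s, of UNIV]] continuous_on_compose2[OF smooth_continuous_on[OF smooth_grad[OF s], of UNIV]]
        continuous_on_compose2[OF smooth_continuous_on[OF smooth_hess[OF s], of UNIV]]; auto intro: continuous_intros)+
  show ?thesis
  proof (rule pw_boundedI[OF _ _ K(1)])
    show "linear (jmul \<beta> x)" for x
      by (rule linearI) (auto simp: jmul_def vec_eq_iff algebra_simps)
    show "continuous_on UNIV (\<lambda>p. jmul \<beta> (fst p) (snd p))"
      unfolding jmul_def by (intro continuous_intros continuous_on_vec_lambda c)
    show "jmul \<beta> x v = 0" if "x \<notin> K" for x v
      using that K grad_outside[of K \<beta> x] hess_outside[of K \<beta> x] compact_imp_closed[OF K(1)]
      by (simp add: jmul_def zero_prod_def vec_eq_iff)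
  qed
qed

lemma jmul_J:
  assumes "smooth \<beta>" "smooth \<phi>"
  shows "jmul \<beta> x (J \<phi> x) = J (\<lambda>x. \<beta> x * \<phi> x) x"
proof -
  have p1: "partial_deriv i (\<lambda>x. f x * g x) = (\<lambda>x. f x * partial_deriv i g x + partial_deriv i f x * g x)"
    if "smooth f" "smooth g" for i and f g :: "real^3 \<Rightarrow> real"
    by (rule ext) (rule partial_deriv_mult[OF smooth_differentiable[OF that(1)] smooth_differentiable[OF that(2)]])
  have p2: "partial_deriv i (partial_deriv j (\<lambda>x. \<beta> x * \<phi> x)) x =
     (\<beta> x * partial_deriv i (partial_deriv j \<phi>) x + partial_deriv i \<beta> x * partial_deriv j \<phi> x) +
     (partial_deriv j \<beta> x * partial_deriv i \<phi> x + partial_deriv i (partial_deriv j \<beta>) x * \<phi> x)" for i j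
    unfolding p1[OF assms]
    by (subst partial_deriv_add)
      (simp_all add: p1 assms smooth_differentiable smooth_mult smooth_partial_deriv)
  have g: "grad (\<lambda>x. \<beta> x * \<phi> x) x = \<beta> x *\<^sub>R grad \<phi> x + \<phi> x *\<^sub>R grad \<beta> x"
    by (simp add: grad_def p1[OF assms] vec_eq_iff mult.commute)
  have h: "hess (\<lambda>x. \<beta> x * \<phi> x) x = \<beta> x *\<^sub>R hess \<phi> x
      + (\<chi> i j. grad \<beta> x $ i * grad \<phi> x $ j + grad \<phi> x $ i * grad \<beta> x $ j) + \<phi> x *\<^sub>R hess \<beta> x"
    by (simp add: vec_eq_iff hess_def p2 grad_def algebra_simps)
  show ?thesis unfolding J_def g h by (simp add: jmul_def)
qed

lemma W_jmul:
  assumes w: "w \<in> W UNIV" and \<beta>: "\<beta> \<in> test_fields UNIV"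
  shows "pw (jmul \<beta>) w \<in> W UNIV"
proof -
  obtain \<phi> where \<phi>: "\<And>n. \<phi> n \<in> test_fields UNIV" "(\<lambda>n. abs_L2 (J (\<phi> n))) \<longlonglongrightarrow> w" by (rule W_sequence[OF w]) (rule that)
  have "pw (jmul \<beta>) (abs_L2 (J (\<phi> n))) = abs_L2 (J (\<lambda>x. \<beta> x * \<phi> n x))" for n
    unfolding pw_abs[OF pw_bounded_jmul[OF \<beta>] sq_J[OF \<phi>(1)]] jmul_J[OF test_fields_smooth[OF \<beta>] test_fields_smooth[OF \<phi>(1)]] ..
  then have l: "(\<lambda>n. abs_L2 (J (\<lambda>x. \<beta> x * \<phi> n x))) \<longlonglongrightarrow> pw (jmul \<beta>) w"
    using bounded_linear.tendsto[OF bounded_linear_pw[OF pw_bounded_jmul[OF \<beta>]] \<phi>(2)] by simp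
  show ?thesis
    by (rule closed_sequentially[OF closed_W _ l]) (rule W_J[OF test_fields_smooth_mult[OF test_fields_smooth[OF \<beta>] \<phi>(1)]])
qed

lemma rep_jfun: "AE x in lborel. rep_L2 (jfun w) x = fst (rep_L2 w x)"
  and rep_jhess: "AE x in lborel. rep_L2 (jhess w) x = snd (snd (rep_L2 w x))"
  unfolding jfun_def jhess_def by (rule rep_pw[OF pw_bounded_linear[OF bl_jet(1)]] rep_pw[OF pw_bounded_linear[OF bl_jet(3)]])+

lemma rep_jfun_jmul:
  assumes \<beta>: "\<beta> \<in> test_fields UNIV"
  shows "AE x in lborel. rep_L2 (jfun (pw (jmul \<beta>) w)) x = \<beta> x * rep_L2 (jfun w) x"
  using rep_jfun[of "pw (jmul \<beta>) w"] rep_pw[OF pw_bounded_jmul[OF \<beta>], of w] rep_jfun[of w]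
  by eventually_elim (simp add: jmul_def)

subsection \<open>Boundary charts\<close>

definition chart_box :: "real^3 \<Rightarrow> (real^3 \<Rightarrow> real^3) \<Rightarrow> real^3 \<Rightarrow> (real^3) set" where
  "chart_box p Q a = {x. \<forall>i. \<bar>Q (x - p) $ i\<bar> < a $ i}"

definition subgraph_chart ::
  "(real^3) set \<Rightarrow> real^3 \<Rightarrow> (real^3 \<Rightarrow> real^3) \<Rightarrow> real^3 \<Rightarrow> (real \<times> real \<Rightarrow> real) \<Rightarrow> bool" where
  "subgraph_chart \<Omega> p Q a g \<longleftrightarrow> orthogonal_transformation Q \<and> (\<forall>i. 0 < a $ i) \<and>
    (\<forall>x\<in>chart_box p Q a. \<bar>g (Q (x - p) $ 1, Q (x - p) $ 2)\<bar> \<le> a $ 3 / 2 \<and>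
       (x \<in> \<Omega> \<longleftrightarrow> Q (x - p) $ 3 < g (Q (x - p) $ 1, Q (x - p) $ 2)) \<and>
       (x \<in> frontier \<Omega> \<longleftrightarrow> Q (x - p) $ 3 = g (Q (x - p) $ 1, Q (x - p) $ 2)))"

lemma chart_exists:
  assumes "continuous_boundary \<Omega>" "p \<in> frontier \<Omega>"
  obtains Q a g where "subgraph_chart \<Omega> p Q a g"
proof -
  from assms(1)[unfolded continuous_boundary_def, THEN bspec, OF assms(2)]
  obtain Q :: "real^3 \<Rightarrow> real^3" and a :: "real^3" and g :: "real \<times> real \<Rightarrow> real"
    where c: "orthogonal_transformation Q" "\<forall>i. 0 < a $ i"
    "continuous_on ({- a$1<..<a$1} \<times> {- a$2<..<a$2}) g"
    "\<forall>s\<in>{- a$1<..<a$1}. \<forall>t\<in>{- a$2<..<a$2}. \<bar>g (s, t)\<bar> \<le> a$3 / 2"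
    "\<forall>x. let y = Q (x - p) in (\<forall>i. \<bar>y $ i\<bar> < a $ i) \<longrightarrow>
          (x \<in> \<Omega> \<longleftrightarrow> y$3 < g (y$1, y$2)) \<and> (x \<in> frontier \<Omega> \<longleftrightarrow> y$3 = g (y$1, y$2))"
    by (elim exE conjE) (rule that)
  have "subgraph_chart \<Omega> p Q a g"
    unfolding subgraph_chart_def
  proof (intro conjI ballI)
    fix x assume "x \<in> chart_box p Q a"
    then have x: "\<forall>i. \<bar>Q (x - p) $ i\<bar> < a $ i" by (simp add: chart_box_def)
    have "Q (x - p) $ 1 \<in> {- a$1<..<a$1}" "Q (x - p) $ 2 \<in> {- a$2<..<a$2}"
      using x[THEN spec, of 1] x[THEN spec, of 2] by (auto simp: abs_less_iff)
    then show "\<bar>g (Q (x - p) $ 1, Q (x - p) $ 2)\<bar> \<le> a $ 3 / 2" using c(4) by blast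
    show "x \<in> \<Omega> \<longleftrightarrow> Q (x - p) $ 3 < g (Q (x - p) $ 1, Q (x - p) $ 2)"
      "x \<in> frontier \<Omega> \<longleftrightarrow> Q (x - p) $ 3 = g (Q (x - p) $ 1, Q (x - p) $ 2)"
      using c(5)[THEN spec, of x] x by (simp_all add: Let_def)
  qed (use c in auto)
  then show ?thesis by (rule that)
qed

lemma chartD:
  assumes "subgraph_chart \<Omega> p Q a g"
  shows "orthogonal_transformation Q" "0 < a $ i" "linear Q"
    and "x \<in> chart_box p Q a \<Longrightarrow> \<bar>g (Q (x - p) $ 1, Q (x - p) $ 2)\<bar> \<le> a $ 3 / 2"
    and "x \<in> chart_box p Q a \<Longrightarrow> x \<in> \<Omega> \<longleftrightarrow> Q (x - p) $ 3 < g (Q (x - p) $ 1, Q (x - p) $ 2)"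
    and "x \<in> chart_box p Q a \<Longrightarrow> x \<in> closure \<Omega> \<longleftrightarrow> Q (x - p) $ 3 \<le> g (Q (x - p) $ 1, Q (x - p) $ 2)"
    and "x \<in> chart_box p Q a \<Longrightarrow> x \<in> frontier \<Omega> \<longleftrightarrow> Q (x - p) $ 3 = g (Q (x - p) $ 1, Q (x - p) $ 2)"
  using assms orthogonal_transformation_linear unfolding subgraph_chart_def closure_Un_frontier
  by (auto simp: le_less)

lemma coord_continuous:
  fixes Q :: "real^3 \<Rightarrow> real^3"
  assumes "linear Q"
  shows "continuous_on S (\<lambda>x. Q (x - p) $ i)"
proof -
  have "continuous_on S (\<lambda>x. Q (x - p))"
    by (rule continuous_on_compose2[OF linear_continuous_on[OF assms[unfolded linear_conv_bounded_linear], of UNIV]])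
      (auto intro: continuous_intros)
  then show ?thesis by (rule continuous_on_component)
qed

lemma open_chart_box: "linear Q \<Longrightarrow> open (chart_box p Q a)"
  unfolding chart_box_def Collect_all_eq
  by (intro open_INT finite_class.finite_UNIV ballI open_Collect_less continuous_on_rabs coord_continuous continuous_on_const)

lemma center_chart_box: "linear Q \<Longrightarrow> (\<And>i. 0 < a $ i) \<Longrightarrow> p \<in> chart_box p Q a"
  by (simp add: chart_box_def linear_0)

text \<open>The vector \<open>d\<close> is the preimage of the third axis, so that moving along it
  changes only the height in the chart.\<close>

lemma chart_direction:
  fixes Q :: "real^3 \<Rightarrow> real^3"
  assumes "orthogonal_transformation Q"
  obtains d where "\<And>x t p. Q (x + t *\<^sub>R d - p) = Q (x - p) + t *\<^sub>R axis 3 (1::real)"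
proof -
  have "axis 3 1 \<in> range Q" using orthogonal_transformation_surj[OF assms] by simp
  then obtain d where "axis 3 1 = Q d" by (rule rangeE)
  then have d: "Q d = axis 3 1" by simp
  note lin = orthogonal_transformation_linear[OF assms]
  have "Q (x + t *\<^sub>R d - p) = Q (x - p) + t *\<^sub>R axis 3 (1::real)" for x t p
  proof -
    have "x + t *\<^sub>R d - p = (x - p) + t *\<^sub>R d" by simp
    then show ?thesis by (simp only: linear_add[OF lin] linear_scale[OF lin] d)
  qed
  then show ?thesis by (rule that)
qed

lemma axis3_nth: "axis 3 (1::real) $ (3::3) = 1" "axis 3 (1::real) $ (1::3) = 0" "axis 3 (1::real) $ (2::3) = 0"
  by (simp_all add: axis_def)

text \<open>Every point of the part of the box above the graph can be moved upwards into a flat slab.\<close>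

lemma connected_above_chart:
  assumes c: "subgraph_chart \<Omega> p Q a g"
  shows "connected (chart_box p Q a - closure \<Omega>)"
proof -
  note D = chartD[OF c]
  obtain d where d: "\<And>x t p. Q (x + t *\<^sub>R d - p) = Q (x - p) + t *\<^sub>R axis 3 (1::real)"
    by (rule chart_direction[OF D(1)]) (rule that)
  define E where "E = chart_box p Q a - closure \<Omega>"
  \<comment> \<open>Since the graph stays at heights of modulus at most \<open>a $ 3 / 2\<close>,
    this convex slab lies in the exterior.\<close>
  define S where "S = {x \<in> chart_box p Q a. a $ 3 / 2 < Q (x - p) $ 3}"
  have SE: "S \<subseteq> E"
  proof
    fix x assume x: "x \<in> S"
    then have xb: "x \<in> chart_box p Q a" by (simp add: S_def)
    from D(4)[OF xb] x have "g (Q (x - p) $ 1, Q (x - p) $ 2) < Q (x - p) $ 3" by (auto simp: S_def)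
    then have "x \<notin> closure \<Omega>" using D(6)[OF xb] by simp
    then show "x \<in> E" using xb by (simp add: E_def)
  qed
  have cS: "convex S"
  proof (rule convexI)
    fix x y :: "real^3" and u v :: real
    assume xy: "x \<in> S" "y \<in> S" and uv: "0 \<le> u" "0 \<le> v" "u + v = 1"
    have "u *\<^sub>R x + v *\<^sub>R y - p = u *\<^sub>R (x - p) + v *\<^sub>R (y - p)"
      using uv(3) by (simp add: algebra_simps flip: scaleR_add_left)
    then have e: "Q (u *\<^sub>R x + v *\<^sub>R y - p) $ i = u * (Q (x - p) $ i) + v * (Q (y - p) $ i)" for i
      by (simp add: linear_add[OF D(3)] linear_scale[OF D(3)])
    have b: "\<bar>u * s + v * t\<bar> < r" if "\<bar>s\<bar> < r" "\<bar>t\<bar> < r" for s t r :: real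
    proof -
      have "u * s + v * t < r" using convex_bound_lt[of s r t u v] that uv by auto
      moreover have "u * (- s) + v * (- t) < r" using convex_bound_lt[of "- s" r "- t" u v] that uv by auto
      ultimately show ?thesis by (simp add: abs_less_iff)
    qed
    have "- (u * (Q (x - p) $ 3) + v * (Q (y - p) $ 3)) < - (a $ 3 / 2)"
      using convex_bound_lt[of "- (Q (x - p) $ 3)" "- (a $ 3 / 2)" "- (Q (y - p) $ 3)" u v] xy uv by (simp add: S_def)
    then show "u *\<^sub>R x + v *\<^sub>R y \<in> S"
      using xy b by (simp add: S_def chart_box_def e)
  qed
  \<comment> \<open>A vertical segment to height \<open>3/4 * a $ 3\<close> joined to the slab; the
    maximum with 0 leaves points that are already higher in place. All these sets share the slab,
    hence their union is connected.\<close>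
  define F where "F x = closed_segment x (x + max 0 (3/4 * a $ 3 - Q (x - p) $ 3) *\<^sub>R d) \<union> S" for x
  have top: "x + max 0 (3/4 * a $ 3 - Q (x - p) $ 3) *\<^sub>R d \<in> S" and up: "x + s *\<^sub>R d \<in> E" 
    if x: "x \<in> E" and s: "0 \<le> s" "s \<le> max 0 (3/4 * a $ 3 - Q (x - p) $ 3)" for x s
  proof -
    have xb: "x \<in> chart_box p Q a" and xc: "g (Q (x - p) $ 1, Q (x - p) $ 2) < Q (x - p) $ 3"
      using x D(6)[of x] by (auto simp: E_def)
    have x3: "\<bar>Q (x - p) $ 3\<bar> < a $ 3" using xb by (simp add: chart_box_def)
    have bx: "x + t *\<^sub>R d \<in> chart_box p Q a" if t: "0 \<le> t" "t \<le> max 0 (3/4 * a $ 3 - Q (x - p) $ 3)" for t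
    proof -
      have "\<bar>Q (x - p) $ 3 + t\<bar> < a $ 3"
        using x3 t D(2)[of 3] by (auto simp: abs_less_iff max_def split: if_splits)
      then show ?thesis
        using xb unfolding chart_box_def d mem_Collect_eq forall_3 by (simp add: axis3_nth)
    qed
    show "x + max 0 (3/4 * a $ 3 - Q (x - p) $ 3) *\<^sub>R d \<in> S"
      unfolding S_def d mem_Collect_eq using bx[of "max 0 (3/4 * a $ 3 - Q (x - p) $ 3)"] D(2)[of 3]
      by (auto simp: axis3_nth max_def split: if_splits)
    have "x + s *\<^sub>R d \<notin> closure \<Omega>"
      unfolding D(6)[OF bx[OF s]] d using xc s(1) by (simp add: axis3_nth)
    then show "x + s *\<^sub>R d \<in> E" using bx[OF s] by (simp add: E_def)
  qed
  have conF: "connected (F x)" if x: "x \<in> E" for x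
    unfolding F_def
  proof (rule connected_Un)
    show "closed_segment x (x + max 0 (3/4 * a $ 3 - Q (x - p) $ 3) *\<^sub>R d) \<inter> S \<noteq> {}"
      using top[OF x, of 0] by auto
  qed (auto intro: convex_connected cS)
  have FE: "F x \<subseteq> E" if x: "x \<in> E" for x
  proof -
    have "y \<in> E" if "y \<in> closed_segment x (x + max 0 (3/4 * a $ 3 - Q (x - p) $ 3) *\<^sub>R d)" for y
    proof -
      define m where "m = max 0 (3/4 * a $ 3 - Q (x - p) $ 3)"
      from that obtain u where u: "0 \<le> u" "u \<le> 1" "y = (1 - u) *\<^sub>R x + u *\<^sub>R (x + m *\<^sub>R d)"
        by (auto simp: closed_segment_def m_def)
      have "y = x + (u * m) *\<^sub>R d" unfolding u(3) by (simp add: algebra_simps)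
      moreover have "0 \<le> u * m" "u * m \<le> m" using u by (auto simp: m_def mult_left_le_one_le)
      ultimately show ?thesis using up[OF x, of "u * m"] by (simp add: m_def)
    qed
    then show ?thesis using SE by (auto simp: F_def)
  qed
  show ?thesis
  proof (cases "E = {}")
    case False
    have "E = \<Union>(F ` E)" using FE by (auto simp: F_def)
    moreover have "connected (\<Union>(F ` E))"
    proof (rule connected_Union)
      from False obtain x where "x \<in> E" by blast
      with top[of x 0] have "S \<noteq> {}" by auto
      moreover have "S \<subseteq> \<Inter>(F ` E)" by (auto simp: F_def)
      ultimately show "\<Inter>(F ` E) \<noteq> {}" by blast
    qed (use conF in auto)
    ultimately show ?thesis unfolding E_def[symmetric] by simp
  qed (simp add: E_def[symmetric])
qed

section \<open>Exterior components near the boundary\<close>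

text \<open>Small upward shifts of a boundary point leave \<open>closure \<Omega>\<close>. Thus
  \<Omega> has no slits, and continuous functions vanishing on the exterior also vanish on the
  boundary.\<close>

lemma frontier_subset_closure_exterior:
  assumes "continuous_boundary \<Omega>" "p \<in> frontier \<Omega>"
  shows "p \<in> closure (- closure \<Omega>)"
proof -
  obtain Q a g where c: "subgraph_chart \<Omega> p Q a g" by (rule chart_exists[OF assms]) (rule that)
  note D = chartD[OF c]
  obtain d where d: "\<And>x t p. Q (x + t *\<^sub>R d - p) = Q (x - p) + t *\<^sub>R axis 3 (1::real)"
    by (rule chart_direction[OF D(1)]) (rule that)
  have pb: "p \<in> chart_box p Q a" by (rule center_chart_box[OF D(3,2)])
  \<comment> \<open>The boundary point is the origin of the chart and lies on the graph.\<close>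
  have g0: "g (0, 0) = 0" using D(7)[OF pb] assms(2) by (simp add: linear_0[OF D(3)])
  define t where "t n = a $ 3 * inverse (real (Suc (Suc n)))" for n
  have "p + t n *\<^sub>R d \<in> - closure \<Omega>" for n
  proof -
    have "inverse (real (Suc (Suc n))) < 1" by (simp add: inverse_less_1_iff)
    from mult_strict_left_mono[OF this D(2)[of 3]] have t: "0 < t n" "t n < a $ 3"
      using D(2)[of 3] by (simp_all add: t_def)
    have Qd: "Q (p + t n *\<^sub>R d - p) = t n *\<^sub>R axis 3 1" unfolding d by (simp add: linear_0[OF D(3)])
    have b: "p + t n *\<^sub>R d \<in> chart_box p Q a"
      unfolding chart_box_def mem_Collect_eq Qd forall_3 using t D(2) by (simp add: axis3_nth)
    show ?thesis using D(6)[OF b] t(1) g0 unfolding Qd by (simp add: axis3_nth)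
  qed
  moreover have "(\<lambda>n. p + t n *\<^sub>R d) \<longlonglongrightarrow> p + (a $ 3 * 0) *\<^sub>R d"
    unfolding t_def by (intro tendsto_intros LIMSEQ_Suc[OF LIMSEQ_inverse_real_of_nat])
  ultimately show ?thesis unfolding closure_sequential by (intro exI[of _ "\<lambda>n. p + t n *\<^sub>R d"]) simp
qed

text \<open>The part of the box outside \<open>closure \<Omega>\<close> is connected, so a component
  meeting it contains all of it, and distinct components are disjoint.\<close>

lemma same_component_near_boundary:
  assumes c: "subgraph_chart \<Omega> p Q a g"
    and C: "C \<in> components (- closure \<Omega>)" "C' \<in> components (- closure \<Omega>)"
    and m: "C \<inter> chart_box p Q a \<noteq> {}" "C' \<inter> chart_box p Q a \<noteq> {}"
  shows "C = C'"
proof -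
  define E where "E = chart_box p Q a - closure \<Omega>"
  have E: "connected E" "E \<subseteq> - closure \<Omega>" unfolding E_def using connected_above_chart[OF c] by auto
  have "E \<subseteq> D" if "D \<in> components (- closure \<Omega>)" "D \<inter> chart_box p Q a \<noteq> {}" for D
    by (rule components_maximal[OF that(1) E]) (use that in_components_subset[OF that(1)] in \<open>auto simp: E_def\<close>)
  then have "E \<subseteq> C" "E \<subseteq> C'" using C m by auto
  moreover have "E \<noteq> {}" using m(1) in_components_subset[OF C(1)] by (auto simp: E_def)
  ultimately have "C \<inter> C' \<noteq> {}" by blast
  then show ?thesis using components_nonoverlap[OF C] by blast
qed

text \<open>Every candidate for a common closure point has a neighbourhood met by at most one
  component: a chart box at the boundary, a ball in the exterior. Disjoint closures are what permits
  cutoffs that are constant up to the boundary.\<close>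

lemma disjoint_component_closures:
  assumes \<Omega>: "open \<Omega>" "continuous_boundary \<Omega>"
    and C: "C \<in> components (- closure \<Omega>)" "C' \<in> components (- closure \<Omega>)" "C \<noteq> C'"
  shows "closure C \<inter> closure C' = {}"
proof (rule ccontr)
  assume "closure C \<inter> closure C' \<noteq> {}"
  then obtain x where x: "x \<in> closure C" "x \<in> closure C'" by blast
  obtain N where N: "open N" "x \<in> N" "\<And>D D'. D \<in> components (- closure \<Omega>) \<Longrightarrow> D' \<in> components (- closure \<Omega>) \<Longrightarrow>
      D \<inter> N \<noteq> {} \<Longrightarrow> D' \<inter> N \<noteq> {} \<Longrightarrow> D = D'"
  proof (cases "x \<in> closure \<Omega>")
    case True
    have "x \<notin> \<Omega>"
    proof
      assume "x \<in> \<Omega>"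
      then have "\<Omega> \<inter> C \<noteq> {}" using x(1) \<Omega>(1) open_Int_closure_eq_empty[of \<Omega> C] by blast
      then show False using in_components_subset[OF C(1)] closure_subset[of \<Omega>] by blast
    qed
    then have "x \<in> frontier \<Omega>" using True \<Omega>(1) by (simp add: frontier_def interior_open)
    then obtain Q a g where c: "subgraph_chart \<Omega> x Q a g" by (rule chart_exists[OF \<Omega>(2)]) (rule that)
    show ?thesis
      by (rule that[OF open_chart_box[OF chartD(3)[OF c]] center_chart_box[OF chartD(3,2)[OF c]]])
        (rule same_component_near_boundary[OF c])
  next
    case False
    then obtain e where e: "0 < e" "ball x e \<subseteq> - closure \<Omega>"
      using open_contains_ball[of "- closure \<Omega>"] by (auto simp: open_Compl)
    show ?thesis
    proof (rule that[of "ball x e"])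
      fix D D' assume D: "D \<in> components (- closure \<Omega>)" "D' \<in> components (- closure \<Omega>)" "D \<inter> ball x e \<noteq> {}" "D' \<inter> ball x e \<noteq> {}"
      have "ball x e \<subseteq> D" "ball x e \<subseteq> D'"
        using components_maximal[OF D(1) connected_ball e(2) D(3)] components_maximal[OF D(2) connected_ball e(2) D(4)] by auto
      moreover have "x \<in> ball x e" using e(1) by simp
      ultimately have "D \<inter> D' \<noteq> {}" by blast
      then show "D = D'" using components_nonoverlap[OF D(1,2)] by blast
    qed (use e in auto)
  qed
  have "C \<inter> N \<noteq> {}" "C' \<inter> N \<noteq> {}"
    using x N(1,2) open_Int_closure_eq_empty[OF N(1)] by blast+
  then show False using N(3)[OF C(1,2)] C(3) by blast
qed

text \<open>The boundary is covered by finitely many chart boxes. Each component has a nonempty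
  frontier inside the boundary of \<Omega>, hence meets one of these boxes, and each box meets at
  most one component.\<close>

lemma finite_exterior_components:
  assumes \<Omega>: "open \<Omega>" "bounded \<Omega>" "continuous_boundary \<Omega>"
  shows "finite (components (- closure \<Omega>))"
proof (cases "\<Omega> = {}")
  case False
  have "\<exists>N. open N \<and> p \<in> N \<and> (\<forall>D\<in>components (- closure \<Omega>). \<forall>D'\<in>components (- closure \<Omega>).
      D \<inter> N \<noteq> {} \<longrightarrow> D' \<inter> N \<noteq> {} \<longrightarrow> D = D')" if p: "p \<in> frontier \<Omega>" for p
  proof -
    obtain Q a g where c: "subgraph_chart \<Omega> p Q a g" by (rule chart_exists[OF \<Omega>(3) p]) (rule that)
    show ?thesis
      using open_chart_box[OF chartD(3)[OF c], of p a] center_chart_box[OF chartD(3,2)[OF c], of p] same_component_near_boundary[OF c]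
      by (intro exI[of _ "chart_box p Q a"]) blast
  qed
  then obtain N where N: "\<And>p. p \<in> frontier \<Omega> \<Longrightarrow> open (N p)" "\<And>p. p \<in> frontier \<Omega> \<Longrightarrow> p \<in> N p"
    "\<And>p D D'. p \<in> frontier \<Omega> \<Longrightarrow> D \<in> components (- closure \<Omega>) \<Longrightarrow> D' \<in> components (- closure \<Omega>) \<Longrightarrow>
      D \<inter> N p \<noteq> {} \<Longrightarrow> D' \<inter> N p \<noteq> {} \<Longrightarrow> D = D'" by metis
  have "compact (frontier \<Omega>)" using \<Omega>(2) by (simp add: compact_frontier_bounded)
  then obtain F where F: "F \<subseteq> frontier \<Omega>" "finite F" "frontier \<Omega> \<subseteq> (\<Union>p\<in>F. N p)"
    by (rule compactE_image[of "frontier \<Omega>" "frontier \<Omega>" N]) (use N in auto)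
  have "\<exists>p\<in>F. D \<inter> N p \<noteq> {}" if D: "D \<in> components (- closure \<Omega>)" for D
  proof -
    have "D \<noteq> {}" by (rule in_components_nonempty[OF D])
    moreover have "D \<noteq> UNIV" using in_components_subset[OF D] False closure_subset[of \<Omega>] by blast
    ultimately have "frontier D \<noteq> {}" by (simp add: frontier_eq_empty)
    then obtain q where q: "q \<in> frontier D" by blast
    have "frontier (closure \<Omega>) \<subseteq> frontier \<Omega>"
      unfolding frontier_def closure_closure using interior_mono[OF closure_subset[of \<Omega>]] by blast
    then have "frontier D \<subseteq> frontier \<Omega>"
      using frontier_of_components_subset[OF D] unfolding frontier_complement by (rule order_trans[rotated])
    then obtain p where p: "p \<in> F" "q \<in> N p" using q F(3) by blast
    have "q \<in> closure D" using q by (simp add: frontier_def)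
    then have "N p \<inter> D \<noteq> {}" using open_Int_closure_eq_empty[OF N(1)] p F(1) by blast
    then show ?thesis using p(1) by blast
  qed
  then obtain f where f: "\<And>D. D \<in> components (- closure \<Omega>) \<Longrightarrow> f D \<in> F \<and> D \<inter> N (f D) \<noteq> {}" by metis
  have "inj_on f (components (- closure \<Omega>))"
  proof (rule inj_onI)
    fix D D' assume D: "D \<in> components (- closure \<Omega>)" "D' \<in> components (- closure \<Omega>)" "f D = f D'"
    show "D = D'" by (rule N(3)[of "f D", OF _ D(1,2)]) (use f[OF D(1)] f[OF D(2)] D(3) F(1) in auto)
  qed
  then show ?thesis
    by (rule finite_imageD[rotated]) (rule finite_subset[OF _ F(2)], use f in auto)
qed simp

subsection \<open>Cutoff functions in several variables\<close>

lemma coordinate_bump: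
  assumes Q: "orthogonal_transformation Q" and a: "\<And>i. 0 < a $ i"
  obtains \<beta> :: "real^3 \<Rightarrow> real" and K where "smooth \<beta>" "compact K" "K \<subseteq> chart_box p Q a"
    "\<And>x i. x \<in> K \<Longrightarrow> \<bar>Q (x - p) $ i\<bar> \<le> 3/4 * a $ i"
    "\<And>x. x \<notin> K \<Longrightarrow> \<beta> x = 0" "\<And>x. x \<in> chart_box p Q ((1/2) *\<^sub>R a) \<Longrightarrow> \<beta> x = 1"
proof -
  have lin: "linear Q" by (rule orthogonal_transformation_linear[OF Q])
  \<comment> \<open>With s the coordinate divided by \<open>a $ i\<close>, the arguments
    \<open>3 - 4 s\<close> and \<open>3 + 4 s\<close> are both at least 1 for |s| up to 1/2, and one
    of them is at most 0 for |s| from 3/4 on.\<close>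
  define \<beta> where "\<beta> x = (\<Prod>i\<in>UNIV. smooth_step (3 - 4 / a $ i * (Q (x - p) $ i)) * smooth_step (3 + 4 / a $ i * (Q (x - p) $ i)))" for x
  define K where "K = {x. \<forall>i. \<bar>Q (x - p) $ i\<bar> \<le> 3/4 * a $ i}"
  have s: "smooth (\<lambda>x. smooth_step (3 + m * (Q (x - p) $ i)))" for m i
  proof -
    have bl: "bounded_linear (\<lambda>x. m * (Q x $ i))"
      using lin by (intro bounded_linear_const_mult bounded_linear_compose[OF bounded_linear_vec_nth])
        (simp add: linear_conv_bounded_linear)
    have "smooth (\<lambda>x. smooth_step ((3 - m * (Q p $ i)) + m * (Q x $ i)))"
      by (rule smooth_affine[where L''="\<lambda>x. m * (Q x $ i)" and f=smooth_step and a="3 - m * (Q p $ i)", OF bl smooth_smooth_step])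
    then show ?thesis by (simp add: linear_diff[OF lin] algebra_simps)
  qed
  show ?thesis
  proof (rule that[of \<beta> K])
    show "smooth \<beta>" unfolding \<beta>_def[abs_def]
      by (intro smooth_prod smooth_mult) (use s[of "- (4 / a $ i)" i for i] s[of "4 / a $ i" i for i] in simp_all)
    have "closed K" unfolding K_def Collect_all_eq
      by (intro closed_INT ballI closed_Collect_le continuous_on_rabs coord_continuous[OF lin] continuous_on_const)
    moreover have "bounded K"
    proof (rule boundedI)
      fix x assume x: "x \<in> K"
      have "norm x \<le> norm p + norm (x - p)" using norm_triangle_sub[of x p] .
      also have "norm (x - p) = norm (Q (x - p))" by (rule orthogonal_transformation_norm[OF Q, symmetric])
      also have "\<dots> \<le> (\<Sum>i\<in>UNIV. \<bar>Q (x - p) $ i\<bar>)" by (rule norm_le_l1_cart)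
      also have "\<dots> \<le> (\<Sum>i\<in>UNIV. 3/4 * a $ i)" using x by (intro sum_mono) (simp add: K_def)
      finally show "norm x \<le> norm p + (\<Sum>i\<in>UNIV. 3/4 * a $ i)" by simp
    qed
    ultimately show "compact K" by (simp add: compact_eq_bounded_closed)
    show "K \<subseteq> chart_box p Q a"
    proof
      fix x assume x: "x \<in> K"
      have "\<bar>Q (x - p) $ i\<bar> < a $ i" for i
        using x a[of i] by (auto simp: K_def intro: le_less_trans[of _ "3/4 * a $ i"])
      then show "x \<in> chart_box p Q a" by (simp add: chart_box_def)
    qed
    show "x \<in> K \<Longrightarrow> \<bar>Q (x - p) $ i\<bar> \<le> 3/4 * a $ i" for x i by (simp add: K_def)
    show "\<beta> x = 0" if "x \<notin> K" for x
    proof -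
      from that obtain i where i: "3/4 * a $ i < \<bar>Q (x - p) $ i\<bar>" by (auto simp: K_def not_le)
      have "4 / a $ i * (3/4 * a $ i) < 4 / a $ i * \<bar>Q (x - p) $ i\<bar>"
        by (rule mult_strict_left_mono[OF i]) (simp add: a)
      then have "3 < 4 / a $ i * \<bar>Q (x - p) $ i\<bar>" using a[of i] by simp
      then have "3 - 4 / a $ i * (Q (x - p) $ i) \<le> 0 \<or> 3 + 4 / a $ i * (Q (x - p) $ i) \<le> 0"
        by (auto simp: abs_if split: if_splits)
      then have "smooth_step (3 - 4 / a $ i * (Q (x - p) $ i)) * smooth_step (3 + 4 / a $ i * (Q (x - p) $ i)) = 0"
        by (auto simp: smooth_step_0)
      then show ?thesis unfolding \<beta>_def by (intro prod_zero) auto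
    qed
    show "\<beta> x = 1" if x: "x \<in> chart_box p Q ((1/2) *\<^sub>R a)" for x
      unfolding \<beta>_def
    proof (rule prod.neutral, rule ballI)
      fix i
      have i: "\<bar>Q (x - p) $ i\<bar> \<le> 1/2 * a $ i" using x by (auto simp: chart_box_def intro: less_imp_le)
      have "4 / a $ i * \<bar>Q (x - p) $ i\<bar> \<le> 4 / a $ i * (1/2 * a $ i)"
        by (rule mult_left_mono[OF i]) (use a[of i] in simp)
      then have "\<bar>4 / a $ i * (Q (x - p) $ i)\<bar> \<le> 2" using a[of i] by (simp add: abs_mult)
      then have "1 \<le> 3 - 4 / a $ i * (Q (x - p) $ i) \<and> 1 \<le> 3 + 4 / a $ i * (Q (x - p) $ i)"
        unfolding abs_le_iff by linarith
      then show "smooth_step (3 - 4 / a $ i * (Q (x - p) $ i)) * smooth_step (3 + 4 / a $ i * (Q (x - p) $ i)) = 1"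
        by (simp add: smooth_step_1)
    qed
  qed
qed

lemma cutoff_exists:
  fixes K U :: "(real^3) set"
  assumes K: "compact K" and U: "open U" "K \<subseteq> U"
  obtains \<eta> N where "\<eta> \<in> test_fields U" "open N" "K \<subseteq> N" "\<And>x. x \<in> N \<Longrightarrow> \<eta> x = (1::real)"
proof -
  have "\<exists>\<beta> N. \<beta> \<in> test_fields U \<and> open N \<and> x \<in> N \<and> (\<forall>y\<in>N. \<beta> y = (1::real))" if x: "x \<in> K" for x
  proof -
    obtain r where r: "0 < r" "ball x r \<subseteq> U" using U x open_contains_ball by blast
    \<comment> \<open>The sum of the three coordinates bounds the norm, so the cube of half side
      \<open>r / 3\<close> fits into the ball of radius \<open>r\<close>.\<close>
    define a :: "real^3" where "a = (\<chi> i. r / 3)"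
    have a: "0 < a $ i" for i using r by (simp add: a_def)
    have Q: "orthogonal_transformation (\<lambda>x::real^3. x)" by (rule orthogonal_transformation_id)
    obtain \<beta> :: "real^3 \<Rightarrow> real" and L where b: "smooth \<beta>" "compact L" "L \<subseteq> chart_box x (\<lambda>x. x) a"
      "\<And>y. y \<notin> L \<Longrightarrow> \<beta> y = 0" "\<And>y. y \<in> chart_box x (\<lambda>x. x) ((1/2) *\<^sub>R a) \<Longrightarrow> \<beta> y = 1"
      by (rule coordinate_bump[OF Q a, of x]) (rule that)
    have "chart_box x (\<lambda>x. x) a \<subseteq> ball x r"
    proof
      fix y assume y: "y \<in> chart_box x (\<lambda>x. x) a"
      have "norm (y - x) \<le> (\<Sum>i\<in>UNIV. \<bar>(y - x) $ i\<bar>)" by (rule norm_le_l1_cart)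
      also have "\<dots> < (\<Sum>i\<in>(UNIV::3 set). r / 3)" using y by (intro sum_strict_mono) (auto simp: chart_box_def a_def)
      finally show "y \<in> ball x r" by (simp add: dist_norm norm_minus_commute)
    qed
    then have "\<beta> \<in> test_fields U" using b r by (intro test_fieldsI[OF b(1,2)]) auto
    moreover have "open (chart_box x (\<lambda>x. x) ((1/2) *\<^sub>R a))" by (rule open_chart_box) (rule linear_ident)
    moreover have "x \<in> chart_box x (\<lambda>x. x) ((1/2) *\<^sub>R a)" by (rule center_chart_box[OF linear_ident]) (use a in simp)
    ultimately show ?thesis using b(5) by blast
  qed
  then obtain \<beta> N where b: "\<And>x. x \<in> K \<Longrightarrow> \<beta> x \<in> test_fields U" "\<And>x. x \<in> K \<Longrightarrow> open (N x)" "\<And>x. x \<in> K \<Longrightarrow> x \<in> N x"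
    "\<And>x y. x \<in> K \<Longrightarrow> y \<in> N x \<Longrightarrow> \<beta> x y = (1::real)" by metis
  obtain F where F: "F \<subseteq> K" "finite F" "K \<subseteq> (\<Union>x\<in>F. N x)"
    by (rule compactE_image[OF K, of K N]) (use b in auto)
  \<comment> \<open>Equals 1 wherever one of the local bumps does, and vanishes where all of them
    do, without a normalising denominator.\<close>
  define \<eta> where "\<eta> S y = 1 - (\<Prod>x\<in>S. 1 - \<beta> x y)" for S y
  have "\<eta> S \<in> test_fields U" if "finite S" "S \<subseteq> K" for S
    using that
  proof (induction S)
    case empty
    then show ?case by (simp add: \<eta>_def[abs_def] test_fields_zero)
  next
    case (insert x S)
    have bx: "\<beta> x \<in> test_fields U" using b(1) insert by auto
    have "\<eta> (insert x S) = (\<lambda>y. \<eta> S y + (1 - \<eta> S y) * \<beta> x y)"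
      using insert by (simp add: \<eta>_def fun_eq_iff algebra_simps)
    moreover have "(\<lambda>y. \<eta> S y + (1 - \<eta> S y) * \<beta> x y) \<in> test_fields U"
      using insert bx
      by (intro test_fields_add test_fields_smooth_mult smooth_diff smooth_const test_fields_smooth[of "\<eta> S" U]) auto
    ultimately show ?case by simp
  qed
  then have "\<eta> F \<in> test_fields U" using F by blast
  moreover have "\<eta> F y = 1" if y: "y \<in> (\<Union>x\<in>F. N x)" for y
  proof -
    from y obtain x where x: "x \<in> F" "y \<in> N x" by blast
    then have "1 - \<beta> x y = 0" using b(4) F(1) by auto
    then have "(\<Prod>x\<in>F. 1 - \<beta> x y) = 0" using x(1) F(2) by (intro prod_zero) auto
    then show ?thesis by (simp add: \<eta>_def)
  qed
  moreover have "open (\<Union>x\<in>F. N x)" using b(2) F(1) by auto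
  ultimately show ?thesis using F(3) that by blast
qed

subsection \<open>Functions in the second order Sobolev space vanishing outside the domain\<close>

text \<open>The bump lives where coordinates are at most three quarters of the box size, so lowering
  the height by less than \<open>a $ 3 / 4\<close> stays in the box; there a point on or below the
  graph moves strictly below it.\<close>

lemma boundary_push:
  assumes c: "subgraph_chart \<Omega> p Q a g"
  obtains \<beta> N K d t0 where "\<beta> \<in> test_fields UNIV" "open N" "p \<in> N" "\<And>x. x \<in> N \<Longrightarrow> \<beta> x = 1"
    "compact K" "\<And>x. x \<notin> K \<Longrightarrow> \<beta> x = (0::real)" "0 < t0"
    "\<And>t y. 0 < t \<Longrightarrow> t < t0 \<Longrightarrow> y \<in> K \<inter> closure \<Omega> \<Longrightarrow> y - t *\<^sub>R d \<in> \<Omega>"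
proof -
  note D = chartD[OF c]
  obtain d where d: "\<And>x t p. Q (x + t *\<^sub>R d - p) = Q (x - p) + t *\<^sub>R axis 3 (1::real)"
    by (rule chart_direction[OF D(1)]) (rule that)
  obtain \<beta> :: "real^3 \<Rightarrow> real" and K where b: "smooth \<beta>" "compact K" "K \<subseteq> chart_box p Q a"
    "\<And>x i. x \<in> K \<Longrightarrow> \<bar>Q (x - p) $ i\<bar> \<le> 3/4 * a $ i"
    "\<And>y. y \<notin> K \<Longrightarrow> \<beta> y = 0" "\<And>y. y \<in> chart_box p Q ((1/2) *\<^sub>R a) \<Longrightarrow> \<beta> y = 1"
    by (rule coordinate_bump[OF D(1,2), of p]) (rule that)
  show ?thesis
  proof (rule that[of \<beta> "chart_box p Q ((1/2) *\<^sub>R a)" K "a $ 3 / 4" d])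
    show "\<beta> \<in> test_fields UNIV" by (rule test_fieldsI[OF b(1,2)]) (use b(5) in auto)
    show "open (chart_box p Q ((1/2) *\<^sub>R a))" by (rule open_chart_box[OF D(3)])
    show "p \<in> chart_box p Q ((1/2) *\<^sub>R a)" by (rule center_chart_box[OF D(3)]) (use D(2) in simp)
    show "0 < a $ 3 / 4" using D(2)[of 3] by simp
    fix t y assume t: "0 < t" "t < a $ 3 / 4" and y: "y \<in> K \<inter> closure \<Omega>"
    have yb: "y \<in> chart_box p Q a" using y b(3) by blast
    have y3: "\<bar>Q (y - p) $ 3\<bar> \<le> 3/4 * a $ 3" using b(4)[of y 3] y by simp
    have Qd: "Q (y - t *\<^sub>R d - p) = Q (y - p) - t *\<^sub>R axis 3 1" using d[of y "- t" p] by simp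
    have yt: "y - t *\<^sub>R d \<in> chart_box p Q a"
      unfolding chart_box_def mem_Collect_eq Qd forall_3 using yb y3 t by (auto simp: chart_box_def axis3_nth)
    have "Q (y - p) $ 3 \<le> g (Q (y - p) $ 1, Q (y - p) $ 2)" using D(6)[OF yb] y by simp
    then show "y - t *\<^sub>R d \<in> \<Omega>" unfolding D(5)[OF yt] Qd using t by (simp add: axis3_nth)
  qed (use b in auto)
qed

text \<open>Instead of a partition of unity, one chart is peeled off at a time: the localised part
  is pushed into \<Omega>, and the remainder vanishes near the boundary points treated so far. What
  is finally left lives on a compact subset of \<Omega>.\<close>

lemma W_of_vanishing:
  assumes \<Omega>: "open \<Omega>" "bounded \<Omega>" "continuous_boundary \<Omega>" and w: "w \<in> W UNIV"
    and v: "AE x in lborel. x \<in> closure \<Omega> \<or> rep_L2 (jfun w) x = 0"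
  shows "w \<in> W \<Omega>"
proof -
  define good where "good p \<beta> N \<longleftrightarrow> \<beta> \<in> test_fields UNIV \<and> open N \<and> p \<in> N \<and> (\<forall>x\<in>N. \<beta> x = 1) \<and>
    (\<exists>K d t0. compact K \<and> (\<forall>x. x \<notin> K \<longrightarrow> \<beta> x = (0::real)) \<and> 0 < t0 \<and>
      (\<forall>t y. 0 < t \<longrightarrow> t < t0 \<longrightarrow> y \<in> K \<inter> closure \<Omega> \<longrightarrow> y - t *\<^sub>R d \<in> \<Omega>))" for p \<beta> N
  have "\<exists>\<beta> N. good p \<beta> N" if p: "p \<in> frontier \<Omega>" for p
  proof -
    obtain Q a g where c: "subgraph_chart \<Omega> p Q a g" by (rule chart_exists[OF \<Omega>(3) p]) (rule that)
    obtain \<beta> N K d t0 where "\<beta> \<in> test_fields UNIV" "open N" "p \<in> N" "\<And>x. x \<in> N \<Longrightarrow> \<beta> x = 1"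
      "compact K" "\<And>x. x \<notin> K \<Longrightarrow> \<beta> x = (0::real)" "0 < t0"
      "\<And>t y. 0 < t \<Longrightarrow> t < t0 \<Longrightarrow> y \<in> K \<inter> closure \<Omega> \<Longrightarrow> y - t *\<^sub>R d \<in> \<Omega>"
      by (rule boundary_push[OF c]) (rule that)
    then have "good p \<beta> N" unfolding good_def by blast
    then show ?thesis by blast
  qed
  then obtain \<beta> N where good: "\<And>p. p \<in> frontier \<Omega> \<Longrightarrow> good p (\<beta> p) (N p)" by metis
  have ccl: "compact (closure \<Omega>)" using \<Omega>(2) by simp
  have "compact (frontier \<Omega>)" using \<Omega>(2) by (simp add: compact_frontier_bounded)
  then obtain F where F: "F \<subseteq> frontier \<Omega>" "finite F" "frontier \<Omega> \<subseteq> (\<Union>p\<in>F. N p)"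
    by (rule compactE_image[of "frontier \<Omega>" "frontier \<Omega>" N]) (use good in \<open>auto simp: good_def\<close>)
  have "\<exists>w'\<in>W UNIV. w - w' \<in> W \<Omega> \<and> (AE x in lborel. x \<in> closure \<Omega> - (\<Union>p\<in>S. N p) \<or> rep_L2 (jfun w') x = 0)"
    if "finite S" "S \<subseteq> frontier \<Omega>" for S
    using that
  proof (induction S)
    case empty
    then show ?case using w v subspace_0[OF subspace_W] by (intro bexI[of _ w]) auto
  next
    case (insert p S)
    then obtain w' where w': "w' \<in> W UNIV" "w - w' \<in> W \<Omega>"
      and ae: "AE x in lborel. x \<in> closure \<Omega> - (\<Union>p\<in>S. N p) \<or> rep_L2 (jfun w') x = 0" by auto
    have gp: "good p (\<beta> p) (N p)" using good insert by auto
    then obtain K d t0 where \<beta>: "\<beta> p \<in> test_fields UNIV" "\<forall>x\<in>N p. \<beta> p x = 1" "open (N p)" and K: "compact K" "\<forall>x. x \<notin> K \<longrightarrow> \<beta> p x = (0::real)" "0 < t0"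
      "\<forall>t y. 0 < t \<longrightarrow> t < t0 \<longrightarrow> y \<in> K \<inter> closure \<Omega> \<longrightarrow> y - t *\<^sub>R d \<in> \<Omega>"
      unfolding good_def by blast
    define z where "z = pw (jmul (\<beta> p)) w'"
    have zW: "z \<in> W UNIV" unfolding z_def by (rule W_jmul[OF w'(1) \<beta>(1)])
    note rz = rep_jfun_jmul[OF \<beta>(1), of w', folded z_def]
    have zO: "z \<in> W \<Omega>"
    proof (rule W_push_inside[OF zW \<Omega>(1) compact_Int[OF K(1) ccl] _ K(3)])
      show "AE y in lborel. y \<in> K \<inter> closure \<Omega> \<or> rep_L2 (jfun z) y = 0"
        using rz ae by eventually_elim (use K(2) in auto)
    qed (use K(4) in blast)
    have e: "w - (w' - z) = (w - w') + z" by simp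
    \<comment> \<open>The new remainder \<open>w' - z\<close> is \<open>w'\<close> multiplied by 1
      minus the bump, so it vanishes on \<open>N p\<close> and its support does not grow.\<close>
    have "w - (w' - z) \<in> W \<Omega>" unfolding e by (rule subspace_add[OF subspace_W w'(2) zO])
    moreover have "w' - z \<in> W UNIV" by (rule subspace_diff[OF subspace_W w'(1) zW])
    moreover have "AE x in lborel. x \<in> closure \<Omega> - (\<Union>q\<in>insert p S. N q) \<or> rep_L2 (jfun (w' - z)) x = 0"
    proof -
      have "jfun (w' - z) = jfun w' - jfun z" by (rule linear_diff[OF bounded_linear.linear[OF bounded_linear_j(1)]])
      then have "AE x in lborel. rep_L2 (jfun (w' - z)) x = rep_L2 (jfun w') x - rep_L2 (jfun z) x"
        using rep_diff[of "jfun w'" "jfun z"] by simp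
      then show ?thesis using rz ae by eventually_elim (use \<beta>(2) in auto)
    qed
    ultimately show ?case by blast
  qed
  from this[OF F(2,1)] obtain w' where w': "w' \<in> W UNIV" "w - w' \<in> W \<Omega>"
    and ae: "AE x in lborel. x \<in> closure \<Omega> - (\<Union>p\<in>F. N p) \<or> rep_L2 (jfun w') x = 0" by blast
  have oN: "open (\<Union>p\<in>F. N p)" using good F(1) by (auto simp: good_def)
  have "w' \<in> W \<Omega>"
  \<comment> \<open>The chart neighbourhoods cover the boundary, so the remaining compact set
    already lies in \<Omega> and the direction 0 serves: pure mollification.\<close>
  proof (rule W_push_inside[OF w'(1) \<Omega>(1) compact_diff[OF ccl oN] ae zero_less_one, where d=0])
    fix t y assume "y \<in> closure \<Omega> - (\<Union>p\<in>F. N p)"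
    then have "y \<in> closure \<Omega>" "y \<notin> frontier \<Omega>" using F(3) by auto
    then show "y - t *\<^sub>R 0 \<in> \<Omega>" by (simp add: closure_Un_frontier)
  qed
  from subspace_add[OF subspace_W w'(2) this] show ?thesis by simp
qed

subsection \<open>Cutoffs of the components of the exterior\<close>

lemma exterior_enumeration:
  assumes \<Omega>: "open \<Omega>" "bounded \<Omega>" "continuous_boundary \<Omega>" and m: "m = card (components (- closure \<Omega>))"
  obtains \<Xi> where "bij_betw \<Xi> {0..<m} (components (- closure \<Omega>))" "\<not> bounded (\<Xi> 0)"
proof -
  obtain C where C: "C \<in> components (- closure \<Omega>)" "\<not> bounded C"
    using cobounded_unbounded_components[of "- closure \<Omega>"] \<Omega>(2) by auto
  note fin = finite_exterior_components[OF \<Omega>]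
  obtain f where f: "bij_betw f {0..<m} (components (- closure \<Omega>))"
    using ex_bij_betw_nat_finite[OF fin] m by blast
  have m0: "0 < m" using C(1) fin m by (auto simp: card_gt_0_iff)
  obtain i where i: "i \<in> {0..<m}" "f i = C" using f C(1) by (metis bij_betw_imp_surj_on imageE)
  have t: "bij_betw (Transposition.transpose 0 i) {0..<m} {0..<m}"
    by (rule bij_betw_transpose_iff) (use i m0 in auto)
  show ?thesis
  proof (rule that[of "f \<circ> Transposition.transpose 0 i"])
    show "bij_betw (f \<circ> Transposition.transpose 0 i) {0..<m} (components (- closure \<Omega>))" by (rule bij_betw_trans[OF t f])
    show "\<not> bounded ((f \<circ> Transposition.transpose 0 i) 0)" using i(2) C(2) by simp
  qed
qed

text \<open>Closures of distinct components are disjoint, so the sets of points nearer to one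
  closure than to all others separate them. For positive indices the closures are compact, which
  allows cutoffs supported in these sets.\<close>

lemma strong_cutoffs:
  assumes \<Omega>: "open \<Omega>" "bounded \<Omega>" "continuous_boundary \<Omega>"
    and \<Xi>: "bij_betw \<Xi> {0..<m} (components (- closure \<Omega>))" "\<not> bounded (\<Xi> 0)"
  obtains \<xi> where "exterior_cutoffs \<Omega> m \<Xi> \<xi>"
    "\<And>l k. l \<in> {1..<m} \<Longrightarrow> k < m \<Longrightarrow> \<exists>U. open U \<and> closure (\<Xi> k) \<subseteq> U \<and> (\<forall>x\<in>U. \<xi> l x = (if k = l then 1 else 0))"
proof -
  have comp: "\<Xi> k \<in> components (- closure \<Omega>)" if "k < m" for k using \<Xi>(1) that by (auto simp: bij_betw_def)
  have inj: "\<Xi> k \<noteq> \<Xi> l" if "k < m" "l < m" "k \<noteq> l" for k l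
    using \<Xi>(1) that by (auto simp: bij_betw_def inj_on_def)
  define C where "C k = closure (\<Xi> k)" for k
  have Cne: "C k \<noteq> {}" if "k < m" for k using in_components_nonempty[OF comp[OF that]] by (simp add: C_def)
  have Cd: "C k \<inter> C l = {}" if "k < m" "l < m" "k \<noteq> l" for k l
    unfolding C_def by (rule disjoint_component_closures[OF \<Omega>(1,3) comp comp inj]) (use that in auto)
  define D where "D k = (\<Union>l\<in>{0..<m} - {k}. C l)" for k
  have Dc: "closed (D k)" for k unfolding D_def C_def by (intro closed_UN) auto
  define U where "U k = {x. infdist x (C k) < infdist x (D k)}" for k
  have oU: "open (U k)" for k unfolding U_def by (intro open_Collect_less continuous_intros)
  \<comment> \<open>A second index is required because \<open>infdist\<close> from the empty set is
    0 by convention, in which case \<open>U k\<close> would be empty.\<close>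
  have CU: "C k \<subseteq> U k" if k: "k < m" and l: "l < m" "l \<noteq> k" for k l
  proof
    fix x assume x: "x \<in> C k"
    have "x \<notin> D k"
    proof
      assume "x \<in> D k"
      then obtain q where "q \<in> {0..<m} - {k}" "x \<in> C q" unfolding D_def by (rule UN_E)
      then show False using Cd[of k q] x k by auto
    qed
    moreover have "D k \<noteq> {}" using Cne[OF l(1)] l by (auto simp: D_def)
    ultimately have "0 < infdist x (D k)" by (intro infdist_pos_not_in_closed[OF Dc])
    moreover have "infdist x (C k) = 0" using x by (rule infdist_zero)
    ultimately show "x \<in> U k" by (simp add: U_def)
  qed
  have Ud: "U k \<inter> U l = {}" if k: "k < m" and l: "l < m" "l \<noteq> k" for k l
  proof -
    have "infdist x (D k) \<le> infdist x (C l)" for x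
      by (rule infdist_mono) (use Cne[OF l(1)] l in \<open>auto simp: D_def\<close>)
    moreover have "infdist x (D l) \<le> infdist x (C k)" for x
      by (rule infdist_mono) (use Cne[OF k] k l in \<open>auto simp: D_def\<close>)
    ultimately show ?thesis unfolding U_def by (auto simp: disjoint_iff) (smt (verit))
  qed
  \<comment> \<open>The complement of a bounded set in dimension three has only one unbounded
    component, and index 0 is taken by it.\<close>
  have Ccomp: "compact (C l)" if l: "l \<in> {1..<m}" for l
  proof -
    have "bounded (\<Xi> l)"
    proof (rule ccontr)
      assume "\<not> bounded (\<Xi> l)"
      then have "\<Xi> l = \<Xi> 0"
        using cobounded_unique_unbounded_components[of "- closure \<Omega>" "\<Xi> 0" "\<Xi> l"] comp[of 0] comp[of l] l \<Xi>(2) \<Omega>(2) by auto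
      then show False using inj[of l 0] l by auto
    qed
    then show ?thesis by (simp add: C_def)
  qed
  have "\<exists>\<eta> N. \<eta> \<in> test_fields (U l) \<and> open N \<and> C l \<subseteq> N \<and> (\<forall>x\<in>N. \<eta> x = (1::real))" if l: "l \<in> {1..<m}" for l
  proof -
    have "C l \<subseteq> U l" using CU[of l 0] l by auto
    then obtain \<eta> N where "\<eta> \<in> test_fields (U l)" "open N" "C l \<subseteq> N" "\<And>x. x \<in> N \<Longrightarrow> \<eta> x = (1::real)"
      by (rule cutoff_exists[OF Ccomp[OF l] oU]) (rule that)
    then show ?thesis by blast
  qed
  then obtain \<xi> N where x: "\<And>l. l \<in> {1..<m} \<Longrightarrow> \<xi> l \<in> test_fields (U l)" "\<And>l. l \<in> {1..<m} \<Longrightarrow> open (N l)"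
    "\<And>l. l \<in> {1..<m} \<Longrightarrow> C l \<subseteq> N l" "\<And>l x. l \<in> {1..<m} \<Longrightarrow> x \<in> N l \<Longrightarrow> \<xi> l x = (1::real)" by metis
  have key: "\<exists>V. open V \<and> closure (\<Xi> k) \<subseteq> V \<and> (\<forall>x\<in>V. \<xi> l x = (if k = l then 1 else 0))"
    if l: "l \<in> {1..<m}" and k: "k < m" for l k
  proof (cases "k = l")
    case True
    then show ?thesis using x(2,3)[OF l] x(4)[OF l] unfolding C_def by (intro exI[of _ "N l"]) auto
  next
    case False
    have "U l \<inter> U k = {}" using Ud[of l k] l k False by auto
    then have "\<forall>x\<in>U k. \<xi> l x = 0" using test_fields_outside[OF x(1)[OF l]] by blast
    moreover have "C k \<subseteq> U k" using CU[of k l] l k False by auto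
    ultimately show ?thesis using oU False unfolding C_def by (intro exI[of _ "U k"]) auto
  qed
  have "exterior_cutoffs \<Omega> m \<Xi> \<xi>"
    unfolding exterior_cutoffs_def
  proof (intro conjI ballI impI)
    show "\<xi> l \<in> test_fields UNIV" if "l \<in> {1..<m}" for l by (rule test_fields_UNIV[OF x(1)[OF that]])
    show "supp (\<xi> l) \<inter> supp (\<xi> k) = {}" if l: "l \<in> {1..<m}" and k: "k \<in> {1..<m}" "l \<noteq> k" for l k
    proof -
      have "supp (\<xi> l) \<subseteq> U l" "supp (\<xi> k) \<subseteq> U k" using x(1) l k by (auto simp: test_fields_def)
      then show ?thesis using Ud[of l k] l k by auto
    qed
    show "\<exists>V. open V \<and> \<Xi> l \<subseteq> V \<and> (\<forall>x\<in>V. \<xi> l x = 1)" if l: "l \<in> {1..<m}" for l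
    proof -
      obtain V where V: "open V" "closure (\<Xi> l) \<subseteq> V" "\<forall>x\<in>V. \<xi> l x = (if l = l then 1 else 0)"
        using key[OF l, of l] l by auto
      have "\<Xi> l \<subseteq> V" by (rule order_trans[OF closure_subset V(2)])
      then show ?thesis using V(1,3) by (intro exI[of _ V]) simp
    qed
    show "\<exists>V. open V \<and> \<Xi> k \<subseteq> V \<and> (\<forall>x\<in>V. \<xi> l x = 0)" if l: "l \<in> {1..<m}" and k: "k \<in> {0..<m} - {l}" for l k
    proof -
      obtain V where V: "open V" "closure (\<Xi> k) \<subseteq> V" "\<forall>x\<in>V. \<xi> l x = (if k = l then 1 else 0)"
        using key[OF l, of k] k by auto
      have "\<Xi> k \<subseteq> V" by (rule order_trans[OF closure_subset V(2)])
      then show ?thesis using V(1,3) k by (intro exI[of _ V]) simp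
    qed
  qed (use \<Xi> in auto)
  then show ?thesis using key that by blast
qed

subsection \<open>Weak derivatives of restricted jets\<close>

text \<open>Truncation on classes, the counterpart of \<open>restr\<close> on functions. As a
  bounded operator it can be interchanged with limits of jets.\<close>

definition ext0 :: "(real^3) set \<Rightarrow> 'b::euclidean_space L2 \<Rightarrow> 'b L2" where
  "ext0 \<Omega> = pw (\<lambda>x v. indicator \<Omega> x *\<^sub>R v)"

lemma bounded_linear_ext0: "open \<Omega> \<Longrightarrow> bounded_linear (ext0 \<Omega>)"
  unfolding ext0_def by (rule bounded_linear_pw[OF pw_bounded_indicator]) auto

lemma ext0_L2_on:
  assumes "open \<Omega>"
  shows "ext0 \<Omega> u \<in> L2_on \<Omega>"
proof -
  have "AE x in lborel. rep_L2 (ext0 \<Omega> u) x = indicator \<Omega> x *\<^sub>R rep_L2 u x"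
    unfolding ext0_def by (rule rep_pw[OF pw_bounded_indicator]) (use assms in auto)
  then have "AE x in lborel. x \<notin> \<Omega> \<longrightarrow> rep_L2 (ext0 \<Omega> u) x = 0" by eventually_elim simp
  then show ?thesis by (simp add: L2_on_def)
qed

lemma ext0_id: "open \<Omega> \<Longrightarrow> u \<in> L2_on \<Omega> \<Longrightarrow> ext0 \<Omega> u = u"
  using L2_on_iff[of \<Omega> u] unfolding ext0_def by auto

lemma restr_ext0: "open \<Omega> \<Longrightarrow> square_integrable f \<Longrightarrow> restr \<Omega> f = ext0 \<Omega> (abs_L2 f)"
  unfolding ext0_def by (rule restr_pw) auto

lemma inner_restr_test:
  fixes f \<psi> :: "real^3 \<Rightarrow> 'b::euclidean_space"
  assumes "open \<Omega>" "square_integrable f" "\<psi> \<in> test_fields \<Omega>"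
  shows "restr \<Omega> f \<bullet> restr \<Omega> \<psi> = (LINT x|lborel. f x \<bullet> \<psi> x)"
proof -
  note sq = test_fields_square_integrable[OF assms(3)]
  have O: "\<Omega> \<in> sets borel" using assms(1) by auto
  have "restr \<Omega> \<psi> \<in> L2_on \<Omega>" by (rule restr_L2_on[OF O sq])
  then have "restr \<Omega> \<psi> \<bullet> restr \<Omega> f = restr \<Omega> \<psi> \<bullet> abs_L2 f" by (rule inner_L2_on_restr[OF O assms(2)])
  then show ?thesis unfolding restr_test[OF assms(3)] by (simp add: abs_inner[OF sq assms(2)] inner_commute)
qed

lemma test_fields_diverg: "v \<in> test_fields \<Omega> \<Longrightarrow> diverg v \<in> test_fields \<Omega>"
  unfolding diverg_def[abs_def] by (intro test_fields_sum test_fields_partial_deriv test_fields_nth)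

lemma test_fields_Div: "T \<in> test_fields \<Omega> \<Longrightarrow> Div T \<in> test_fields \<Omega>"
  unfolding Div_def[abs_def] by (intro test_fields_vec test_fields_diverg test_fields_nth)

lemma integral_diverg:
  fixes \<phi> :: "real^3 \<Rightarrow> real"
  assumes \<phi>: "smooth \<phi>" and v: "v \<in> test_fields \<Omega>"
  shows "(LINT x|lborel. \<phi> x * diverg v x) = - (\<Sum>i\<in>UNIV. LINT x|lborel. partial_deriv i \<phi> x * v x $ i)"
proof -
  note tv = test_fields_nth[OF v]
  have "(LINT x|lborel. \<phi> x * diverg v x) = (LINT x|lborel. (\<Sum>i\<in>UNIV. \<phi> x * partial_deriv i (\<lambda>y. v y $ i) x))"
    by (simp add: diverg_def sum_distrib_left)
  also have "\<dots> = (\<Sum>i\<in>UNIV. LINT x|lborel. \<phi> x * partial_deriv i (\<lambda>y. v y $ i) x)"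
    by (rule Bochner_Integration.integral_sum[OF test_fields_integrable[OF test_fields_smooth_mult[OF \<phi> test_fields_partial_deriv[OF tv]]]])
  also have "\<dots> = (\<Sum>i\<in>UNIV. - (LINT x|lborel. partial_deriv i \<phi> x * v x $ i))"
    by (intro sum.cong refl integral_by_parts[OF \<phi> tv])
  finally show ?thesis by (simp add: sum_negf)
qed

text \<open>The function \<phi> need not vanish at the boundary of \<Omega>; the boundary terms
  disappear because the field tested against has compact support in \<Omega>.\<close>

lemma weak_derivatives_test:
  assumes \<Omega>: "open \<Omega>" and \<phi>: "\<phi> \<in> test_fields UNIV"
  shows "v \<in> test_fields \<Omega> \<Longrightarrow> restr \<Omega> \<phi> \<bullet> restr \<Omega> (diverg v) = - (restr \<Omega> (grad \<phi>) \<bullet> restr \<Omega> v)"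
    and "\<Phi> \<in> test_fields \<Omega> \<Longrightarrow> restr \<Omega> \<phi> \<bullet> restr \<Omega> (diverg (Div \<Phi>)) = restr \<Omega> (hess \<phi>) \<bullet> restr \<Omega> \<Phi>"
proof -
  note s = test_fields_smooth[OF \<phi>] and sq = test_fields_square_integrable
  show "restr \<Omega> \<phi> \<bullet> restr \<Omega> (diverg v) = - (restr \<Omega> (grad \<phi>) \<bullet> restr \<Omega> v)" if v: "v \<in> test_fields \<Omega>"
  proof -
    have "(LINT x|lborel. grad \<phi> x \<bullet> v x) = (LINT x|lborel. (\<Sum>i\<in>UNIV. partial_deriv i \<phi> x * v x $ i))"
      by (simp add: grad_def inner_vec_def)
    also have "\<dots> = (\<Sum>i\<in>UNIV. LINT x|lborel. partial_deriv i \<phi> x * v x $ i)"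
      by (rule Bochner_Integration.integral_sum[OF test_fields_integrable[OF test_fields_smooth_mult[OF smooth_partial_deriv[OF s] test_fields_nth[OF v]]]])
    finally show ?thesis
      unfolding inner_restr_test[OF \<Omega> sq[OF \<phi>] test_fields_diverg[OF v]] inner_restr_test[OF \<Omega> sq[OF test_fields_grad[OF \<phi>]] v]
      by (simp add: integral_diverg[OF s v])
  qed
  show "restr \<Omega> \<phi> \<bullet> restr \<Omega> (diverg (Div \<Phi>)) = restr \<Omega> (hess \<phi>) \<bullet> restr \<Omega> \<Phi>" if \<Phi>: "\<Phi> \<in> test_fields \<Omega>"
  proof -
    have i: "integrable lborel (\<lambda>x. partial_deriv j (partial_deriv i \<phi>) x * \<Phi> x $ i $ j)" for i j
      by (rule test_fields_integrable[OF test_fields_smooth_mult[OF smooth_partial_deriv[OF smooth_partial_deriv[OF s]] test_fields_nth[OF test_fields_nth[OF \<Phi>]]]])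
    have "(LINT x|lborel. \<phi> x * diverg (Div \<Phi>) x) = - (\<Sum>i\<in>UNIV. LINT x|lborel. partial_deriv i \<phi> x * diverg (\<lambda>y. \<Phi> y $ i) x)"
      unfolding integral_diverg[OF s test_fields_Div[OF \<Phi>]] by (simp add: Div_def)
    also have "\<dots> = (\<Sum>i\<in>UNIV. \<Sum>j\<in>UNIV. LINT x|lborel. partial_deriv j (partial_deriv i \<phi>) x * \<Phi> x $ i $ j)"
      unfolding integral_diverg[OF smooth_partial_deriv[OF s] test_fields_nth[OF \<Phi>]] by (simp add: sum_negf)
    also have "\<dots> = (LINT x|lborel. (\<Sum>i\<in>UNIV. \<Sum>j\<in>UNIV. partial_deriv j (partial_deriv i \<phi>) x * \<Phi> x $ i $ j))"
      using i by (simp add: Bochner_Integration.integral_sum integrable_sum)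
    also have "\<dots> = (LINT x|lborel. hess \<phi> x \<bullet> \<Phi> x)"
    proof -
      have "(\<Sum>i\<in>UNIV. \<Sum>j\<in>UNIV. partial_deriv j (partial_deriv i \<phi>) x * \<Phi> x $ i $ j) = hess \<phi> x \<bullet> \<Phi> x" for x
        unfolding partial_deriv_commute[OF s, of _ _ x, symmetric] by (simp add: hess_def inner_vec_def partial_deriv_commute[OF s])
      then show ?thesis by simp
    qed
    finally show ?thesis
      unfolding inner_restr_test[OF \<Omega> sq[OF \<phi>] test_fields_diverg[OF test_fields_Div[OF \<Phi>]]]
        inner_restr_test[OF \<Omega> sq[OF test_fields_hess[OF \<phi>]] \<Phi>] by simp
  qed
qed

lemma weak_derivatives_W:
  assumes \<Omega>: "open \<Omega>" and w: "w \<in> W UNIV"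
  shows "is_weak_grad \<Omega> (ext0 \<Omega> (jfun w)) (ext0 \<Omega> (jgrad w))" "is_weak_hess \<Omega> (ext0 \<Omega> (jfun w)) (ext0 \<Omega> (jhess w))"
proof -
  obtain \<phi> where \<phi>: "\<And>n. \<phi> n \<in> test_fields UNIV" "(\<lambda>n. abs_L2 (J (\<phi> n))) \<longlonglongrightarrow> w" by (rule W_sequence[OF w]) (rule that)
  note sq = test_fields_square_integrable
  have l0: "(\<lambda>n. restr \<Omega> (\<phi> n)) \<longlonglongrightarrow> ext0 \<Omega> (jfun w)"
    using bounded_linear.tendsto[OF bounded_linear_compose[OF bounded_linear_ext0[OF \<Omega>] bounded_linear_j(1)] \<phi>(2)]
    by (simp add: j_J[OF sq_J[OF \<phi>(1)]] restr_ext0[OF \<Omega> sq[OF \<phi>(1)]])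
  have l1: "(\<lambda>n. restr \<Omega> (grad (\<phi> n))) \<longlonglongrightarrow> ext0 \<Omega> (jgrad w)"
    using bounded_linear.tendsto[OF bounded_linear_compose[OF bounded_linear_ext0[OF \<Omega>] bounded_linear_j(2)] \<phi>(2)]
    by (simp add: j_J[OF sq_J[OF \<phi>(1)]] restr_ext0[OF \<Omega> sq[OF test_fields_grad[OF \<phi>(1)]]])
  have l2: "(\<lambda>n. restr \<Omega> (hess (\<phi> n))) \<longlonglongrightarrow> ext0 \<Omega> (jhess w)"
    using bounded_linear.tendsto[OF bounded_linear_compose[OF bounded_linear_ext0[OF \<Omega>] bounded_linear_j(3)] \<phi>(2)]
    by (simp add: j_J[OF sq_J[OF \<phi>(1)]] restr_ext0[OF \<Omega> sq[OF test_fields_hess[OF \<phi>(1)]]])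
  show "is_weak_grad \<Omega> (ext0 \<Omega> (jfun w)) (ext0 \<Omega> (jgrad w))"
    unfolding is_weak_grad_def
  proof (intro conjI ballI ext0_L2_on[OF \<Omega>])
    fix v :: "real^3 \<Rightarrow> real^3" assume v: "v \<in> test_fields \<Omega>"
    have "(\<lambda>n. restr \<Omega> (\<phi> n) \<bullet> restr \<Omega> (diverg v)) \<longlonglongrightarrow> ext0 \<Omega> (jfun w) \<bullet> restr \<Omega> (diverg v)"
      by (intro tendsto_inner l0 tendsto_const)
    moreover have "(\<lambda>n. - (restr \<Omega> (grad (\<phi> n)) \<bullet> restr \<Omega> v)) \<longlonglongrightarrow> - (ext0 \<Omega> (jgrad w) \<bullet> restr \<Omega> v)"
      by (intro tendsto_minus tendsto_inner l1 tendsto_const)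
    ultimately show "ext0 \<Omega> (jfun w) \<bullet> restr \<Omega> (diverg v) = - (ext0 \<Omega> (jgrad w) \<bullet> restr \<Omega> v)"
      unfolding weak_derivatives_test(1)[OF \<Omega> \<phi>(1) v] by (rule LIMSEQ_unique)
  qed
  show "is_weak_hess \<Omega> (ext0 \<Omega> (jfun w)) (ext0 \<Omega> (jhess w))"
    unfolding is_weak_hess_def
  proof (intro conjI ballI ext0_L2_on[OF \<Omega>])
    fix \<Phi> :: "real^3 \<Rightarrow> real^3^3" assume \<Phi>: "\<Phi> \<in> test_fields \<Omega>"
    have "(\<lambda>n. restr \<Omega> (\<phi> n) \<bullet> restr \<Omega> (diverg (Div \<Phi>))) \<longlonglongrightarrow> ext0 \<Omega> (jfun w) \<bullet> restr \<Omega> (diverg (Div \<Phi>))"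
      by (intro tendsto_inner l0 tendsto_const)
    moreover have "(\<lambda>n. restr \<Omega> (hess (\<phi> n)) \<bullet> restr \<Omega> \<Phi>) \<longlonglongrightarrow> ext0 \<Omega> (jhess w) \<bullet> restr \<Omega> \<Phi>"
      by (intro tendsto_inner l2 tendsto_const)
    ultimately show "ext0 \<Omega> (jfun w) \<bullet> restr \<Omega> (diverg (Div \<Phi>)) = ext0 \<Omega> (jhess w) \<bullet> restr \<Omega> \<Phi>"
      unfolding weak_derivatives_test(2)[OF \<Omega> \<phi>(1) \<Phi>] by (rule LIMSEQ_unique)
  qed
qed

section \<open>Uniqueness of weak derivatives; jets and the space \<open>H20\<close>\<close>

text \<open>Uniqueness of weak derivatives rests on this; it resolves the definite descriptions in
  \<open>weak_grad\<close> and \<open>Gradgrad\<close>.\<close>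

lemma L2_on_eqI:
  fixes g g' :: "'b::euclidean_space L2"
  assumes \<Omega>: "open \<Omega>" and g: "g \<in> L2_on \<Omega>" "g' \<in> L2_on \<Omega>"
    and e: "\<And>\<Phi>. \<Phi> \<in> test_fields \<Omega> \<Longrightarrow> g \<bullet> restr \<Omega> \<Phi> = g' \<bullet> restr \<Omega> \<Phi>"
  shows "g = g'"
proof -
  have "g - g' = 0"
  proof (rule test_fields_orthogonal_zero[OF \<Omega> subspace_diff[OF subspace_L2_on g]])
    fix \<Phi> :: "real^3 \<Rightarrow> 'b" assume \<Phi>: "\<Phi> \<in> test_fields \<Omega>"
    show "(g - g') \<bullet> abs_L2 \<Phi> = 0" using e[OF \<Phi>] by (simp add: restr_test[OF \<Phi>] inner_diff_left)
  qed
  then show ?thesis by simp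
qed

lemma weak_grad_eq: "open \<Omega> \<Longrightarrow> is_weak_grad \<Omega> u g \<Longrightarrow> weak_grad \<Omega> u = g"
  unfolding weak_grad_def is_weak_grad_def
  by (rule the_equality) (auto intro!: L2_on_eqI[of \<Omega>])

lemma Gradgrad_eq: "open \<Omega> \<Longrightarrow> is_weak_hess \<Omega> u T \<Longrightarrow> Gradgrad \<Omega> u = T"
  unfolding Gradgrad_def is_weak_hess_def
  by (rule the_equality) (auto intro!: L2_on_eqI[of \<Omega>])

lemma is_weak_hess_diff:
  "is_weak_hess \<Omega> u T \<Longrightarrow> is_weak_hess \<Omega> u' T' \<Longrightarrow> is_weak_hess \<Omega> (u - u') (T - T')"
  unfolding is_weak_hess_def by (auto simp: inner_diff_left subspace_diff[OF subspace_L2_on])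

lemma H2_W:
  assumes "open \<Omega>" "w \<in> W UNIV"
  shows "ext0 \<Omega> (jfun w) \<in> H2 \<Omega>" "Gradgrad \<Omega> (ext0 \<Omega> (jfun w)) = ext0 \<Omega> (jhess w)"
    "weak_grad \<Omega> (ext0 \<Omega> (jfun w)) = ext0 \<Omega> (jgrad w)"
  using weak_derivatives_W[OF assms] ext0_L2_on[OF assms(1)] weak_grad_eq[OF assms(1)] Gradgrad_eq[OF assms(1)]
  by (auto simp: H2_def)

lemma W_ext0:
  assumes \<Omega>: "open \<Omega>" and w: "w \<in> W \<Omega>"
  shows "ext0 \<Omega> (jfun w) = jfun w" "ext0 \<Omega> (jgrad w) = jgrad w" "ext0 \<Omega> (jhess w) = jhess w"
proof -
  obtain \<phi> where \<phi>: "\<And>n. \<phi> n \<in> test_fields \<Omega>" "(\<lambda>n. abs_L2 (J (\<phi> n))) \<longlonglongrightarrow> w" by (rule W_sequence[OF w]) (rule that)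
  note l = bounded_linear.tendsto[OF _ \<phi>(2)]
  show "ext0 \<Omega> (jfun w) = jfun w"
    by (rule ext0_id[OF \<Omega> L2_limit_on[OF \<Omega> \<phi>(1)]]) (use l[OF bounded_linear_j(1)] in \<open>simp add: j_J[OF sq_J[OF \<phi>(1)]]\<close>)
  show "ext0 \<Omega> (jgrad w) = jgrad w"
    by (rule ext0_id[OF \<Omega> L2_limit_on[OF \<Omega> test_fields_grad[OF \<phi>(1)]]]) (use l[OF bounded_linear_j(2)] in \<open>simp add: j_J[OF sq_J[OF \<phi>(1)]]\<close>)
  show "ext0 \<Omega> (jhess w) = jhess w"
    by (rule ext0_id[OF \<Omega> L2_limit_on[OF \<Omega> test_fields_hess[OF \<phi>(1)]]]) (use l[OF bounded_linear_j(3)] in \<open>simp add: j_J[OF sq_J[OF \<phi>(1)]]\<close>)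
qed

lemma W_UNIV: "w \<in> W \<Omega> \<Longrightarrow> w \<in> W UNIV"
  using W_mono[of \<Omega> UNIV] by auto

lemma W_derivatives:
  assumes "open \<Omega>" "w \<in> W \<Omega>"
  shows "jfun w \<in> H2 \<Omega>" "Gradgrad \<Omega> (jfun w) = jhess w" "weak_grad \<Omega> (jfun w) = jgrad w"
  using H2_W[OF assms(1) W_UNIV[OF assms(2)]] unfolding W_ext0[OF assms] .

lemma j_diff: "jfun (a - b) = jfun a - jfun b" "jgrad (a - b) = jgrad a - jgrad b" "jhess (a - b) = jhess a - jhess b"
  by (rule linear_diff[OF bounded_linear.linear[OF bounded_linear_j(1)]] linear_diff[OF bounded_linear.linear[OF bounded_linear_j(2)]]
     linear_diff[OF bounded_linear.linear[OF bounded_linear_j(3)]])+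

text \<open>Convergence of jets is convergence in \<open>H2_norm\<close>, which gives one inclusion.
  Conversely the Hessians of the approximating test functions converge, their limit is the Hessian
  of some \<open>w\<close> in \<open>W \<Omega>\<close>, and Friedrichs' inequality makes the jets
  themselves converge to \<open>w\<close>.\<close>

lemma H20_eq:
  assumes \<Omega>: "open \<Omega>" "bounded \<Omega>"
  shows "H20 \<Omega> = jfun ` W \<Omega>"
proof
  show "jfun ` W \<Omega> \<subseteq> H20 \<Omega>"
  proof (rule image_subsetI)
    fix w assume w: "w \<in> W \<Omega>"
    obtain \<phi> where \<phi>: "\<And>n. \<phi> n \<in> test_fields \<Omega>" "(\<lambda>n. abs_L2 (J (\<phi> n))) \<longlonglongrightarrow> w" by (rule W_sequence[OF w]) (rule that)
    define z where "z n = w - abs_L2 (J (\<phi> n))" for n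
    have zW: "z n \<in> W \<Omega>" for n unfolding z_def by (rule subspace_diff[OF subspace_W w W_J[OF \<phi>(1)]])
    have z0: "z \<longlonglongrightarrow> 0" unfolding z_def[abs_def] using tendsto_diff[OF tendsto_const \<phi>(2), of w] by simp
    have e: "H2_norm \<Omega> (jfun w - restr \<Omega> (\<phi> n)) = sqrt ((norm (jfun (z n)))\<^sup>2 + (norm (jgrad (z n)))\<^sup>2 + (norm (jhess (z n)))\<^sup>2)" for n
    proof -
      have "jfun w - restr \<Omega> (\<phi> n) = jfun (z n)"
        unfolding restr_test[OF \<phi>(1)] z_def j_diff j_J[OF sq_J[OF \<phi>(1)]] ..
      then show ?thesis unfolding H2_norm_def by (simp only: W_derivatives(2,3)[OF \<Omega>(1) zW])
    qed
    have j0: "(\<lambda>n. norm (j (z n))) \<longlonglongrightarrow> 0" if "bounded_linear j" for j :: "jet L2 \<Rightarrow> 'b::real_normed_vector"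
      using tendsto_norm[OF bounded_linear.tendsto[OF that z0]] linear_0[OF bounded_linear.linear[OF that]] by simp
    have "(\<lambda>n. sqrt ((norm (jfun (z n)))\<^sup>2 + (norm (jgrad (z n)))\<^sup>2 + (norm (jhess (z n)))\<^sup>2)) \<longlonglongrightarrow> sqrt (0\<^sup>2 + 0\<^sup>2 + 0\<^sup>2)"
      by (intro tendsto_intros j0 bounded_linear_j)
    then have "(\<lambda>n. H2_norm \<Omega> (jfun w - restr \<Omega> (\<phi> n))) \<longlonglongrightarrow> 0" unfolding e by simp
    moreover have "jfun w \<in> H2 \<Omega>" by (rule W_derivatives(1)[OF \<Omega>(1) w])
    ultimately show "jfun w \<in> H20 \<Omega>" unfolding H20_def using \<phi>(1) by blast
  qed
  show "H20 \<Omega> \<subseteq> jfun ` W \<Omega>"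
  proof
    fix u assume u: "u \<in> H20 \<Omega>"
    then obtain \<phi> where \<phi>: "\<And>n. \<phi> n \<in> test_fields \<Omega>" "(\<lambda>n. H2_norm \<Omega> (u - restr \<Omega> (\<phi> n))) \<longlonglongrightarrow> 0"
      unfolding H20_def by blast
    from u obtain T where T: "is_weak_hess \<Omega> u T" by (auto simp: H20_def H2_def)
    note r = restr_test[OF \<phi>(1)] restr_test[OF test_fields_hess[OF \<phi>(1)]]
    have G: "Gradgrad \<Omega> (u - restr \<Omega> (\<phi> n)) = T - abs_L2 (hess (\<phi> n))" for n
    proof (rule Gradgrad_eq[OF \<Omega>(1) is_weak_hess_diff[OF T]])
      have "is_weak_hess \<Omega> (ext0 \<Omega> (jfun (abs_L2 (J (\<phi> n))))) (ext0 \<Omega> (jhess (abs_L2 (J (\<phi> n)))))"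
        by (rule weak_derivatives_W(2)[OF \<Omega>(1) W_UNIV[OF W_J[OF \<phi>(1)]]])
      then show "is_weak_hess \<Omega> (restr \<Omega> (\<phi> n)) (abs_L2 (hess (\<phi> n)))"
        unfolding W_ext0[OF \<Omega>(1) W_J[OF \<phi>(1)]] unfolding j_J[OF sq_J[OF \<phi>(1)]] r .
    qed
    have b: "norm (u - abs_L2 (\<phi> n)) \<le> H2_norm \<Omega> (u - restr \<Omega> (\<phi> n))" "norm (T - abs_L2 (hess (\<phi> n))) \<le> H2_norm \<Omega> (u - restr \<Omega> (\<phi> n))" for n
      unfolding H2_norm_def G unfolding r by (auto intro!: real_le_rsqrt)
    have l0: "(\<lambda>n. u - abs_L2 (\<phi> n)) \<longlonglongrightarrow> 0" by (rule Lim_null_comparison[OF always_eventually \<phi>(2)]) (use b in auto)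
    have l2: "(\<lambda>n. T - abs_L2 (hess (\<phi> n))) \<longlonglongrightarrow> 0" by (rule Lim_null_comparison[OF always_eventually \<phi>(2)]) (use b in auto)
    have l2': "(\<lambda>n. abs_L2 (hess (\<phi> n))) \<longlonglongrightarrow> T" using tendsto_diff[OF tendsto_const l2, of T] by simp
    have "T \<in> jhess ` W \<Omega>"
    proof (rule closed_sequentially[OF closed_hess_range[OF \<Omega>(2)] _ l2'])
      show "abs_L2 (hess (\<phi> n)) \<in> jhess ` W \<Omega>" for n
        unfolding j_J(3)[OF sq_J[OF \<phi>(1)], symmetric] by (rule imageI[OF W_J[OF \<phi>(1)]])
    qed
    then obtain w where w: "w \<in> W \<Omega>" "T = jhess w" by blast
    obtain C where C: "0 < C" "\<And>w. w \<in> W \<Omega> \<Longrightarrow> norm w \<le> C * norm (jhess w)" by (rule friedrichs[OF \<Omega>(2)]) (rule that)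
    have "(\<lambda>n. w - abs_L2 (J (\<phi> n))) \<longlonglongrightarrow> 0"
    proof (rule Lim_null_comparison[OF always_eventually])
      show "\<forall>n. norm (w - abs_L2 (J (\<phi> n))) \<le> C * norm (T - abs_L2 (hess (\<phi> n)))"
        using C(2)[OF subspace_diff[OF subspace_W w(1) W_J[OF \<phi>(1)]]] by (simp add: j_diff j_J[OF sq_J[OF \<phi>(1)]] w(2))
      show "(\<lambda>n. C * norm (T - abs_L2 (hess (\<phi> n)))) \<longlonglongrightarrow> 0"
        using tendsto_mult[OF tendsto_const tendsto_norm[OF l2], of C] by simp
    qed
    from bounded_linear.tendsto[OF bounded_linear_j(1) this]
    have "(\<lambda>n. jfun w - abs_L2 (\<phi> n)) \<longlonglongrightarrow> 0"
      by (simp add: j_diff j_J[OF sq_J[OF \<phi>(1)]] linear_0[OF bounded_linear.linear[OF bounded_linear_j(1)]])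
    from tendsto_diff[OF this l0] have "(\<lambda>n. jfun w - u) \<longlonglongrightarrow> 0" by simp
    then have "jfun w = u" by (simp add: LIMSEQ_const_iff)
    then show "u \<in> jfun ` W \<Omega>" using w(1) by blast
  qed
qed

subsection \<open>The kernel of \<open>divDiv_S\<close> and its orthogonal projector\<close>

lemma pw_bounded_transpose: "pw_bounded (\<lambda>x. transpose :: real^3^3 \<Rightarrow> real^3^3)"
proof (rule pw_bounded_linear)
  have "linear (transpose :: real^3^3 \<Rightarrow> real^3^3)"
    by (rule linearI) (simp_all add: transpose_def vec_eq_iff)
  then show "bounded_linear (transpose :: real^3^3 \<Rightarrow> real^3^3)" by (simp add: linear_conv_bounded_linear)
qed

lemma L2_S_iff: "T \<in> L2_S \<Omega> \<longleftrightarrow> T \<in> L2_on \<Omega> \<and> pw (\<lambda>x. transpose) T = T"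
proof -
  have r: "AE x in lborel. rep_L2 (pw (\<lambda>x. transpose) T) x = transpose (rep_L2 T x)" by (rule rep_pw[OF pw_bounded_transpose])
  have "(AE x in lborel. transpose (rep_L2 T x) = rep_L2 T x) \<longleftrightarrow> pw (\<lambda>x. transpose) T = T"
    unfolding L2_eq_iff_rep[of "pw (\<lambda>x. transpose) T"]
  proof
    assume "AE x in lborel. transpose (rep_L2 T x) = rep_L2 T x"
    with r show "AE x in lborel. rep_L2 (pw (\<lambda>x. transpose) T) x = rep_L2 T x" by eventually_elim simp
  next
    assume "AE x in lborel. rep_L2 (pw (\<lambda>x. transpose) T) x = rep_L2 T x"
    with r show "AE x in lborel. transpose (rep_L2 T x) = rep_L2 T x" by eventually_elim simp
  qed
  then show ?thesis by (simp add: L2_S_def)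
qed

lemma subspace_L2_S: "subspace (L2_S \<Omega>)"
proof -
  note bl = bounded_linear.linear[OF bounded_linear_pw[OF pw_bounded_transpose]]
  show ?thesis
    by (rule subspaceI)
      (auto simp: L2_S_iff subspace_0[OF subspace_L2_on] subspace_add[OF subspace_L2_on] subspace_scale[OF subspace_L2_on]
        linear_0[OF bl] linear_add[OF bl] linear_scale[OF bl])
qed

lemma hess_transpose_W:
  assumes "w \<in> W UNIV"
  shows "pw (\<lambda>x. transpose) (jhess w) = jhess w"
proof -
  obtain \<phi> where \<phi>: "\<And>n. \<phi> n \<in> test_fields UNIV" "(\<lambda>n. abs_L2 (J (\<phi> n))) \<longlonglongrightarrow> w" by (rule W_sequence[OF assms]) (rule that)
  have l: "(\<lambda>n. abs_L2 (hess (\<phi> n))) \<longlonglongrightarrow> jhess w"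
    using bounded_linear.tendsto[OF bounded_linear_j(3) \<phi>(2)] by (simp add: j_J[OF sq_J[OF \<phi>(1)]])
  have "pw (\<lambda>x. transpose) (abs_L2 (hess (\<phi> n))) = abs_L2 (hess (\<phi> n))" for n
    unfolding pw_abs[OF pw_bounded_transpose test_fields_square_integrable[OF test_fields_hess[OF \<phi>(1)]]]
    by (simp add: transpose_hess[OF test_fields_smooth[OF \<phi>(1)]])
  then show ?thesis
    using LIMSEQ_unique[OF bounded_linear.tendsto[OF bounded_linear_pw[OF pw_bounded_transpose] l]] l by simp
qed

lemma hess_W_L2_S: "open \<Omega> \<Longrightarrow> w \<in> W \<Omega> \<Longrightarrow> jhess w \<in> L2_S \<Omega>"
  using hess_transpose_W[OF W_UNIV] ext0_L2_on[of \<Omega> "jhess w"] W_ext0(3)[of \<Omega> w] by (simp add: L2_S_iff)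

text \<open>The kernel of the adjoint is the orthogonal complement of the range. For a point
  \<open>(x, y)\<close> of the closed graph, closedness of the Hessian range already places
  \<open>y\<close> in it.\<close>

lemma kernel_divDiv_S:
  assumes \<Omega>: "open \<Omega>" "bounded \<Omega>"
  shows "kernel (divDiv_S \<Omega>) = {T \<in> L2_S \<Omega>. \<forall>w\<in>W \<Omega>. jhess w \<bullet> T = 0}"
proof (intro set_eqI iffI)
  fix T assume "T \<in> kernel (divDiv_S \<Omega>)"
  then have T: "T \<in> L2_S \<Omega>" "\<And>x y. (x, y) \<in> Gradgrad0 \<Omega> \<Longrightarrow> y \<bullet> T = 0"
    by (auto simp: kernel_def divDiv_S_def adjoint_op_def)
  have "jhess w \<bullet> T = 0" if w: "w \<in> W \<Omega>" for w
  proof -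
    obtain \<phi> where \<phi>: "\<And>n. \<phi> n \<in> test_fields \<Omega>" "(\<lambda>n. abs_L2 (J (\<phi> n))) \<longlonglongrightarrow> w" by (rule W_sequence[OF w]) (rule that)
    have "(restr \<Omega> (\<phi> n), restr \<Omega> (hess (\<phi> n))) \<in> Gradgrad0 \<Omega>" for n
      unfolding Gradgrad0_def by (rule subsetD[OF closure_subset]) (use \<phi>(1) in blast)
    from T(2)[OF this] have "abs_L2 (hess (\<phi> n)) \<bullet> T = 0" for n by (simp add: restr_test[OF test_fields_hess[OF \<phi>(1)]])
    moreover have "(\<lambda>n. abs_L2 (hess (\<phi> n)) \<bullet> T) \<longlonglongrightarrow> jhess w \<bullet> T"
      using bounded_linear.tendsto[OF bounded_linear_j(3) \<phi>(2)] by (intro tendsto_inner tendsto_const) (simp add: j_J[OF sq_J[OF \<phi>(1)]])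
    ultimately show ?thesis by (simp add: LIMSEQ_const_iff)
  qed
  then show "T \<in> {T \<in> L2_S \<Omega>. \<forall>w\<in>W \<Omega>. jhess w \<bullet> T = 0}" using T(1) by simp
next
  fix T assume "T \<in> {T \<in> L2_S \<Omega>. \<forall>w\<in>W \<Omega>. jhess w \<bullet> T = 0}"
  then have T: "T \<in> L2_S \<Omega>" "\<And>w. w \<in> W \<Omega> \<Longrightarrow> jhess w \<bullet> T = 0" by auto
  have "y \<bullet> T = 0" if xy: "(x, y) \<in> Gradgrad0 \<Omega>" for x y
  proof -
    from xy obtain f where f: "\<forall>n. f n \<in> {(restr \<Omega> \<phi>, restr \<Omega> (hess \<phi>)) | \<phi>. \<phi> \<in> test_fields \<Omega>}" "f \<longlonglongrightarrow> (x, y)"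
      unfolding Gradgrad0_def closure_sequential by blast
    have "snd (f n) \<in> jhess ` W \<Omega>" for n
    proof -
      from f(1) obtain \<phi> where \<phi>: "\<phi> \<in> test_fields \<Omega>" "f n = (restr \<Omega> \<phi>, restr \<Omega> (hess \<phi>))" by blast
      then have "snd (f n) = jhess (abs_L2 (J \<phi>))"
        by (simp add: restr_test[OF test_fields_hess[OF \<phi>(1)]] j_J[OF sq_J[OF \<phi>(1)]])
      then show ?thesis using W_J[OF \<phi>(1)] by simp
    qed
    then have "y \<in> jhess ` W \<Omega>"
      by (rule closed_sequentially[OF closed_hess_range[OF \<Omega>(2)]]) (use tendsto_snd[OF f(2)] in simp)
    then show ?thesis using T(2) by auto
  qed
  then show "T \<in> kernel (divDiv_S \<Omega>)"
    using T(1) subspace_0[OF subspace_L2_on] by (auto simp: kernel_def divDiv_S_def adjoint_op_def)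
qed

lemma subspace_kernel_divDiv_S:
  assumes "open \<Omega>" "bounded \<Omega>"
  shows "subspace (kernel (divDiv_S \<Omega>))"
  unfolding kernel_divDiv_S[OF assms]
  by (rule subspaceI) (auto simp: subspace_0[OF subspace_L2_S] subspace_add[OF subspace_L2_S] subspace_scale[OF subspace_L2_S] inner_add_right)

lemma subspace_hess_range: "subspace (jhess ` W \<Omega>)"
  by (rule linear_subspace_image[OF bounded_linear.linear[OF bounded_linear_j(3)] subspace_W])

text \<open>The projection is computed on the complementary side: the Hessian range is closed, and
  the residual of \<open>x\<close> after projecting onto it stays symmetric and lies in the kernel.
  Uniqueness settles the description in \<open>orth_proj\<close>.\<close>

lemma orth_proj_kernel:
  assumes \<Omega>: "open \<Omega>" "bounded \<Omega>" and x: "x \<in> L2_S \<Omega>"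
  obtains w where "w \<in> W \<Omega>" "orth_proj (kernel (divDiv_S \<Omega>)) x = x - jhess w" "x - jhess w \<in> kernel (divDiv_S \<Omega>)"
proof -
  note K = kernel_divDiv_S[OF \<Omega>]
  from orthogonal_projection_exists[OF subspace_hess_range closed_hess_range[OF \<Omega>(2)], of x]
  obtain w where w: "w \<in> W \<Omega>" "\<forall>v\<in>W \<Omega>. (x - jhess w) \<bullet> jhess v = 0" by auto
  have k: "x - jhess w \<in> kernel (divDiv_S \<Omega>)"
    unfolding K using subspace_diff[OF subspace_L2_S x hess_W_L2_S[OF \<Omega>(1) w(1)]] w(2) by (simp add: inner_commute)
  have o: "\<forall>q\<in>kernel (divDiv_S \<Omega>). (x - (x - jhess w)) \<bullet> q = 0" unfolding K using w(1) by simp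
  have "orth_proj (kernel (divDiv_S \<Omega>)) x = x - jhess w"
    unfolding orth_proj_def
  proof (rule the_equality)
    show "x - jhess w \<in> kernel (divDiv_S \<Omega>) \<and> (\<forall>q\<in>kernel (divDiv_S \<Omega>). (x - (x - jhess w)) \<bullet> q = 0)" using k o by blast
    fix p assume p: "p \<in> kernel (divDiv_S \<Omega>) \<and> (\<forall>q\<in>kernel (divDiv_S \<Omega>). (x - p) \<bullet> q = 0)"
    define r where "r = p - (x - jhess w)"
    have r: "r \<in> kernel (divDiv_S \<Omega>)" unfolding r_def by (rule subspace_diff[OF subspace_kernel_divDiv_S[OF \<Omega>] conjunct1[OF p] k])
    have "(x - p) \<bullet> r = 0" "(x - (x - jhess w)) \<bullet> r = 0" using p o r by auto
    then have "((x - (x - jhess w)) - (x - p)) \<bullet> r = 0" by (simp only: inner_diff_left)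
    moreover have "(x - (x - jhess w)) - (x - p) = r" by (simp add: r_def algebra_simps)
    ultimately have "r = 0" by simp
    then show "p = x - jhess w" by (simp add: r_def)
  qed
  then show ?thesis using that w(1) k by blast
qed

subsection \<open>Hessians are curl free\<close>

lemma Curl_hess:
  assumes "smooth \<phi>"
  shows "Curl (hess \<phi>) x = 0"
proof -
  have s: "partial_deriv k (\<lambda>y. hess \<phi> y $ i $ j) x = partial_deriv j (\<lambda>y. hess \<phi> y $ i $ k) x" for i j k
  proof -
    have c: "partial_deriv i (partial_deriv j \<phi>) = partial_deriv j (partial_deriv i \<phi>)" for i j
      by (rule ext) (rule partial_deriv_commute[OF assms])
    have "partial_deriv k (\<lambda>y. hess \<phi> y $ i $ j) x = partial_deriv k (partial_deriv j (partial_deriv i \<phi>)) x"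
      by (simp add: hess_def c[of i j])
    also have "\<dots> = partial_deriv j (partial_deriv k (partial_deriv i \<phi>)) x"
      by (rule partial_deriv_commute[OF smooth_partial_deriv[OF assms]])
    also have "\<dots> = partial_deriv j (\<lambda>y. hess \<phi> y $ i $ k) x" by (simp add: hess_def c[of i k])
    finally show ?thesis .
  qed
  have "curl (\<lambda>y. hess \<phi> y $ i) x = 0" for i
    by (simp add: vec_eq_iff forall_3 curl_def vector_3 s[of 2 i 3] s[of 3 i 1] s[of 1 i 2])
  then show ?thesis by (simp add: Curl_def vec_eq_iff)
qed

lemma J_sum:
  assumes "\<And>i. i \<in> I \<Longrightarrow> smooth (\<phi> i)"
  shows "J (\<lambda>x. \<Sum>i\<in>I. c i *\<^sub>R \<phi> i x) x = (\<Sum>i\<in>I. c i *\<^sub>R J (\<phi> i) x)"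
  using assms
proof (induction I rule: infinite_finite_induct)
  case (insert i I)
  have s: "smooth (\<phi> i)" "smooth (\<lambda>x. \<Sum>i\<in>I. c i *\<^sub>R \<phi> i x)"
    by (rule insert.prems, rule insertI1) (intro smooth_sum smooth_cmult insert.prems insertI2)
  have "J (\<lambda>x. c i *\<^sub>R \<phi> i x + (\<Sum>i\<in>I. c i *\<^sub>R \<phi> i x)) x = c i *\<^sub>R J (\<phi> i) x + (\<Sum>i\<in>I. c i *\<^sub>R J (\<phi> i) x)"
    unfolding J_add[OF smooth_cmult[OF s(1)] s(2)] J_scaleR[OF s(1)] using insert by simp
  then show ?case using insert.hyps by simp
next
  case empty
  have p0: "partial_deriv i (\<lambda>x. 0 :: real) = (\<lambda>x. 0)" for i by (rule ext) simp
  show ?case by (simp add: J_def grad_def hess_def vec_eq_iff zero_prod_def p0)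
next
  case (infinite I)
  have p0: "partial_deriv i (\<lambda>x. 0 :: real) = (\<lambda>x. 0)" for i by (rule ext) simp
  show ?case using infinite by (simp add: J_def grad_def hess_def vec_eq_iff zero_prod_def p0)
qed

lemma hess_sum:
  assumes "\<And>i. i \<in> I \<Longrightarrow> smooth (\<phi> i)"
  shows "hess (\<lambda>x. \<Sum>i\<in>I. c i *\<^sub>R \<phi> i x) x = (\<Sum>i\<in>I. c i *\<^sub>R hess (\<phi> i) x)"
proof -
  have "snd (snd (J (\<lambda>x. \<Sum>i\<in>I. c i *\<^sub>R \<phi> i x) x)) = snd (snd (\<Sum>i\<in>I. c i *\<^sub>R J (\<phi> i) x))"
    by (rule arg_cong[where f="\<lambda>v. snd (snd v)"]) (rule J_sum[OF assms])
  also have "\<dots> = (\<Sum>i\<in>I. c i *\<^sub>R snd (snd (J (\<phi> i) x)))" by (simp add: snd_sum)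
  finally show ?thesis by (simp only: J_def snd_conv)
qed

text \<open>Compact support in \<Omega> is demanded of the Hessian of \<open>\<phi>0\<close>, while
  \<open>\<phi>0\<close> may be affine and nonzero near the exterior. Adding Hessians of test
  functions gives symmetric curl free test fields that converge to the sum.\<close>

lemma hess_curl_kernel:
  assumes \<Omega>: "open \<Omega>" and \<phi>0: "smooth \<phi>0" "hess \<phi>0 \<in> test_fields \<Omega>" and w: "w \<in> W \<Omega>"
  shows "abs_L2 (hess \<phi>0) + jhess w \<in> kernel (Curl0_S \<Omega>)"
proof -
  obtain \<phi> where \<phi>: "\<And>n. \<phi> n \<in> test_fields \<Omega>" "(\<lambda>n. abs_L2 (J (\<phi> n))) \<longlonglongrightarrow> w" by (rule W_sequence[OF w]) (rule that)
  note sq = test_fields_square_integrable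
  define F where "F n = (\<lambda>x. hess \<phi>0 x + hess (\<phi> n) x)" for n
  note th = test_fields_hess[OF \<phi>(1)]
  have tF: "F n \<in> test_fields \<Omega>" for n unfolding F_def by (rule test_fields_add[OF \<phi>0(2) th])
  have Fh: "F n = hess (\<lambda>x. \<phi>0 x + \<phi> n x)" for n
    using J_add[OF \<phi>0(1) test_fields_smooth[OF \<phi>(1)]] by (simp add: F_def fun_eq_iff J_def)
  have s: "smooth (\<lambda>x. \<phi>0 x + \<phi> n x)" for n by (rule smooth_add[OF \<phi>0(1) test_fields_smooth[OF \<phi>(1)]])
  have CF: "Curl (F n) = (\<lambda>x. 0)" for n unfolding Fh by (rule ext) (rule Curl_hess[OF s])
  have sy: "transpose (F n x) = F n x" for n x unfolding Fh by (rule transpose_hess[OF s])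
  have r: "restr \<Omega> (F n) = abs_L2 (hess \<phi>0) + abs_L2 (hess (\<phi> n))" for n
  proof -
    have "restr \<Omega> (F n) = abs_L2 (F n)" by (rule restr_test[OF tF])
    also have "\<dots> = abs_L2 (hess \<phi>0) + abs_L2 (hess (\<phi> n))"
      unfolding F_def by (rule abs_add[OF sq[OF \<phi>0(2)] sq[OF th], symmetric])
    finally show ?thesis .
  qed
  have r0: "restr \<Omega> (Curl (F n)) = 0" for n unfolding CF by (simp add: restr_def abs_zero)
  have "(\<lambda>n. (restr \<Omega> (F n), restr \<Omega> (Curl (F n)))) \<longlonglongrightarrow> (abs_L2 (hess \<phi>0) + jhess w, 0)"
    unfolding r r0 using bounded_linear.tendsto[OF bounded_linear_j(3) \<phi>(2)]
    by (intro tendsto_Pair tendsto_add tendsto_const) (simp add: j_J[OF sq_J[OF \<phi>(1)]])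
  then have "(abs_L2 (hess \<phi>0) + jhess w, 0) \<in> Curl0_S \<Omega>"
    unfolding Curl0_S_def closure_sequential using tF sy
    by (intro exI[of _ "\<lambda>n. (restr \<Omega> (F n), restr \<Omega> (Curl (F n)))"]) blast
  then show ?thesis by (simp add: kernel_def)
qed

lemma curl_kernel_sequence:
  assumes "T \<in> kernel (Curl0_S \<Omega>)"
  obtains \<Phi> where "\<And>n. \<Phi> n \<in> test_fields \<Omega>" "\<And>n x. transpose (\<Phi> n x) = \<Phi> n x"
    "(\<lambda>n. restr \<Omega> (\<Phi> n)) \<longlonglongrightarrow> T" "(\<lambda>n. restr \<Omega> (Curl (\<Phi> n))) \<longlonglongrightarrow> 0"
proof -
  from assms obtain f where f: "\<forall>n. f n \<in> {(restr \<Omega> \<Phi>, restr \<Omega> (Curl \<Phi>)) | \<Phi>. \<Phi> \<in> test_fields \<Omega> \<and> (\<forall>x. transpose (\<Phi> x) = \<Phi> x)}"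
    "f \<longlonglongrightarrow> (T, 0)"
    unfolding kernel_def Curl0_S_def closure_sequential by blast
  have "\<exists>\<Phi>. f n = (restr \<Omega> \<Phi>, restr \<Omega> (Curl \<Phi>)) \<and> \<Phi> \<in> test_fields \<Omega> \<and> (\<forall>x. transpose (\<Phi> x) = \<Phi> x)" for n
    using f(1) by blast
  then obtain \<Phi> where \<Phi>: "\<And>n. f n = (restr \<Omega> (\<Phi> n), restr \<Omega> (Curl (\<Phi> n)))" "\<And>n. \<Phi> n \<in> test_fields \<Omega>"
    "\<And>n. \<forall>x. transpose (\<Phi> n x) = \<Phi> n x" by metis
  show ?thesis
    using that[of \<Phi>] \<Phi>(2,3) tendsto_fst[OF f(2)] tendsto_snd[OF f(2)] by (simp add: \<Phi>(1))
qed

subsection \<open>Affine functions\<close>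

text \<open>Brings the functions \<open>p_hat j\<close> into the form
  \<open>a + b \<bullet> x\<close> in which locally affine potentials are found.\<close>

definition p_slope :: "nat \<Rightarrow> real^3" where
  "p_slope j = (if j = 1 then axis 1 1 else if j = 2 then axis 2 1 else if j = 3 then axis 3 1 else 0)"

lemma p_hat_affine: "j \<in> {0..3} \<Longrightarrow> p_hat j x = of_bool (j = 0) + p_slope j \<bullet> x"
proof -
  assume "j \<in> {0..3}"
  then consider "j = 0" | "j = 1" | "j = 2" | "j = 3" by fastforce
  then show ?thesis by cases (simp_all add: p_hat_def p_slope_def inner_axis' numeral_2_eq_2 numeral_3_eq_3)
qed

lemma sum_0_3: "(\<Sum>j\<in>{0..3::nat}. f j) = f 0 + f 1 + f 2 + f (3::nat)"
  by (simp add: numeral_2_eq_2 numeral_3_eq_3)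

lemma smooth_affine_fun: "smooth (\<lambda>x. a + b \<bullet> x)" for b :: "real^3"
  by (intro smooth_add smooth_const smooth_linear bounded_linear_inner_right)

lemma partial_deriv_affine: "partial_deriv i (\<lambda>x. a + b \<bullet> x) = (\<lambda>x. b $ i)"
proof (rule ext)
  fix x :: "real^3"
  have "((\<lambda>x. a + b \<bullet> x) has_derivative (\<lambda>v. b \<bullet> v)) (at x)" by (auto intro!: derivative_eq_intros)
  from frechet_derivative_eqI[OF this] show "partial_deriv i (\<lambda>x. a + b \<bullet> x) x = b $ i" by (simp add: partial_deriv_def inner_axis)
qed

lemma hess_affine: "hess (\<lambda>x. a + b \<bullet> x) x = 0"
  by (simp add: hess_def partial_deriv_affine vec_eq_iff)

lemma hess_local:
  assumes U: "open U" "x \<in> U" and e: "\<And>y. y \<in> U \<Longrightarrow> f y = g y"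
  shows "hess f x = hess g x"
proof -
  have "partial_deriv j f y = partial_deriv j g y" if "y \<in> U" for j y by (rule partial_deriv_cong_open[OF U(1) that e])
  then have "partial_deriv i (partial_deriv j f) x = partial_deriv i (partial_deriv j g) x" for i j
    by (rule partial_deriv_cong_open[OF U])
  then show ?thesis by (simp add: hess_def vec_eq_iff)
qed

text \<open>Vanishing of coefficients indexed by \<open>I\<close>, rather than by vectors, rules out
  repetitions as well, so cardinality can be read off from the index set.\<close>

lemma family_basis:
  fixes F :: "'i \<Rightarrow> 'v::real_vector"
  assumes I: "finite I" and z: "\<And>c i. (\<Sum>i\<in>I. c i *\<^sub>R F i) = 0 \<Longrightarrow> i \<in> I \<Longrightarrow> c i = 0"
  shows "inj_on F I" "independent (F ` I)" "span (F ` I) = range (\<lambda>c. \<Sum>i\<in>I. c i *\<^sub>R F i)"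
proof -
  show inj: "inj_on F I"
  proof (rule inj_onI, rule ccontr)
    fix i i' assume i: "i \<in> I" "i' \<in> I" "F i = F i'" "i \<noteq> i'"
    \<comment> \<open>Equal members at two indices would give the vanishing combination with
      coefficients 1 and -1.\<close>
    define c :: "'i \<Rightarrow> real" where "c k = (if k = i then 1 else if k = i' then - 1 else 0)" for k
    have "(\<Sum>k\<in>I. c k *\<^sub>R F k) = (\<Sum>k\<in>I. (if k = i then F k else 0) - (if k = i' then F k else 0))"
      using i(4) by (intro sum.cong) (auto simp: c_def)
    also have "\<dots> = 0" using i I by (simp add: sum_subtractf)
    finally have "c i = 0" by (rule z[OF _ i(1)])
    then show False by (simp add: c_def)
  qed
  have re: "(\<Sum>v\<in>F ` I. u v *\<^sub>R v) = (\<Sum>i\<in>I. u (F i) *\<^sub>R F i)" for u :: "'v \<Rightarrow> real"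
    by (simp add: sum.reindex[OF inj])
  show "independent (F ` I)"
  proof
    assume "dependent (F ` I)"
    then obtain u where u: "\<exists>v\<in>F ` I. u v \<noteq> 0" "(\<Sum>v\<in>F ` I. u v *\<^sub>R v) = 0"
      using dependent_finite[of "F ` I"] I by auto
    then show False using z[of "\<lambda>i. u (F i)"] by (auto simp: re)
  qed
  have "range (\<lambda>u. \<Sum>v\<in>F ` I. u v *\<^sub>R v) = range (\<lambda>c. \<Sum>i\<in>I. c i *\<^sub>R F i)"
  proof (intro set_eqI iffI)
    fix y assume "y \<in> range (\<lambda>c. \<Sum>i\<in>I. c i *\<^sub>R F i)"
    then obtain c where y: "y = (\<Sum>i\<in>I. c i *\<^sub>R F i)" by blast
    have "y = (\<Sum>v\<in>F ` I. c (the_inv_into I F v) *\<^sub>R v)"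
      unfolding y re by (intro sum.cong refl) (simp add: the_inv_into_f_f[OF inj])
    then show "y \<in> range (\<lambda>u. \<Sum>v\<in>F ` I. u v *\<^sub>R v)"
      by (rule range_eqI[where f="\<lambda>u. \<Sum>v\<in>F ` I. u v *\<^sub>R v" and x="\<lambda>v. c (the_inv_into I F v)"])
  qed (auto simp: re)
  then show "span (F ` I) = range (\<lambda>c. \<Sum>i\<in>I. c i *\<^sub>R F i)" using I by (simp add: span_finite)
qed

subsection \<open>The basis\<close>

locale exterior_setting =
  fixes \<Omega> :: "(real^3) set" and m :: nat and \<Xi> :: "nat \<Rightarrow> (real^3) set" and \<xi> :: "nat \<Rightarrow> real^3 \<Rightarrow> real"
  assumes open_Omega: "open \<Omega>" and bounded_Omega: "bounded \<Omega>" and boundary_Omega: "continuous_boundary \<Omega>"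
    and cutoffs: "exterior_cutoffs \<Omega> m \<Xi> \<xi>"
begin

lemma exterior_component:
  assumes "k < m"
  shows "\<Xi> k \<in> components (- closure \<Omega>)" "open (\<Xi> k)" "connected (\<Xi> k)" "\<Xi> k \<noteq> {}" "\<Xi> k \<inter> \<Omega> = {}"
proof -
  show c: "\<Xi> k \<in> components (- closure \<Omega>)"
    using cutoffs assms by (auto simp: exterior_cutoffs_def bij_betw_def)
  show "open (\<Xi> k)" by (rule open_components[OF _ c]) (simp add: open_Compl)
  show "connected (\<Xi> k)" by (rule in_components_connected[OF c])
  show "\<Xi> k \<noteq> {}" by (rule in_components_nonempty[OF c])
  show "\<Xi> k \<inter> \<Omega> = {}" using in_components_subset[OF c] closure_subset[of \<Omega>] by blast
qed

lemma exterior_cover: "- closure \<Omega> = (\<Union>k\<in>{0..<m}. \<Xi> k)"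
proof -
  have "\<Xi> ` {0..<m} = components (- closure \<Omega>)" using cutoffs by (auto simp: exterior_cutoffs_def bij_betw_def)
  then show ?thesis using Union_components[of "- closure \<Omega>"] by simp
qed

text \<open>Points outside \<Omega> are exterior points or boundary points, and the latter are
  limits of the former because there are no slits.\<close>

lemma complement_subset: "x \<notin> \<Omega> \<Longrightarrow> x \<in> closure (- closure \<Omega>)"
  using frontier_subset_closure_exterior[OF boundary_Omega, of x] closure_subset[of "- closure \<Omega>"]
  by (auto simp: closure_Un_frontier[of \<Omega>])

definition idx :: "(nat \<times> nat) set" where "idx = {1..<m} \<times> {0..3}"

lemma finite_idx: "finite idx" by (simp add: idx_def)

definition f :: "nat \<times> nat \<Rightarrow> real^3 \<Rightarrow> real" where "f i = xi \<xi> (fst i) (snd i)"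

lemma f_test: "i \<in> idx \<Longrightarrow> f i \<in> test_fields UNIV"
proof -
  assume i: "i \<in> idx"
  then have t: "\<xi> (fst i) \<in> test_fields UNIV" using cutoffs by (auto simp: exterior_cutoffs_def idx_def)
  have "f i = (\<lambda>x. \<xi> (fst i) x *\<^sub>R (of_bool (snd i = 0) + p_slope (snd i) \<bullet> x))"
    using i by (auto simp: f_def xi_def[abs_def] idx_def p_hat_affine)
  then show ?thesis using test_fields_mult_smooth[OF t smooth_affine_fun] by simp
qed

lemma f_local:
  assumes i: "i \<in> idx" and k: "k < m"
  obtains U where "open U" "\<Xi> k \<subseteq> U" "\<And>x. x \<in> U \<Longrightarrow> f i x = (if k = fst i then p_hat (snd i) x else 0)"
proof -
  have l: "fst i \<in> {1..<m}" using i by (auto simp: idx_def)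
  show ?thesis
  proof (cases "k = fst i")
    case True
    have "\<forall>l\<in>{1..<m}. \<exists>U. open U \<and> \<Xi> l \<subseteq> U \<and> (\<forall>x\<in>U. \<xi> l x = 1)" using cutoffs by (simp add: exterior_cutoffs_def)
    from bspec[OF this l] obtain U where "open U" "\<Xi> k \<subseteq> U" "\<forall>x\<in>U. \<xi> (fst i) x = 1" unfolding True by blast
    then show ?thesis using True by (intro that[of U]) (auto simp: f_def xi_def)
  next
    case False
    then have k': "k \<in> {0..<m} - {fst i}" using k by auto
    have "\<forall>l\<in>{1..<m}. \<forall>k\<in>{0..<m} - {l}. \<exists>U. open U \<and> \<Xi> k \<subseteq> U \<and> (\<forall>x\<in>U. \<xi> l x = 0)"
      using cutoffs by (simp add: exterior_cutoffs_def)
    from bspec[OF bspec[OF this l] k'] obtain U where "open U" "\<Xi> k \<subseteq> U" "\<forall>x\<in>U. \<xi> (fst i) x = 0" by blast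
    then show ?thesis using False by (intro that[of U]) (auto simp: f_def xi_def)
  qed
qed

lemma f_component: "i \<in> idx \<Longrightarrow> k < m \<Longrightarrow> x \<in> \<Xi> k \<Longrightarrow> f i x = (if k = fst i then p_hat (snd i) x else 0)"
  by (rule f_local) auto

lemma hess_affine_piece:
  assumes "open U" "x \<in> U" "\<And>y. y \<in> U \<Longrightarrow> g y = (if c then p_hat j y else 0)" "j \<in> {0..3}"
  shows "hess g x = 0"
proof -
  have "hess g x = hess (\<lambda>y. of_bool c * of_bool (j = 0) + (of_bool c *\<^sub>R p_slope j) \<bullet> y) x"
    by (rule hess_local[OF assms(1,2)]) (auto simp: assms(3) p_hat_affine[OF assms(4)])
  then show ?thesis by (simp only: hess_affine)
qed

text \<open>Near every exterior point the function is affine; continuity of the Hessian extends the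
  conclusion to the boundary.\<close>

lemma hess_f_outside:
  assumes i: "i \<in> idx" and x: "x \<notin> \<Omega>"
  shows "hess (f i) x = 0"
proof -
  have z: "hess (f i) y = 0" if y: "y \<in> - closure \<Omega>" for y
  proof -
    from y obtain k where k: "k < m" "y \<in> \<Xi> k" unfolding exterior_cover by auto
    obtain U where "open U" "\<Xi> k \<subseteq> U" "\<And>x. x \<in> U \<Longrightarrow> f i x = (if k = fst i then p_hat (snd i) x else 0)"
      by (rule f_local[OF i k(1)]) (rule that)
    then show ?thesis using i k(2) by (intro hess_affine_piece[of U]) (auto simp: idx_def)
  qed
  have "closed {y. hess (f i) y = 0}"
    by (rule closed_Collect_eq[OF smooth_continuous_on[OF smooth_hess[OF test_fields_smooth[OF f_test[OF i]]]] continuous_on_const])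
  then have "closure (- closure \<Omega>) \<subseteq> {y. hess (f i) y = 0}" using z by (intro closure_minimal) auto
  then show ?thesis using complement_subset[OF x] by auto
qed

lemma restr_hess_f: "i \<in> idx \<Longrightarrow> restr \<Omega> (hess (f i)) = jhess (abs_L2 (J (f i)))"
proof -
  assume i: "i \<in> idx"
  have "(\<lambda>x. indicator \<Omega> x *\<^sub>R hess (f i) x) = hess (f i)"
    using hess_f_outside[OF i] by (auto simp: fun_eq_iff indicator_def)
  then show ?thesis by (simp add: restr_def j_J[OF sq_J[OF f_test[OF i]]])
qed

definition F :: "nat \<times> nat \<Rightarrow> (real^3^3) L2" where "F i = Gradgrad \<Omega> (u_fun \<Omega> \<xi> (fst i) (snd i))"

text \<open>Identifies the function described in \<open>psi\<close> with the first component of the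
  jet \<open>w\<close> from the projection; two candidates have equal Hessians and coincide by
  Friedrichs' inequality. \<open>F i\<close> is thereby the Hessian of a jet on the whole
  space.\<close>

lemma basis_element:
  assumes i: "i \<in> idx"
  shows "\<exists>w\<in>W \<Omega>. u_fun \<Omega> \<xi> (fst i) (snd i) \<in> H2 \<Omega> \<and> F i = jhess (abs_L2 (J (f i)) - w) \<and> F i \<in> kernel (divDiv_S \<Omega>)"
proof -
  note \<Omega> = open_Omega bounded_Omega
  define a where "a = abs_L2 (J (f i))"
  define x where "x = jhess a"
  have aW: "a \<in> W UNIV" unfolding a_def by (rule W_J[OF f_test[OF i]])
  \<comment> \<open>The Hessian of \<open>f i\<close> vanishes off \<Omega>, so truncation does not
    affect it; hence the whole-space Hessian agrees with the one taken in \<Omega>.\<close>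
  have xr: "x = ext0 \<Omega> x"
    using restr_hess_f[OF i] restr_ext0[OF \<Omega>(1) test_fields_square_integrable[OF test_fields_hess[OF f_test[OF i]]]]
    by (simp add: x_def a_def j_J[OF sq_J[OF f_test[OF i]]])
  have r: "restr \<Omega> (xi \<xi> (fst i) (snd i)) = ext0 \<Omega> (jfun a)"
    unfolding a_def j_J(1)[OF sq_J[OF f_test[OF i]]] f_def[symmetric]
    by (rule restr_ext0[OF \<Omega>(1) test_fields_square_integrable[OF f_test[OF i]]])
  have Gx: "Gradgrad \<Omega> (ext0 \<Omega> (jfun a)) = x" using H2_W(2)[OF \<Omega>(1) aW] xr by (simp add: x_def)
  have xS: "x \<in> L2_S \<Omega>"
    unfolding L2_S_iff using ext0_L2_on[OF \<Omega>(1), of x] hess_transpose_W[OF aW] xr by (simp add: x_def)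
  obtain w where w: "w \<in> W \<Omega>" "orth_proj (kernel (divDiv_S \<Omega>)) x = x - jhess w" "x - jhess w \<in> kernel (divDiv_S \<Omega>)"
    by (rule orth_proj_kernel[OF \<Omega> xS]) (rule that)
  have d: "ext0 \<Omega> (jfun a) - jfun v = ext0 \<Omega> (jfun (a - v))" "a - v \<in> W UNIV" "Gradgrad \<Omega> (ext0 \<Omega> (jfun a) - jfun v) = x - jhess v"
    if v: "v \<in> W \<Omega>" for v
  proof -
    show e: "ext0 \<Omega> (jfun a) - jfun v = ext0 \<Omega> (jfun (a - v))"
      using linear_diff[OF bounded_linear.linear[OF bounded_linear_ext0[OF \<Omega>(1)]], of "jfun a" "jfun v"]
      by (simp add: j_diff W_ext0(1)[OF \<Omega>(1) v])
    show aW': "a - v \<in> W UNIV" by (rule subspace_diff[OF subspace_W aW W_UNIV[OF v]])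
    show "Gradgrad \<Omega> (ext0 \<Omega> (jfun a) - jfun v) = x - jhess v"
      unfolding e H2_W(2)[OF \<Omega>(1) aW']
      using linear_diff[OF bounded_linear.linear[OF bounded_linear_ext0[OF \<Omega>(1)]], of "jhess a" "jhess v"] xr
      by (simp add: j_diff W_ext0(3)[OF \<Omega>(1) v] x_def)
  qed
  have "psi \<Omega> \<xi> (fst i) (snd i) = jfun w"
    unfolding psi_def r Gx w(2)
  proof (rule the_equality)
    show "jfun w \<in> H20 \<Omega> \<and> x - jhess w = Gradgrad \<Omega> (ext0 \<Omega> (jfun a) - jfun w)"
      using w(1) d(3)[OF w(1)] by (simp add: H20_eq[OF \<Omega>])
    fix \<psi> assume \<psi>: "\<psi> \<in> H20 \<Omega> \<and> x - jhess w = Gradgrad \<Omega> (ext0 \<Omega> (jfun a) - \<psi>)"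
    then obtain v where v: "v \<in> W \<Omega>" "\<psi> = jfun v" by (auto simp: H20_eq[OF \<Omega>])
    have "jhess (w - v) = 0" using \<psi> d(3)[OF v(1)] by (simp add: v(2) j_diff)
    obtain C where C: "0 < C" "\<And>w. w \<in> W \<Omega> \<Longrightarrow> norm w \<le> C * norm (jhess w)" by (rule friedrichs[OF \<Omega>(2)]) (rule that)
    from C(2)[OF subspace_diff[OF subspace_W w(1) v(1)]] \<open>jhess (w - v) = 0\<close> have "w = v" by simp
    then show "\<psi> = jfun w" by (simp add: v(2))
  qed
  then have u: "u_fun \<Omega> \<xi> (fst i) (snd i) = ext0 \<Omega> (jfun a) - jfun w" by (simp add: u_fun_def r)
  show ?thesis
  proof (intro bexI[of _ w] conjI)
    show "u_fun \<Omega> \<xi> (fst i) (snd i) \<in> H2 \<Omega>" unfolding u d(1)[OF w(1)] by (rule H2_W(1)[OF \<Omega>(1) d(2)[OF w(1)]])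
    show "F i = jhess (abs_L2 (J (f i)) - w)" unfolding F_def u d(3)[OF w(1)] by (simp add: j_diff x_def a_def)
    show "F i \<in> kernel (divDiv_S \<Omega>)" unfolding F_def u d(3)[OF w(1)] by (rule w(3))
  qed (rule w(1))
qed

lemma sum_idx: "(\<Sum>i\<in>idx. g i) = (\<Sum>l\<in>{1..<m}. \<Sum>j\<in>{0..3}. g (l, j))"
  unfolding idx_def by (simp add: sum.cartesian_product)

lemma sum_f_component:
  assumes k: "k < m" and x: "x \<in> \<Xi> k"
  shows "(\<Sum>i\<in>idx. c i * f i x) = (if k = 0 then 0 else \<Sum>j\<in>{0..3}. c (k, j) * p_hat j x)"
proof -
  have "(\<Sum>i\<in>idx. c i * f i x) = (\<Sum>i\<in>idx. if k = fst i then c i * p_hat (snd i) x else 0)"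
    using f_component[OF _ k x] by (intro sum.cong) auto
  also have "\<dots> = (\<Sum>l\<in>{1..<m}. if k = l then (\<Sum>j\<in>{0..3}. c (l, j) * p_hat j x) else 0)"
    unfolding sum_idx by (intro sum.cong refl) simp
  also have "\<dots> = (if k = 0 then 0 else \<Sum>j\<in>{0..3}. c (k, j) * p_hat j x)"
    using k by (simp add: sum.delta)
  finally show ?thesis .
qed

lemma sum_p_hat: "(\<Sum>j\<in>{0..3}. c j * p_hat j x) = c 0 + (c 1 *\<^sub>R axis 1 1 + c 2 *\<^sub>R axis 2 1 + c 3 *\<^sub>R axis 3 1) \<bullet> x"
  by (simp add: sum_0_3 p_hat_affine p_slope_def inner_add_left)

lemma jfun_combination:
  "jfun (\<Sum>i\<in>idx. c i *\<^sub>R abs_L2 (J (f i))) = abs_L2 (\<lambda>x. \<Sum>i\<in>idx. c i * f i x)"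
proof -
  have "jfun (\<Sum>i\<in>idx. c i *\<^sub>R abs_L2 (J (f i))) = (\<Sum>i\<in>idx. c i *\<^sub>R jfun (abs_L2 (J (f i))))"
    by (simp add: linear_sum[OF bounded_linear.linear[OF bounded_linear_j(1)]] linear_scale[OF bounded_linear.linear[OF bounded_linear_j(1)]])
  also have "\<dots> = (\<Sum>i\<in>idx. abs_L2 (\<lambda>x. c i *\<^sub>R f i x))"
    by (intro sum.cong refl) (simp add: j_J[OF sq_J[OF f_test]] abs_scaleR[OF test_fields_square_integrable[OF f_test]])
  also have "\<dots> = abs_L2 (\<lambda>x. \<Sum>i\<in>idx. c i *\<^sub>R f i x)"
    by (intro abs_sum square_integrable_scaleR test_fields_square_integrable[OF f_test])
  finally show ?thesis by simp
qed

lemma sq_combination: "square_integrable (\<lambda>x. \<Sum>i\<in>idx. c i * f i x)"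
  using square_integrable_sum[of idx "\<lambda>i x. c i *\<^sub>R f i x"] square_integrable_scaleR[OF test_fields_square_integrable[OF f_test]]
  by simp

lemma basis_independent:
  assumes s: "(\<Sum>i\<in>idx. c i *\<^sub>R F i) = 0" and i: "i \<in> idx"
  shows "c i = 0"
proof -
  note \<Omega> = open_Omega bounded_Omega
  obtain w where w: "\<And>i. i \<in> idx \<Longrightarrow> w i \<in> W \<Omega>" "\<And>i. i \<in> idx \<Longrightarrow> F i = jhess (abs_L2 (J (f i)) - w i)"
    using basis_element by metis
  \<comment> \<open>A bounded set carrying all summands of the potential, whose cutoffs may reach
    beyond \<Omega>; Friedrichs' inequality is applied on it.\<close>
  define B where "B = \<Omega> \<union> (\<Union>i\<in>idx. supp (f i))"
  have "bounded (supp (f i))" if "i \<in> idx" for i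
    using f_test[OF that] by (auto simp: test_fields_def compact_imp_bounded)
  then have bB: "bounded B" unfolding B_def using \<Omega>(2) finite_idx by (auto simp: bounded_UN)
  have fB: "f i \<in> test_fields B" if "i \<in> idx" for i
    using f_test[OF that] that by (auto simp: test_fields_def B_def)
  define z where "z = (\<Sum>i\<in>idx. c i *\<^sub>R (abs_L2 (J (f i)) - w i))"
  have zB: "z \<in> W B"
    unfolding z_def
  proof (intro subspace_sum[OF subspace_W] subspace_scale[OF subspace_W] subspace_diff[OF subspace_W])
    show "abs_L2 (J (f i)) \<in> W B" if "i \<in> idx" for i by (rule W_J[OF fB[OF that]])
    show "w i \<in> W B" if "i \<in> idx" for i using w(1)[OF that] W_mono[of \<Omega> B] by (auto simp: B_def)
  qed
  note lh = bounded_linear.linear[OF bounded_linear_j(3)] and lf = bounded_linear.linear[OF bounded_linear_j(1)]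
  have "jhess z = (\<Sum>i\<in>idx. c i *\<^sub>R F i)"
    unfolding z_def linear_sum[OF lh] linear_scale[OF lh] using w(2) by simp
  then have "jhess z = 0" using s by simp
  moreover obtain C where "0 < C" "\<And>w. w \<in> W B \<Longrightarrow> norm w \<le> C * norm (jhess w)" by (rule friedrichs[OF bB]) (rule that)
  ultimately have z0: "z = 0" using zB by force
  define wW where "wW = (\<Sum>i\<in>idx. c i *\<^sub>R w i)"
  have wW: "wW \<in> W \<Omega>" unfolding wW_def using w(1) by (intro subspace_sum[OF subspace_W] subspace_scale[OF subspace_W])
  have "(\<Sum>i\<in>idx. c i *\<^sub>R abs_L2 (J (f i))) = wW"
    using z0 by (simp add: z_def wW_def scaleR_diff_right sum_subtractf)
  \<comment> \<open>The combination of cutoffs coincides with the value part of an element of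
    \<open>W \<Omega>\<close>, so it vanishes outside \<Omega>, in particular on every exterior
    component.\<close>
  then have e: "abs_L2 (\<lambda>x. \<Sum>i\<in>idx. c i * f i x) = jfun wW" using jfun_combination[of c] by simp
  have "jfun wW \<in> L2_on \<Omega>" using W_ext0(1)[OF \<Omega>(1) wW] ext0_L2_on[OF \<Omega>(1), of "jfun wW"] by simp
  then have "AE x in lborel. x \<notin> \<Omega> \<longrightarrow> rep_L2 (jfun wW) x = 0" by (simp add: L2_on_def)
  then have ae: "AE x in lborel. x \<notin> \<Omega> \<longrightarrow> (\<Sum>i\<in>idx. c i * f i x) = 0"
    using rep_abs[OF sq_combination, of c] unfolding e by eventually_elim simp
  obtain l j where lj: "i = (l, j)" "1 \<le> l" "l < m" "j \<in> {0..3}" using i by (auto simp: idx_def)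
  define b where "b = c (l, 1) *\<^sub>R axis 1 1 + c (l, 2) *\<^sub>R axis 2 1 + c (l, 3) *\<^sub>R (axis 3 1 :: real^3)"
  have "AE x in lborel. x \<in> \<Xi> l \<longrightarrow> c (l, 0) + b \<bullet> x = 0"
    using ae
  proof eventually_elim
    case (elim x)
    show ?case
    proof
      assume x: "x \<in> \<Xi> l"
      then have "x \<notin> \<Omega>" using exterior_component(5)[OF lj(3)] by blast
      then have "(\<Sum>j\<in>{0..3}. c (l, j) * p_hat j x) = 0"
        using elim sum_f_component[OF lj(3) x, of c] lj(2) by simp
      then show "c (l, 0) + b \<bullet> x = 0" unfolding sum_p_hat[of "\<lambda>j. c (l, j)"] b_def .
    qed
  qed
  then have z: "c (l, 0) = 0 \<and> b = 0" by (rule affine_zero_open[OF exterior_component(2,4)[OF lj(3)]])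
  have "c (l, 1) = b $ 1" "c (l, 2) = b $ 2" "c (l, 3) = b $ 3" by (simp_all add: b_def axis_def)
  moreover have "j = 0 \<or> j = 1 \<or> j = 2 \<or> j = 3" using lj(4) by fastforce
  ultimately show ?thesis using z lj(1) by auto
qed

text \<open>The supports of the Hessians of the \<open>\<xi>\<^bsub>l,j\<^esub>\<close> may touch the boundary of \<open>\<Omega>\<close>. Cutoffs \<open>\<eta>\<close> which
  are locally constant near the closures of the components avoid this, and replacing \<open>\<xi>\<close>
  by \<open>\<eta>\<close> changes the potentials by elements of \<open>W \<Omega>\<close>.\<close>

lemma combination_in_harmonic_fields: "(\<Sum>i\<in>idx. c i *\<^sub>R F i) \<in> harmonic_fields \<Omega>"
proof -
  note \<Omega> = open_Omega bounded_Omega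
  obtain w where w: "\<And>i. i \<in> idx \<Longrightarrow> w i \<in> W \<Omega>" "\<And>i. i \<in> idx \<Longrightarrow> F i = jhess (abs_L2 (J (f i)) - w i)"
    "\<And>i. i \<in> idx \<Longrightarrow> F i \<in> kernel (divDiv_S \<Omega>)" using basis_element by metis
  have K: "(\<Sum>i\<in>idx. c i *\<^sub>R F i) \<in> kernel (divDiv_S \<Omega>)"
    using w(3) by (intro subspace_sum[OF subspace_kernel_divDiv_S[OF \<Omega>]] subspace_scale[OF subspace_kernel_divDiv_S[OF \<Omega>]])
  have enum: "bij_betw \<Xi> {0..<m} (components (- closure \<Omega>))" "\<not> bounded (\<Xi> 0)"
    using cutoffs by (auto simp: exterior_cutoffs_def)
  obtain \<eta> where \<eta>: "exterior_cutoffs \<Omega> m \<Xi> \<eta>"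
    "\<And>l k. l \<in> {1..<m} \<Longrightarrow> k < m \<Longrightarrow> \<exists>U. open U \<and> closure (\<Xi> k) \<subseteq> U \<and> (\<forall>x\<in>U. \<eta> l x = (if k = l then 1 else 0))"
    by (rule strong_cutoffs[OF \<Omega> boundary_Omega enum]) (rule that)
  interpret S: exterior_setting \<Omega> m \<Xi> \<eta> by unfold_locales (use \<Omega> boundary_Omega \<eta>(1) in auto)
  define g where "g = S.f"
  have g: "g i \<in> test_fields UNIV" if "i \<in> idx" for i using S.f_test that by (simp add: g_def S.idx_def idx_def)
  have hg: "hess (g i) \<in> test_fields \<Omega>" if i: "i \<in> idx" for i
  proof -
    have i': "fst i \<in> {1..<m}" "snd i \<in> {0..3}" using i by (auto simp: idx_def)
    have "\<forall>k<m. \<exists>U. open U \<and> closure (\<Xi> k) \<subseteq> U \<and> (\<forall>x\<in>U. \<eta> (fst i) x = (if k = fst i then 1 else 0))"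
      using \<eta>(2)[OF i'(1)] by blast
    then obtain U where U: "\<And>k. k < m \<Longrightarrow> open (U k)" "\<And>k. k < m \<Longrightarrow> closure (\<Xi> k) \<subseteq> U k"
      "\<And>k x. k < m \<Longrightarrow> x \<in> U k \<Longrightarrow> \<eta> (fst i) x = (if k = fst i then 1 else 0)" by metis
    \<comment> \<open>An open neighbourhood of the closed exterior on which \<open>g i\<close> is
      locally affine. Its complement lies in \<Omega>, so the Hessian of \<open>g i\<close> has
      compact support in \<Omega>.\<close>
    define V where "V = (\<Union>k\<in>{0..<m}. U k)"
    have oV: "open V" unfolding V_def using U(1) by auto
    have "closure (- closure \<Omega>) \<subseteq> V"
    proof -
      have "closure (- closure \<Omega>) \<subseteq> (\<Union>k\<in>{0..<m}. closure (\<Xi> k))"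
        unfolding exterior_cover by (intro closure_minimal closed_UN UN_mono subset_refl closure_subset) auto
      also have "\<dots> \<subseteq> V" unfolding V_def by (intro UN_mono subset_refl) (use U(2) in auto)
      finally show ?thesis .
    qed
    then have cV: "- V \<subseteq> \<Omega>" using complement_subset by blast
    have hV: "hess (g i) x = 0" if "x \<in> V" for x
    proof -
      from that obtain k where k: "k < m" "x \<in> U k" by (auto simp: V_def)
      show ?thesis
        by (rule hess_affine_piece[OF U(1)[OF k(1)] k(2) _ i'(2), of _ "k = fst i"])
          (simp add: g_def S.f_def xi_def U(3)[OF k(1)])
    qed
    from test_fields_hess[OF g[OF i]] obtain L where L: "compact L" "\<And>x. x \<notin> L \<Longrightarrow> hess (g i) x = 0"
      by (rule test_fieldsE) (rule that)
    show ?thesis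
      by (rule test_fieldsI[OF smooth_hess[OF test_fields_smooth[OF g[OF i]]] compact_diff[OF L(1) oV]]) (use cV hV L(2) in auto)
  qed
  define z where "z i = abs_L2 (J (f i)) - abs_L2 (J (g i)) - w i" for i
  have zW: "z i \<in> W \<Omega>" if i: "i \<in> idx" for i
  proof -
    \<comment> \<open>Both cutoff families take the same values on each exterior component, so the
      difference of the potentials vanishes off \<open>closure \<Omega>\<close>.\<close>
    have "abs_L2 (J (f i)) - abs_L2 (J (g i)) \<in> W \<Omega>"
    proof (rule W_of_vanishing[OF \<Omega> boundary_Omega])
      show "abs_L2 (J (f i)) - abs_L2 (J (g i)) \<in> W UNIV"
        by (rule subspace_diff[OF subspace_W W_J[OF f_test[OF i]] W_J[OF g[OF i]]])
      note sq = test_fields_square_integrable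
      have e: "jfun (abs_L2 (J (f i)) - abs_L2 (J (g i))) = abs_L2 (\<lambda>x. f i x - g i x)"
        unfolding j_diff j_J[OF sq_J[OF f_test[OF i]]] j_J[OF sq_J[OF g[OF i]]] by (rule abs_diff[OF sq[OF f_test[OF i]] sq[OF g[OF i]]])
      have v: "f i x - g i x = 0" if "x \<notin> closure \<Omega>" for x
      proof -
        from that have "x \<in> - closure \<Omega>" by simp
        then obtain k where k: "k < m" "x \<in> \<Xi> k" unfolding exterior_cover by auto
        have "i \<in> S.idx" using i by (simp add: idx_def S.idx_def)
        then show ?thesis using f_component[OF i k] S.f_component[OF _ k, of i] by (simp add: g_def)
      qed
      show "AE x in lborel. x \<in> closure \<Omega> \<or> rep_L2 (jfun (abs_L2 (J (f i)) - abs_L2 (J (g i)))) x = 0"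
        unfolding e using rep_abs[OF square_integrable_diff[OF sq[OF f_test[OF i]] sq[OF g[OF i]]]]
        by eventually_elim (use v in auto)
    qed
    then show ?thesis unfolding z_def using w(1)[OF i] by (rule subspace_diff[OF subspace_W])
  qed
  define G where "G = (\<lambda>x. \<Sum>i\<in>idx. c i *\<^sub>R g i x)"
  have sG: "smooth G" unfolding G_def using test_fields_smooth[OF g] by (intro smooth_sum smooth_cmult)
  have hG: "hess G = (\<lambda>x. \<Sum>i\<in>idx. c i *\<^sub>R hess (g i) x)"
    unfolding G_def by (rule ext) (rule hess_sum, rule test_fields_smooth[OF g])
  have tG: "hess G \<in> test_fields \<Omega>" unfolding hG by (intro test_fields_sum test_fields_scaleR hg)
  note sqh = test_fields_square_integrable[OF hg]
  note lh = bounded_linear.linear[OF bounded_linear_j(3)]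
  have "(\<Sum>i\<in>idx. c i *\<^sub>R F i) = (\<Sum>i\<in>idx. abs_L2 (\<lambda>x. c i *\<^sub>R hess (g i) x) + jhess (c i *\<^sub>R z i))"
  proof (rule sum.cong[OF refl])
    fix i assume i: "i \<in> idx"
    have "F i = abs_L2 (hess (g i)) + jhess (z i)"
      unfolding w(2)[OF i] z_def j_diff j_J[OF sq_J[OF g[OF i]]] by simp
    then show "c i *\<^sub>R F i = abs_L2 (\<lambda>x. c i *\<^sub>R hess (g i) x) + jhess (c i *\<^sub>R z i)"
      unfolding linear_scale[OF lh] abs_scaleR[OF sqh[OF i], symmetric] by (simp add: scaleR_add_right)
  qed
  also have "\<dots> = abs_L2 (hess G) + jhess (\<Sum>i\<in>idx. c i *\<^sub>R z i)"
    unfolding sum.distrib linear_sum[OF lh] hG by (subst abs_sum) (auto intro: square_integrable_scaleR sqh)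
  also have "\<dots> \<in> kernel (Curl0_S \<Omega>)"
    by (rule hess_curl_kernel[OF \<Omega>(1) sG tG]) (use zW in \<open>intro subspace_sum[OF subspace_W] subspace_scale[OF subspace_W]\<close>)
  finally show ?thesis using K by (simp add: harmonic_fields_def)
qed

lemma harmonic_field_combination:
  assumes T: "T \<in> harmonic_fields \<Omega>"
  obtains c where "T = (\<Sum>i\<in>idx. c i *\<^sub>R F i)"
proof -
  note \<Omega> = open_Omega bounded_Omega
  have TK: "T \<in> kernel (divDiv_S \<Omega>)" and TC: "T \<in> kernel (Curl0_S \<Omega>)" using T by (auto simp: harmonic_fields_def)
  obtain \<Phi> where \<Phi>: "\<And>n. \<Phi> n \<in> test_fields \<Omega>" "\<And>n x. transpose (\<Phi> n x) = \<Phi> n x"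
    "(\<lambda>n. restr \<Omega> (\<Phi> n)) \<longlonglongrightarrow> T" "(\<lambda>n. restr \<Omega> (Curl (\<Phi> n))) \<longlonglongrightarrow> 0"
    by (rule curl_kernel_sequence[OF TC]) (rule that)
  have l: "(\<lambda>n. abs_L2 (\<Phi> n)) \<longlonglongrightarrow> T" "(\<lambda>n. abs_L2 (Curl (\<Phi> n))) \<longlonglongrightarrow> 0"
    using \<Phi>(3,4) by (simp_all add: restr_test[OF \<Phi>(1)] restr_test[OF test_fields_Curl[OF \<Phi>(1)]])
  obtain R v where v: "v \<in> W (ball 0 R)" "jhess v = T" by (rule curl_kernel_potential[OF \<Omega> \<Phi>(1,2) l]) (rule that)
  have vU: "v \<in> W UNIV" by (rule W_UNIV[OF v(1)])
  have "T \<in> L2_on \<Omega>" using TK by (simp add: kernel_divDiv_S[OF \<Omega>] L2_S_iff)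
  then have aeT: "AE x in lborel. x \<notin> \<Omega> \<longrightarrow> rep_L2 (jhess v) x = 0" by (simp add: v(2) L2_on_def)
  have "\<exists>a b. AE x in lborel. x \<in> \<Xi> k \<longrightarrow> rep_L2 (jfun v) x = a + b \<bullet> x" if k: "k < m" for k
  proof (rule hess_zero_affine[OF vU exterior_component(2,3)[OF k]])
    show "AE x in lborel. x \<in> \<Xi> k \<longrightarrow> rep_L2 (jhess v) x = 0"
      using aeT by eventually_elim (use exterior_component(5)[OF k] in auto)
  qed
  then have "\<forall>k. \<exists>p. k < m \<longrightarrow> (AE x in lborel. x \<in> \<Xi> k \<longrightarrow> rep_L2 (jfun v) x = fst p + snd p \<bullet> x)" by simp
  then obtain p where p: "\<forall>k. k < m \<longrightarrow> (AE x in lborel. x \<in> \<Xi> k \<longrightarrow> rep_L2 (jfun v) x = fst (p k) + snd (p k) \<bullet> x)"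
    unfolding choice_iff by (elim exE)
  define a b where "a k = fst (p k)" and "b k = snd (p k)" for k
  have ab: "AE x in lborel. x \<in> \<Xi> k \<longrightarrow> rep_L2 (jfun v) x = a k + b k \<bullet> x" if "k < m" for k
    using p that by (simp add: a_def b_def)
  \<comment> \<open>The potential vanishes off a ball, and the unbounded component reaches outside
    that ball in a nonempty open set.\<close>
  have ab0: "a 0 = 0 \<and> b 0 = 0" if m0: "0 < m"
  proof (rule affine_zero_open)
    show "open (\<Xi> 0 - cball 0 R)" by (intro open_Diff exterior_component(2)[OF m0]) simp
    have "\<not> bounded (\<Xi> 0)" using cutoffs by (simp add: exterior_cutoffs_def)
    then show "\<Xi> 0 - cball 0 R \<noteq> {}" using bounded_subset[OF bounded_cball, of "\<Xi> 0" 0 R] by blast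
    have "jfun v \<in> L2_on (ball 0 R)"
      using W_ext0(1)[OF open_ball v(1)] ext0_L2_on[OF open_ball, of 0 R "jfun v"] by simp
    then have "AE x in lborel. x \<notin> ball 0 R \<longrightarrow> rep_L2 (jfun v) x = 0" by (simp add: L2_on_def)
    then show "AE x in lborel. x \<in> \<Xi> 0 - cball 0 R \<longrightarrow> a 0 + b 0 \<bullet> x = 0"
      using ab[OF m0] by eventually_elim auto
  qed
  \<comment> \<open>The constant term and the three slopes of the affine piece on component
    \<open>fst i\<close>; the last branch serves the index 3.\<close>
  define c where "c i = (if snd i = 0 then a (fst i) else if snd i = 1 then b (fst i) $ 1 else if snd i = 2 then b (fst i) $ 2 else b (fst i) $ 3)" for i :: "nat \<times> nat"
  define y where "y = (\<Sum>i\<in>idx. c i *\<^sub>R abs_L2 (J (f i)))"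
  have yU: "y \<in> W UNIV" unfolding y_def using W_J[OF f_test] by (intro subspace_sum[OF subspace_W] subspace_scale[OF subspace_W])
  have cx: "a k + b k \<bullet> x = (\<Sum>i\<in>idx. c i * f i x)" if k: "k < m" and x: "x \<in> \<Xi> k" for k x
  proof (cases "k = 0")
    case True
    then show ?thesis using ab0 k sum_f_component[OF k x, of c] by simp
  next
    case False
    have e: "b k = b k $ 1 *\<^sub>R axis 1 1 + b k $ 2 *\<^sub>R axis 2 1 + b k $ 3 *\<^sub>R axis 3 1"
      using vec3_expand[of "b k"] by (simp add: sum_3)
    have "(\<Sum>j\<in>{0..3}. c (k, j) * p_hat j x) = a k + (b k $ 1 *\<^sub>R axis 1 1 + b k $ 2 *\<^sub>R axis 2 1 + b k $ 3 *\<^sub>R axis 3 1) \<bullet> x"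
      unfolding sum_p_hat[of "\<lambda>j. c (k, j)"] by (simp add: c_def)
    then show ?thesis unfolding e[symmetric] using sum_f_component[OF k x, of c] False by simp
  qed
  have d: "v - y \<in> W \<Omega>"
  proof (rule W_of_vanishing[OF \<Omega> boundary_Omega subspace_diff[OF subspace_W vU yU]])
    have "AE x in lborel. \<forall>k\<in>{0..<m}. x \<in> \<Xi> k \<longrightarrow> rep_L2 (jfun v) x = a k + b k \<bullet> x"
      by (rule AE_finite_allI) (use ab in auto)
    moreover have "AE x in lborel. rep_L2 (jfun y) x = (\<Sum>i\<in>idx. c i * f i x)"
      unfolding y_def jfun_combination by (rule rep_abs[OF sq_combination])
    moreover have "AE x in lborel. rep_L2 (jfun (v - y)) x = rep_L2 (jfun v) x - rep_L2 (jfun y) x"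
      unfolding j_diff by (rule rep_diff)
    ultimately show "AE x in lborel. x \<in> closure \<Omega> \<or> rep_L2 (jfun (v - y)) x = 0"
    proof eventually_elim
      case (elim x)
      show ?case
      proof (cases "x \<in> closure \<Omega>")
        case False
        then have "x \<in> - closure \<Omega>" by simp
        then obtain k where k: "k < m" "x \<in> \<Xi> k" unfolding exterior_cover by auto
        then show ?thesis using elim cx[OF k] by auto
      qed simp
    qed
  qed
  obtain w where w: "\<And>i. i \<in> idx \<Longrightarrow> w i \<in> W \<Omega>" "\<And>i. i \<in> idx \<Longrightarrow> F i = jhess (abs_L2 (J (f i)) - w i)"
    "\<And>i. i \<in> idx \<Longrightarrow> F i \<in> kernel (divDiv_S \<Omega>)" using basis_element by metis
  note lh = bounded_linear.linear[OF bounded_linear_j(3)]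
  \<comment> \<open>Collects the parts of the potential that lie in \<open>W \<Omega>\<close>. Its
    Hessian is the difference between \<open>T\<close> and the combination, hence lies in the
    Hessian range and in the orthogonal complement of that range, and must vanish.\<close>
  define q where "q = (v - y) + (\<Sum>i\<in>idx. c i *\<^sub>R w i)"
  have qW: "q \<in> W \<Omega>" unfolding q_def
    by (rule subspace_add[OF subspace_W d]) (use w(1) in \<open>intro subspace_sum[OF subspace_W] subspace_scale[OF subspace_W]\<close>)
  have q: "jhess q = T - (\<Sum>i\<in>idx. c i *\<^sub>R F i)"
  proof -
    have "(\<Sum>i\<in>idx. c i *\<^sub>R F i) = jhess (\<Sum>i\<in>idx. c i *\<^sub>R (abs_L2 (J (f i)) - w i))"
      unfolding linear_sum[OF lh] linear_scale[OF lh] using w(2) by simp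
    also have "(\<Sum>i\<in>idx. c i *\<^sub>R (abs_L2 (J (f i)) - w i)) = y - (\<Sum>i\<in>idx. c i *\<^sub>R w i)"
      by (simp add: y_def scaleR_diff_right sum_subtractf)
    finally show ?thesis by (simp add: q_def v(2) j_diff linear_add[OF lh])
  qed
  have "jhess q \<in> kernel (divDiv_S \<Omega>)"
    unfolding q using w(3)
    by (intro subspace_diff[OF subspace_kernel_divDiv_S[OF \<Omega>] TK] subspace_sum[OF subspace_kernel_divDiv_S[OF \<Omega>]]
        subspace_scale[OF subspace_kernel_divDiv_S[OF \<Omega>]])
  then have "jhess q \<bullet> jhess q = 0" using qW by (simp add: kernel_divDiv_S[OF \<Omega>])
  then have "T = (\<Sum>i\<in>idx. c i *\<^sub>R F i)" using q by simp
  then show ?thesis by (rule that)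
qed

lemma basis_theorem:
  "(\<forall>l\<in>{1..<m}. \<forall>j\<in>{0..3}. u_fun \<Omega> \<xi> l j \<in> H2 \<Omega>) \<and>
   inj_on (\<lambda>(l, j). Gradgrad \<Omega> (u_fun \<Omega> \<xi> l j)) ({1..<m} \<times> {0..3}) \<and>
   independent {Gradgrad \<Omega> (u_fun \<Omega> \<xi> l j) | l j. l \<in> {1..<m} \<and> j \<in> {0..3}} \<and>
   span {Gradgrad \<Omega> (u_fun \<Omega> \<xi> l j) | l j. l \<in> {1..<m} \<and> j \<in> {0..3}} = harmonic_fields \<Omega>"
proof -
  have F: "(\<lambda>(l, j). Gradgrad \<Omega> (u_fun \<Omega> \<xi> l j)) = F" by (auto simp: F_def fun_eq_iff)
  have S: "{Gradgrad \<Omega> (u_fun \<Omega> \<xi> l j) | l j. l \<in> {1..<m} \<and> j \<in> {0..3}} = F ` idx"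
    by (force simp: F_def idx_def image_iff)
  have "u_fun \<Omega> \<xi> l j \<in> H2 \<Omega>" if "l \<in> {1..<m}" "j \<in> {0..3}" for l j
    using basis_element[of "(l, j)"] that by (auto simp: idx_def)
  moreover have "inj_on F idx" by (rule family_basis(1)[OF finite_idx]) (rule basis_independent)
  moreover have "independent (F ` idx)" by (rule family_basis(2)[OF finite_idx]) (rule basis_independent)
  moreover have "span (F ` idx) = range (\<lambda>c. \<Sum>i\<in>idx. c i *\<^sub>R F i)"
    by (rule family_basis(3)[OF finite_idx]) (rule basis_independent)
  moreover have "range (\<lambda>c. \<Sum>i\<in>idx. c i *\<^sub>R F i) = harmonic_fields \<Omega>"
  proof (intro set_eqI iffI)
    fix T assume "T \<in> harmonic_fields \<Omega>"
    then obtain c where "T = (\<Sum>i\<in>idx. c i *\<^sub>R F i)" by (rule harmonic_field_combination)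
    then show "T \<in> range (\<lambda>c. \<Sum>i\<in>idx. c i *\<^sub>R F i)" by blast
  qed (use combination_in_harmonic_fields in auto)
  ultimately show ?thesis unfolding F S idx_def[symmetric] by simp
qed

end

theorem theorem11p11:
  fixes \<Omega> :: "(real^3) set" and m :: nat
  assumes "open \<Omega>" and "bounded \<Omega>" and "continuous_boundary \<Omega>"
    and "m = card (components (- closure \<Omega>))"
  shows "finite (components (- closure \<Omega>)) \<and>
    (\<exists>B. finite B \<and> span B = harmonic_fields \<Omega>) \<and>
    dim (harmonic_fields \<Omega>) = 4 * (m - 1) \<and>
    (\<forall>\<Xi> \<xi>. exterior_cutoffs \<Omega> m \<Xi> \<xi> \<longrightarrow>
       (\<forall>l\<in>{1..<m}. \<forall>j\<in>{0..3}. u_fun \<Omega> \<xi> l j \<in> H2 \<Omega>) \<and>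
       inj_on (\<lambda>(l, j). Gradgrad \<Omega> (u_fun \<Omega> \<xi> l j)) ({1..<m} \<times> {0..3}) \<and>
       independent {Gradgrad \<Omega> (u_fun \<Omega> \<xi> l j) | l j. l \<in> {1..<m} \<and> j \<in> {0..3}} \<and>
       span {Gradgrad \<Omega> (u_fun \<Omega> \<xi> l j) | l j. l \<in> {1..<m} \<and> j \<in> {0..3}} =
         harmonic_fields \<Omega>)"
proof -
  have basis: "(\<forall>l\<in>{1..<m}. \<forall>j\<in>{0..3}. u_fun \<Omega> \<xi> l j \<in> H2 \<Omega>) \<and>
       inj_on (\<lambda>(l, j). Gradgrad \<Omega> (u_fun \<Omega> \<xi> l j)) ({1..<m} \<times> {0..3}) \<and>
       independent {Gradgrad \<Omega> (u_fun \<Omega> \<xi> l j) | l j. l \<in> {1..<m} \<and> j \<in> {0..3}} \<and>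
       span {Gradgrad \<Omega> (u_fun \<Omega> \<xi> l j) | l j. l \<in> {1..<m} \<and> j \<in> {0..3}} = harmonic_fields \<Omega>"
    if "exterior_cutoffs \<Omega> m \<Xi> \<xi>" for \<Xi> \<xi>
  proof -
    interpret exterior_setting \<Omega> m \<Xi> \<xi> by unfold_locales (use assms that in auto)
    show ?thesis by (rule basis_theorem)
  qed
  \<comment> \<open>The dimension formula mentions no cutoffs, so one admissible choice has to be
    exhibited before the basis can be counted.\<close>
  obtain \<Xi> where \<Xi>: "bij_betw \<Xi> {0..<m} (components (- closure \<Omega>))" "\<not> bounded (\<Xi> 0)"
    by (rule exterior_enumeration[OF assms]) (rule that)
  obtain \<xi> where \<xi>: "exterior_cutoffs \<Omega> m \<Xi> \<xi>"
    by (rule strong_cutoffs[OF assms(1-3) \<Xi>]) (rule that)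
  define B where "B = {Gradgrad \<Omega> (u_fun \<Omega> \<xi> l j) | l j. l \<in> {1..<m} \<and> j \<in> {0..3}}"
  have B: "B = (\<lambda>(l, j). Gradgrad \<Omega> (u_fun \<Omega> \<xi> l j)) ` ({1..<m} \<times> {0..3})"
    by (force simp: B_def image_iff)
  note b = basis[OF \<xi>]
  have "card B = card ({1..<m} \<times> {0..3::nat})" unfolding B by (rule card_image) (use b in blast)
  also have "\<dots> = 4 * (m - 1)" by (simp add: card_cartesian_product mult.commute)
  finally have cB: "card B = 4 * (m - 1)" .
  have "span B = harmonic_fields \<Omega>" "independent B" using b unfolding B_def by blast+
  then have "dim (harmonic_fields \<Omega>) = card B" by (metis dim_span dim_eq_card_independent)
  moreover have "finite B" unfolding B by simp
  ultimately show ?thesis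
    using \<open>span B = harmonic_fields \<Omega>\<close> cB
    by (intro conjI allI impI finite_exterior_components[OF assms(1-3)] exI[of _ B] basis) simp_all
qed

end
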